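(* Let $0<p<2$ and $q=\frac{2p}{2-p}$, and assume there exists a positive sequence $(\rho_j)_{j\ge1}$ such that $(\rho_j^{-1})_{j\ge1}\in\ell^q(\mathbb{N})$ and $\sup_{x\in D}\sum_{j\ge1}\rho_j|\kappa_j(x)|<\infty$. Let $w$ be the solution of the parametric reduced optimality problem described in the context. Then there exists a sequence of multi-index sets $(\Lambda_N)_{N\ge1}$, $\Lambda_N\subset\mathcal{F}$, with $|\Lambda_N|=N$, such that $$\|w-S_{\Lambda_N}w\|_{L^2_{\boldsymbol{\gamma}}(Y,W)}\le C N^{-s},\qquad s=\frac1p-\frac12,$$ where the constant $C>0$ is independent of $N$.
   Context: $D\subset\mathbb{R}^d$ ($d=1,2,3$) is an open bounded domain with Lipschitz boundary; $f,u_d\in L^2(D)$ and $\beta>0$ are given; $(\cdot,\cdot)$ is the $L^2(D)$ inner product. $(\kappa_j)_{j\ge1}$ is a sequence of functions in $L^\infty(D)$, and for $\boldsymbol{y}=(y_j)_{j\ge1}\in Y=\mathbb{R}^{\mathbb{N}}$ we set $\kappa(\boldsymbol{y})=\sum_{j\ge1}y_j\kappa_j$. $Y$ carries the $\sigma$-algebra generated by the Borel cylinders and the product measure $\boldsymbol{\gamma}=\bigotimes_{j\ge1}\mathcal{N}(0,1)$. $V=H^1_0(D)$ with norm $\|v\|_V=\|\,|\nabla v|\,\|_{L^2(D)}$. $W=V\times V$ with norm $\|w\|_W=(\beta\|u\|_V^2+\|v\|_V^2)^{1/2}$ for $w=(u,v)$. $L^2_{\boldsymbol{\gamma}}(Y,W)$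 is the Bochner space of square integrable $W$-valued functions. Reduced optimality problem: for each $\boldsymbol{y}\in Y$ with $\|\kappa(\boldsymbol{y})\|_{L^\infty(D)}<\infty$ (which under the stated hypotheses on $(\kappa_j)$ holds for $\boldsymbol{\gamma}$-almost every $\boldsymbol{y}$), $w(\boldsymbol{y})=(u(\boldsymbol{y}),v(\boldsymbol{y}))\in W$ is the unique solution of $$A(w(\boldsymbol{y}),\tilde w;\kappa(\boldsymbol{y}))+B(w(\boldsymbol{y}),\tilde w)=(F,\tilde w)\quad\forall\tilde w\in W,$$ where, for $w=(u,v)$, $\tilde w=(\tilde u,\tilde v)\in W$, $a(u,\tilde u;\kappa)=\int_D e^{\kappa}\nabla u\cdot\nabla\tilde u\,dx$, $A(w,\tilde w;\kappa)=\beta a(u,\tilde u;\kappa)+a(v,\tilde v;\kappa)$, $B(w,\tilde w)=(v,\tilde u)-(u,\tilde v)$, $(F,\tilde w)=\beta(f,\tilde u)-(u_d,\tilde v)$. Under the stated hypotheses $w\in L^2_{\boldsymbol{\gamma}}(Y,W)$. $\mathcal{F}$ is the set of finitely supported multi-indices $\boldsymbol{\nu}=(\nu_1,\nu_2,\dots)$ of nonnegative integers, i.e. those with $|\boldsymbol{\nu}|=\sum_j\nu_j<\infty$. $(H_n)_{n\ge0}$ are the Hermite polynomials orthonormal with respect to $\mathcal{N}(0,1)$, $H_{\boldsymbol{\nu}}(\boldsymbol{y})=\prod_{j\ge1}H_{\nu_j}(y_j)$, and the Hermite coefficients of $w$ are $w_{\boldsymbol{\nu}}=\int_Y w(\boldsymbol{y})H_{\boldsymbol{\nu}}(\boldsymbol{y})\,d\boldsymbol{\gamma}(\boldsymbol{y})\in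 W$. For a finite set $\Lambda\subset\mathcal{F}$, $S_\Lambda w(\boldsymbol{y})=\sum_{\boldsymbol{\nu}\in\Lambda}w_{\boldsymbol{\nu}}H_{\boldsymbol{\nu}}(\boldsymbol{y})$. *)

theory Defs
  imports "HOL-Probability.Probability" "HOL-Computational_Algebra.Polynomial"
begin

section \<open>The Hilbert space of square integrable functions on the whole space\<close>

text \<open>
  \<open>('a, 'b) L2\<close> is the Hilbert space of (classes of) square integrable functions from \<open>'a\<close> to \<open>'b\<close>.
  It is shown to be a separable Banach space, as required for taking Bochner integrals of functions
  with values in it.
\<close>

definition sq_int :: "('a::euclidean_space \<Rightarrow> 'b::euclidean_space) set" where
  "sq_int = {f \<in> borel_measurable lborel. integrable lborel (\<lambda>x. (norm (f x))\<^sup>2)}"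

lemma sq_intD [measurable_dest]: "f \<in> sq_int \<Longrightarrow> f \<in> borel_measurable borel"
  by (simp add: sq_int_def)

lemma sq_int_integrable: "f \<in> sq_int \<Longrightarrow> integrable lborel (\<lambda>x. (norm (f x))\<^sup>2)"
  by (simp add: sq_int_def)

lemma sq_int_bound:
  assumes [measurable]: "f \<in> borel_measurable borel" and "g \<in> sq_int"
    and le: "\<And>x. norm (f x) \<le> c * norm (g x)"
  shows "f \<in> sq_int"
proof -
  have "integrable lborel (\<lambda>x. c\<^sup>2 * (norm (g x))\<^sup>2)"
    using sq_int_integrable[OF assms(2)] by simp
  then have "integrable lborel (\<lambda>x. (norm (f x))\<^sup>2)"
  proof (rule Bochner_Integration.integrable_bound)
    show "AE x in lborel. norm ((norm (f x))\<^sup>2) \<le> norm (c\<^sup>2 * (norm (g x))\<^sup>2)"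
    proof (intro AE_I2)
      fix x
      have "(norm (f x))\<^sup>2 \<le> (c * norm (g x))\<^sup>2"
        using le[of x] by (intro power_mono) auto
      then show "norm ((norm (f x))\<^sup>2) \<le> norm (c\<^sup>2 * (norm (g x))\<^sup>2)"
        by (simp add: power_mult_distrib)
    qed
  qed simp
  then show ?thesis by (simp add: sq_int_def)
qed

lemma sq_int_scaleR: "f \<in> sq_int \<Longrightarrow> (\<lambda>x. c *\<^sub>R f x) \<in> sq_int"
  by (rule sq_int_bound[where g = f and c = "\<bar>c\<bar>"]) (auto dest: sq_intD)

lemma sq_int_add:
  assumes f [measurable]: "f \<in> sq_int" and g [measurable]: "g \<in> sq_int"
  shows "(\<lambda>x. f x + g x) \<in> sq_int"
proof -
  have "integrable lborel (\<lambda>x. 2 * (norm (f x))\<^sup>2 + 2 * (norm (g x))\<^sup>2)"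
    using sq_int_integrable[OF f] sq_int_integrable[OF g] by simp
  then have "integrable lborel (\<lambda>x. (norm (f x + g x))\<^sup>2)"
  proof (rule Bochner_Integration.integrable_bound)
    show "AE x in lborel. norm ((norm (f x + g x))\<^sup>2) \<le> norm (2 * (norm (f x))\<^sup>2 + 2 * (norm (g x))\<^sup>2)"
    proof (intro AE_I2)
      fix x
      have "(norm (f x + g x))\<^sup>2 \<le> (norm (f x) + norm (g x))\<^sup>2"
        by (intro power_mono norm_triangle_ineq) auto
      also have "\<dots> \<le> 2 * (norm (f x))\<^sup>2 + 2 * (norm (g x))\<^sup>2"
        using sum_squares_ge_zero[of "norm (f x) - norm (g x)" 0]
        by (simp add: power2_eq_square algebra_simps)
      finally show "norm ((norm (f x + g x))\<^sup>2) \<le> norm (2 * (norm (f x))\<^sup>2 + 2 * (norm (g x))\<^sup>2)"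
        by simp
    qed
  qed simp
  then show ?thesis by (simp add: sq_int_def)
qed

lemma sq_int_zero: "(\<lambda>x. 0) \<in> sq_int"
  by (simp add: sq_int_def)

lemma sq_int_uminus: "f \<in> sq_int \<Longrightarrow> (\<lambda>x. - f x) \<in> sq_int"
  using sq_int_scaleR[of f "-1"] by simp

lemma sq_int_diff: "f \<in> sq_int \<Longrightarrow> g \<in> sq_int \<Longrightarrow> (\<lambda>x. f x - g x) \<in> sq_int"
  using sq_int_add[OF _ sq_int_uminus, of f g] by simp

lemma sq_int_inner:
  assumes f [measurable]: "f \<in> sq_int" and g [measurable]: "g \<in> sq_int"
  shows "integrable lborel (\<lambda>x. f x \<bullet> g x)"
proof -
  have "integrable lborel (\<lambda>x. (norm (f x))\<^sup>2 + (norm (g x))\<^sup>2)"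
    using sq_int_integrable[OF f] sq_int_integrable[OF g] by simp
  then show ?thesis
  proof (rule Bochner_Integration.integrable_bound)
    show "AE x in lborel. norm (f x \<bullet> g x) \<le> norm ((norm (f x))\<^sup>2 + (norm (g x))\<^sup>2)"
    proof (intro AE_I2)
      fix x
      have "\<bar>f x \<bullet> g x\<bar> \<le> norm (f x) * norm (g x)" by (rule Cauchy_Schwarz_ineq2)
      also have "\<dots> \<le> (norm (f x))\<^sup>2 + (norm (g x))\<^sup>2"
      proof -
        have "0 \<le> (norm (f x) - norm (g x))\<^sup>2" "0 \<le> (norm (f x))\<^sup>2" "0 \<le> (norm (g x))\<^sup>2" by simp_all
        then show ?thesis unfolding power2_diff by linarith
      qed
      finally show "norm (f x \<bullet> g x) \<le> norm ((norm (f x))\<^sup>2 + (norm (g x))\<^sup>2)" by simp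
    qed
  qed simp
qed

definition L2_rel :: "('a::euclidean_space \<Rightarrow> 'b::euclidean_space) \<Rightarrow> ('a \<Rightarrow> 'b) \<Rightarrow> bool" where
  "L2_rel f g \<longleftrightarrow> f \<in> sq_int \<and> g \<in> sq_int \<and> (AE x in lborel. f x = g x)"

quotient_type (overloaded) ('a, 'b) L2 = "'a::euclidean_space \<Rightarrow> 'b::euclidean_space" / partial: L2_rel
proof (rule part_equivpI)
  show "\<exists>f. L2_rel f f" using sq_int_zero by (auto simp: L2_rel_def)
  show "symp L2_rel" by (auto simp: symp_def L2_rel_def)
  show "transp L2_rel" by (auto simp: transp_def L2_rel_def elim: AE_mp)
qed

instantiation L2 :: (euclidean_space, euclidean_space) real_inner
begin

lift_definition zero_L2 :: "('a, 'b) L2" is "\<lambda>x. 0"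
  by (simp add: L2_rel_def sq_int_zero)

lift_definition plus_L2 :: "('a, 'b) L2 \<Rightarrow> ('a, 'b) L2 \<Rightarrow> ('a, 'b) L2" is "\<lambda>f g x. f x + g x"
  by (auto simp: L2_rel_def sq_int_add)

lift_definition uminus_L2 :: "('a, 'b) L2 \<Rightarrow> ('a, 'b) L2" is "\<lambda>f x. - f x"
  by (auto simp: L2_rel_def sq_int_uminus)

lift_definition minus_L2 :: "('a, 'b) L2 \<Rightarrow> ('a, 'b) L2 \<Rightarrow> ('a, 'b) L2" is "\<lambda>f g x. f x - g x"
  by (auto simp: L2_rel_def sq_int_diff)

lift_definition scaleR_L2 :: "real \<Rightarrow> ('a, 'b) L2 \<Rightarrow> ('a, 'b) L2" is "\<lambda>c f x. c *\<^sub>R f x"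
  by (auto simp: L2_rel_def sq_int_scaleR)

lift_definition inner_L2 :: "('a, 'b) L2 \<Rightarrow> ('a, 'b) L2 \<Rightarrow> real"
  is "\<lambda>f g. integral\<^sup>L lborel (\<lambda>x. f x \<bullet> g x)"
proof -
  fix f f' g g' :: "'a \<Rightarrow> 'b"
  assume "L2_rel f f'" "L2_rel g g'"
  then have [measurable]: "f \<in> sq_int" "g \<in> sq_int" "f' \<in> sq_int" "g' \<in> sq_int"
    and ae: "AE x in lborel. f x = f' x" "AE x in lborel. g x = g' x"
    by (auto simp: L2_rel_def)
  have "AE x in lborel. f x \<bullet> g x = f' x \<bullet> g' x" using ae by eventually_elim simp
  then show "integral\<^sup>L lborel (\<lambda>x. f x \<bullet> g x) = integral\<^sup>L lborel (\<lambda>x. f' x \<bullet> g' x)"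
    by (intro integral_cong_AE) auto
qed

definition norm_L2 :: "('a, 'b) L2 \<Rightarrow> real" where "norm_L2 f = sqrt (f \<bullet> f)"
definition dist_L2 :: "('a, 'b) L2 \<Rightarrow> ('a, 'b) L2 \<Rightarrow> real" where "dist_L2 f g = norm (f - g)"
definition sgn_L2 :: "('a, 'b) L2 \<Rightarrow> ('a, 'b) L2" where "sgn_L2 f = scaleR (inverse (norm f)) f"
definition uniformity_L2 :: "(('a, 'b) L2 \<times> ('a, 'b) L2) filter" where
  "uniformity_L2 = (INF e\<in>{0<..}. principal {(x, y). dist x y < e})"
definition open_L2 :: "('a, 'b) L2 set \<Rightarrow> bool" where
  "open_L2 S = (\<forall>x\<in>S. \<forall>\<^sub>F (x', y) in uniformity. x' = x \<longrightarrow> y \<in> S)"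

instance
proof
  fix f g h :: "('a, 'b) L2" and a b :: real
  show "f + g + h = f + (g + h)"
    by transfer (auto simp: L2_rel_def add.assoc sq_int_add)
  show "f + g = g + f"
    by transfer (auto simp: L2_rel_def add.commute sq_int_add)
  show "0 + f = f" by transfer (auto simp: L2_rel_def)
  show "- f + f = 0" by transfer (auto simp: L2_rel_def sq_int_zero)
  show "f - g = f + - g" by transfer (auto simp: L2_rel_def sq_int_diff)
  show "a *\<^sub>R (f + g) = a *\<^sub>R f + a *\<^sub>R g"
    by transfer (auto simp: L2_rel_def sq_int_add sq_int_scaleR scaleR_add_right intro!: sq_int_add[OF sq_int_scaleR sq_int_scaleR])
  show "(a + b) *\<^sub>R f = a *\<^sub>R f + b *\<^sub>R f"
    by transfer (auto simp: L2_rel_def scaleR_add_left intro!: sq_int_add[OF sq_int_scaleR sq_int_scaleR])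
  show "a *\<^sub>R b *\<^sub>R f = (a * b) *\<^sub>R f"
    by transfer (auto simp: L2_rel_def sq_int_scaleR)
  show "1 *\<^sub>R f = f" by transfer (auto simp: L2_rel_def)
  show "f \<bullet> g = g \<bullet> f" by transfer (simp add: inner_commute)
  show "(f + g) \<bullet> h = f \<bullet> h + g \<bullet> h"
    by transfer (auto simp: L2_rel_def inner_add_left sq_int_inner)
  show "(a *\<^sub>R f) \<bullet> g = a * (f \<bullet> g)"
    by transfer (auto simp: L2_rel_def)
  show "0 \<le> f \<bullet> f" by transfer simp
  show "f \<bullet> f = 0 \<longleftrightarrow> f = 0"
  proof (transfer, unfold L2_rel_def)
    fix f :: "'a \<Rightarrow> 'b"
    assume *: "f \<in> sq_int \<and> f \<in> sq_int \<and> (AE x in lborel. f x = f x)"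
    then have "(integral\<^sup>L lborel (\<lambda>x. f x \<bullet> f x) = 0) = (AE x in lborel. f x \<bullet> f x = 0)"
      by (intro integral_nonneg_eq_0_iff_AE sq_int_inner) auto
    then show "(integral\<^sup>L lborel (\<lambda>x. f x \<bullet> f x) = 0) =
      (f \<in> sq_int \<and> (\<lambda>x. 0) \<in> sq_int \<and> (AE x in lborel. f x = 0))"
      using * by (simp add: sq_int_zero)
  qed
qed (simp_all add: norm_L2_def dist_L2_def sgn_L2_def uniformity_L2_def open_L2_def)

end


lemma L2_rel_refl: "f \<in> sq_int \<Longrightarrow> L2_rel f f"
  by (simp add: L2_rel_def)

lemma rep_L2_sq_int: "rep_L2 u \<in> sq_int"
  using Quotient3_rel_rep[OF Quotient3_L2, of u u] by (simp add: L2_rel_def)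

lemma abs_rep_L2: "abs_L2 (rep_L2 u) = u"
  by (rule Quotient3_abs_rep[OF Quotient3_L2])

lemma rep_abs_L2: "f \<in> sq_int \<Longrightarrow> AE x in lborel. rep_L2 (abs_L2 f) x = f x"
  using Quotient3_rep_abs[OF Quotient3_L2 L2_rel_refl, of f] by (simp add: L2_rel_def)

lemma abs_L2_eqI: "f \<in> sq_int \<Longrightarrow> g \<in> sq_int \<Longrightarrow> AE x in lborel. f x = g x \<Longrightarrow> abs_L2 f = abs_L2 g"
  using Quotient3_rel_abs[OF Quotient3_L2, of f g] by (simp add: L2_rel_def)

lemma abs_L2_add: "f \<in> sq_int \<Longrightarrow> g \<in> sq_int \<Longrightarrow> abs_L2 f + abs_L2 g = abs_L2 (\<lambda>x. f x + g x)"
  by (simp add: plus_L2.abs_eq L2_rel_refl eq_onp_def)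

lemma abs_L2_diff: "f \<in> sq_int \<Longrightarrow> g \<in> sq_int \<Longrightarrow> abs_L2 f - abs_L2 g = abs_L2 (\<lambda>x. f x - g x)"
  by (simp add: minus_L2.abs_eq L2_rel_refl eq_onp_def)

lemma abs_L2_scaleR: "f \<in> sq_int \<Longrightarrow> c *\<^sub>R abs_L2 f = abs_L2 (\<lambda>x. c *\<^sub>R f x)"
  by (simp add: scaleR_L2.abs_eq L2_rel_refl eq_onp_def)

lemma abs_L2_zero: "abs_L2 (\<lambda>x. 0) = 0"
  by (simp add: zero_L2.abs_eq)

lemma norm_abs_L2: "f \<in> sq_int \<Longrightarrow> (norm (abs_L2 f))\<^sup>2 = integral\<^sup>L lborel (\<lambda>x. (norm (f x))\<^sup>2)"
  by (simp add: norm_L2_def inner_L2.abs_eq L2_rel_refl power2_norm_eq_inner integral_nonneg)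

lemma norm_diff_L2: "(norm (u - v))\<^sup>2 = integral\<^sup>L lborel (\<lambda>x. (norm (rep_L2 u x - rep_L2 v x))\<^sup>2)"
proof -
  have "u - v = abs_L2 (\<lambda>x. rep_L2 u x - rep_L2 v x)"
    using abs_L2_diff[OF rep_L2_sq_int rep_L2_sq_int, of u v] by (simp add: abs_rep_L2)
  then show ?thesis
    using norm_abs_L2[OF sq_int_diff[OF rep_L2_sq_int rep_L2_sq_int], of u v] by simp
qed

lemma nn_norm_L2: "f \<in> sq_int \<Longrightarrow> (\<integral>\<^sup>+x. ennreal ((norm (f x))\<^sup>2) \<partial>lborel) = ennreal ((norm (abs_L2 f))\<^sup>2)"
  by (subst nn_integral_eq_integral) (auto simp: sq_int_integrable norm_abs_L2)

lemma sq_int_nnI: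
  assumes [measurable]: "f \<in> borel_measurable borel"
    and "(\<integral>\<^sup>+x. ennreal ((norm (f x))\<^sup>2) \<partial>lborel) < \<infinity>"
  shows "f \<in> sq_int"
  using assms by (auto simp: sq_int_def intro!: integrableI_bounded)

lemma abs_L2_tendsto:
  fixes f :: "'a::euclidean_space \<Rightarrow> 'b::euclidean_space"
  assumes F: "\<And>i. F i \<in> sq_int" and f: "f \<in> sq_int"
    and lim: "\<And>x. (\<lambda>i. F i x) \<longlonglongrightarrow> f x" and le: "\<And>i x. norm (F i x) \<le> c * norm (f x)"
  shows "(\<lambda>i. abs_L2 (F i)) \<longlonglongrightarrow> abs_L2 f"
proof -
  note [measurable] = sq_intD[OF F] sq_intD[OF f]
  have "(\<lambda>i. integral\<^sup>L lborel (\<lambda>x. (norm (F i x - f x))\<^sup>2)) \<longlonglongrightarrow> integral\<^sup>L lborel (\<lambda>x::'a. 0 :: real)"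
  proof (rule integral_dominated_convergence[where w = "\<lambda>x. (c + 1)\<^sup>2 * (norm (f x))\<^sup>2"])
    show "integrable lborel (\<lambda>x. (c + 1)\<^sup>2 * (norm (f x))\<^sup>2)"
      using sq_int_integrable[OF f] by simp
    have "(\<lambda>i. (norm (F i x - f x))\<^sup>2) \<longlonglongrightarrow> (norm (f x - f x))\<^sup>2" for x
      by (intro tendsto_intros lim)
    then show "AE x in lborel. (\<lambda>i. (norm (F i x - f x))\<^sup>2) \<longlonglongrightarrow> 0" by simp
    fix i
    have "(norm (F i x - f x))\<^sup>2 \<le> ((c + 1) * norm (f x))\<^sup>2" for x
      using norm_triangle_ineq4[of "F i x" "f x"] le[of i x]
      by (intro power_mono) (auto simp: algebra_simps)
    then show "AE x in lborel. norm ((norm (F i x - f x))\<^sup>2) \<le> (c + 1)\<^sup>2 * (norm (f x))\<^sup>2"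
      by (simp add: power_mult_distrib)
  qed auto
  then have "(\<lambda>i. (norm (abs_L2 (F i) - abs_L2 f))\<^sup>2) \<longlonglongrightarrow> 0"
    by (simp add: abs_L2_diff F f norm_abs_L2 sq_int_diff)
  then have "(\<lambda>i. sqrt ((norm (abs_L2 (F i) - abs_L2 f))\<^sup>2)) \<longlonglongrightarrow> sqrt 0"
    by (intro tendsto_intros)
  then have "(\<lambda>i. norm (abs_L2 (F i) - abs_L2 f)) \<longlonglongrightarrow> 0" by simp
  then show ?thesis by (metis LIM_zero_cancel tendsto_norm_zero_cancel)
qed

instance L2 :: (euclidean_space, euclidean_space) complete_space
proof
  fix X :: "nat \<Rightarrow> ('a, 'b) L2"
  assume "Cauchy X"
  have "\<exists>N. \<forall>m\<ge>N. \<forall>n\<ge>N. norm (X m - X n) < e" if "e > 0" for e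
    using \<open>Cauchy X\<close> that by (auto simp: Cauchy_def dist_norm)
  then obtain N where N: "\<And>e m n. e > 0 \<Longrightarrow> m \<ge> N e \<Longrightarrow> n \<ge> N e \<Longrightarrow> norm (X m - X n) < e"
    by metis
  define r where "r k = rec_nat (N 1) (\<lambda>k m. max (Suc m) (N ((1/2)^Suc k))) k" for k
  have r0: "r 0 = N 1" and rS: "r (Suc k) = max (Suc (r k)) (N ((1/2)^Suc k))" for k
    by (simp_all add: r_def)
  have mono: "strict_mono r"
    unfolding strict_mono_Suc_iff by (auto simp: rS less_max_iff_disj simp del: power_Suc)
  have rN: "r k \<ge> N ((1/2)^k)" for k
    by (cases k) (simp_all add: r0 rS)
  have step: "norm (X (r (Suc k)) - X (r k)) < (1/2)^k" for k
    by (rule N) (use rN[of k] strict_mono_less_eq[OF mono, of k "Suc k"] in auto)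
  define g where "g k = rep_L2 (X (r k))" for k
  have g: "g k \<in> sq_int" for k by (simp add: g_def rep_L2_sq_int)
  note [measurable] = sq_intD[OF g]
  define d where "d k x = norm (g (Suc k) x - g k x)" for k x
  define G where "G n x = (\<Sum>k<n. d k x)" for n x
  have d_sq: "d k \<in> sq_int" for k
    unfolding d_def by (rule sq_int_bound[OF _ sq_int_diff[OF g g], where c = 1]) auto
  note [measurable] = sq_intD[OF d_sq]
  have d_norm: "norm (abs_L2 (d k)) < (1/2)^k" for k
  proof -
    have "(norm (abs_L2 (d k)))\<^sup>2 = (norm (X (r (Suc k)) - X (r k)))\<^sup>2"
      by (simp add: norm_abs_L2 d_sq norm_diff_L2 d_def g_def)
    then show ?thesis using step[of k] by (simp add: power2_eq_iff_nonneg)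
  qed
  have G: "G n \<in> sq_int \<and> norm (abs_L2 (G n)) \<le> (\<Sum>k<n. (1/2)^k)" for n
  proof (induction n)
    case 0
    then show ?case by (simp add: G_def sq_int_zero abs_L2_zero cong: abs_L2_zero)
  next
    case (Suc n)
    have eq: "G (Suc n) = (\<lambda>x. G n x + d n x)" by (auto simp: G_def)
    have "norm (abs_L2 (G n) + abs_L2 (d n)) \<le> (\<Sum>k<n. (1/2)^k) + (1/2)^n"
      using Suc d_norm[of n] by (intro order_trans[OF norm_triangle_ineq] add_mono) auto
    then show ?case using Suc by (simp add: eq sq_int_add d_sq abs_L2_add)
  qed
  have geo: "(\<Sum>k<n. (1/2)^k) \<le> (2::real)" for n
    by (simp add: geometric_sum)
  have G_meas [measurable]: "G n \<in> borel_measurable borel" for n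
    using G by (auto dest: sq_intD)
  have G_nonneg: "0 \<le> G n x" for n x by (simp add: G_def d_def sum_nonneg)
  have "(\<integral>\<^sup>+x. (SUP n. ennreal ((G n x)\<^sup>2)) \<partial>lborel) = (SUP n. \<integral>\<^sup>+x. ennreal ((G n x)\<^sup>2) \<partial>lborel)"
  proof (rule nn_integral_monotone_convergence_SUP)
    show "incseq (\<lambda>n x. ennreal ((G n x)\<^sup>2))"
      unfolding incseq_Suc_iff le_fun_def
    proof safe
      fix n x
      have "G n x \<le> G (Suc n) x" by (simp add: G_def d_def)
      then show "ennreal ((G n x)\<^sup>2) \<le> ennreal ((G (Suc n) x)\<^sup>2)"
        by (intro ennreal_leI power_mono G_nonneg)
    qed
  qed simp
  also have "\<dots> \<le> 4"
  proof (rule SUP_least)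
    fix n
    have "(\<integral>\<^sup>+x. ennreal ((G n x)\<^sup>2) \<partial>lborel) = ennreal ((norm (abs_L2 (G n)))\<^sup>2)"
      using nn_norm_L2[of "G n"] G by simp
    also have "\<dots> \<le> ennreal (2\<^sup>2)"
      using G[of n] geo[of n] by (intro ennreal_leI power_mono) auto
    finally show "(\<integral>\<^sup>+x. ennreal ((G n x)\<^sup>2) \<partial>lborel) \<le> 4" by simp
  qed
  also have "\<dots> < \<infinity>" by simp
  finally have "AE x in lborel. (SUP n. ennreal ((G n x)\<^sup>2)) \<noteq> \<infinity>"
    by (intro nn_integral_PInf_AE) auto
  then have conv: "AE x in lborel. convergent (\<lambda>k. g k x)"
  proof eventually_elim
    case (elim x)
    then obtain B where B: "B \<ge> 0" "(SUP n. ennreal ((G n x)\<^sup>2)) = ennreal B"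
      by (cases "SUP n. ennreal ((G n x)\<^sup>2)") auto
    have "G n x \<le> sqrt B" for n
    proof -
      have "ennreal ((G n x)\<^sup>2) \<le> ennreal B" unfolding B(2)[symmetric] by (rule SUP_upper) simp
      then show ?thesis using B(1) by (simp add: real_le_rsqrt)
    qed
    then have "summable (\<lambda>k. norm (g (Suc k) x - g k x))"
      unfolding G_def d_def by (intro summableI_nonneg_bounded) auto
    then have "summable (\<lambda>k. g (Suc k) x - g k x)" by (rule summable_norm_cancel)
    then have "convergent (\<lambda>n. \<Sum>k<n. g (Suc k) x - g k x)" by (simp add: summable_iff_convergent)
    then have "convergent (\<lambda>n. g n x - g 0 x)" by (simp add: sum_lessThan_telescope[of "\<lambda>k. g k x"])
    then have "convergent (\<lambda>n. g n x - g 0 x + g 0 x)" by (intro convergent_add convergent_const)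
    then show ?case by simp
  qed
  define h where "h x = lim (\<lambda>k. g k x)" for x
  have h_meas [measurable]: "h \<in> borel_measurable borel"
    unfolding h_def by measurable
  have lim: "AE x in lborel. (\<lambda>k. g k x) \<longlonglongrightarrow> h x"
    using conv by eventually_elim (simp add: h_def convergent_LIMSEQ_iff)
  have fatou: "(\<integral>\<^sup>+x. ennreal ((norm (h x - g m x))\<^sup>2) \<partial>lborel) \<le> ennreal (e\<^sup>2)"
    if e: "e > 0" and m: "r m \<ge> N e" for e m
  proof -
    have "(\<integral>\<^sup>+x. ennreal ((norm (h x - g m x))\<^sup>2) \<partial>lborel)
        = (\<integral>\<^sup>+x. liminf (\<lambda>k. ennreal ((norm (g k x - g m x))\<^sup>2)) \<partial>lborel)"
    proof (rule nn_integral_cong_AE, use lim in eventually_elim)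
      case (elim x)
      have "(\<lambda>k. ennreal ((norm (g k x - g m x))\<^sup>2)) \<longlonglongrightarrow> ennreal ((norm (h x - g m x))\<^sup>2)"
        by (intro tendsto_ennrealI tendsto_intros elim)
      then show ?case by (intro lim_imp_Liminf[symmetric]) simp_all
    qed
    also have "\<dots> \<le> liminf (\<lambda>k. \<integral>\<^sup>+x. ennreal ((norm (g k x - g m x))\<^sup>2) \<partial>lborel)"
      by (rule nn_integral_liminf) simp
    also have "\<dots> \<le> ennreal (e\<^sup>2)"
    proof (rule Liminf_le)
      have "r k \<ge> N e" if "k \<ge> m" for k
        using m strict_mono_less_eq[OF mono, of m k] that by auto
      then have "norm (X (r k) - X (r m)) < e" if "k \<ge> m" for k
        using N[OF e] m that by auto
      then have "(norm (X (r k) - X (r m)))\<^sup>2 \<le> e\<^sup>2" if "k \<ge> m" for k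
        using that by (intro power_mono) (auto intro: less_imp_le)
      moreover have "(\<integral>\<^sup>+x. ennreal ((norm (g k x - g m x))\<^sup>2) \<partial>lborel) = ennreal ((norm (X (r k) - X (r m)))\<^sup>2)" for k
        using nn_norm_L2[OF sq_int_diff[OF g[of k] g[of m]]] abs_L2_diff[OF g[of k] g[of m]]
        by (simp add: g_def abs_rep_L2)
      ultimately show "\<forall>\<^sub>F k in sequentially. (\<integral>\<^sup>+x. ennreal ((norm (g k x - g m x))\<^sup>2) \<partial>lborel) \<le> ennreal (e\<^sup>2)"
        unfolding eventually_sequentially by (intro exI[of _ m]) (auto intro!: ennreal_leI)
    qed simp
    finally show ?thesis .
  qed
  have "(\<lambda>x. h x - g 0 x) \<in> sq_int"
    using fatou[of 1 0] by (intro sq_int_nnI) (auto simp: r0 intro: le_less_trans)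
  from sq_int_add[OF this g[of 0]] have h: "h \<in> sq_int" by simp
  have sub: "(\<lambda>k. X (r k)) \<longlonglongrightarrow> abs_L2 h"
  proof (rule LIMSEQ_I)
    fix e :: real assume "e > 0"
    then have e2: "e / 2 > 0" by simp
    have "norm (X (r m) - abs_L2 h) < e" if m: "m \<ge> N (e/2)" for m
    proof -
      have "r m \<ge> N (e/2)" using m seq_suble[OF mono, of m] by simp
      then have "ennreal ((norm (abs_L2 h - X (r m)))\<^sup>2) \<le> ennreal ((e/2)\<^sup>2)"
        using fatou[OF e2, of m] nn_norm_L2[OF sq_int_diff[OF h g[of m]]] abs_L2_diff[OF h g[of m]]
        by (simp add: g_def abs_rep_L2)
      then have "(norm (abs_L2 h - X (r m)))\<^sup>2 \<le> (e/2)\<^sup>2" by (simp add: ennreal_le_iff)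
      then have "norm (abs_L2 h - X (r m)) \<le> e/2"
        using e2 by (simp add: abs_le_square_iff[symmetric])
      then show ?thesis using \<open>e > 0\<close> by (simp add: norm_minus_commute)
    qed
    then show "\<exists>no. \<forall>m\<ge>no. norm (X (r m) - abs_L2 h) < e" by blast
  qed
  have "X \<longlonglongrightarrow> abs_L2 h"
    using Cauchy_converges_subseq[OF \<open>Cauchy X\<close> mono] sub by (simp add: o_def)
  then show "convergent X" by (rule convergentI)
qed

instance L2 :: (euclidean_space, euclidean_space) banach ..

lemma ex_countable_dense_L2:
  "\<exists>T :: ('a::euclidean_space, 'b::euclidean_space) L2 set. countable T \<and> closure T = UNIV"
proof -
  obtain B0 :: "'a set set" where B0: "countable B0" "topological_basis B0"
    using ex_countable_basis by auto
  define B where "B = Inter ` {F. finite F \<and> F \<subseteq> B0}"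
  have countB: "countable B"
    unfolding B_def using B0(1) by (intro countable_image countable_Collect_finite_subset)
  have openB: "open U" if "U \<in> B" for U
    using that topological_basis_open[OF B0(2)] by (auto simp: B_def intro!: open_Inter)
  have "B0 \<subseteq> B"
  proof
    fix U assume "U \<in> B0"
    then have "U = Inter {U}" "finite {U} \<and> {U} \<subseteq> B0" by auto
    then show "U \<in> B" unfolding B_def by blast
  qed
  then have "topological_basis B"
    using B0(2) openB unfolding topological_basis_def by (meson subset_trans)
  then have borelB: "sets (borel :: 'a measure) = sigma_sets UNIV B"
    by (simp add: borel_eq_countable_basis[OF countB])
  have intB: "Int_stable B"
  proof (rule Int_stableI)
    fix U V assume "U \<in> B" "V \<in> B"
    then obtain F G where "U = Inter F" "V = Inter G" "finite F" "F \<subseteq> B0" "finite G" "G \<subseteq> B0"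
      by (auto simp: B_def)
    then have "U \<inter> V = Inter (F \<union> G)" "finite (F \<union> G) \<and> F \<union> G \<subseteq> B0" by auto
    then show "U \<inter> V \<in> B" unfolding B_def by blast
  qed
  define e where "e A n b = (\<lambda>x::'a. indicator (A \<inter> ball 0 (real n)) x *\<^sub>R (b::'b))" for A n b
  have fin: "emeasure lborel (A \<inter> ball 0 (real n)) < \<infinity>" if "A \<in> sets borel" for A :: "'a set" and n
  proof -
    have "emeasure lborel (A \<inter> ball 0 (real n)) \<le> emeasure lborel (ball (0::'a) (real n))"
      by (intro emeasure_mono) auto
    also have "\<dots> < \<infinity>" by (intro emeasure_bounded_finite) auto
    finally show ?thesis .
  qed
  have e_sq: "e A n b \<in> sq_int" if [measurable]: "A \<in> sets borel" for A n b
  proof -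
    have [measurable]: "(\<lambda>x. indicator (A \<inter> ball 0 (real n)) x :: real) \<in> borel_measurable borel"
      by (intro borel_measurable_indicator) auto
    have "integrable lborel (\<lambda>x. indicator (A \<inter> ball 0 (real n)) x * (norm b)\<^sup>2)"
      using fin[OF that, of n] by (intro integrable_mult_left integrable_real_indicator) auto
    also have "(\<lambda>x. indicator (A \<inter> ball 0 (real n)) x * (norm b)\<^sup>2) = (\<lambda>x. (norm (e A n b x))\<^sup>2)"
      by (auto simp: e_def indicator_def)
    finally show ?thesis by (simp add: sq_int_def e_def)
  qed
  define E where "E = (\<Union>U\<in>B. \<Union>n. \<Union>b\<in>Basis. {abs_L2 (e U n b)})"
  have countE: "countable E"
    unfolding E_def using countB
    by (intro countable_UN) (auto intro!: countable_finite)
  define T where "T = (\<lambda>l. \<Sum>(q, u)\<leftarrow>l. real_of_rat q *\<^sub>R u) ` lists (UNIV \<times> E)"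
  have countT: "countable T"
    unfolding T_def using countE by (intro countable_image countable_lists countable_SIGMA) auto
  have T0: "0 \<in> T" unfolding T_def by (rule image_eqI[where x = "[]"]) auto
  have TE: "u \<in> T" if "u \<in> E" for u
    unfolding T_def by (rule image_eqI[where x = "[(1, u)]"]) (use that in auto)
  have Tadd: "u + v \<in> T" if "u \<in> T" "v \<in> T" for u v
  proof -
    obtain k l where "u = (\<Sum>(q, u)\<leftarrow>k. real_of_rat q *\<^sub>R u)" "v = (\<Sum>(q, u)\<leftarrow>l. real_of_rat q *\<^sub>R u)"
      "k \<in> lists (UNIV \<times> E)" "l \<in> lists (UNIV \<times> E)"
      using \<open>u \<in> T\<close> \<open>v \<in> T\<close> unfolding T_def by blast
    then show ?thesis unfolding T_def by (intro image_eqI[where x = "k @ l"]) auto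
  qed
  have Tscale: "real_of_rat r *\<^sub>R u \<in> T" if "u \<in> T" for r u
  proof -
    obtain l where l: "u = (\<Sum>(q, u)\<leftarrow>l. real_of_rat q *\<^sub>R u)" "l \<in> lists (UNIV \<times> E)"
      using \<open>u \<in> T\<close> unfolding T_def by blast
    have "real_of_rat r *\<^sub>R (\<Sum>(q, u)\<leftarrow>l. real_of_rat q *\<^sub>R u)
        = (\<Sum>(q, u)\<leftarrow>map (\<lambda>(q, u). (r * q, u)) l. real_of_rat q *\<^sub>R u)"
      by (induction l) (auto simp: scaleR_add_right of_rat_mult)
    moreover have "map (\<lambda>(q, u). (r * q, u)) l \<in> lists (UNIV \<times> E)"
      using l(2) by (induction l) auto
    ultimately show ?thesis unfolding T_def l(1) by (metis image_eqI)
  qed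
  define S where "S = closure T"
  have closedS: "closed S" by (simp add: S_def)
  have S_lim: "u \<in> S" if "\<And>i. X i \<in> S" "X \<longlonglongrightarrow> u" for X u
    using closedS that by (auto simp: closed_sequential_limits)
  have S0: "0 \<in> S" using T0 closure_subset by (auto simp: S_def)
  have SE: "u \<in> S" if "u \<in> E" for u using TE[OF that] closure_subset by (auto simp: S_def)
  have S_seq: "\<exists>X. (\<forall>i. X i \<in> T) \<and> X \<longlonglongrightarrow> u" if "u \<in> S" for u
    using that by (simp add: S_def closure_sequential)
  have Sadd: "u + v \<in> S" if "u \<in> S" "v \<in> S" for u v
  proof -
    obtain X Y where X: "\<And>i. X i \<in> T" "X \<longlonglongrightarrow> u" and Y: "\<And>i. Y i \<in> T" "Y \<longlonglongrightarrow> v"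
      using S_seq[OF \<open>u \<in> S\<close>] S_seq[OF \<open>v \<in> S\<close>] by metis
    have "X i + Y i \<in> T" for i using X(1) Y(1) by (rule Tadd)
    moreover have "(\<lambda>i. X i + Y i) \<longlonglongrightarrow> u + v" using X(2) Y(2) by (rule tendsto_add)
    ultimately show ?thesis unfolding S_def closure_sequential by (intro exI[of _ "\<lambda>i. X i + Y i"]) simp
  qed
  have Sscale: "c *\<^sub>R u \<in> S" if "u \<in> S" for c u
  proof -
    obtain X where X: "\<And>i. X i \<in> T" "X \<longlonglongrightarrow> u"
      using S_seq[OF \<open>u \<in> S\<close>] by metis
    have rat: "real_of_rat r *\<^sub>R u \<in> S" for r
    proof -
      have "(\<lambda>i. real_of_rat r *\<^sub>R X i) \<longlonglongrightarrow> real_of_rat r *\<^sub>R u" using X(2) by (intro tendsto_intros)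
      moreover have "real_of_rat r *\<^sub>R X i \<in> T" for i using X(1) by (rule Tscale)
      ultimately show ?thesis
        unfolding S_def closure_sequential by (intro exI[of _ "\<lambda>i. real_of_rat r *\<^sub>R X i"]) simp
    qed
    have "\<exists>r. \<bar>real_of_rat r - c\<bar> < 1 / real (Suc n)" for n
    proof -
      have "c - 1 / real (Suc n) < c + 1 / real (Suc n)" by (simp add: add_pos_pos)
      then obtain r where "c - 1 / real (Suc n) < real_of_rat r" "real_of_rat r < c + 1 / real (Suc n)"
        using of_rat_dense
        by blast
      then show ?thesis by (intro exI[of _ r]) (simp add: abs_less_iff)
    qed
    then obtain r where r: "\<And>n. \<bar>real_of_rat (r n) - c\<bar> < 1 / real (Suc n)" by metis
    have "(\<lambda>n. real_of_rat (r n)) \<longlonglongrightarrow> c"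
    proof (rule LIMSEQ_I)
      fix d :: real assume "d > 0"
      then obtain N where N: "1 / real (Suc N) < d" using nat_approx_posE by metis
      have "\<bar>real_of_rat (r n) - c\<bar> < d" if "n \<ge> N" for n
      proof -
        have "1 / real (Suc n) \<le> 1 / real (Suc N)" using that by (simp add: frac_le)
        then show ?thesis using r[of n] N by linarith
      qed
      then show "\<exists>no. \<forall>n\<ge>no. norm (real_of_rat (r n) - c) < d" by auto
    qed
    then have "(\<lambda>n. real_of_rat (r n) *\<^sub>R u) \<longlonglongrightarrow> c *\<^sub>R u" by (intro tendsto_intros)
    then show ?thesis using rat by (rule S_lim[rotated])
  qed
  have Sdiff: "u - v \<in> S" if "u \<in> S" "v \<in> S" for u v
    using Sadd[OF that(1) Sscale[OF that(2), of "-1"]] by simp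
  have Ssum: "(\<Sum>i\<in>I. u i) \<in> S" if "\<And>i. i \<in> I \<Longrightarrow> u i \<in> S" for I :: "'i set" and u
    using that by (induction I rule: infinite_finite_induct) (auto intro: S0 Sadd)
  have abs_sum: "(\<lambda>x. \<Sum>i\<in>I. F i x) \<in> sq_int \<and> abs_L2 (\<lambda>x. \<Sum>i\<in>I. F i x) = (\<Sum>i\<in>I. abs_L2 (F i))"
    if "\<And>i. i \<in> I \<Longrightarrow> F i \<in> sq_int" for I :: "'i set" and F :: "'i \<Rightarrow> 'a \<Rightarrow> 'b"
    using that
    by (induction I rule: infinite_finite_induct)
      (auto simp: sq_int_zero abs_L2_zero sq_int_add abs_L2_add[symmetric])
  have S_ind_Basis: "abs_L2 (e A n b) \<in> S" if "A \<in> sets borel" "b \<in> Basis" for A n b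
  proof -
    have "B \<subseteq> Pow UNIV" "A \<in> sigma_sets UNIV B" using \<open>A \<in> sets borel\<close> by (simp_all add: borelB)
    with intB show ?thesis
    proof (induction rule: sigma_sets_induct_disjoint)
      case (basic A)
      then show ?case using \<open>b \<in> Basis\<close> by (intro SE) (auto simp: E_def)
    next
      case empty
      show ?case using S0 by (simp add: e_def abs_L2_zero)
    next
      case (compl A)
      then have A: "A \<in> sets borel" by (simp add: borelB)
      have "UNIV \<in> B" unfolding B_def by (rule image_eqI[where x = "{}"]) auto
      then have "abs_L2 (e UNIV n b) \<in> S" using \<open>b \<in> Basis\<close> by (intro SE) (auto simp: E_def)
      from Sdiff[OF this compl(2)] have "abs_L2 (\<lambda>x. e UNIV n b x - e A n b x) \<in> S"
        using A by (simp add: abs_L2_diff e_sq)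
      also have "(\<lambda>x. e UNIV n b x - e A n b x) = e (UNIV - A) n b"
        by (auto simp: e_def indicator_def)
      finally show ?case .
    next
      case (union A)
      then have A: "A i \<in> sets borel" for i by (auto simp: borelB)
      have part: "(\<Sum>i<k. e (A i) n b x) = e (\<Union>i<k. A i) n b x" for k x
      proof -
        have "indicator (\<Union>i<k. A i \<inter> ball 0 (real n)) x = (\<Sum>i<k. indicator (A i \<inter> ball 0 (real n)) x :: real)"
          using \<open>disjoint_family A\<close>
          by (intro indicator_UN_disjoint) (auto simp: disjoint_family_on_def)
        then show ?thesis by (simp add: e_def scaleR_sum_left)
      qed
      have "(\<lambda>k. abs_L2 (\<lambda>x. \<Sum>i<k. e (A i) n b x)) \<longlonglongrightarrow> abs_L2 (e (\<Union>i. A i) n b)"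
      proof (rule abs_L2_tendsto[where c = 1])
        show "(\<lambda>x. \<Sum>i<k. e (A i) n b x) \<in> sq_int" for k
          using A by (simp add: abs_sum e_sq)
        show "e (\<Union>i. A i) n b \<in> sq_int" using A by (intro e_sq) auto
        show "norm (\<Sum>i<k. e (A i) n b x) \<le> 1 * norm (e (\<Union>i. A i) n b x)" for k x
          unfolding part by (auto simp: e_def indicator_def)
        fix x
        have "(\<lambda>k. indicator (\<Union>i<k. A i) x :: real) \<longlonglongrightarrow> indicator (\<Union>i. A i) x"
          by (rule LIMSEQ_indicator_UN)
        then have "(\<lambda>k. (indicator (\<Union>i<k. A i) x * indicator (ball 0 (real n)) x) *\<^sub>R b)
            \<longlonglongrightarrow> (indicator (\<Union>i. A i) x * indicator (ball 0 (real n)) x) *\<^sub>R b"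
          by (intro tendsto_intros)
        then show "(\<lambda>k. \<Sum>i<k. e (A i) n b x) \<longlonglongrightarrow> e (\<Union>i. A i) n b x"
          unfolding part by (simp only: e_def indicator_inter_arith)
      qed
      moreover have "abs_L2 (\<lambda>x. \<Sum>i<k. e (A i) n b x) \<in> S" for k
        using A union by (simp add: abs_sum e_sq Ssum)
      ultimately show ?case by (rule S_lim[rotated])
    qed
  qed
  have S_ind: "abs_L2 (e A n v) \<in> S" if A: "A \<in> sets borel" for A n v
  proof -
    have "e A n v = (\<lambda>x. \<Sum>b\<in>Basis. (v \<bullet> b) *\<^sub>R e A n b x)"
    proof
      fix x
      have "e A n v x = indicator (A \<inter> ball 0 (real n)) x *\<^sub>R (\<Sum>b\<in>Basis. (v \<bullet> b) *\<^sub>R b)"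
        by (simp add: e_def euclidean_representation)
      then show "e A n v x = (\<Sum>b\<in>Basis. (v \<bullet> b) *\<^sub>R e A n b x)"
        by (simp add: e_def scaleR_sum_right mult.commute)
    qed
    moreover have "abs_L2 (\<lambda>x. \<Sum>b\<in>Basis. (v \<bullet> b) *\<^sub>R e A n b x) = (\<Sum>b\<in>Basis. abs_L2 (\<lambda>x. (v \<bullet> b) *\<^sub>R e A n b x))"
      using A by (intro conjunct2[OF abs_sum] sq_int_scaleR e_sq)
    ultimately show ?thesis
      using A by (auto intro!: Ssum Sscale S_ind_Basis simp: abs_L2_scaleR[symmetric] e_sq)
  qed
  have "u \<in> S" for u
  proof -
    define f where "f = rep_L2 u"
    have f: "f \<in> sq_int" and u: "u = abs_L2 f" by (simp_all add: f_def rep_L2_sq_int abs_rep_L2)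
    have "f \<in> borel_measurable lborel" using sq_intD[OF f] by simp
    from borel_measurable_implies_sequence_metric[OF this, of 0]
    obtain s where s: "\<And>i. simple_function lborel (s i)" "\<And>x. (\<lambda>i. s i x) \<longlonglongrightarrow> f x"
      "\<And>i x. norm (s i x) \<le> 2 * norm (f x)" by auto
    define t where "t i x = indicator (ball 0 (real i)) x *\<^sub>R s i x" for i x
    have t_eq: "t i = (\<lambda>x. \<Sum>v\<in>range (s i). e (s i -` {v}) i v x)" for i
    proof
      fix x
      have "finite (range (s i))" using s(1)[of i] by (auto simp: simple_function_def)
      then have "(\<Sum>v\<in>range (s i). e (s i -` {v}) i v x) = (\<Sum>v\<in>{s i x}. e (s i -` {v}) i v x)"
        by (intro sum.mono_neutral_right) (auto simp: e_def)
      then show "t i x = (\<Sum>v\<in>range (s i). e (s i -` {v}) i v x)"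
        by (simp add: t_def e_def indicator_def)
    qed
    have meas: "s i -` {v} \<in> sets borel" for i v
      using simple_functionD(2)[OF s(1)[of i], of "{v}"] by simp
    have t_S: "abs_L2 (t i) \<in> S" and t_sq: "t i \<in> sq_int" for i
      using abs_sum[of "range (s i)" "\<lambda>v. e (s i -` {v}) i v"] e_sq[OF meas] S_ind[OF meas]
      by (auto simp: t_eq intro!: Ssum)
    have "(\<lambda>i. abs_L2 (t i)) \<longlonglongrightarrow> abs_L2 f"
    proof (rule abs_L2_tendsto[OF t_sq f, where c = 2])
      show "norm (t i x) \<le> 2 * norm (f x)" for i x
        using s(3)[of i x] by (auto simp: t_def indicator_def)
      fix x :: 'a
      obtain m :: nat where m: "norm x < real m" using reals_Archimedean2 by blast
      have "\<forall>\<^sub>F i in sequentially. t i x = s i x"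
        using eventually_ge_at_top[of m]
        by eventually_elim (use m in \<open>auto simp: t_def indicator_def\<close>)
      then show "(\<lambda>i. t i x) \<longlonglongrightarrow> f x"
        using s(2)[of x] by (simp cong: tendsto_cong)
    qed
    with t_S show ?thesis unfolding u by (rule S_lim)
  qed
  then have "closure T = UNIV" by (auto simp: S_def)
  then show ?thesis using countT by blast
qed

instance L2 :: (euclidean_space, euclidean_space) second_countable_topology
proof
  obtain T :: "('a, 'b) L2 set" where T: "countable T" "closure T = UNIV"
    using ex_countable_dense_L2 by blast
  define B where "B = (\<lambda>(u, q). ball u (real_of_rat q)) ` (T \<times> UNIV)"
  have "countable B" unfolding B_def using T(1) by (intro countable_image countable_SIGMA) auto
  moreover have "topological_basis B"
  proof (rule topological_basisI)
    show "open U" if "U \<in> B" for U using that by (auto simp: B_def)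
    fix U :: "('a, 'b) L2 set" and x assume "open U" "x \<in> U"
    then obtain r where r: "r > 0" "ball x r \<subseteq> U" by (auto simp: open_contains_ball)
    obtain q where q: "0 < real_of_rat q" "real_of_rat q < r / 2"
      using of_rat_dense[of 0 "r / 2"] r(1) by auto
    have "x \<in> closure T" using T(2) by simp
    then obtain u where u: "u \<in> T" "dist u x < real_of_rat q"
      using q(1) unfolding closure_approachable by blast
    have "ball u (real_of_rat q) \<subseteq> ball x r"
    proof
      fix z assume "z \<in> ball u (real_of_rat q)"
      then show "z \<in> ball x r"
        using u(2) q(2) dist_triangle[of x z u] by (simp add: dist_commute)
    qed
    then show "\<exists>B'\<in>B. x \<in> B' \<and> B' \<subseteq> U"
      using u r(2) by (intro bexI[of _ "ball u (real_of_rat q)"]) (auto simp: B_def)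
  qed
  ultimately show "\<exists>B :: ('a, 'b) L2 set set. countable B \<and> open = generate_topology B"
    by (metis topological_basis_imp_subbasis)
qed

section \<open>Sobolev spaces\<close>

text \<open>
  Near every boundary point, \<open>D\<close> is the strict epigraph, in some direction \<open>e\<close>, of a Lipschitz function
  on the hyperplane orthogonal to \<open>e\<close>.  A domain is an open, connected, nonempty set.
\<close>

definition lipschitz_boundary :: "'a::euclidean_space set \<Rightarrow> bool" where
  "lipschitz_boundary D \<longleftrightarrow>
    (\<forall>z\<in>frontier D. \<exists>r e L \<phi>. r > 0 \<and> norm e = 1 \<and> L-lipschitz_on {x. x \<bullet> e = 0} \<phi> \<and>
      D \<inter> ball z r = {x \<in> ball z r. \<phi> (x - (x \<bullet> e) *\<^sub>R e) < x \<bullet> e})"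

definition bounded_lipschitz_domain :: "'a::euclidean_space set \<Rightarrow> bool" where
  "bounded_lipschitz_domain D \<longleftrightarrow>
    open D \<and> connected D \<and> D \<noteq> {} \<and> bounded D \<and> lipschitz_boundary D"

text \<open>\<open>dderivs [v\<^sub>1, \<dots>, v\<^sub>n] \<phi>\<close> is the iterated directional derivative of \<open>\<phi>\<close>.\<close>

primrec dderivs :: "'a::real_normed_vector list \<Rightarrow> ('a \<Rightarrow> real) \<Rightarrow> 'a \<Rightarrow> real" where
  "dderivs [] \<phi> = \<phi>"
| "dderivs (v # vs) \<phi> = (\<lambda>x. frechet_derivative (dderivs vs \<phi>) (at x) v)"

definition smooth :: "('a::real_normed_vector \<Rightarrow> real) \<Rightarrow> bool" where
  "smooth \<phi> \<longleftrightarrow> (\<forall>vs x. dderivs vs \<phi> differentiable (at x))"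

definition gradient :: "('a::euclidean_space \<Rightarrow> real) \<Rightarrow> 'a \<Rightarrow> 'a" where
  "gradient \<phi> x = (\<Sum>b\<in>Basis. frechet_derivative \<phi> (at x) b *\<^sub>R b)"

definition test_functions :: "'a::euclidean_space set \<Rightarrow> ('a \<Rightarrow> real) set" where
  "test_functions D = {\<phi>. smooth \<phi> \<and> compact (closure {x. \<phi> x \<noteq> 0}) \<and> closure {x. \<phi> x \<noteq> 0} \<subseteq> D}"

lemma sq_int_compact_support:
  fixes \<phi> :: "'a::euclidean_space \<Rightarrow> 'b::euclidean_space"
  assumes cont: "continuous_on UNIV \<phi>" and K: "compact K" and zero: "\<And>x. x \<notin> K \<Longrightarrow> \<phi> x = 0"
  shows "\<phi> \<in> sq_int"
proof -
  have "compact (\<phi> ` K)"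
    using K by (intro compact_continuous_image continuous_on_subset[OF cont]) auto
  then obtain c where "\<forall>z\<in>\<phi> ` K. norm z \<le> c"
    using compact_imp_bounded bounded_iff by blast
  then have c: "\<And>x. x \<in> K \<Longrightarrow> norm (\<phi> x) \<le> c" by blast
  have K_meas: "K \<in> sets borel" using K by (simp add: borel_compact)
  have meas [measurable]: "\<phi> \<in> borel_measurable borel"
    using cont by (rule borel_measurable_continuous_onI)
  have "integrable lborel (\<lambda>x. c\<^sup>2 * indicator K x :: real)"
    using K_meas emeasure_compact_finite[OF K]
    by (intro integrable_mult_right integrable_real_indicator) auto
  then have "integrable lborel (\<lambda>x. (norm (\<phi> x))\<^sup>2)"
  proof (rule Bochner_Integration.integrable_bound)
    have "(norm (\<phi> x))\<^sup>2 \<le> c\<^sup>2 * indicator K x" for x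
      using c[of x] zero[of x] by (cases "x \<in> K") (auto intro: power_mono)
    then show "AE x in lborel. norm ((norm (\<phi> x))\<^sup>2) \<le> norm (c\<^sup>2 * indicator K x :: real)"
      by (intro AE_I2) simp
  qed simp
  then show ?thesis by (simp add: sq_int_def)
qed

text \<open>Hence the classes in the definition of \<open>H\<^sup>1\<^sub>0(D)\<close> below are well defined.\<close>

lemma test_functions_sq_int:
  assumes "\<phi> \<in> test_functions D"
  shows "\<phi> \<in> sq_int" and "gradient \<phi> \<in> sq_int"
proof -
  let ?K = "closure {x. \<phi> x \<noteq> 0}"
  have "smooth \<phi>" and K: "compact ?K"
    using assms by (simp_all add: test_functions_def)
  then have sm: "dderivs vs \<phi> differentiable (at x)" for vs x
    by (simp add: smooth_def)
  have cont: "continuous_on UNIV (dderivs vs \<phi>)" for vs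
    by (intro continuous_at_imp_continuous_on ballI differentiable_imp_continuous_within sm)
  have zero: "\<phi> x = 0" if "x \<notin> ?K" for x
  proof -
    have "x \<notin> {x. \<phi> x \<noteq> 0}" by (rule contra_subsetD[OF closure_subset that])
    then show ?thesis by simp
  qed
  show "\<phi> \<in> sq_int"
    by (rule sq_int_compact_support[OF _ K zero]) (use cont[of "[]"] in simp)
  have "frechet_derivative \<phi> (at x) = (\<lambda>_. 0)" if "x \<notin> ?K" for x
  proof -
    have "(\<phi> has_derivative (\<lambda>_. 0)) (at x)"
    proof (rule has_derivative_transform_within_open)
      show "((\<lambda>_. 0) has_derivative (\<lambda>_. 0)) (at x)" by (rule has_derivative_const)
      show "open (- ?K)" by (rule open_Compl[OF closed_closure])
      show "x \<in> - ?K" using that by simp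
      show "0 = \<phi> z" if "z \<in> - ?K" for z using zero[of z] that by simp
    qed
    then show ?thesis by (rule frechet_derivative_at[symmetric])
  qed
  then have grad_zero: "gradient \<phi> x = 0" if "x \<notin> ?K" for x
    using that by (simp add: gradient_def)
  have "continuous_on UNIV (gradient \<phi>)"
    unfolding gradient_def[abs_def]
    by (intro continuous_on_sum continuous_on_scaleR continuous_on_const) (use cont[of "[_]"] in simp)
  then show "gradient \<phi> \<in> sq_int"
    using K grad_zero by (rule sq_int_compact_support)
qed

text \<open>
  A Sobolev function is represented by the pair \<open>(u, \<nabla>u)\<close>; the norm of the product type is then the
  norm of \<open>H\<^sup>1\<close>.  In this representation \<open>H\<^sup>1\<^sub>0(D)\<close> is the closure of the test functions, all functions
  being extended by zero outside \<open>D\<close>.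
\<close>

type_synonym 'a sobolev = "('a, real) L2 \<times> ('a, 'a) L2"

definition val :: "'a::euclidean_space sobolev \<Rightarrow> 'a \<Rightarrow> real" where
  "val u = rep_L2 (fst u)"

definition grad :: "'a::euclidean_space sobolev \<Rightarrow> 'a \<Rightarrow> 'a" where
  "grad u = rep_L2 (snd u)"

definition H10 :: "'a::euclidean_space set \<Rightarrow> 'a sobolev set" where
  "H10 D = closure ((\<lambda>\<phi>. (abs_L2 \<phi>, abs_L2 (gradient \<phi>))) ` test_functions D)"

definition V_norm :: "'a::euclidean_space set \<Rightarrow> 'a sobolev \<Rightarrow> real" where
  "V_norm D u = sqrt (integral\<^sup>L (lebesgue_on D) (\<lambda>x. (norm (grad u x))\<^sup>2))"

definition W_space :: "'a::euclidean_space set \<Rightarrow> ('a sobolev \<times> 'a sobolev) set" where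
  "W_space D = H10 D \<times> H10 D"

definition W_norm :: "'a::euclidean_space set \<Rightarrow> real \<Rightarrow> 'a sobolev \<times> 'a sobolev \<Rightarrow> real" where
  "W_norm D \<beta> w = sqrt (\<beta> * (V_norm D (fst w))\<^sup>2 + (V_norm D (snd w))\<^sup>2)"


section \<open>The reduced optimality problem\<close>

definition L2_on :: "'a::euclidean_space set \<Rightarrow> ('a \<Rightarrow> real) set" where
  "L2_on D = {f \<in> borel_measurable (lebesgue_on D). integrable (lebesgue_on D) (\<lambda>x. (f x)\<^sup>2)}"

text \<open>The essential supremum of a function that is not measurable is \<open>\<infinity>\<close>.\<close>

definition Linf_on :: "'a::euclidean_space set \<Rightarrow> ('a \<Rightarrow> real) set" where
  "Linf_on D = {f \<in> borel_measurable (lebesgue_on D). esssup (lebesgue_on D) (\<lambda>x. ereal \<bar>f x\<bar>) < \<infinity>}"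

definition L2_inner :: "'a::euclidean_space set \<Rightarrow> ('a \<Rightarrow> real) \<Rightarrow> ('a \<Rightarrow> real) \<Rightarrow> real" where
  "L2_inner D f g = integral\<^sup>L (lebesgue_on D) (\<lambda>x. f x * g x)"

definition a_form ::
  "'a::euclidean_space set \<Rightarrow> 'a sobolev \<Rightarrow> 'a sobolev \<Rightarrow> ('a \<Rightarrow> real) \<Rightarrow> real" where
  "a_form D u u' k = integral\<^sup>L (lebesgue_on D) (\<lambda>x. exp (k x) * (grad u x \<bullet> grad u' x))"

definition A_form :: "'a::euclidean_space set \<Rightarrow> real \<Rightarrow>
    'a sobolev \<times> 'a sobolev \<Rightarrow> 'a sobolev \<times> 'a sobolev \<Rightarrow> ('a \<Rightarrow> real) \<Rightarrow> real" where
  "A_form D \<beta> w w' k = \<beta> * a_form D (fst w) (fst w') k + a_form D (snd w) (snd w') k"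

definition B_form :: "'a::euclidean_space set \<Rightarrow>
    'a sobolev \<times> 'a sobolev \<Rightarrow> 'a sobolev \<times> 'a sobolev \<Rightarrow> real" where
  "B_form D w w' = L2_inner D (val (snd w)) (val (fst w')) - L2_inner D (val (fst w)) (val (snd w'))"

definition F_form :: "'a::euclidean_space set \<Rightarrow> real \<Rightarrow> ('a \<Rightarrow> real) \<Rightarrow> ('a \<Rightarrow> real) \<Rightarrow>
    'a sobolev \<times> 'a sobolev \<Rightarrow> real" where
  "F_form D \<beta> f ud w' = \<beta> * L2_inner D f (val (fst w')) - L2_inner D ud (val (snd w'))"

definition kappa_series :: "(nat \<Rightarrow> 'a \<Rightarrow> real) \<Rightarrow> (nat \<Rightarrow> real) \<Rightarrow> 'a \<Rightarrow> real" where
  "kappa_series \<kappa> y x = (\<Sum>j. y j * \<kappa> j x)"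

text \<open>The parameters \<open>y\<close> for which the series converges almost everywhere to a function in \<open>L\<^sup>\<infinity>(D)\<close>.\<close>

definition admissible ::
  "'a::euclidean_space set \<Rightarrow> (nat \<Rightarrow> 'a \<Rightarrow> real) \<Rightarrow> (nat \<Rightarrow> real) set" where
  "admissible D \<kappa> =
    {y. (AE x in lebesgue_on D. summable (\<lambda>j. y j * \<kappa> j x)) \<and> kappa_series \<kappa> y \<in> Linf_on D}"

definition solves_reduced :: "'a::euclidean_space set \<Rightarrow> real \<Rightarrow> ('a \<Rightarrow> real) \<Rightarrow> ('a \<Rightarrow> real) \<Rightarrow>
    ('a \<Rightarrow> real) \<Rightarrow> 'a sobolev \<times> 'a sobolev \<Rightarrow> bool" where
  "solves_reduced D \<beta> f ud k w \<longleftrightarrow> w \<in> W_space D \<and>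
    (\<forall>w'\<in>W_space D. A_form D \<beta> w w' k + B_form D w w' = F_form D \<beta> f ud w')"

text \<open>
  The problem determines the solution for admissible parameters, hence almost everywhere;
  it is extended by zero to the remaining parameters.
\<close>

definition reduced_solution :: "'a::euclidean_space set \<Rightarrow> real \<Rightarrow> ('a \<Rightarrow> real) \<Rightarrow> ('a \<Rightarrow> real) \<Rightarrow>
    (nat \<Rightarrow> 'a \<Rightarrow> real) \<Rightarrow> (nat \<Rightarrow> real) \<Rightarrow> 'a sobolev \<times> 'a sobolev" where
  "reduced_solution D \<beta> f ud \<kappa> y =
    (if y \<in> admissible D \<kappa> then (THE w. solves_reduced D \<beta> f ud (kappa_series \<kappa> y) w) else 0)"


section \<open>Gaussian measure and Hermite expansions\<close>

abbreviation std_normal :: "real measure" where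
  "std_normal \<equiv> density lborel std_normal_density"

definition gauss :: "(nat \<Rightarrow> real) measure" where
  "gauss = PiM UNIV (\<lambda>_. std_normal)"

definition bochner_L2 :: "'a::euclidean_space set \<Rightarrow> real \<Rightarrow>
    ((nat \<Rightarrow> real) \<Rightarrow> 'a sobolev \<times> 'a sobolev) set" where
  "bochner_L2 D \<beta> = {g \<in> borel_measurable gauss.
    (\<forall>y. g y \<in> W_space D) \<and> integrable gauss (\<lambda>y. (W_norm D \<beta> (g y))\<^sup>2)}"

definition bochner_L2_norm :: "'a::euclidean_space set \<Rightarrow> real \<Rightarrow>
    ((nat \<Rightarrow> real) \<Rightarrow> 'a sobolev \<times> 'a sobolev) \<Rightarrow> real" where
  "bochner_L2_norm D \<beta> g = sqrt (integral\<^sup>L gauss (\<lambda>y. (W_norm D \<beta> (g y))\<^sup>2))"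

text \<open>The monic (probabilists') Hermite polynomials, and their normalization in \<open>L\<^sup>2(N(0,1))\<close>.\<close>

fun monic_hermite :: "nat \<Rightarrow> real poly" where
  "monic_hermite 0 = 1"
| "monic_hermite (Suc 0) = [:0, 1:]"
| "monic_hermite (Suc (Suc n)) =
    [:0, 1:] * monic_hermite (Suc n) - smult (real (Suc n)) (monic_hermite n)"

definition hermite :: "nat \<Rightarrow> real \<Rightarrow> real" where
  "hermite n x = poly (monic_hermite n) x / sqrt (fact n)"

lemma hermite_orthonormal:
  "integrable std_normal (\<lambda>x. hermite m x * hermite n x)"
  "integral\<^sup>L std_normal (\<lambda>x. hermite m x * hermite n x) = (if m = n then 1 else 0)"
proof -
  have mom: "integrable std_normal (\<lambda>x. x ^ k)" for k :: nat
    by (subst integrable_density) (auto simp: integrable_std_normal_moment)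
  define E where "E p = integral\<^sup>L std_normal (poly p)" for p :: "real poly"
  have int: "integrable std_normal (poly p)" for p :: "real poly"
    unfolding poly_altdef[abs_def] by (intro Bochner_Integration.integrable_sum integrable_mult_right mom)
  have E_add: "E (p + q) = E p + E q" for p q
  proof -
    have "poly (p + q) = (\<lambda>x. poly p x + poly q x)" by auto
    then show ?thesis using Bochner_Integration.integral_add[OF int[of p] int[of q]] by (simp only: E_def)
  qed
  have E_smult: "E (smult c p) = c * E p" for c p
  proof -
    have "poly (smult c p) = (\<lambda>x. c * poly p x)" by auto
    then show ?thesis by (simp only: E_def integral_mult_right_zero)
  qed
  have E_diff: "E (p - q) = E p - E q" for p q
    using E_add[of p "smult (-1) q"] E_smult[of "-1" q] by simp
  have E_monom: "E (monom 1 k) = integral\<^sup>L lborel (\<lambda>x. std_normal_density x * x ^ k)" for k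
  proof -
    have "poly (monom 1 k) = (\<lambda>x::real. x ^ k)" by (auto simp: poly_monom)
    then show ?thesis by (simp add: E_def integral_density)
  qed
  have even: "E (monom 1 (2 * k)) = fact (2 * k) / (2 ^ k * fact k)"
    and odd: "E (monom 1 (2 * k + 1)) = 0" for k
    using integral_std_normal_moment_even[of k] integral_std_normal_moment_odd[of k]
    by (simp_all add: E_monom)
  have shift: "E (monom 1 (Suc (Suc k))) = real (Suc k) * E (monom 1 k)" for k
  proof (cases "even k")
    case True
    then obtain j where j: "k = 2 * j" by blast
    have "E (monom 1 (Suc (Suc k))) = E (monom 1 (2 * Suc j))" by (simp add: j)
    also have "\<dots> = fact (2 * Suc j) / (2 ^ Suc j * fact (Suc j))" by (rule even)
    also have "fact (2 * Suc j) = real (2 * Suc j) * (real (Suc k) * fact (2 * j))"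
      by (simp add: j)
    also have "2 ^ Suc j * fact (Suc j) = real (2 * Suc j) * (2 ^ j * fact j)"
      by simp
    also have "real (2 * Suc j) * (real (Suc k) * fact (2 * j)) / (real (2 * Suc j) * (2 ^ j * fact j))
        = real (Suc k) * (fact (2 * j) / (2 ^ j * fact j))"
      by (subst mult_divide_mult_cancel_left) simp_all
    finally show ?thesis using even[of j] by (simp only: j)
  next
    case False
    then obtain j where j: "k = 2 * j + 1" by (rule oddE)
    have "E (monom 1 (Suc (Suc k))) = E (monom 1 (2 * Suc j + 1))" by (simp add: j)
    then show ?thesis unfolding odd using odd[of j] by (simp add: j)
  qed
  have E_X: "E (monom 1 1) = 0" using odd[of 0] by simp
  have E0: "E 0 = 0" using E_smult[of 0 0] by simp
  have E1: "E 1 = 1" using even[of 0] by simp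
  have stein_monom: "E ([:0, 1:] * monom 1 k) = E (pderiv (monom 1 k))" for k
  proof -
    have eq: "[:0, 1:] * monom 1 k = monom (1::real) (Suc k)" by (simp add: monom_Suc)
    show ?thesis
    proof (cases k)
      case 0 then show ?thesis using E_X eq by (simp add: pderiv_monom E0)
    next
      case (Suc j)
      have "pderiv (monom (1::real) k) = smult (real k) (monom 1 j)"
        by (simp add: Suc pderiv_monom smult_monom)
      then show ?thesis using shift[of j] by (simp only: eq[unfolded Suc] E_smult Suc)
    qed
  qed
  have E_sum: "E (\<Sum>i\<in>I. p i) = (\<Sum>i\<in>I. E (p i))" for I :: "nat set" and p
    by (induction I rule: infinite_finite_induct) (auto simp: E0 E_add)
  have deriv_sum: "pderiv (\<Sum>i\<in>I. p i) = (\<Sum>i\<in>I. pderiv (p i))"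
    for I :: "nat set" and p :: "nat \<Rightarrow> real poly"
    by (induction I rule: infinite_finite_induct) (auto simp: pderiv_add)
  have stein: "E ([:0, 1:] * p) = E (pderiv p)" for p
  proof -
    have p: "p = (\<Sum>i\<le>degree p. smult (coeff p i) (monom 1 i))"
      using poly_as_sum_of_monoms[of p] by (simp add: smult_monom)
    have "E ([:0, 1:] * p) = (\<Sum>i\<le>degree p. coeff p i * E ([:0, 1:] * monom 1 i))"
      by (subst p) (simp only: sum_distrib_left E_sum mult_smult_right E_smult)
    also have "\<dots> = (\<Sum>i\<le>degree p. coeff p i * E (pderiv (monom 1 i)))"
      by (simp only: stein_monom)
    also have "\<dots> = E (pderiv p)"
      by (subst (3) p) (simp only: deriv_sum E_sum pderiv_smult E_smult)
    finally show ?thesis .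
  qed
  have deriv: "pderiv (monic_hermite (Suc k)) = smult (real (Suc k)) (monic_hermite k)" for k
  proof (induction k rule: less_induct)
    case (less k)
    consider "k = 0" | "k = 1" | j where "k = Suc (Suc j)" by (metis One_nat_def not0_implies_Suc)
    then show ?case
    proof cases
      case 3
      have "pderiv (monic_hermite (Suc k)) = monic_hermite k
          + [:0, 1:] * smult (real k) (monic_hermite (Suc j))
          - smult (real k) (smult (real (Suc j)) (monic_hermite j))"
        using less[of "Suc j"] less[of j] 3
        by (simp add: pderiv_diff pderiv_mult pderiv_smult pderiv_pCons del: monic_hermite.simps(3))
          (simp add: pderiv_diff pderiv_mult pderiv_smult pderiv_pCons)
      also have "\<dots> = monic_hermite k
          + smult (real k) ([:0, 1:] * monic_hermite (Suc j) - smult (real (Suc j)) (monic_hermite j))"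
        by (simp only: smult_diff_right mult_smult_right add_diff_eq)
      also have "\<dots> = smult (real (Suc k)) (monic_hermite k)"
        by (simp only: 3 monic_hermite.simps(3)[symmetric] of_nat_Suc[of "Suc (Suc j)"] smult_add_left smult_1_left)
      finally show ?thesis .
    qed (simp_all add: pderiv_pCons pderiv_diff)
  qed
  have step: "E (monic_hermite (Suc k) * p) = E (monic_hermite k * pderiv p)" for k p
  proof -
    have "monic_hermite (Suc k) = [:0, 1:] * monic_hermite k - pderiv (monic_hermite k)"
      by (cases k) (simp_all add: deriv del: mult_pCons_left)
    then have "E (monic_hermite (Suc k) * p)
        = E ([:0, 1:] * (monic_hermite k * p)) - E (pderiv (monic_hermite k) * p)"
      by (simp only: left_diff_distrib E_diff mult.assoc)
    also have "\<dots> = E (monic_hermite k * pderiv p)"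
      by (simp only: stein pderiv_mult E_add mult.commute[of p] add_diff_cancel_right')
    finally show ?thesis .
  qed
  have zero: "E (monic_hermite (Suc k)) = 0" for k
    using step[of k 1] by (simp add: E0)
  have orth: "E (monic_hermite m * monic_hermite n) = (if m = n then fact n else 0)"
  proof (induction m arbitrary: n)
    case 0
    then show ?case using zero[of "n - 1"] by (cases n) (auto simp: E1)
  next
    case (Suc m)
    show ?case
    proof (cases n)
      case 0
      then show ?thesis using zero[of m] by simp
    next
      case (Suc k)
      have "E (monic_hermite (Suc m) * monic_hermite n) = real n * E (monic_hermite m * monic_hermite k)"
        by (simp only: step Suc deriv mult_smult_right E_smult)
      then show ?thesis using Suc.IH[of k] Suc by simp
    qed
  qed
  have eq: "hermite m x * hermite n x =
      1 / (sqrt (fact m) * sqrt (fact n)) * poly (monic_hermite m * monic_hermite n) x" for x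
    by (simp add: hermite_def)
  show "integrable std_normal (\<lambda>x. hermite m x * hermite n x)"
    unfolding eq by (intro integrable_mult_right int)
  have "integral\<^sup>L std_normal (\<lambda>x. hermite m x * hermite n x) =
      1 / (sqrt (fact m) * sqrt (fact n)) * E (monic_hermite m * monic_hermite n)"
    unfolding eq E_def by (rule integral_mult_right_zero)
  then show "integral\<^sup>L std_normal (\<lambda>x. hermite m x * hermite n x) = (if m = n then 1 else 0)"
    by (simp add: orth)
qed

text \<open>Multi-indices are indexed from \<open>0\<close>, like the sequences of parameters and functions.\<close>

definition multi_indices :: "(nat \<Rightarrow> nat) set" where
  "multi_indices = {\<nu>. finite {j. \<nu> j \<noteq> 0}}"

text \<open>The factors with \<open>\<nu>\<^sub>j = 0\<close> equal 1.\<close>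

definition hermite_multi :: "(nat \<Rightarrow> nat) \<Rightarrow> (nat \<Rightarrow> real) \<Rightarrow> real" where
  "hermite_multi \<nu> y = (\<Prod>j | \<nu> j \<noteq> 0. hermite (\<nu> j) (y j))"

definition hermite_coeff ::
  "((nat \<Rightarrow> real) \<Rightarrow> 'b::{banach, second_countable_topology}) \<Rightarrow> (nat \<Rightarrow> nat) \<Rightarrow> 'b" where
  "hermite_coeff w \<nu> = integral\<^sup>L gauss (\<lambda>y. hermite_multi \<nu> y *\<^sub>R w y)"

definition hermite_sum ::
  "(nat \<Rightarrow> nat) set \<Rightarrow> ((nat \<Rightarrow> real) \<Rightarrow> 'b::{banach, second_countable_topology}) \<Rightarrow>
    (nat \<Rightarrow> real) \<Rightarrow> 'b" where
  "hermite_sum \<Lambda> w y = (\<Sum>\<nu>\<in>\<Lambda>. hermite_multi \<nu> y *\<^sub>R hermite_coeff w \<nu>)"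

end

theory Submission
  imports Defs
begin

text \<open>
  Let \<open>w(y)\<close> be the solution for the parameter \<open>y\<close>.  The rate of convergence follows from a weighted
  square summability of the Hermite coefficients, \<open>\<Sum>\<^sub>\<nu> b\<^sub>\<nu> \<parallel>w\<^sub>\<nu>\<parallel>\<^sup>2 < \<infinity>\<close>, for explicit weights \<open>b\<^sub>\<nu>\<close> with
  \<open>S = \<Sum>\<^sub>\<nu> b\<^sub>\<nu> powr (- q/2) < \<infinity>\<close>.  Indeed, at most \<open>N\<close> indices can violate \<open>b\<^sub>\<nu> powr (- q/2) \<le> S/N\<close>; if
  \<open>\<Lambda>\<^sub>N\<close> contains these, every other index satisfies \<open>1 \<le> (S/N) powr (2/q) * b\<^sub>\<nu>\<close>, so that by Parseval's
  identity the squared error is at most \<open>(S/N) powr (2/q)\<close> times the weighted sum.  Its square root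
  decays like \<open>N\<close> to the power \<open>- 1/q = 1/2 - 1/p\<close>.

  The weighted summability comes from the derivatives of \<open>w\<close> in the parameters.  The normalized
  derivatives \<open>T\<^sub>k = \<rho>\<^sup>k \<partial>\<^sup>k w / k!\<close>, where \<open>\<rho>\<^sup>k\<close> is the product of the powers of the numbers \<open>\<rho>\<^sub>j\<close>, solve
  the problem of \<open>w\<close> with a right-hand side formed from the \<open>T\<^sub>l\<close> with \<open>l < k\<close>; the factor in front of \<open>T\<^sub>l\<close>
  is the coefficient of index \<open>k - l\<close> in the expansion of the function \<open>exp (\<Sum>\<^sub>j t\<^sub>j \<rho>\<^sub>j \<kappa>\<^sub>j(x))\<close> of \<open>t\<close>.  After
  multiplying all \<open>\<rho>\<^sub>j\<close> by a small constant, the moduli of these coefficients other than the first have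
  sum at most \<open>1/2\<close> at every point \<open>x\<close>.  Testing the equation of each \<open>T\<^sub>k\<close> with \<open>T\<^sub>k\<close> itself (which
  removes the skew coupling form) and adding up therefore bounds \<open>\<Sum>\<^sub>k \<parallel>T\<^sub>k(y)\<parallel>\<^sup>2\<close> by a multiple of
  \<open>exp (2 \<parallel>\<kappa>(y)\<parallel>)\<close> (lemma \<open>taylor_sum_le\<close>).  This function of \<open>y\<close> is integrable: \<open>\<parallel>\<kappa>(y)\<parallel>\<close> is at most a
  multiple of \<open>sup\<^sub>j \<bar>y\<^sub>j\<bar> / \<rho>\<^sub>j\<close>, which has exponential moments because \<open>(1/\<rho>\<^sub>j)\<close> is \<open>q\<close>-summable (lemma
  \<open>gauss_exp_weighted_sup\<close>).

  Gaussian integration by parts turns derivatives into shifts of Hermite coefficients: up to an explicit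
  factor, the coefficient of index \<open>\<mu>\<close> of \<open>T\<^sub>k\<close> is the coefficient of index \<open>k + \<mu>\<close> of \<open>w\<close> (lemma
  \<open>hermite_coeff_taylor\<close>).  Each \<open>\<nu>\<close> is written as \<open>k + \<mu>\<close> with \<open>k\<^sub>j = min \<nu>\<^sub>j r\<close> for a fixed large \<open>r\<close>, and
  Bessel's inequality for every \<open>T\<^sub>k\<close> yields the weighted sum, with weights \<open>b\<^sub>\<nu>\<close> that grow in each
  coordinate like \<open>\<nu>\<^sub>j\<close> to the power \<open>r\<close>; \<open>r q / 2 > 1\<close> makes \<open>\<Sum>\<^sub>\<nu> b\<^sub>\<nu> powr (- q/2)\<close> finite (lemma
  \<open>mi_weight_sum\<close>).

  The analytic tools developed for this purpose are the solution theory of coercive problems and its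
  dependence on the operator, the Poincare inequality on \<open>H\<^sup>1\<^sub>0(D)\<close>, and the completeness of the Hermite
  polynomials in countably many Gaussian variables.
\<close>

section \<open>Coercive variational problems on a closed subspace\<close>

text \<open>
  A minimizing sequence for the distance to \<open>x\<close> is Cauchy by the parallelogram identity.  Its limit is
  the foot of the perpendicular, because moving from it along \<open>W\<close> cannot decrease the distance.
\<close>

lemma orthogonal_projection_exists:
  fixes W :: "'h::{real_inner, banach} set"
  assumes W: "subspace W" "closed W"
  shows "\<exists>p\<in>W. \<forall>v\<in>W. inner (x - p) v = 0"
proof -
  have ne: "W \<noteq> {}" using W(1) by (auto simp: subspace_def)
  define d where "d = infdist x W"
  have d0: "d \<ge> 0" by (simp add: d_def infdist_nonneg)
  have dle: "d \<le> norm (x - v)" if "v \<in> W" for v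
    using infdist_le[OF that, of x] by (simp add: d_def dist_norm)
  have "\<exists>v\<in>W. dist x v < d + 1 / real (Suc n)" for n
  proof (rule ccontr)
    assume "\<not> ?thesis"
    then have "d + 1 / real (Suc n) \<le> infdist x W"
      using ne by (auto simp: infdist_def not_less intro!: cINF_greatest)
    then show False by (simp add: d_def)
  qed
  then obtain p where p: "\<And>n. p n \<in> W" "\<And>n. norm (x - p n) < d + 1 / real (Suc n)"
    unfolding dist_norm by metis
  have par: "(norm (p n - p m))\<^sup>2 \<le> (4 * d + 2) * (1 / real (Suc n) + 1 / real (Suc m))" for n m
  proof -
    have half: "(1/2) *\<^sub>R (p n + p m) \<in> W"
      using p(1) W(1) by (intro subspace_scale subspace_add)
    have id: "(norm (p n - p m))\<^sup>2 = 2 * (norm (x - p n))\<^sup>2 + 2 * (norm (x - p m))\<^sup>2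
        - 4 * (norm (x - (1/2) *\<^sub>R (p n + p m)))\<^sup>2"
      unfolding power2_norm_eq_inner
      by (simp add: inner_diff_left inner_diff_right inner_add_left inner_add_right inner_commute algebra_simps)
    have half_le: "d\<^sup>2 \<le> (norm (x - (1/2) *\<^sub>R (p n + p m)))\<^sup>2"
      using dle[OF half] d0 by (intro power_mono) auto
    have "(norm (x - p i))\<^sup>2 \<le> d\<^sup>2 + (2 * d + 1) * (1 / real (Suc i))" for i
    proof -
      have "(norm (x - p i))\<^sup>2 \<le> (d + 1 / real (Suc i))\<^sup>2"
        using p(2)[of i] by (intro power_mono) auto
      also have "\<dots> = d\<^sup>2 + 2 * d * (1 / real (Suc i)) + (1 / real (Suc i)) * (1 / real (Suc i))"
        by (simp add: power2_eq_square algebra_simps)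
      also have "(1 / real (Suc i)) * (1 / real (Suc i)) \<le> 1 * (1 / real (Suc i))"
        by (intro mult_right_mono) auto
      finally show ?thesis by (simp add: algebra_simps)
    qed
    moreover have "2 * A + 2 * B \<le> 4 * d\<^sup>2 + (4 * d + 2) * (a + b)"
      if "A \<le> d\<^sup>2 + (2 * d + 1) * a" "B \<le> d\<^sup>2 + (2 * d + 1) * b" for A B a b
      using that by (simp add: algebra_simps)
    ultimately have "2 * (norm (x - p n))\<^sup>2 + 2 * (norm (x - p m))\<^sup>2
        \<le> 4 * d\<^sup>2 + (4 * d + 2) * (1 / real (Suc n) + 1 / real (Suc m))"
      by blast
    with id half_le show ?thesis by linarith
  qed
  have "Cauchy p"
  proof (rule metric_CauchyI)
    fix e :: real assume e: "e > 0"
    define c where "c = e\<^sup>2 / (2 * (4 * d + 2))"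
    have c: "c > 0" using e d0 by (simp add: c_def)
    obtain N where N: "1 / real (Suc N) < c" using c nat_approx_posE by metis
    show "\<exists>M. \<forall>m\<ge>M. \<forall>n\<ge>M. dist (p m) (p n) < e"
    proof (intro exI[of _ N] allI impI)
      fix m n assume "m \<ge> N" "n \<ge> N"
      then have "1 / real (Suc m) < c" "1 / real (Suc n) < c"
        using N by (auto intro: le_less_trans[rotated] simp: frac_le)
      then have "(4 * d + 2) * (1 / real (Suc m) + 1 / real (Suc n)) < (4 * d + 2) * (2 * c)"
        using d0 by (intro mult_strict_left_mono) auto
      also have "\<dots> = e\<^sup>2" using d0 by (simp add: c_def divide_simps)
      finally have "(norm (p m - p n))\<^sup>2 < e\<^sup>2" using par[of m n] by linarith
      then show "dist (p m) (p n) < e"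
        unfolding dist_norm using e by (intro power2_less_imp_less[of _ e]) auto
    qed
  qed
  then obtain q where q: "p \<longlonglongrightarrow> q" using Cauchy_convergent convergent_def by blast
  have qW: "q \<in> W" using W(2) p(1) q closed_sequentially by blast
  have "norm (x - q) \<le> d"
  proof (rule LIMSEQ_le)
    show "(\<lambda>n. norm (x - p n)) \<longlonglongrightarrow> norm (x - q)" by (intro tendsto_intros q)
    have "(\<lambda>n. d + 1 / real (Suc n)) \<longlonglongrightarrow> d + 0"
      by (intro tendsto_intros LIMSEQ_Suc[OF lim_1_over_n])
    then show "(\<lambda>n. d + 1 / real (Suc n)) \<longlonglongrightarrow> d" by simp
    show "\<exists>N. \<forall>n\<ge>N. norm (x - p n) \<le> d + 1 / real (Suc n)" using p(2) less_imp_le by blast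
  qed
  with dle[OF qW] have qd: "norm (x - q) = d" by simp
  have "inner (x - q) v = 0" if v: "v \<in> W" for v
  proof (cases "v = 0")
    case False
    \<comment> \<open>The choice of \<open>t\<close> minimizes \<open>norm (x - q - t v)\<close>.\<close>
    define t where "t = inner (x - q) v / inner v v"
    have vv: "inner v v > 0" using False by simp
    have "q + t *\<^sub>R v \<in> W" using qW v W(1) by (intro subspace_add subspace_scale)
    from dle[OF this] have "d\<^sup>2 \<le> (norm (x - q - t *\<^sub>R v))\<^sup>2"
      using d0 by (intro power_mono) (auto simp: algebra_simps)
    also have "\<dots> = d\<^sup>2 - 2 * t * inner (x - q) v + t * t * inner v v"
      unfolding qd[symmetric] power2_norm_eq_inner
      by (simp add: inner_diff_left inner_diff_right inner_commute algebra_simps)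
    also have "t * t * inner v v = t * inner (x - q) v" using vv by (simp add: t_def)
    finally have "t * inner (x - q) v \<le> 0" by simp
    then have "(inner (x - q) v)\<^sup>2 / inner v v \<le> 0" by (simp add: t_def power2_eq_square)
    then have "(inner (x - q) v)\<^sup>2 \<le> 0" using vv by (simp add: divide_le_0_iff)
    then show ?thesis by simp
  qed simp
  with qW show ?thesis by blast
qed

definition orth_proj :: "'h::{real_inner, banach} set \<Rightarrow> 'h \<Rightarrow> 'h" where
  "orth_proj W x = (SOME p. p \<in> W \<and> (\<forall>v\<in>W. inner (x - p) v = 0))"

context
  fixes W :: "'h::{real_inner, banach} set"
  assumes W: "subspace W" "closed W"
begin

lemma orth_proj_mem: "orth_proj W x \<in> W"
  and orth_proj_inner: "v \<in> W \<Longrightarrow> inner (orth_proj W x) v = inner x v"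
proof -
  have *: "orth_proj W x \<in> W \<and> (\<forall>v\<in>W. inner (x - orth_proj W x) v = 0)"
    unfolding orth_proj_def by (rule someI_ex) (use orthogonal_projection_exists[OF W, of x] in blast)
  then show "orth_proj W x \<in> W" by blast
  show "v \<in> W \<Longrightarrow> inner (orth_proj W x) v = inner x v"
    using * by (simp add: inner_diff_left)
qed

lemma eqI_inner_subspace:
  assumes "a \<in> W" "b \<in> W" "\<And>v. v \<in> W \<Longrightarrow> inner a v = inner b v"
  shows "a = b"
proof -
  have "inner (a - b) (a - b) = 0"
    using assms(3)[of "a - b"] assms(1,2) subspace_diff[OF W(1)] by (simp add: inner_diff_left)
  then show ?thesis by simp
qed

lemma orth_proj_id: "x \<in> W \<Longrightarrow> orth_proj W x = x"
  by (rule eqI_inner_subspace) (auto simp: orth_proj_mem orth_proj_inner)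

lemma orth_proj_norm_le: "norm (orth_proj W x) \<le> norm x"
proof (cases "orth_proj W x = 0")
  case False
  have "norm (orth_proj W x) * norm (orth_proj W x) = inner x (orth_proj W x)"
    using orth_proj_inner[OF orth_proj_mem, of x x] by (simp add: power2_norm_eq_inner[symmetric] power2_eq_square)
  also have "\<dots> \<le> norm x * norm (orth_proj W x)" by (rule norm_cauchy_schwarz)
  finally show ?thesis using False by simp
qed simp

lemma bounded_linear_orth_proj: "bounded_linear (orth_proj W)"
proof (rule bounded_linear_intro[where K = 1])
  show "orth_proj W (x + y) = orth_proj W x + orth_proj W y" for x y
    by (rule eqI_inner_subspace)
      (auto simp: orth_proj_mem orth_proj_inner inner_add_left intro: subspace_add[OF W(1)])
  show "orth_proj W (r *\<^sub>R x) = r *\<^sub>R orth_proj W x" for r x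
    by (rule eqI_inner_subspace)
      (auto simp: orth_proj_mem orth_proj_inner intro: subspace_scale[OF W(1)])
qed (simp add: orth_proj_norm_le)

text \<open>
  Write \<open>P\<close> for the projection onto \<open>W\<close>.  With the step length \<open>\<tau> = \<alpha> / n\<^sup>2\<close> the map \<open>w \<mapsto> w - \<tau> P (L w - f)\<close>
  contracts \<open>W\<close> by the factor \<open>sqrt (1 - \<alpha>\<^sup>2 / n\<^sup>2)\<close>, and its fixed point is the solution.
\<close>

lemma Lax_Milgram:
  fixes L :: "'h \<Rightarrow>\<^sub>L 'h"
  assumes \<alpha>: "\<alpha> > 0" and coercive: "\<And>w. w \<in> W \<Longrightarrow> \<alpha> * (norm w)\<^sup>2 \<le> inner (L w) w"
  shows "\<exists>w\<in>W. \<forall>v\<in>W. inner (L w) v = inner f v"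
proof -
  \<comment> \<open>Adding \<open>\<alpha>\<close> to \<open>norm L\<close> ensures \<open>0 < \<alpha> \<le> n\<close>, so that the contraction factor is real also if \<open>L\<close> is small.\<close>
  define n where "n = norm L + \<alpha>"
  have n: "n > 0" "norm L \<le> n" "\<alpha> \<le> n" using \<alpha> by (auto simp: n_def add_nonneg_pos)
  define \<tau> where "\<tau> = \<alpha> / n\<^sup>2"
  have \<tau>: "\<tau> > 0" using \<alpha> n by (simp add: \<tau>_def)
  define T where "T w = w - \<tau> *\<^sub>R orth_proj W (L w - f)" for w
  define c where "c = sqrt (1 - \<alpha>\<^sup>2 / n\<^sup>2)"
  have "\<alpha>\<^sup>2 \<le> n\<^sup>2" using \<alpha> n by (intro power_mono) auto
  then have c2: "0 \<le> 1 - \<alpha>\<^sup>2 / n\<^sup>2" "1 - \<alpha>\<^sup>2 / n\<^sup>2 < 1" using n \<alpha> by (auto simp: divide_le_eq)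
  then have c: "0 \<le> c" "c < 1" "c\<^sup>2 = 1 - \<alpha>\<^sup>2 / n\<^sup>2"
    by (auto simp: c_def real_sqrt_lt_1_iff)
  have "\<exists>!w\<in>W. T w = w"
  proof (rule Banach_fix[OF complete_eq_closed[THEN iffD2, OF W(2)]])
    show "W \<noteq> {}" using W(1) by (auto simp: subspace_def)
    show "0 \<le> c" "c < 1" by (rule c)+
    show "T ` W \<subseteq> W"
      by (auto simp: T_def intro!: subspace_diff[OF W(1)] subspace_scale[OF W(1)] orth_proj_mem)
    show "dist (T u) (T v) \<le> c * dist u v" if "u \<in> W" "v \<in> W" for u v
    proof -
      define z where "z = u - v"
      have z: "z \<in> W" using that W(1) by (auto simp: z_def intro: subspace_diff)
      define p where "p = orth_proj W (L z)"
      have "orth_proj W (L u - f) - orth_proj W (L v - f) = p"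
        unfolding p_def z_def linear_diff[OF bounded_linear.linear[OF bounded_linear_orth_proj], symmetric]
        by (simp add: blinfun.diff_right)
      then have "T u - T v = z - \<tau> *\<^sub>R p"
        by (simp add: T_def z_def algebra_simps flip: scaleR_diff_right)
      note Tuv = this
      have "(dist (T u) (T v))\<^sup>2 = (norm z)\<^sup>2 - 2 * \<tau> * inner p z + \<tau>\<^sup>2 * (norm p)\<^sup>2"
        unfolding dist_norm Tuv power2_norm_eq_inner
        by (simp add: inner_diff_left inner_diff_right inner_commute power2_eq_square algebra_simps)
      also have "\<dots> \<le> (norm z)\<^sup>2 - 2 * \<tau> * (\<alpha> * (norm z)\<^sup>2) + \<tau>\<^sup>2 * (n\<^sup>2 * (norm z)\<^sup>2)"
      proof -
        have "norm p \<le> n * norm z"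
          unfolding p_def using orth_proj_norm_le[of "L z"] norm_blinfun[of L z] mult_right_mono[OF n(2) norm_ge_zero[of z]]
          by linarith
        then have "(norm p)\<^sup>2 \<le> (n * norm z)\<^sup>2" by (intro power_mono) auto
        then have 1: "\<tau>\<^sup>2 * (norm p)\<^sup>2 \<le> \<tau>\<^sup>2 * (n\<^sup>2 * (norm z)\<^sup>2)"
          by (intro mult_left_mono) (auto simp: power_mult_distrib)
        have "\<alpha> * (norm z)\<^sup>2 \<le> inner p z"
          unfolding p_def orth_proj_inner[OF z] using coercive[OF z] .
        then have "2 * \<tau> * (\<alpha> * (norm z)\<^sup>2) \<le> 2 * \<tau> * inner p z" using \<tau> by simp
        with 1 show ?thesis by linarith
      qed
      also have "\<dots> = c\<^sup>2 * (norm z)\<^sup>2"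
      proof -
        have "\<tau>\<^sup>2 * (n\<^sup>2 * (norm z)\<^sup>2) = \<tau> * (\<alpha> * (norm z)\<^sup>2)"
          unfolding \<tau>_def using n(1) by (simp add: power2_eq_square)
        moreover have "c\<^sup>2 * (norm z)\<^sup>2 = (norm z)\<^sup>2 - \<tau> * (\<alpha> * (norm z)\<^sup>2)"
          unfolding c(3) \<tau>_def by (simp add: left_diff_distrib power2_eq_square)
        ultimately show ?thesis by linarith
      qed
      finally have "(dist (T u) (T v))\<^sup>2 \<le> (c * dist u v)\<^sup>2"
        by (simp add: z_def dist_norm power_mult_distrib)
      then show ?thesis by (rule power2_le_imp_le) (use c in simp)
    qed
  qed
  then obtain w where w: "w \<in> W" "T w = w" by blast
  then have "orth_proj W (L w - f) = 0" using \<tau> by (simp add: T_def)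
  then have "inner (L w - f) v = 0" if "v \<in> W" for v
    using orth_proj_inner[OF that, of "L w - f"] by simp
  then show ?thesis using w(1) by (auto simp: inner_diff_left)
qed

end

definition variational_solution :: "'h::{real_inner, banach} set \<Rightarrow> ('h \<Rightarrow>\<^sub>L 'h) \<Rightarrow> 'h \<Rightarrow> 'h" where
  "variational_solution W L f = (SOME w. w \<in> W \<and> (\<forall>v\<in>W. inner (L w) v = inner f v))"

definition coercive_on :: "'h::{real_inner, banach} set \<Rightarrow> real \<Rightarrow> ('h \<Rightarrow>\<^sub>L 'h) \<Rightarrow> bool" where
  "coercive_on W \<alpha> L \<longleftrightarrow> \<alpha> > 0 \<and> (\<forall>w\<in>W. \<alpha> * (norm w)\<^sup>2 \<le> inner (L w) w)"

text \<open>
  The projection onto \<open>W\<close> commutes with the integral and fixes the values of \<open>g\<close>.  The integral of a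
  function that is not integrable is \<open>0\<close>, which lies in \<open>W\<close> as well.
\<close>

lemma integral_mem_closed_subspace:
  fixes g :: "'m \<Rightarrow> 'h::{real_inner, banach, second_countable_topology}"
  assumes W: "subspace W" "closed W" and g: "\<And>y. g y \<in> W"
  shows "integral\<^sup>L M g \<in> W"
proof (cases "integrable M g")
  case True
  have "integral\<^sup>L M g = integral\<^sup>L M (\<lambda>y. orth_proj W (g y))"
    using g by (simp add: orth_proj_id[OF W])
  also have "\<dots> = orth_proj W (integral\<^sup>L M g)"
    by (rule integral_bounded_linear[OF bounded_linear_orth_proj[OF W] True])
  finally show ?thesis using orth_proj_mem[OF W, of "integral\<^sup>L M g"] by argo
next
  case False
  then show ?thesis using W(1) by (simp add: not_integrable_integral_eq subspace_def)
qed

lemma coercive_norm_le: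
  assumes L: "coercive_on W \<alpha> L" and w: "w \<in> W" and r: "inner (L w) w = inner f w"
  shows "norm w \<le> norm f / \<alpha>"
proof (cases "w = 0")
  case True
  then show ?thesis using L by (simp add: coercive_on_def)
next
  case False
  have "\<alpha> * (norm w)\<^sup>2 \<le> inner f w" using L w r by (auto simp: coercive_on_def)
  also have "\<dots> \<le> norm f * norm w" by (rule norm_cauchy_schwarz)
  finally show ?thesis
    using False L by (simp add: coercive_on_def pos_le_divide_eq mult.commute power2_eq_square)
qed

context
  fixes W :: "'h::{real_inner, banach} set" and \<alpha> :: real and L :: "'h \<Rightarrow>\<^sub>L 'h"
  assumes W: "subspace W" "closed W" and L: "coercive_on W \<alpha> L"
begin

lemma variational_solution_mem: "variational_solution W L f \<in> W"
  and variational_solution_inner: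
    "v \<in> W \<Longrightarrow> inner (L (variational_solution W L f)) v = inner f v"
proof -
  have *: "variational_solution W L f \<in> W \<and> (\<forall>v\<in>W. inner (L (variational_solution W L f)) v = inner f v)"
    unfolding variational_solution_def
    by (rule someI_ex) (use Lax_Milgram[OF W, of \<alpha> L f] L in \<open>auto simp: coercive_on_def\<close>)
  then show "variational_solution W L f \<in> W" by blast
  show "v \<in> W \<Longrightarrow> inner (L (variational_solution W L f)) v = inner f v" using * by blast
qed

lemma variational_solution_eqI:
  assumes "w \<in> W" "\<And>v. v \<in> W \<Longrightarrow> inner (L w) v = inner f v"
  shows "variational_solution W L f = w"
proof -
  let ?z = "variational_solution W L f - w"
  have z: "?z \<in> W" using variational_solution_mem assms(1) W(1) by (intro subspace_diff)
  have "norm ?z \<le> norm (0::'h) / \<alpha>"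
    by (rule coercive_norm_le[OF L z])
      (simp add: blinfun.diff_right inner_diff_left variational_solution_inner assms(2) z)
  then show ?thesis by simp
qed

lemma variational_solution_norm_le: "norm (variational_solution W L f) \<le> norm f / \<alpha>"
  by (rule coercive_norm_le[OF L variational_solution_mem])
    (simp add: variational_solution_inner variational_solution_mem)

lemma variational_solution_scaleR:
  "variational_solution W L (c *\<^sub>R f) = c *\<^sub>R variational_solution W L f"
  by (rule variational_solution_eqI)
    (auto simp: variational_solution_mem blinfun.scaleR_right
       variational_solution_inner intro: subspace_scale[OF W(1)])

end

text \<open>
  This is the resolvent identity \<open>L\<inverse> - L'\<inverse> = L\<inverse> (L' - L) L'\<inverse>\<close>, with both data varying.  It expresses
  increments of the solution by solutions for one fixed operator, to which the a priori bound applies.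
\<close>

lemma variational_solution_resolvent:
  assumes W: "subspace W" "closed W" and L: "coercive_on W \<alpha> L" and L': "coercive_on W \<alpha>' L'"
  shows "variational_solution W L f - variational_solution W L' f' =
    variational_solution W L (f - f' - (L - L') (variational_solution W L' f'))"
proof (rule sym, rule variational_solution_eqI[OF W L])
  show "variational_solution W L f - variational_solution W L' f' \<in> W"
    by (intro subspace_diff[OF W(1)] variational_solution_mem[OF W L] variational_solution_mem[OF W L'])
  show "inner (L (variational_solution W L f - variational_solution W L' f')) v =
      inner (f - f' - (L - L') (variational_solution W L' f')) v" if "v \<in> W" for v
    using that by (simp add: blinfun.diff_right blinfun.diff_left inner_diff_left
        variational_solution_inner[OF W L] variational_solution_inner[OF W L'])
qed

lemma has_vector_derivative_iff_quotient:
  "(f has_vector_derivative f') (at t) \<longleftrightarrow> ((\<lambda>h. (1 / (h - t)) *\<^sub>R (f h - f t)) \<longlongrightarrow> f') (at t)"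
proof -
  have eq: "norm (f h - f t - (h - t) *\<^sub>R f') / norm (h - t)
      = norm ((1 / (h - t)) *\<^sub>R (f h - f t) - f')" if "h \<noteq> t" for h
  proof -
    have "(1 / (h - t)) *\<^sub>R (f h - f t) - f' = (1 / (h - t)) *\<^sub>R (f h - f t - (h - t) *\<^sub>R f')"
      using that by (simp add: scaleR_diff_right)
    then show ?thesis by (simp add: divide_inverse mult.commute)
  qed
  have "(f has_vector_derivative f') (at t) \<longleftrightarrow>
      ((\<lambda>h. norm (f h - f t - (h - t) *\<^sub>R f') / norm (h - t)) \<longlongrightarrow> 0) (at t)"
    unfolding has_vector_derivative_def has_derivative_iff_norm
    by (simp add: bounded_linear_scaleR_left)
  also have "\<dots> \<longleftrightarrow> ((\<lambda>h. norm ((1 / (h - t)) *\<^sub>R (f h - f t) - f')) \<longlongrightarrow> 0) (at t)"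
    by (rule tendsto_cong) (use eq in \<open>simp add: eventually_at_filter\<close>)
  finally show ?thesis by (simp add: tendsto_norm_zero_iff LIM_zero_iff)
qed

text \<open>
  The derivative is found by differentiating \<open>L u = f\<close> implicitly.  Applying the resolvent identity twice,
  first to the difference quotient and then to its distance from the claimed derivative, leaves the
  solution of a problem with right-hand side tending to \<open>0\<close>; the coercivity constant \<open>\<alpha>\<close>, common to all
  \<open>h\<close> near \<open>t\<close>, bounds it.
\<close>

lemma variational_solution_has_vector_derivative:
  fixes W :: "'h::{real_inner, banach} set"
  assumes W: "subspace W" "closed W"
    and L: "(L has_vector_derivative L') (at t)" and f: "(f has_vector_derivative f') (at t)"
    and coercive: "\<forall>\<^sub>F h in at t. coercive_on W \<alpha> (L h)" and coercive_t: "coercive_on W \<alpha> (L t)"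
  shows "((\<lambda>h. variational_solution W (L h) (f h)) has_vector_derivative
    variational_solution W (L t) (f' - L' (variational_solution W (L t) (f t)))) (at t)"
proof -
  define u where "u = variational_solution W (L t) (f t)"
  define g where "g = f' - L' u"
  define q where "q h = (1 / (h - t)) *\<^sub>R (f h - f t) - ((1 / (h - t)) *\<^sub>R (L h - L t)) u" for h
  define s where "s = variational_solution W (L t) g"
  have \<alpha>: "\<alpha> > 0" using coercive_t by (simp add: coercive_on_def)
  have Llim: "(L \<longlongrightarrow> L t) (at t)"
    using has_vector_derivative_continuous[OF L] by (simp add: continuous_at)
  have q: "(q \<longlongrightarrow> g) (at t)"
    unfolding q_def g_def using L f unfolding has_vector_derivative_iff_quotient
    by (intro tendsto_diff blinfun.tendsto tendsto_const)
  have eq: "(1 / (h - t)) *\<^sub>R (variational_solution W (L h) (f h) - u) - s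
      = variational_solution W (L h) (q h - g - (L h - L t) s)" if "coercive_on W \<alpha> (L h)" for h
  proof -
    have "(1 / (h - t)) *\<^sub>R (variational_solution W (L h) (f h) - u)
        = variational_solution W (L h) ((1 / (h - t)) *\<^sub>R (f h - f t - (L h - L t) u))"
      unfolding u_def variational_solution_resolvent[OF W that coercive_t]
        variational_solution_scaleR[OF W that] ..
    also have "(1 / (h - t)) *\<^sub>R (f h - f t - (L h - L t) u) = q h"
      by (simp only: q_def scaleR_diff_right[of _ "f h - f t"] blinfun.scaleR_left)
    finally show ?thesis
      unfolding s_def by (simp add: variational_solution_resolvent[OF W that coercive_t])
  qed
  have "((\<lambda>h. (1 / (h - t)) *\<^sub>R (variational_solution W (L h) (f h) - u) - s) \<longlongrightarrow> 0) (at t)"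
  proof (rule Lim_null_comparison)
    show "\<forall>\<^sub>F h in at t. norm ((1 / (h - t)) *\<^sub>R (variational_solution W (L h) (f h) - u) - s)
        \<le> norm (q h - g - (L h - L t) s) / \<alpha>"
      using coercive by eventually_elim (simp only: eq variational_solution_norm_le[OF W])
    have "((\<lambda>h. norm (q h - g - (L h - L t) s) / \<alpha>) \<longlongrightarrow> norm (g - g - (L t - L t) s) / \<alpha>) (at t)"
      using \<alpha> by (intro tendsto_intros q Llim blinfun.tendsto) auto
    then show "((\<lambda>h. norm (q h - g - (L h - L t) s) / \<alpha>) \<longlongrightarrow> 0) (at t)" by simp
  qed
  then show ?thesis
    unfolding has_vector_derivative_iff_quotient by (simp add: LIM_zero_iff u_def s_def g_def)
qed

text \<open>
  Pettis' theorem for separable spaces.  The norm is a supremum of countably many functionals, so that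
  the distances to the points of a countable dense set are measurable, and balls around these points
  generate the topology.
\<close>

lemma borel_measurable_weak:
  fixes h :: "'m \<Rightarrow> 'h::{real_inner, second_countable_topology}"
  assumes weak: "\<And>v. (\<lambda>y. inner (h y) v) \<in> borel_measurable M"
  shows "h \<in> borel_measurable M"
proof -
  obtain T :: "'h set" where T: "countable T" "\<And>X. open X \<Longrightarrow> X \<noteq> {} \<Longrightarrow> \<exists>d\<in>T. d \<in> X"
    using countable_dense_exists by metis
  \<comment> \<open>Test with \<open>v = z\<close>; the inequality extends from \<open>T\<close> to all vectors by continuity.\<close>
  have norm_eq: "norm z \<le> r \<longleftrightarrow> (\<forall>v\<in>T. inner z v \<le> r * norm v)" if "r \<ge> 0" for z :: 'h and r
  proof
    assume "norm z \<le> r"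
    then show "\<forall>v\<in>T. inner z v \<le> r * norm v"
      by (meson mult_right_mono norm_cauchy_schwarz norm_ge_zero order_trans)
  next
    assume *: "\<forall>v\<in>T. inner z v \<le> r * norm v"
    have "closed {v. inner z v \<le> r * norm v}"
      by (intro closed_Collect_le continuous_intros)
    then have "open (- {v. inner z v \<le> r * norm v})" by (rule open_Compl)
    then have "- {v. inner z v \<le> r * norm v} = {}"
      using T(2)[of "- {v. inner z v \<le> r * norm v}"] * by blast
    then have "inner z z \<le> r * norm z" by blast
    then have "norm z * norm z \<le> r * norm z" by (simp add: power2_norm_eq_inner[symmetric] power2_eq_square)
    then show "norm z \<le> r" using that by (cases "z = 0") auto
  qed
  have ball: "{y \<in> space M. norm (h y - c) \<le> r} \<in> sets M" for c and r :: real
  proof (cases "r \<ge> 0")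
    case True
    have [measurable]: "(\<lambda>y. inner (h y - c) v) \<in> borel_measurable M" for v
      using weak[of v] by (simp add: inner_diff_left)
    have "{y \<in> space M. \<forall>v\<in>T. inner (h y - c) v \<le> r * norm v} \<in> sets M"
      using T(1) by measurable
    then show ?thesis using norm_eq[OF True] by simp
  next
    case False
    then have "\<not> norm (h y - c) \<le> r" for y using norm_ge_zero[of "h y - c"] by linarith
    then show ?thesis by simp
  qed
  have [measurable]: "(\<lambda>y. dist c (h y)) \<in> borel_measurable M" for c
    unfolding borel_measurable_iff_le using ball[of c] by (simp add: dist_norm norm_minus_commute)
  show ?thesis
  proof (rule borel_measurableI)
    fix S :: "'h set" assume S: "open S"
    define I where "I = {(c, n). c \<in> T \<and> ball c (1 / real (Suc n)) \<subseteq> S}"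
    have S_eq: "S = (\<Union>(c, n)\<in>I. ball c (1 / real (Suc n)))"
    proof (intro equalityI subsetI)
      fix x assume "x \<in> S"
      then obtain r where r: "r > 0" "ball x r \<subseteq> S" using S by (auto simp: open_contains_ball)
      obtain n where n: "1 / real (Suc n) < r / 2" using r(1) nat_approx_posE[of "r / 2"] by auto
      obtain c where c: "c \<in> T" "c \<in> ball x (1 / real (Suc n))"
        using T(2)[of "ball x (1 / real (Suc n))"] by auto
      have "ball c (1 / real (Suc n)) \<subseteq> ball x r"
      proof
        fix z assume "z \<in> ball c (1 / real (Suc n))"
        then show "z \<in> ball x r" using c(2) n dist_triangle[of x z c] by simp
      qed
      then have "(c, n) \<in> I" using c(1) r(2) by (auto simp: I_def)
      moreover have "x \<in> ball c (1 / real (Suc n))" using c(2) by (simp add: dist_commute)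
      ultimately show "x \<in> (\<Union>(c, n)\<in>I. ball c (1 / real (Suc n)))" by blast
    qed (auto simp: I_def)
    have "h -` S \<inter> space M = (\<Union>(c, n)\<in>I. {y \<in> space M. dist c (h y) < 1 / real (Suc n)})"
    proof -
      have "h y \<in> S \<longleftrightarrow> (\<exists>i\<in>I. dist (fst i) (h y) < 1 / real (Suc (snd i)))" for y
        by (subst S_eq) (simp add: split_beta mem_ball)
      then show ?thesis by (auto simp: split_beta)
    qed
    also have "\<dots> \<in> sets M"
    proof (rule sets.countable_UN'')
      show "countable I"
        by (rule countable_subset[of _ "T \<times> UNIV"]) (use T(1) in \<open>auto simp: I_def\<close>)
      show "(case i of (c, n) \<Rightarrow> {y \<in> space M. dist c (h y) < 1 / real (Suc n)}) \<in> sets M" if "i \<in> I" for i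
        by (cases i) simp
    qed
    finally show "h -` S \<inter> space M \<in> sets M" .
  qed
qed

text \<open>
  The solution is a limit of functions with countably many values: among the members \<open>e i\<close> of a dense
  sequence in \<open>W\<close>, take the first one whose residual is smaller than \<open>1 / (n + 1)\<close>.  Coercivity turns
  a small residual into a small error.
\<close>

lemma variational_solution_measurable:
  fixes W :: "'h::{real_inner, banach, second_countable_topology} set"
    and L :: "'m \<Rightarrow> 'h \<Rightarrow>\<^sub>L 'h"
  assumes W: "subspace W" "closed W"
    and L: "\<And>u v. (\<lambda>y. inner (L y u) v) \<in> borel_measurable M"
    and coercive: "\<And>y. y \<in> space M \<Longrightarrow> \<exists>\<alpha>. coercive_on W \<alpha> (L y)"
  shows "(\<lambda>y. variational_solution W (L y) f) \<in> borel_measurable M"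
proof -
  obtain T :: "'h set" where T: "countable T" "\<And>X. open X \<Longrightarrow> X \<noteq> {} \<Longrightarrow> \<exists>d\<in>T. d \<in> X"
    using countable_dense_exists by metis
  have "T \<noteq> {}" using T(2)[of UNIV] by auto
  define e where "e i = orth_proj W (from_nat_into T i)" for i
  have eW: "e i \<in> W" for i by (simp add: e_def orth_proj_mem[OF W])
  have dense: "\<exists>i. norm (w - e i) < r" if "w \<in> W" "r > 0" for w r
  proof -
    obtain d where d: "d \<in> T" "d \<in> ball w r" using T(2)[of "ball w r"] \<open>r > 0\<close> by auto
    obtain i where i: "from_nat_into T i = d" using from_nat_into_surj[OF T(1) d(1)] by blast
    have "w - e i = orth_proj W (w - d)"
      using linear_diff[OF bounded_linear.linear[OF bounded_linear_orth_proj[OF W]]] \<open>w \<in> W\<close>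
      by (simp add: e_def i orth_proj_id[OF W])
    then show ?thesis
      using orth_proj_norm_le[OF W, of "w - d"] d(2) by (intro exI[of _ i]) (simp add: dist_norm)
  qed
  define R where "R i y = orth_proj W (f - L y (e i))" for i y
  have [measurable]: "R i \<in> borel_measurable M" for i
  proof (rule borel_measurable_weak)
    fix v
    have "inner (R i y) v = inner f (orth_proj W v) - inner (L y (e i)) (orth_proj W v)" for y
      using orth_proj_inner[OF W orth_proj_mem[OF W], of "f - L y (e i)" v]
        orth_proj_inner[OF W orth_proj_mem[OF W], of v "f - L y (e i)"]
      by (simp add: R_def inner_commute inner_diff_left inner_diff_right)
    then show "(\<lambda>y. inner (R i y) v) \<in> borel_measurable M" using L by simp
  qed
  define N where "N n y = (LEAST i. norm (R i y) < 1 / real (Suc n))" for n y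
  have [measurable]: "N n \<in> measurable M (count_space UNIV)" for n
    unfolding N_def by measurable
  have [measurable]: "(\<lambda>y. e (N n y)) \<in> borel_measurable M" for n
    by (rule measurable_compose[of "N n" _ "count_space UNIV"]) auto
  show ?thesis
  proof (rule borel_measurable_LIMSEQ_metric)
    fix y assume y: "y \<in> space M"
    then obtain \<alpha> where \<alpha>: "coercive_on W \<alpha> (L y)" using coercive by blast
    define w where "w = variational_solution W (L y) f"
    have w: "w \<in> W" unfolding w_def by (rule variational_solution_mem[OF W \<alpha>])
    have \<alpha>0: "\<alpha> > 0" using \<alpha> by (simp add: coercive_on_def)
    have R_eq: "R i y = orth_proj W (L y (w - e i))" for i
    proof (rule eqI_inner_subspace[OF W])
      show "inner (R i y) v = inner (orth_proj W (L y (w - e i))) v" if "v \<in> W" for v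
        using that by (simp add: R_def w_def orth_proj_inner[OF W] inner_diff_left blinfun.diff_right
            variational_solution_inner[OF W \<alpha>])
    qed (simp_all add: R_def orth_proj_mem[OF W])
    have lower: "norm (w - e i) \<le> norm (R i y) / \<alpha>" for i
    proof (rule coercive_norm_le[OF \<alpha>])
      show mem: "w - e i \<in> W" by (rule subspace_diff[OF W(1) w eW])
      show "inner (L y (w - e i)) (w - e i) = inner (R i y) (w - e i)"
        unfolding R_eq orth_proj_inner[OF W mem] ..
    qed
    have "\<exists>i. norm (R i y) < 1 / real (Suc n)" for n
    proof -
      have pos: "norm (L y) + 1 > 0" by (simp add: add_nonneg_pos)
      obtain i where i: "norm (w - e i) < 1 / real (Suc n) / (norm (L y) + 1)"
        using dense[OF w, of "1 / real (Suc n) / (norm (L y) + 1)"] pos by auto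
      have "norm (R i y) \<le> norm (L y) * norm (w - e i)"
        unfolding R_eq by (rule order_trans[OF orth_proj_norm_le[OF W] norm_blinfun])
      also have "\<dots> \<le> (norm (L y) + 1) * norm (w - e i)" by (intro mult_right_mono) auto
      also have "\<dots> < 1 / real (Suc n)" using i unfolding pos_less_divide_eq[OF pos] by (simp only: mult.commute)
      finally show ?thesis by blast
    qed
    then have N: "norm (R (N n y) y) < 1 / real (Suc n)" for n
      unfolding N_def by (rule LeastI_ex)
    have "(\<lambda>n. norm (e (N n y) - w)) \<longlonglongrightarrow> 0"
    proof (rule Lim_null_comparison)
      have "norm (e (N n y) - w) \<le> 1 / real (Suc n) / \<alpha>" for n
        using lower[of "N n y"] N[of n] \<alpha>0
        by (smt (verit) divide_right_mono norm_minus_commute)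
      then show "\<forall>\<^sub>F n in sequentially. norm (norm (e (N n y) - w)) \<le> 1 / real (Suc n) / \<alpha>"
        by simp
      show "(\<lambda>n. 1 / real (Suc n) / \<alpha>) \<longlonglongrightarrow> 0"
        using tendsto_divide[OF LIMSEQ_Suc[OF lim_1_over_n] tendsto_const[of \<alpha>]] \<alpha>0 by simp
    qed
    then show "(\<lambda>n. e (N n y)) \<longlonglongrightarrow> variational_solution W (L y) f"
      unfolding w_def by (simp add: LIM_zero_iff tendsto_norm_zero_iff)
  qed measurable
qed

section \<open>Multiplication operators and the energy form\<close>

text \<open>
  The bound is a parameter of the notion because the norms of the operators below are estimated by it.
\<close>

definition ess_bounded :: "('a::euclidean_space \<Rightarrow> real) \<Rightarrow> real \<Rightarrow> bool" where
  "ess_bounded c b \<longleftrightarrow> c \<in> borel_measurable borel \<and> (AE x in lborel. \<bar>c x\<bar> \<le> b)"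

lemma ess_boundedD [measurable_dest]: "ess_bounded c b \<Longrightarrow> c \<in> borel_measurable borel"
  by (simp add: ess_bounded_def)

lemma ess_bounded_AE: "ess_bounded c b \<Longrightarrow> AE x in lborel. \<bar>c x\<bar> \<le> b"
  by (simp add: ess_bounded_def)

lemma ess_bounded_nonneg:
  fixes c :: "'a::euclidean_space \<Rightarrow> real"
  assumes "ess_bounded c b" shows "0 \<le> b"
proof (rule ccontr)
  assume "\<not> 0 \<le> b"
  then have "AE x::'a in lborel. False"
    using ess_bounded_AE[OF assms] by (elim AE_mp) auto
  then have "emeasure lborel (UNIV::'a set) = 0"
    by (simp add: AE_iff_measurable[OF _ refl])
  then show False by simp
qed

lemma ess_bounded_mult:
  assumes c: "ess_bounded c b" and d: "ess_bounded d e"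
  shows "ess_bounded (\<lambda>x. c x * d x) (b * e)"
proof -
  note [measurable] = ess_boundedD[OF c] ess_boundedD[OF d]
  have "AE x in lborel. \<bar>c x * d x\<bar> \<le> b * e"
    using ess_bounded_AE[OF c] ess_bounded_AE[OF d]
    by eventually_elim (auto simp: abs_mult intro!: mult_mono ess_bounded_nonneg[OF c])
  then show ?thesis by (simp add: ess_bounded_def)
qed

lemma sq_int_ess_bounded_mult:
  assumes c: "ess_bounded c b" and f: "f \<in> sq_int"
  shows "(\<lambda>x. c x *\<^sub>R f x) \<in> sq_int"
proof -
  note [measurable] = ess_boundedD[OF c] sq_intD[OF f]
  have "integrable lborel (\<lambda>x. b\<^sup>2 * (norm (f x))\<^sup>2)"
    using sq_int_integrable[OF f] by simp
  then have "integrable lborel (\<lambda>x. (norm (c x *\<^sub>R f x))\<^sup>2)"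
  proof (rule Bochner_Integration.integrable_bound)
    show "AE x in lborel. norm ((norm (c x *\<^sub>R f x))\<^sup>2) \<le> norm (b\<^sup>2 * (norm (f x))\<^sup>2)"
      using ess_bounded_AE[OF c]
    proof eventually_elim
      case (elim x)
      then have "\<bar>c x\<bar>\<^sup>2 \<le> b\<^sup>2" by (intro power_mono) auto
      then show ?case by (auto simp: power_mult_distrib intro!: mult_right_mono)
    qed
  qed measurable
  then show ?thesis by (simp add: sq_int_def)
qed

lemma inner_L2_eq: "inner u v = integral\<^sup>L lborel (\<lambda>x. inner (rep_L2 u x) (rep_L2 v x))"
proof -
  have "inner (abs_L2 (rep_L2 u)) (abs_L2 (rep_L2 v))
      = integral\<^sup>L lborel (\<lambda>x. inner (rep_L2 u x) (rep_L2 v x))"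
    by (rule inner_L2.abs_eq) (simp_all add: L2_rel_refl rep_L2_sq_int)
  then show ?thesis by (simp only: abs_rep_L2)
qed

lemma norm_L2_eq: "(norm u)\<^sup>2 = integral\<^sup>L lborel (\<lambda>x. (norm (rep_L2 u x))\<^sup>2)"
  by (simp only: power2_norm_eq_inner inner_L2_eq)

lemma rep_L2_add: "AE x in lborel. rep_L2 (u + v) x = rep_L2 u x + rep_L2 v x"
  using rep_abs_L2[OF sq_int_add[OF rep_L2_sq_int rep_L2_sq_int], of u v]
  by (simp add: abs_L2_add[OF rep_L2_sq_int rep_L2_sq_int, symmetric] abs_rep_L2)

lemma rep_L2_scaleR: "AE x in lborel. rep_L2 (r *\<^sub>R u) x = r *\<^sub>R rep_L2 u x"
  using rep_abs_L2[OF sq_int_scaleR[OF rep_L2_sq_int], of r u]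
  by (simp add: abs_L2_scaleR[OF rep_L2_sq_int, symmetric] abs_rep_L2)

definition mult_L2 :: "('a::euclidean_space \<Rightarrow> real) \<Rightarrow> ('a, 'b::euclidean_space) L2 \<Rightarrow> ('a, 'b) L2" where
  "mult_L2 c u = abs_L2 (\<lambda>x. c x *\<^sub>R rep_L2 u x)"

context
  fixes c :: "'a::euclidean_space \<Rightarrow> real" and b :: real
  assumes c: "ess_bounded c b"
begin

lemma mult_L2_add: "mult_L2 c (u + v) = mult_L2 c u + (mult_L2 c v :: ('a, 'b::euclidean_space) L2)"
  unfolding mult_L2_def
  by (subst abs_L2_add, (rule sq_int_ess_bounded_mult[OF c] rep_L2_sq_int)+, rule abs_L2_eqI)
    (use rep_L2_add[of u v] in \<open>auto simp: scaleR_add_right elim: AE_mp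
      intro!: sq_int_ess_bounded_mult[OF c] rep_L2_sq_int sq_int_add\<close>)

lemma mult_L2_scaleR: "mult_L2 c (r *\<^sub>R u) = r *\<^sub>R (mult_L2 c u :: ('a, 'b::euclidean_space) L2)"
  unfolding mult_L2_def
  by (subst abs_L2_scaleR, (rule sq_int_ess_bounded_mult[OF c] rep_L2_sq_int)+, rule abs_L2_eqI)
    (use rep_L2_scaleR[of r u] in \<open>auto simp: scaleR_left_commute simp del: scaleR_scaleR elim: AE_mp
      intro!: sq_int_ess_bounded_mult[OF c] rep_L2_sq_int sq_int_scaleR\<close>)

lemma norm_mult_L2_le: "norm (mult_L2 c u :: ('a, 'b::euclidean_space) L2) \<le> b * norm u"
proof (rule power2_le_imp_le)
  note [measurable] = ess_boundedD[OF c] sq_intD[OF rep_L2_sq_int]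
  have "(norm (mult_L2 c u))\<^sup>2 = integral\<^sup>L lborel (\<lambda>x. (norm (c x *\<^sub>R rep_L2 u x))\<^sup>2)"
    unfolding mult_L2_def by (rule norm_abs_L2[OF sq_int_ess_bounded_mult[OF c rep_L2_sq_int]])
  also have "\<dots> \<le> integral\<^sup>L lborel (\<lambda>x. b\<^sup>2 * (norm (rep_L2 u x))\<^sup>2)"
  proof (rule integral_mono_AE)
    show "integrable lborel (\<lambda>x. (norm (c x *\<^sub>R rep_L2 u x))\<^sup>2)"
      by (rule sq_int_integrable[OF sq_int_ess_bounded_mult[OF c rep_L2_sq_int]])
    show "integrable lborel (\<lambda>x. b\<^sup>2 * (norm (rep_L2 u x))\<^sup>2)"
      by (intro integrable_mult_right sq_int_integrable[OF rep_L2_sq_int])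
    show "AE x in lborel. (norm (c x *\<^sub>R rep_L2 u x))\<^sup>2 \<le> b\<^sup>2 * (norm (rep_L2 u x))\<^sup>2"
      using ess_bounded_AE[OF c]
    proof eventually_elim
      case (elim x)
      then have "\<bar>c x\<bar>\<^sup>2 \<le> b\<^sup>2" by (intro power_mono) auto
      then show ?case by (auto simp: power_mult_distrib intro!: mult_right_mono)
    qed
  qed
  also have "\<dots> = (b * norm u)\<^sup>2" by (simp add: norm_L2_eq power_mult_distrib)
  finally show "(norm (mult_L2 c u))\<^sup>2 \<le> (b * norm u)\<^sup>2" .
  show "0 \<le> b * norm u" using ess_bounded_nonneg[OF c] by simp
qed

lemma integrable_mult_inner:
  "integrable lborel (\<lambda>x. c x * inner (rep_L2 u x) (rep_L2 (v :: ('a, 'b::euclidean_space) L2) x))"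
  using sq_int_inner[OF sq_int_ess_bounded_mult[OF c rep_L2_sq_int] rep_L2_sq_int, of u v] by simp

lemma inner_mult_L2:
  "inner (mult_L2 c u) v = integral\<^sup>L lborel (\<lambda>x. c x * inner (rep_L2 u x) (rep_L2 (v :: ('a, 'b::euclidean_space) L2) x))"
proof -
  have *: "(\<lambda>x. c x *\<^sub>R rep_L2 u x) \<in> sq_int"
    by (rule sq_int_ess_bounded_mult[OF c rep_L2_sq_int])
  have "inner (abs_L2 (\<lambda>x. c x *\<^sub>R rep_L2 u x)) (abs_L2 (rep_L2 v))
      = integral\<^sup>L lborel (\<lambda>x. inner (c x *\<^sub>R rep_L2 u x) (rep_L2 v x))"
    by (rule inner_L2.abs_eq) (simp_all add: L2_rel_refl rep_L2_sq_int *)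
  then show ?thesis by (simp add: abs_rep_L2 mult_L2_def)
qed

end

definition energy_density ::
  "real \<Rightarrow> 'a::euclidean_space sobolev \<times> 'a sobolev \<Rightarrow> 'a sobolev \<times> 'a sobolev \<Rightarrow> 'a \<Rightarrow> real" where
  "energy_density \<beta> w v x = \<beta> * inner (grad (fst w) x) (grad (fst v) x) + inner (grad (snd w) x) (grad (snd v) x)"

definition energy_form :: "real \<Rightarrow> ('a::euclidean_space \<Rightarrow> real) \<Rightarrow>
    'a sobolev \<times> 'a sobolev \<Rightarrow> 'a sobolev \<times> 'a sobolev \<Rightarrow> real" where
  "energy_form \<beta> c w v = integral\<^sup>L lborel (\<lambda>x. c x * energy_density \<beta> w v x)"

text \<open>
  In the Hilbert space of pairs \<open>(u, \<nabla>u)\<close> the representing vector of a form that depends only on gradients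
  has the value components \<open>0\<close>.
\<close>

definition energy_op :: "real \<Rightarrow> ('a::euclidean_space \<Rightarrow> real) \<Rightarrow>
    ('a sobolev \<times> 'a sobolev) \<Rightarrow>\<^sub>L ('a sobolev \<times> 'a sobolev)" where
  "energy_op \<beta> c = Blinfun (\<lambda>w. ((0, \<beta> *\<^sub>R mult_L2 c (snd (fst w))), (0, mult_L2 c (snd (snd w)))))"

lemma energy_density_measurable [measurable]: "energy_density \<beta> w v \<in> borel_measurable borel"
proof -
  note [measurable] = sq_intD[OF rep_L2_sq_int]
  show ?thesis unfolding energy_density_def[abs_def] grad_def by measurable
qed

lemma integrable_energy_density:
  assumes "ess_bounded c b"
  shows "integrable lborel (\<lambda>x. c x * energy_density \<beta> w v x)"
proof -
  have "integrable lborel (\<lambda>x. \<beta> * (c x * inner (grad (fst w) x) (grad (fst v) x))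
      + c x * inner (grad (snd w) x) (grad (snd v) x))"
    unfolding grad_def by (intro Bochner_Integration.integrable_add integrable_mult_right integrable_mult_inner[OF assms])
  then show ?thesis by (simp add: energy_density_def algebra_simps)
qed

lemma energy_density_nonneg: "\<beta> \<ge> 0 \<Longrightarrow> 0 \<le> energy_density \<beta> w w x"
  by (simp add: energy_density_def)

text \<open>
  The pointwise version is essential: the weights that multiply the density later are small in sum at
  every point \<open>x\<close>, but they cannot be pulled out of the integral over \<open>x\<close>.
\<close>

lemma energy_density_Cauchy_Schwarz:
  assumes "\<beta> \<ge> 0"
  shows "\<bar>energy_density \<beta> w v x\<bar> \<le> (energy_density \<beta> w w x + energy_density \<beta> v v x) / 2"
proof -
  have "\<bar>inner a b\<bar> \<le> (inner a a + inner b b) / 2" for a b :: 'a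
  proof -
    have "\<bar>inner a b\<bar> \<le> norm a * norm b" by (rule Cauchy_Schwarz_ineq2)
    moreover have "0 \<le> (norm a - norm b)\<^sup>2" by simp
    ultimately show ?thesis unfolding power2_diff by (simp add: power2_norm_eq_inner)
  qed
  note h = this
  have "\<bar>energy_density \<beta> w v x\<bar> \<le> \<beta> * \<bar>inner (grad (fst w) x) (grad (fst v) x)\<bar>
      + \<bar>inner (grad (snd w) x) (grad (snd v) x)\<bar>"
    unfolding energy_density_def using assms by (simp add: abs_triangle_ineq[THEN order_trans] abs_mult)
  also have "\<dots> \<le> \<beta> * ((inner (grad (fst w) x) (grad (fst w) x) + inner (grad (fst v) x) (grad (fst v) x)) / 2)
      + (inner (grad (snd w) x) (grad (snd w) x) + inner (grad (snd v) x) (grad (snd v) x)) / 2"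
    by (intro add_mono mult_left_mono h assms)
  also have "\<dots> = (energy_density \<beta> w w x + energy_density \<beta> v v x) / 2"
    by (simp add: energy_density_def algebra_simps add_divide_distrib)
  finally show ?thesis .
qed

lemma energy_op_apply:
  assumes c: "ess_bounded c b"
  shows "energy_op \<beta> c w = ((0, \<beta> *\<^sub>R mult_L2 c (snd (fst w))), (0, mult_L2 c (snd (snd w))))"
    and norm_energy_op_le: "norm (energy_op \<beta> c) \<le> (\<bar>\<beta>\<bar> + 1) * b"
proof -
  have b: "0 \<le> b" by (rule ess_bounded_nonneg[OF c])
  have le: "norm ((0::('a,real) L2, \<beta> *\<^sub>R mult_L2 c (snd (fst w))), (0::('a,real) L2, mult_L2 c (snd (snd w))))
      \<le> norm w * ((\<bar>\<beta>\<bar> + 1) * b)" for w :: "'a sobolev \<times> 'a sobolev"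
  proof -
    have "norm ((0::('a,real) L2, \<beta> *\<^sub>R mult_L2 c (snd (fst w))), (0::('a,real) L2, mult_L2 c (snd (snd w))))
      \<le> norm (0::('a,real) L2, \<beta> *\<^sub>R mult_L2 c (snd (fst w))) + norm (0::('a,real) L2, mult_L2 c (snd (snd w)))"
      by (rule norm_Pair_le)
    also have "\<dots> = \<bar>\<beta>\<bar> * norm (mult_L2 c (snd (fst w))) + norm (mult_L2 c (snd (snd w)))"
      by (simp add: norm_Pair)
    also have "\<dots> \<le> \<bar>\<beta>\<bar> * (b * norm w) + b * norm w"
    proof -
      have 1: "norm (snd (fst w)) \<le> norm w"
        by (cases w, cases "fst w") (auto intro: order_trans[OF norm_snd_le norm_fst_le])
      have 2: "norm (snd (snd w)) \<le> norm w"
        by (cases w, cases "snd w") (auto intro: order_trans[OF norm_snd_le norm_snd_le])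
      show ?thesis
        by (intro add_mono mult_left_mono order_trans[OF norm_mult_L2_le[OF c]] 1 2 b) auto
    qed
    finally show ?thesis by (simp add: algebra_simps)
  qed
  have "bounded_linear (\<lambda>w :: 'a sobolev \<times> 'a sobolev. ((0::('a,real) L2, \<beta> *\<^sub>R mult_L2 c (snd (fst w))), (0::('a,real) L2, mult_L2 c (snd (snd w)))))"
    by (rule bounded_linear_intro[where K = "(\<bar>\<beta>\<bar> + 1) * b"])
      (simp_all add: mult_L2_add[OF c] mult_L2_scaleR[OF c] scaleR_add_right scaleR_left_commute le)
  then show eq: "energy_op \<beta> c w = ((0, \<beta> *\<^sub>R mult_L2 c (snd (fst w))), (0, mult_L2 c (snd (snd w))))" for w
    unfolding energy_op_def by (simp add: bounded_linear_Blinfun_apply)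
  show "norm (energy_op \<beta> c) \<le> (\<bar>\<beta>\<bar> + 1) * b"
    by (rule norm_blinfun_bound) (use le b in \<open>simp_all add: eq mult.commute\<close>)
qed

lemma inner_energy_op:
  assumes c: "ess_bounded c b"
  shows "inner (energy_op \<beta> c w) v = energy_form \<beta> c w v"
proof -
  have "energy_form \<beta> c w v = integral\<^sup>L lborel (\<lambda>x. \<beta> * (c x * inner (grad (fst w) x) (grad (fst v) x))
      + c x * inner (grad (snd w) x) (grad (snd v) x))"
    by (simp add: energy_form_def energy_density_def algebra_simps)
  also have "\<dots> = \<beta> * integral\<^sup>L lborel (\<lambda>x. c x * inner (grad (fst w) x) (grad (fst v) x))
      + integral\<^sup>L lborel (\<lambda>x. c x * inner (grad (snd w) x) (grad (snd v) x))"
    unfolding grad_def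
    by (subst Bochner_Integration.integral_add) (auto intro!: integrable_mult_right integrable_mult_inner[OF c])
  finally show ?thesis
    by (simp add: energy_op_apply[OF c] inner_prod_def inner_mult_L2[OF c] grad_def)
qed

lemma blinfun_eqI_inner:
  fixes S T :: "'g::real_normed_vector \<Rightarrow>\<^sub>L 'h::real_inner"
  assumes "\<And>w v. inner (S w) v = inner (T w) v"
  shows "S = T"
proof (rule blinfun_eqI)
  fix w
  have "inner (S w - T w) (S w - T w) = 0" by (simp add: inner_diff_left assms)
  then show "S w = T w" by simp
qed

lemma energy_form_linear:
  assumes c: "ess_bounded c b" and d: "ess_bounded d e"
  shows "energy_form \<beta> (\<lambda>x. r * c x + s * d x) w v = r * energy_form \<beta> c w v + s * energy_form \<beta> d w v"
proof -
  have "energy_form \<beta> (\<lambda>x. r * c x + s * d x) w v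
      = integral\<^sup>L lborel (\<lambda>x. r * (c x * energy_density \<beta> w v x) + s * (d x * energy_density \<beta> w v x))"
    by (simp add: energy_form_def algebra_simps)
  also have "\<dots> = r * energy_form \<beta> c w v + s * energy_form \<beta> d w v"
    unfolding energy_form_def
    by (subst Bochner_Integration.integral_add)
      (auto intro!: integrable_mult_right integrable_energy_density[OF c] integrable_energy_density[OF d])
  finally show ?thesis .
qed

lemma ess_bounded_linear:
  assumes c: "ess_bounded c b" and d: "ess_bounded d e"
  shows "ess_bounded (\<lambda>x. r * c x + s * d x) (\<bar>r\<bar> * b + \<bar>s\<bar> * e)"
proof -
  note [measurable] = ess_boundedD[OF c] ess_boundedD[OF d]
  have "AE x in lborel. \<bar>r * c x + s * d x\<bar> \<le> \<bar>r\<bar> * b + \<bar>s\<bar> * e"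
    using ess_bounded_AE[OF c] ess_bounded_AE[OF d]
  proof eventually_elim
    case (elim x)
    have "\<bar>r * c x + s * d x\<bar> \<le> \<bar>r\<bar> * \<bar>c x\<bar> + \<bar>s\<bar> * \<bar>d x\<bar>"
      using abs_triangle_ineq[of "r * c x" "s * d x"] by (simp add: abs_mult)
    also have "\<dots> \<le> \<bar>r\<bar> * b + \<bar>s\<bar> * e" by (intro add_mono mult_left_mono elim) auto
    finally show ?case .
  qed
  then show ?thesis by (simp add: ess_bounded_def)
qed

lemma energy_op_linear:
  assumes c: "ess_bounded c b" and d: "ess_bounded d e"
  shows "energy_op \<beta> (\<lambda>x. r * c x + s * d x) = r *\<^sub>R energy_op \<beta> c + s *\<^sub>R energy_op \<beta> d"
  by (rule blinfun_eqI_inner)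
    (simp add: inner_energy_op[OF ess_bounded_linear[OF c d]] energy_form_linear[OF c d]
      blinfun.add_left blinfun.scaleR_left inner_add_left inner_energy_op[OF c] inner_energy_op[OF d])

lemma energy_op_cong:
  assumes c: "ess_bounded c b" and d: "d \<in> borel_measurable borel" and eq: "AE x in lborel. c x = d x"
  shows "energy_op \<beta> c = energy_op \<beta> d"
proof -
  have "AE x in lborel. \<bar>d x\<bar> \<le> b" using ess_bounded_AE[OF c] eq by eventually_elim simp
  with d have d': "ess_bounded d b" by (simp add: ess_bounded_def)
  note [measurable] = ess_boundedD[OF c] d
  have "energy_form \<beta> c w v = energy_form \<beta> d w v" for w v
    unfolding energy_form_def using eq by (intro integral_cong_AE) (auto elim: AE_mp)
  then show ?thesis
    by (intro blinfun_eqI_inner) (simp add: inner_energy_op[OF c] inner_energy_op[OF d'])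
qed

lemma exp_remainder_le: "\<bar>exp t - 1 - t\<bar> \<le> t\<^sup>2 * exp \<bar>t\<bar>" for t :: real
proof -
  obtain s where s: "\<bar>s\<bar> \<le> \<bar>t\<bar>" "exp t = (\<Sum>m<2. t ^ m / fact m) + exp s / fact 2 * t ^ 2"
    using Maclaurin_exp_le[of t 2] by blast
  have "\<bar>exp t - 1 - t\<bar> = exp s / 2 * t\<^sup>2" using s(2) by (simp add: numeral_2_eq_2)
  also have "\<dots> \<le> exp \<bar>t\<bar> * t\<^sup>2"
  proof -
    have "exp s \<le> exp \<bar>t\<bar>" using s(1) by simp
    then have "exp s / 2 \<le> exp \<bar>t\<bar>" using exp_gt_zero[of s] by linarith
    then show ?thesis by (rule mult_right_mono) simp
  qed
  finally show ?thesis by (simp add: mult.commute)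
qed

text \<open>
  The operator depends linearly on its coefficient and is bounded by the essential supremum of the
  coefficient, so that a uniform estimate of \<open>exp (h d) - 1 - h d\<close> suffices.
\<close>

lemma energy_op_exp_has_vector_derivative:
  assumes c: "ess_bounded c b" and d: "ess_bounded d e"
  shows "((\<lambda>h. energy_op \<beta> (\<lambda>x. c x * exp (h * d x))) has_vector_derivative
    energy_op \<beta> (\<lambda>x. c x * d x)) (at 0)"
proof -
  note [measurable] = ess_boundedD[OF c] ess_boundedD[OF d]
  have b: "0 \<le> b" "0 \<le> e" by (rule ess_bounded_nonneg[OF c] ess_bounded_nonneg[OF d])+
  have ex: "ess_bounded (\<lambda>x. exp (h * d x)) (exp (\<bar>h\<bar> * e))" for h
  proof -
    have "AE x in lborel. \<bar>exp (h * d x)\<bar> \<le> exp (\<bar>h\<bar> * e)"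
      using ess_bounded_AE[OF d]
    proof eventually_elim
      case (elim x)
      have "h * d x \<le> \<bar>h\<bar> * \<bar>d x\<bar>" by (metis abs_ge_self abs_mult)
      also have "\<dots> \<le> \<bar>h\<bar> * e" by (intro mult_left_mono elim) auto
      finally show ?case by simp
    qed
    then show ?thesis by (simp add: ess_bounded_def)
  qed
  note cex = ess_bounded_mult[OF c ex] and cd = ess_bounded_mult[OF c d]
  have rem: "norm ((1 / h) *\<^sub>R (energy_op \<beta> (\<lambda>x. c x * exp (h * d x)) - energy_op \<beta> c) - energy_op \<beta> (\<lambda>x. c x * d x))
      \<le> (\<bar>\<beta>\<bar> + 1) * (b * (\<bar>h\<bar> * (e\<^sup>2 * exp (\<bar>h\<bar> * e))))" if h: "h \<noteq> 0" for h
  proof -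
    let ?q = "\<lambda>x. (1 / h) * (1 * (c x * exp (h * d x)) + (-1) * c x) + (-1) * (c x * d x)"
    have quot: "(1 / h) *\<^sub>R (energy_op \<beta> (\<lambda>x. c x * exp (h * d x)) - energy_op \<beta> c) - energy_op \<beta> (\<lambda>x. c x * d x)
        = energy_op \<beta> ?q"
      unfolding energy_op_linear[OF ess_bounded_linear[OF cex[of h] c] cd]
        energy_op_linear[OF cex[of h] c] by simp
    have bound: "ess_bounded ?q (b * (\<bar>h\<bar> * (e\<^sup>2 * exp (\<bar>h\<bar> * e))))"
      unfolding ess_bounded_def
    proof
      show "AE x in lborel. \<bar>?q x\<bar> \<le> b * (\<bar>h\<bar> * (e\<^sup>2 * exp (\<bar>h\<bar> * e)))"
        using ess_bounded_AE[OF c] ess_bounded_AE[OF d]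
      proof eventually_elim
        case (elim x)
        have hd: "\<bar>h * d x\<bar> \<le> \<bar>h\<bar> * e" by (simp add: abs_mult mult_left_mono elim)
        have "?q x = c x * ((exp (h * d x) - 1 - h * d x) / h)"
          using h by (simp add: field_simps)
        then have "\<bar>?q x\<bar> = \<bar>c x\<bar> * (\<bar>exp (h * d x) - 1 - h * d x\<bar> / \<bar>h\<bar>)"
          by (simp add: abs_mult)
        also have "\<dots> \<le> b * (((h * d x)\<^sup>2 * exp \<bar>h * d x\<bar>) / \<bar>h\<bar>)"
          by (intro mult_mono divide_right_mono exp_remainder_le elim b) auto
        also have "((h * d x)\<^sup>2 * exp \<bar>h * d x\<bar>) / \<bar>h\<bar> \<le> ((\<bar>h\<bar> * e)\<^sup>2 * exp (\<bar>h\<bar> * e)) / \<bar>h\<bar>"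
        proof (intro divide_right_mono mult_mono)
          show "(h * d x)\<^sup>2 \<le> (\<bar>h\<bar> * e)\<^sup>2" using hd by (metis abs_ge_zero power2_abs power_mono)
        qed (use hd in auto)
        also have "((\<bar>h\<bar> * e)\<^sup>2 * exp (\<bar>h\<bar> * e)) / \<bar>h\<bar> = \<bar>h\<bar> * (e\<^sup>2 * exp (\<bar>h\<bar> * e))"
          using h by (simp add: power2_eq_square)
        finally show ?case using b by (simp add: mult_left_mono)
      qed
    qed measurable
    show ?thesis unfolding quot by (rule norm_energy_op_le[OF bound])
  qed
  have "((\<lambda>h. (1 / (h - 0)) *\<^sub>R (energy_op \<beta> (\<lambda>x. c x * exp (h * d x)) - energy_op \<beta> (\<lambda>x. c x * exp (0 * d x)))
      - energy_op \<beta> (\<lambda>x. c x * d x)) \<longlongrightarrow> 0) (at 0)"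
  proof (rule Lim_null_comparison)
    show "\<forall>\<^sub>F h in at 0. norm ((1 / (h - 0)) *\<^sub>R (energy_op \<beta> (\<lambda>x. c x * exp (h * d x)) - energy_op \<beta> (\<lambda>x. c x * exp (0 * d x)))
      - energy_op \<beta> (\<lambda>x. c x * d x)) \<le> (\<bar>\<beta>\<bar> + 1) * (b * (\<bar>h\<bar> * (e\<^sup>2 * exp (\<bar>h\<bar> * e))))"
    proof -
      have "\<forall>\<^sub>F h::real in at 0. h \<noteq> 0" by (rule eventually_neq_at_within)
      then show ?thesis
        by eventually_elim (unfold diff_zero mult_zero_left exp_zero mult_1_right, erule rem)
    qed
    have "((\<lambda>h. (\<bar>\<beta>\<bar> + 1) * (b * (\<bar>h\<bar> * (e\<^sup>2 * exp (\<bar>h\<bar> * e))))) \<longlongrightarrow>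
        (\<bar>\<beta>\<bar> + 1) * (b * (\<bar>0\<bar> * (e\<^sup>2 * exp (\<bar>0\<bar> * e))))) (at 0)"
      by (intro tendsto_intros)
    then show "((\<lambda>h. (\<bar>\<beta>\<bar> + 1) * (b * (\<bar>h\<bar> * (e\<^sup>2 * exp (\<bar>h\<bar> * e))))) \<longlongrightarrow> 0) (at 0)" by simp
  qed
  then show ?thesis unfolding has_vector_derivative_iff_quotient by (simp add: LIM_zero_iff)
qed

section \<open>The space of Sobolev functions with zero boundary values\<close>

text \<open>
  Every difference quotient of \<open>\<psi>\<close> has integral \<open>0\<close> by the translation invariance of Lebesgue measure,
  and dominated convergence passes to the derivative.
\<close>

lemma integral_directional_derivative_eq_0:
  fixes \<psi> :: "'a::euclidean_space \<Rightarrow> real"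
  assumes diff: "\<And>x. \<psi> differentiable (at x)"
    and cont: "continuous_on UNIV (\<lambda>x. frechet_derivative \<psi> (at x) b)"
    and K: "compact K" and zero: "\<And>x. x \<notin> K \<Longrightarrow> \<psi> x = 0"
  shows "integral\<^sup>L lborel (\<lambda>x. frechet_derivative \<psi> (at x) b) = 0"
proof -
  let ?d = "\<lambda>x. frechet_derivative \<psi> (at x) b"
  have c\<psi>: "continuous_on UNIV \<psi>"
    by (intro continuous_at_imp_continuous_on ballI differentiable_imp_continuous_within diff)
  note [measurable] = borel_measurable_continuous_onI[OF c\<psi>] borel_measurable_continuous_onI[OF cont]
  have line: "((\<lambda>t. \<psi> (x + t *\<^sub>R b)) has_real_derivative ?d (x + t *\<^sub>R b)) (at t)" for x t
  proof -
    let ?f = "frechet_derivative \<psi> (at (x + t *\<^sub>R b))"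
    have f: "(\<psi> has_derivative ?f) (at (x + t *\<^sub>R b))"
      using diff frechet_derivative_works by blast
    have "((\<lambda>t. x + t *\<^sub>R b) has_derivative (\<lambda>s. s *\<^sub>R b)) (at t)"
      by (auto intro!: derivative_eq_intros)
    from has_derivative_compose[OF this f]
    have "((\<lambda>t. \<psi> (x + t *\<^sub>R b)) has_derivative (\<lambda>s. ?f (s *\<^sub>R b))) (at t)" .
    moreover have "?f (s *\<^sub>R b) = ?f b * s" for s
      using linear_scale[OF has_derivative_linear[OF f], of s b] by simp
    ultimately show ?thesis by (simp add: has_field_derivative_def)
  qed
  obtain r where r: "\<And>x. x \<in> K \<Longrightarrow> norm x \<le> r" "r > 0"
    using compact_imp_bounded[OF K] unfolding bounded_pos by blast
  \<comment> \<open>This ball contains the supports of all difference quotients with step at most \<open>1\<close>.\<close>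
  define K' where "K' = cball (0::'a) (r + norm b)"
  have "compact (?d ` K')" unfolding K'_def
    by (intro compact_continuous_image continuous_on_subset[OF cont]) auto
  then obtain C where C: "\<And>x. x \<in> K' \<Longrightarrow> \<bar>?d x\<bar> \<le> C" "C > 0"
    using compact_imp_bounded[of "?d ` K'"] unfolding bounded_pos by auto
  have d0: "?d x = 0" if "x \<notin> K" for x
  proof -
    have "open (- K)" using K by (simp add: compact_imp_closed open_Compl)
    have "(\<psi> has_derivative (\<lambda>_. 0)) (at x)"
      by (rule has_derivative_transform_within_open[OF has_derivative_const \<open>open (- K)\<close>]) (use that zero in auto)
    then show ?thesis by (simp add: frechet_derivative_at[symmetric])
  qed
  have d_le: "\<bar>?d x\<bar> \<le> C" for x
  proof (cases "x \<in> K")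
    case True
    then have "norm x \<le> r + norm b" using r(1)[of x] norm_ge_zero[of b] by linarith
    then show ?thesis by (intro C) (simp add: K'_def)
  qed (use C d0 in simp)
  define q where "q n x = (\<psi> (x + (1 / real (Suc n)) *\<^sub>R b) - \<psi> x) * real (Suc n)" for n x
  have int\<psi>: "integrable lborel \<psi>"
  proof -
    have "integrable lborel (\<lambda>x. indicator K x *\<^sub>R \<psi> x)"
      by (rule borel_integrable_compact[OF K continuous_on_subset[OF c\<psi>]]) simp
    also have "(\<lambda>x. indicator K x *\<^sub>R \<psi> x) = \<psi>" using zero by (auto simp: indicator_def fun_eq_iff)
    finally show ?thesis .
  qed
  have shift: "integrable lborel (\<lambda>x. \<psi> (x + v))" "integral\<^sup>L lborel (\<lambda>x. \<psi> (x + v)) = integral\<^sup>L lborel \<psi>" for v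
  proof -
    have "integral\<^sup>L lborel \<psi> = integral\<^sup>L (distr lborel borel ((+) v)) \<psi>"
      by (simp only: lborel_distr_plus)
    also have "\<dots> = integral\<^sup>L lborel (\<lambda>x. \<psi> (v + x))"
      by (rule integral_distr) auto
    finally show "integral\<^sup>L lborel (\<lambda>x. \<psi> (x + v)) = integral\<^sup>L lborel \<psi>"
      by (simp add: add.commute)
    have "integrable (distr lborel borel ((+) v)) \<psi>"
      unfolding lborel_distr_plus by (rule int\<psi>)
    then have "integrable lborel (\<lambda>x. \<psi> (v + x))"
      by (subst (asm) integrable_distr_eq) auto
    then show "integrable lborel (\<lambda>x. \<psi> (x + v))"
      by (simp add: add.commute)
  qed
  have "integral\<^sup>L lborel (q n) = 0" for n
    unfolding q_def using shift int\<psi> by simp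
  moreover have "(\<lambda>n. integral\<^sup>L lborel (q n)) \<longlonglongrightarrow> integral\<^sup>L lborel ?d"
  proof (rule integral_dominated_convergence[where w = "\<lambda>x. C * indicator K' x"])
    show "integrable lborel (\<lambda>x. C * indicator K' x :: real)"
      unfolding K'_def using emeasure_compact_finite[OF compact_cball[of "0::'a" "r + norm b"]]
      by (intro integrable_mult_right integrable_real_indicator) auto
    show "AE x in lborel. (\<lambda>n. q n x) \<longlonglongrightarrow> ?d x"
    proof (rule AE_I2)
      fix x
      have "((\<lambda>t. (\<psi> (x + t *\<^sub>R b) - \<psi> (x + 0 *\<^sub>R b)) / (t - 0)) \<longlongrightarrow> ?d (x + 0 *\<^sub>R b)) (at 0)"
        using line[of x 0] unfolding has_field_derivative_iff .
      then have "((\<lambda>t. (\<psi> (x + t *\<^sub>R b) - \<psi> x) / t) \<longlongrightarrow> ?d x) (at 0)"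
        by (simp only: scaleR_zero_left add_0_right diff_zero)
      moreover have "filterlim (\<lambda>n. 1 / real (Suc n)) (at 0) sequentially"
        by (rule filterlim_atI[OF LIMSEQ_Suc[OF lim_1_over_n]]) simp
      ultimately have "(\<lambda>n. (\<psi> (x + (1 / real (Suc n)) *\<^sub>R b) - \<psi> x) / (1 / real (Suc n))) \<longlonglongrightarrow> ?d x"
        by (rule filterlim_compose)
      moreover have "(\<psi> (x + (1 / real (Suc n)) *\<^sub>R b) - \<psi> x) / (1 / real (Suc n)) = q n x" for n
        by (simp add: q_def)
      ultimately show "(\<lambda>n. q n x) \<longlonglongrightarrow> ?d x" by (simp only:)
    qed
    show "AE x in lborel. norm (q n x) \<le> C * indicator K' x" for n
    proof (rule AE_I2)
      fix x
      let ?h = "1 / real (Suc n)"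
      have h: "0 < ?h" "?h \<le> 1" by auto
      show "norm (q n x) \<le> C * indicator K' x"
      proof (cases "x \<in> K'")
        case True
        obtain z where z: "0 < z" "z < ?h" "\<psi> (x + ?h *\<^sub>R b) - \<psi> (x + 0 *\<^sub>R b) = (?h - 0) * ?d (x + z *\<^sub>R b)"
          using MVT2[OF h(1), of "\<lambda>t. \<psi> (x + t *\<^sub>R b)" "\<lambda>t. ?d (x + t *\<^sub>R b)"] line by blast
        then have "q n x = ?d (x + z *\<^sub>R b)" by (simp add: q_def field_simps)
        then show ?thesis using d_le True by simp
      next
        case False
        then have "norm x > r + norm b" by (simp add: K'_def)
        moreover have "norm (?h *\<^sub>R b) \<le> norm b" using h mult_right_mono[OF h(2) norm_ge_zero[of b]] by simp
        moreover have "norm x \<le> norm (x + ?h *\<^sub>R b) + norm (?h *\<^sub>R b)"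
          using norm_triangle_ineq4[of "x + ?h *\<^sub>R b" "?h *\<^sub>R b"] by simp
        moreover have "norm b \<ge> 0" by simp
        ultimately have "\<not> norm x \<le> r" "\<not> norm (x + ?h *\<^sub>R b) \<le> r" by linarith+
        then have "x \<notin> K" "x + ?h *\<^sub>R b \<notin> K" using r(1) by blast+
        then show ?thesis using False by (simp add: q_def zero)
      qed
    qed
  qed (simp_all add: q_def[abs_def])
  ultimately show ?thesis by (simp add: LIMSEQ_const_iff)
qed

lemma gradient_inner_Basis:
  assumes "b \<in> Basis" shows "inner (gradient \<phi> x) b = frechet_derivative \<phi> (at x) b"
  unfolding gradient_def using assms by (simp add: inner_sum_left inner_Basis if_distrib sum.delta cong: if_cong)

text \<open>
  The derivative of \<open>\<phi>\<^sup>2 x\<^sub>b\<close> in the direction of a basis vector \<open>b\<close> is \<open>\<phi>\<^sup>2 + 2 \<phi> (\<partial>\<^sub>b \<phi>) x\<^sub>b\<close>, and its integral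
  vanishes.  As \<open>\<bar>x\<^sub>b\<bar> \<le> r\<close> on \<open>D\<close>, the Cauchy-Schwarz inequality gives the constant \<open>2 r\<close>.
\<close>

lemma Poincare_test_function:
  fixes D :: "'a::euclidean_space set"
  assumes \<phi>: "\<phi> \<in> test_functions D" and D: "\<And>x. x \<in> D \<Longrightarrow> norm x \<le> r" and r0: "r \<ge> 0"
  shows "norm (abs_L2 \<phi>) \<le> 2 * r * norm (abs_L2 (gradient \<phi>))"
proof (cases "abs_L2 \<phi> = 0")
  case False
  let ?K = "closure {x. \<phi> x \<noteq> 0}"
  have sm: "dderivs vs \<phi> differentiable (at x)" for vs x
    using \<phi> by (auto simp: test_functions_def smooth_def)
  have K: "compact ?K" "?K \<subseteq> D" using \<phi> by (auto simp: test_functions_def)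
  have zero: "\<phi> x = 0" if "x \<notin> ?K" for x
  proof -
    have "x \<notin> {x. \<phi> x \<noteq> 0}" by (rule contra_subsetD[OF closure_subset that])
    then show ?thesis by simp
  qed
  note sq = test_functions_sq_int[OF \<phi>]
  note [measurable] = sq_intD[OF sq(1)] sq_intD[OF sq(2)]
  obtain b :: 'a where b: "b \<in> Basis" using nonempty_Basis by blast
  let ?d = "\<lambda>x. frechet_derivative \<phi> (at x) b"
  let ?\<psi> = "\<lambda>x. (\<phi> x)\<^sup>2 * inner x b"
  have \<phi>d: "(\<phi> has_derivative frechet_derivative \<phi> (at x)) (at x)" for x
    using sm[of "[]" x] frechet_derivative_works by auto
  have \<psi>d: "(?\<psi> has_derivative (\<lambda>v. (\<phi> x)\<^sup>2 * inner v b + 2 * \<phi> x * frechet_derivative \<phi> (at x) v * inner x b)) (at x)" for x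
    by (auto intro!: derivative_eq_intros \<phi>d simp: power2_eq_square algebra_simps)
  have \<psi>f: "frechet_derivative ?\<psi> (at x) b = (\<phi> x)\<^sup>2 + 2 * \<phi> x * ?d x * inner x b" for x
    unfolding frechet_derivative_at[OF \<psi>d[of x], symmetric] using b by (simp add: inner_Basis)
  have cont: "continuous_on UNIV (dderivs vs \<phi>)" for vs
    by (intro continuous_at_imp_continuous_on ballI differentiable_imp_continuous_within sm)
  have "integral\<^sup>L lborel (\<lambda>x. frechet_derivative ?\<psi> (at x) b) = 0"
  proof (rule integral_directional_derivative_eq_0[OF _ _ K(1)])
    show "?\<psi> differentiable (at x)" for x using \<psi>d differentiableI by blast
    show "?\<psi> x = 0" if "x \<notin> ?K" for x using zero[OF that] by simp
    show "continuous_on UNIV (\<lambda>x. frechet_derivative ?\<psi> (at x) b)"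
      unfolding \<psi>f using cont[of "[]"] cont[of "[b]"] by (intro continuous_intros) auto
  qed
  then have eq0: "integral\<^sup>L lborel (\<lambda>x. (\<phi> x)\<^sup>2 + 2 * \<phi> x * ?d x * inner x b) = 0" by (simp only: \<psi>f)
  have i1: "integrable lborel (\<lambda>x. (\<phi> x)\<^sup>2)" using sq_int_integrable[OF sq(1)] by simp
  have xr: "\<bar>\<phi> x * ?d x * inner x b\<bar> \<le> r * (\<bar>\<phi> x\<bar> * norm (gradient \<phi> x))" for x
  proof (cases "x \<in> ?K")
    case True
    then have "\<bar>inner x b\<bar> \<le> r" using Basis_le_norm[OF b, of x] D K(2) by force
    moreover have "\<bar>?d x\<bar> \<le> norm (gradient \<phi> x)"
      using Basis_le_norm[OF b, of "gradient \<phi> x"] by (simp add: gradient_inner_Basis[OF b])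
    ultimately have "(\<bar>\<phi> x\<bar> * \<bar>?d x\<bar>) * \<bar>inner x b\<bar> \<le> (\<bar>\<phi> x\<bar> * norm (gradient \<phi> x)) * r"
      by (intro mult_mono mult_left_mono) auto
    then show ?thesis by (simp add: abs_mult mult.commute)
  next
    case False
    then show ?thesis using zero[OF False] by simp
  qed
  have i3: "integrable lborel (\<lambda>x. \<bar>\<phi> x\<bar> * norm (gradient \<phi> x))"
    and CS: "integral\<^sup>L lborel (\<lambda>x. \<bar>\<phi> x\<bar> * norm (gradient \<phi> x)) \<le> norm (abs_L2 \<phi>) * norm (abs_L2 (gradient \<phi>))"
  proof -
    have a: "(\<lambda>x. \<bar>\<phi> x\<bar>) \<in> sq_int" by (rule sq_int_bound[OF _ sq(1), where c = 1]) auto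
    have g: "(\<lambda>x. norm (gradient \<phi> x)) \<in> sq_int" by (rule sq_int_bound[OF _ sq(2), where c = 1]) auto
    show "integrable lborel (\<lambda>x. \<bar>\<phi> x\<bar> * norm (gradient \<phi> x))" using sq_int_inner[OF a g] by simp
    have "integral\<^sup>L lborel (\<lambda>x. \<bar>\<phi> x\<bar> * norm (gradient \<phi> x)) = inner (abs_L2 (\<lambda>x. \<bar>\<phi> x\<bar>)) (abs_L2 (\<lambda>x. norm (gradient \<phi> x)))"
      by (subst inner_L2.abs_eq) (simp_all add: L2_rel_refl a g)
    also have "\<dots> \<le> norm (abs_L2 (\<lambda>x. \<bar>\<phi> x\<bar>)) * norm (abs_L2 (\<lambda>x. norm (gradient \<phi> x)))"
      by (rule norm_cauchy_schwarz)
    also have "norm (abs_L2 (\<lambda>x. \<bar>\<phi> x\<bar>)) = norm (abs_L2 \<phi>)"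
      by (rule power2_eq_imp_eq) (simp_all add: norm_abs_L2 a sq)
    also have "norm (abs_L2 (\<lambda>x. norm (gradient \<phi> x))) = norm (abs_L2 (gradient \<phi>))"
      by (rule power2_eq_imp_eq) (simp_all add: norm_abs_L2 g sq)
    finally show "integral\<^sup>L lborel (\<lambda>x. \<bar>\<phi> x\<bar> * norm (gradient \<phi> x)) \<le> norm (abs_L2 \<phi>) * norm (abs_L2 (gradient \<phi>))" .
  qed
  have [measurable]: "?d \<in> borel_measurable borel"
    using cont[of "[b]"] by (intro borel_measurable_continuous_onI) simp
  have i2: "integrable lborel (\<lambda>x. \<phi> x * ?d x * inner x b)"
  proof (rule Bochner_Integration.integrable_bound[OF integrable_mult_right[OF i3, of r]])
    show "AE x in lborel. norm (\<phi> x * ?d x * inner x b) \<le> norm (r * (\<bar>\<phi> x\<bar> * norm (gradient \<phi> x)))"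
      by (intro AE_I2) (unfold real_norm_def, rule order_trans[OF xr abs_ge_self])
  qed measurable
  have "(norm (abs_L2 \<phi>))\<^sup>2 = integral\<^sup>L lborel (\<lambda>x. (\<phi> x)\<^sup>2)"
    using norm_abs_L2[OF sq(1)] by simp
  also have "\<dots> = - 2 * integral\<^sup>L lborel (\<lambda>x. \<phi> x * ?d x * inner x b)"
  proof -
    have "integral\<^sup>L lborel (\<lambda>x. (\<phi> x)\<^sup>2 + 2 * \<phi> x * ?d x * inner x b)
        = integral\<^sup>L lborel (\<lambda>x. (\<phi> x)\<^sup>2 + 2 * (\<phi> x * ?d x * inner x b))"
      by (simp only: mult.assoc)
    also have "\<dots> = integral\<^sup>L lborel (\<lambda>x. (\<phi> x)\<^sup>2) + 2 * integral\<^sup>L lborel (\<lambda>x. \<phi> x * ?d x * inner x b)"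
      by (subst Bochner_Integration.integral_add[OF i1 integrable_mult_right[OF i2]]) simp
    finally show ?thesis using eq0 by linarith
  qed
  also have "\<dots> \<le> 2 * \<bar>integral\<^sup>L lborel (\<lambda>x. \<phi> x * ?d x * inner x b)\<bar>" by simp
  also have "\<dots> \<le> 2 * integral\<^sup>L lborel (\<lambda>x. r * (\<bar>\<phi> x\<bar> * norm (gradient \<phi> x)))"
    by (intro mult_left_mono order_trans[OF integral_abs_bound[of lborel "\<lambda>x. \<phi> x * ?d x * inner x b"]]
        integral_mono integrable_abs[OF i2] integrable_mult_right[OF i3] xr) simp
  also have "\<dots> \<le> 2 * (r * (norm (abs_L2 \<phi>) * norm (abs_L2 (gradient \<phi>))))"
    using CS r0 by (simp add: mult_left_mono)
  finally have "norm (abs_L2 \<phi>) * norm (abs_L2 \<phi>) \<le> (2 * r * norm (abs_L2 (gradient \<phi>))) * norm (abs_L2 \<phi>)"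
    by (simp add: power2_eq_square algebra_simps)
  then show ?thesis using False by simp
qed (use r0 in simp)

lemma dderivs_linear:
  assumes "smooth \<phi>" "smooth \<psi>"
  shows "dderivs vs (\<lambda>x. a * \<phi> x + b * \<psi> x) = (\<lambda>x. a * dderivs vs \<phi> x + b * dderivs vs \<psi> x)"
proof (induction vs)
  case (Cons v vs)
  have "frechet_derivative (\<lambda>x. a * dderivs vs \<phi> x + b * dderivs vs \<psi> x) (at x) v
      = a * frechet_derivative (dderivs vs \<phi>) (at x) v + b * frechet_derivative (dderivs vs \<psi>) (at x) v" for x
  proof -
    have d: "(dderivs vs \<phi> has_derivative frechet_derivative (dderivs vs \<phi>) (at x)) (at x)"
      "(dderivs vs \<psi> has_derivative frechet_derivative (dderivs vs \<psi>) (at x)) (at x)"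
      using assms frechet_derivative_works unfolding smooth_def by blast+
    have "((\<lambda>x. a * dderivs vs \<phi> x + b * dderivs vs \<psi> x) has_derivative
        (\<lambda>v. a * frechet_derivative (dderivs vs \<phi>) (at x) v + b * frechet_derivative (dderivs vs \<psi>) (at x) v)) (at x)"
      by (intro has_derivative_add has_derivative_mult_right d)
    then show ?thesis by (simp add: frechet_derivative_at[symmetric])
  qed
  then show ?case by (simp add: Cons.IH)
qed simp

lemma test_functions_linear:
  fixes \<phi> \<psi> :: "'a::euclidean_space \<Rightarrow> real"
  assumes \<phi>: "\<phi> \<in> test_functions D" and \<psi>: "\<psi> \<in> test_functions D"
  shows "(\<lambda>x. a * \<phi> x + b * \<psi> x) \<in> test_functions D"
    and "gradient (\<lambda>x. a * \<phi> x + b * \<psi> x) x = a *\<^sub>R gradient \<phi> x + b *\<^sub>R gradient \<psi> x"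
proof -
  have sm: "smooth \<phi>" "smooth \<psi>" using \<phi> \<psi> by (simp_all add: test_functions_def)
  have "smooth (\<lambda>x. a * \<phi> x + b * \<psi> x)"
    unfolding smooth_def dderivs_linear[OF sm]
    using sm unfolding smooth_def by (intro allI derivative_intros) blast+
  moreover have sub: "closure {x. a * \<phi> x + b * \<psi> x \<noteq> 0} \<subseteq> closure {x. \<phi> x \<noteq> 0} \<union> closure {x. \<psi> x \<noteq> 0}"
    unfolding closure_Un[symmetric] by (intro closure_mono) auto
  moreover have "compact (closure {x. a * \<phi> x + b * \<psi> x \<noteq> 0})"
  proof -
    have "compact (closure {x. \<phi> x \<noteq> 0} \<union> closure {x. \<psi> x \<noteq> 0})"
      using \<phi> \<psi> unfolding test_functions_def by (intro compact_Un) simp_all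
    from compact_Int_closed[OF this closed_closure[of "{x. a * \<phi> x + b * \<psi> x \<noteq> 0}"]]
    show ?thesis unfolding Int_absorb1[OF sub] .
  qed
  moreover have "closure {x. \<phi> x \<noteq> 0} \<union> closure {x. \<psi> x \<noteq> 0} \<subseteq> D"
    using \<phi> \<psi> unfolding test_functions_def by (intro Un_least) simp_all
  ultimately show "(\<lambda>x. a * \<phi> x + b * \<psi> x) \<in> test_functions D"
    unfolding test_functions_def by blast
  show "gradient (\<lambda>x. a * \<phi> x + b * \<psi> x) x = a *\<^sub>R gradient \<phi> x + b *\<^sub>R gradient \<psi> x"
  proof -
    have "frechet_derivative (\<lambda>x. a * \<phi> x + b * \<psi> x) (at x) v
        = a * frechet_derivative \<phi> (at x) v + b * frechet_derivative \<psi> (at x) v" for v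
      using fun_cong[OF dderivs_linear[OF sm, of "[v]" a b], of x] by simp
    then show ?thesis
      by (simp add: gradient_def scaleR_add_left sum.distrib scaleR_sum_right)
  qed
qed

lemma zero_test_function: "(\<lambda>_. 0) \<in> test_functions D"
proof -
  have "dderivs vs (\<lambda>_::'a. 0::real) = (\<lambda>_. 0)" for vs :: "'a list"
    by (induction vs) (auto simp: frechet_derivative_const)
  then show ?thesis by (simp add: test_functions_def smooth_def)
qed

lemma subspace_H10: "subspace (H10 D)"
  unfolding H10_def
proof -
  let ?f = "\<lambda>\<phi>. (abs_L2 \<phi>, abs_L2 (gradient \<phi>))"
  let ?S = "?f ` test_functions D"
  have lin: "a *\<^sub>R u + b *\<^sub>R v \<in> ?S" if "u \<in> ?S" "v \<in> ?S" for a b u v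
  proof -
    obtain \<phi> \<psi> where *: "\<phi> \<in> test_functions D" "\<psi> \<in> test_functions D" "u = ?f \<phi>" "v = ?f \<psi>"
      using \<open>u \<in> ?S\<close> \<open>v \<in> ?S\<close> by blast
    note sq = test_functions_sq_int[OF *(1)] test_functions_sq_int[OF *(2)]
    have "a *\<^sub>R u + b *\<^sub>R v = (abs_L2 (\<lambda>x. a *\<^sub>R \<phi> x + b *\<^sub>R \<psi> x),
        abs_L2 (\<lambda>x. a *\<^sub>R gradient \<phi> x + b *\<^sub>R gradient \<psi> x))"
      by (simp only: *(3,4) scaleR_Pair add_Pair abs_L2_scaleR[OF sq(1)] abs_L2_scaleR[OF sq(2)]
          abs_L2_scaleR[OF sq(3)] abs_L2_scaleR[OF sq(4)] abs_L2_add[OF sq_int_scaleR[OF sq(1)] sq_int_scaleR[OF sq(3)]]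
          abs_L2_add[OF sq_int_scaleR[OF sq(2)] sq_int_scaleR[OF sq(4)]])
    also have "\<dots> = ?f (\<lambda>x. a * \<phi> x + b * \<psi> x)"
    proof -
      have "gradient (\<lambda>x. a * \<phi> x + b * \<psi> x) = (\<lambda>x. a *\<^sub>R gradient \<phi> x + b *\<^sub>R gradient \<psi> x)"
        by (rule ext) (rule test_functions_linear(2)[OF *(1,2)])
      then show ?thesis by (simp only: real_scaleR_def)
    qed
    finally have "a *\<^sub>R u + b *\<^sub>R v = ?f (\<lambda>x. a * \<phi> x + b * \<psi> x)" .
    then show ?thesis using test_functions_linear(1)[OF *(1,2)] by blast
  qed
  have zero: "0 \<in> ?S"
    using lin[of "?f (\<lambda>_. 0)" "?f (\<lambda>_. 0)" 0 0] zero_test_function by (auto simp: zero_prod_def)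
  show "subspace (closure ?S)"
  proof (rule subspaceI)
    have seq: "\<exists>X. (\<forall>i. X i \<in> ?S) \<and> X \<longlonglongrightarrow> u" if "u \<in> closure ?S" for u
      using that unfolding closure_sequential .
    show "0 \<in> closure ?S" by (rule subsetD[OF closure_subset zero])
    show "u + v \<in> closure ?S" if u: "u \<in> closure ?S" and v: "v \<in> closure ?S" for u v
    proof -
      obtain X Y where X: "\<And>i. X i \<in> ?S" "X \<longlonglongrightarrow> u" and Y: "\<And>i. Y i \<in> ?S" "Y \<longlonglongrightarrow> v"
        using seq[OF u] seq[OF v] by blast
      have "X i + Y i \<in> ?S" for i using lin[OF X(1) Y(1), of 1 i 1 i] by simp
      moreover have "(\<lambda>i. X i + Y i) \<longlonglongrightarrow> u + v" by (intro tendsto_add X Y)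
      ultimately show ?thesis unfolding closure_sequential by (intro exI[of _ "\<lambda>i. X i + Y i"] conjI allI)
    qed
    show "c *\<^sub>R u \<in> closure ?S" if u: "u \<in> closure ?S" for c u
    proof -
      obtain X where X: "\<And>i. X i \<in> ?S" "X \<longlonglongrightarrow> u"
        using seq[OF u] by blast
      have "c *\<^sub>R X i \<in> ?S" for i using lin[OF X(1) X(1), of c i 0 i] by simp
      moreover have "(\<lambda>i. c *\<^sub>R X i) \<longlonglongrightarrow> c *\<^sub>R u" by (intro tendsto_intros X)
      ultimately show ?thesis unfolding closure_sequential by (intro exI[of _ "\<lambda>i. c *\<^sub>R X i"] conjI allI)
    qed
  qed
qed

lemma closed_H10: "closed (H10 D)"
  by (simp add: H10_def)

lemma H10_induct:
  assumes u: "u \<in> H10 D" and closed: "closed {u. P u}"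
    and test: "\<And>\<phi>. \<phi> \<in> test_functions D \<Longrightarrow> P (abs_L2 \<phi>, abs_L2 (gradient \<phi>))"
  shows "P u"
proof -
  have "H10 D \<subseteq> {u. P u}" unfolding H10_def by (rule closure_minimal[OF _ closed]) (use test in auto)
  then show ?thesis using u by blast
qed

lemma Poincare:
  assumes u: "u \<in> H10 D" and D: "\<And>x. x \<in> D \<Longrightarrow> norm x \<le> r" and r: "r \<ge> 0"
  shows "norm (fst u) \<le> 2 * r * norm (snd u)"
  using u
proof (rule H10_induct)
  show "closed {u :: 'a sobolev. norm (fst u) \<le> 2 * r * norm (snd u)}"
    by (intro closed_Collect_le continuous_intros)
  show "norm (fst (abs_L2 \<phi>, abs_L2 (gradient \<phi>))) \<le> 2 * r * norm (snd (abs_L2 \<phi>, abs_L2 (gradient \<phi>)))"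
    if "\<phi> \<in> test_functions D" for \<phi>
    using Poincare_test_function[OF that D r] by simp
qed

text \<open>
  Multiplication by the indicator of the complement of \<open>D\<close> is continuous and annihilates the test
  functions and their gradients, hence the closure.
\<close>

lemma H10_zero_outside:
  fixes D :: "'a::euclidean_space set"
  assumes u: "u \<in> H10 D" and D: "D \<in> sets borel"
  shows "AE x in lborel. x \<notin> D \<longrightarrow> val u x = 0" and "AE x in lborel. x \<notin> D \<longrightarrow> grad u x = 0"
proof -
  let ?c = "indicator (- D) :: 'a \<Rightarrow> real"
  have c: "ess_bounded ?c 1"
    using D by (auto simp: ess_bounded_def indicator_def intro!: borel_measurable_indicator)
  have cont: "continuous_on UNIV (mult_L2 ?c :: ('a, 'b::euclidean_space) L2 \<Rightarrow> _)"
  proof -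
    have "bounded_linear (mult_L2 ?c :: ('a, 'b) L2 \<Rightarrow> _)"
      by (rule bounded_linear_intro[where K = 1])
        (use norm_mult_L2_le[OF c] in \<open>simp_all add: mult_L2_add[OF c] mult_L2_scaleR[OF c]\<close>)
    then show ?thesis by (rule linear_continuous_on)
  qed
  have AE_zero: "AE x in lborel. x \<notin> D \<longrightarrow> rep_L2 v x = 0" if v: "mult_L2 ?c v = 0" for v :: "('a, 'b::euclidean_space) L2"
  proof -
    have "(\<lambda>x. ?c x *\<^sub>R rep_L2 v x) \<in> sq_int" by (rule sq_int_ess_bounded_mult[OF c rep_L2_sq_int])
    from rep_abs_L2[OF this] have "AE x in lborel. rep_L2 (0 :: ('a, 'b) L2) x = ?c x *\<^sub>R rep_L2 v x"
      using v by (simp add: mult_L2_def)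
    moreover have "AE x in lborel. rep_L2 (0 :: ('a, 'b) L2) x = 0"
      using rep_abs_L2[OF sq_int_zero] by (simp add: abs_L2_zero)
    ultimately show ?thesis by eventually_elim (auto simp: indicator_def)
  qed
  have test0: "mult_L2 ?c (abs_L2 f) = 0" if f: "f \<in> sq_int" and z: "\<And>x. x \<notin> D \<Longrightarrow> f x = 0" for f :: "'a \<Rightarrow> 'b::euclidean_space"
  proof -
    have "mult_L2 ?c (abs_L2 f) = abs_L2 (\<lambda>x. 0)"
      unfolding mult_L2_def
    proof (rule abs_L2_eqI[OF sq_int_ess_bounded_mult[OF c rep_L2_sq_int] sq_int_zero])
      show "AE x in lborel. ?c x *\<^sub>R rep_L2 (abs_L2 f) x = 0"
        using rep_abs_L2[OF f] by eventually_elim (use z in \<open>auto simp: indicator_def\<close>)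
    qed
    then show ?thesis by (simp add: abs_L2_zero)
  qed
  have "mult_L2 ?c (fst u) = 0"
    using u
  proof (rule H10_induct)
    show "closed {u :: 'a sobolev. mult_L2 ?c (fst u) = 0}"
      by (intro closed_Collect_eq continuous_on_compose2[OF cont] continuous_intros) auto
    show "mult_L2 ?c (fst (abs_L2 \<phi>, abs_L2 (gradient \<phi>))) = 0" if \<phi>: "\<phi> \<in> test_functions D" for \<phi>
    proof -
      have "\<phi> x = 0" if "x \<notin> D" for x
        using \<phi> that closure_subset[of "{x. \<phi> x \<noteq> 0}"] by (auto simp: test_functions_def)
      then show ?thesis using test0[OF test_functions_sq_int(1)[OF \<phi>]] by simp
    qed
  qed
  then show "AE x in lborel. x \<notin> D \<longrightarrow> val u x = 0" unfolding val_def by (rule AE_zero)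
  have "mult_L2 ?c (snd u) = 0"
    using u
  proof (rule H10_induct)
    show "closed {u :: 'a sobolev. mult_L2 ?c (snd u) = 0}"
      by (intro closed_Collect_eq continuous_on_compose2[OF cont] continuous_intros) auto
    show "mult_L2 ?c (snd (abs_L2 \<phi>, abs_L2 (gradient \<phi>))) = 0" if \<phi>: "\<phi> \<in> test_functions D" for \<phi>
    proof -
      have K: "closure {x. \<phi> x \<noteq> 0} \<subseteq> D" using \<phi> by (simp add: test_functions_def)
      have "gradient \<phi> x = 0" if "x \<notin> D" for x
      proof -
        have "(\<phi> has_derivative (\<lambda>_. 0)) (at x)"
        proof (rule has_derivative_transform_within_open[OF has_derivative_const])
          show "open (- closure {x. \<phi> x \<noteq> 0})" by (rule open_Compl[OF closed_closure])
          show "x \<in> - closure {x. \<phi> x \<noteq> 0}" using that K by blast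
          show "0 = \<phi> z" if "z \<in> - closure {x. \<phi> x \<noteq> 0}" for z
            using that closure_subset[of "{x. \<phi> x \<noteq> 0}"] by auto
        qed
        then show ?thesis by (simp add: gradient_def frechet_derivative_at[symmetric])
      qed
      then show ?thesis using test0[OF test_functions_sq_int(2)[OF \<phi>]] by simp
    qed
  qed
  then show "AE x in lborel. x \<notin> D \<longrightarrow> grad u x = 0" unfolding grad_def by (rule AE_zero)
qed

section \<open>Taylor coefficients of a parametric variational problem\<close>

definition incr :: "nat \<Rightarrow> (nat \<Rightarrow> nat) \<Rightarrow> nat \<Rightarrow> nat" where
  "incr j k = k(j := Suc (k j))"

lemma incr_apply: "incr j k i = (if i = j then Suc (k i) else k i)"
  by (simp add: incr_def)

definition mi_degree :: "(nat \<Rightarrow> nat) \<Rightarrow> nat" where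
  "mi_degree k = (\<Sum>j | k j \<noteq> 0. k j)"

lemma zero_multi_index: "(\<lambda>_. 0) \<in> multi_indices"
  by (simp add: multi_indices_def)

lemma incr_multi_index: "k \<in> multi_indices \<Longrightarrow> incr j k \<in> multi_indices"
  by (auto simp: multi_indices_def incr_apply elim: finite_subset[rotated] intro: finite_subset[of _ "insert j {i. k i \<noteq> 0}"])

lemma incr_inject [simp]: "incr j k = incr j l \<longleftrightarrow> k = l"
  by (auto simp: fun_eq_iff incr_apply split: if_splits)

lemma multi_index_le:
  assumes "k \<in> multi_indices" "l \<le> k" shows "l \<in> multi_indices"
proof -
  have "{j. l j \<noteq> 0} \<subseteq> {j. k j \<noteq> 0}" using assms(2) by (auto simp: le_fun_def intro: less_le_trans)
  then show ?thesis using assms(1) by (auto simp: multi_indices_def intro: finite_subset)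
qed

lemma finite_mi_le:
  assumes k: "k \<in> multi_indices" shows "finite {l. l \<le> k}"
proof -
  let ?S = "{j. k j \<noteq> 0}"
  have fin: "finite ?S" using k by (simp add: multi_indices_def)
  have "inj_on (\<lambda>l. restrict l ?S) {l. l \<le> k}"
  proof (rule inj_onI)
    fix l m assume lm: "l \<in> {l. l \<le> k}" "m \<in> {l. l \<le> k}" and eq: "restrict l ?S = restrict m ?S"
    show "l = m"
    proof
      fix j
      show "l j = m j"
      proof (cases "k j = 0")
        case True
        then show ?thesis using lm by (simp add: le_fun_def) (metis le_zero_eq)
      next
        case False
        then show ?thesis using fun_cong[OF eq, of j] by simp
      qed
    qed
  qed
  moreover have "(\<lambda>l. restrict l ?S) ` {l. l \<le> k} \<subseteq> (\<Pi>\<^sub>E j\<in>?S. {..k j})"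
    by (auto simp: le_fun_def PiE_def extensional_def)
  then have "finite ((\<lambda>l. restrict l ?S) ` {l. l \<le> k})"
    by (rule finite_subset) (intro finite_PiE fin, simp)
  ultimately show ?thesis by (rule finite_imageD[rotated])
qed

lemma mi_degree_less:
  assumes k: "k \<in> multi_indices" and l: "l \<le> k" "l \<noteq> k" shows "mi_degree l < mi_degree k"
proof -
  have fin: "finite {j. k j \<noteq> 0}" using k by (simp add: multi_indices_def)
  have le: "l j \<le> k j" for j using l(1) by (simp add: le_fun_def)
  then have "{j. l j \<noteq> 0} \<subseteq> {j. k j \<noteq> 0}" by (auto intro: less_le_trans)
  then have "mi_degree l = (\<Sum>j | k j \<noteq> 0. l j)"
    unfolding mi_degree_def by (rule sum.mono_neutral_left[OF fin]) auto
  also obtain i where "l i \<noteq> k i" using l(2) by (auto simp: fun_eq_iff)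
  then have i: "l i < k i" using le[of i] by simp
  then have "(\<Sum>j | k j \<noteq> 0. l j) < (\<Sum>j | k j \<noteq> 0. k j)"
    by (intro sum_strict_mono_ex1 fin) (use le i in \<open>auto intro!: exI[of _ i]\<close>)
  finally show ?thesis by (simp add: mi_degree_def)
qed

text \<open>
  The power series \<open>\<Sum>\<^sub>k T\<^sub>k t\<^sup>k\<close> formally solves the equation with operator \<open>L + \<Sum>\<^bsub>m \<noteq> 0\<^esub> M\<^sub>m t\<^sup>m\<close> and right-hand
  side \<open>f\<close> if and only if its coefficients obey this recursion.  Arguments with infinite support, below
  which there can be infinitely many others, are mapped to \<open>0\<close>.
\<close>

function taylor_coeff :: "'h::{real_inner, banach} set \<Rightarrow> ('h \<Rightarrow>\<^sub>L 'h) \<Rightarrow> ((nat \<Rightarrow> nat) \<Rightarrow> 'h \<Rightarrow>\<^sub>L 'h) \<Rightarrow> 'h \<Rightarrow>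
    (nat \<Rightarrow> nat) \<Rightarrow> 'h" where
  "taylor_coeff W L M f k = (if k \<in> multi_indices then
     variational_solution W L ((if k = (\<lambda>_. 0) then f else 0) -
       (\<Sum>l\<in>{l. l \<le> k \<and> l \<noteq> k}. M (\<lambda>j. k j - l j) (taylor_coeff W L M f l))) else 0)"
  by auto
termination
  by (relation "Wellfounded.measure (\<lambda>(W, L, M, f, k). mi_degree k)") (auto simp: mi_degree_less)

declare taylor_coeff.simps [simp del]

text \<open>
  If \<open>M\<^sub>m\<close> is the normalized derivative of index \<open>m\<close> of \<open>L\<close>, then \<open>T\<^sub>k\<close> is that of the solution, and
  moving in the direction \<open>j\<close> turns \<open>T\<^sub>k\<close> into \<open>(k\<^sub>j + 1) T\<^bsub>k + e\<^sub>j\<^esub>\<close>.  By induction on the degree the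
  recursion for \<open>T\<^sub>k\<close> can be differentiated.  The terms obtained from the derivatives of \<open>T\<^sub>l\<close> and of
  \<open>M\<^bsub>k - l\<^esub>\<close> carry the factors \<open>l\<^sub>j + 1\<close> and \<open>k\<^sub>j - l\<^sub>j + 1\<close>; after an index shift in the former these add up
  to \<open>k\<^sub>j + 1\<close>, and the recursion for \<open>T\<^bsub>k + e\<^sub>j\<^esub>\<close> appears.
\<close>

lemma taylor_coeff_has_vector_derivative:
  fixes W :: "'h::{real_inner, banach} set" and L :: "real \<Rightarrow> 'h \<Rightarrow>\<^sub>L 'h" and M :: "real \<Rightarrow> (nat \<Rightarrow> nat) \<Rightarrow> 'h \<Rightarrow>\<^sub>L 'h"
  assumes W: "subspace W" "closed W"
    and coercive: "\<forall>\<^sub>F h in at t. coercive_on W \<alpha> (L h)" and coercive_t: "coercive_on W \<alpha> (L t)"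
    and L: "(L has_vector_derivative M t (incr j (\<lambda>_. 0))) (at t)"
    and M: "\<And>m. m \<in> multi_indices \<Longrightarrow>
      ((\<lambda>h. M h m) has_vector_derivative real (Suc (m j)) *\<^sub>R M t (incr j m)) (at t)"
    and k: "k \<in> multi_indices"
  shows "((\<lambda>h. taylor_coeff W (L h) (M h) f k) has_vector_derivative
    real (Suc (k j)) *\<^sub>R taylor_coeff W (L t) (M t) f (incr j k)) (at t)"
  using k
proof (induction k rule: measure_induct_rule[where f = mi_degree])
  case (less k)
  define G where "G h = taylor_coeff W (L h) (M h) f" for h
  define A where "A = {l. l \<le> k \<and> l \<noteq> k}"
  have finA: "finite A" using finite_mi_le[OF less.prems] by (simp add: A_def)
  have A_mi: "l \<in> multi_indices" if "l \<in> A" for l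
    using that multi_index_le[OF less.prems] by (simp add: A_def)
  have sub_mi: "(\<lambda>i. k i - l i) \<in> multi_indices" for l
    by (rule multi_index_le[OF less.prems]) (simp add: le_fun_def)
  have IH: "((\<lambda>h. G h l) has_vector_derivative real (Suc (l j)) *\<^sub>R G t (incr j l)) (at t)" if "l \<in> A" for l
    unfolding G_def using less.IH[of l] mi_degree_less[OF less.prems, of l] A_mi[OF that] that
    by (auto simp: A_def)
  define F where "F = (if k = (\<lambda>_. 0) then f else 0)"
  define r where "r h = F - (\<Sum>l\<in>A. M h (\<lambda>i. k i - l i) (G h l))" for h
  define r' where "r' = - (\<Sum>l\<in>A. M t (\<lambda>i. k i - l i) (real (Suc (l j)) *\<^sub>R G t (incr j l))
      + (real (Suc (k j - l j)) *\<^sub>R M t (incr j (\<lambda>i. k i - l i))) (G t l))"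
  have r: "(r has_vector_derivative r') (at t)"
  proof -
    have "((\<lambda>h. M h (\<lambda>i. k i - l i) (G h l)) has_vector_derivative
        M t (\<lambda>i. k i - l i) (real (Suc (l j)) *\<^sub>R G t (incr j l))
      + (real (Suc (k j - l j)) *\<^sub>R M t (incr j (\<lambda>i. k i - l i))) (G t l)) (at t)" if "l \<in> A" for l
      using bounded_bilinear.has_vector_derivative[OF bounded_bilinear_blinfun_apply M[OF sub_mi[of l]] IH[OF that]]
      by simp
    then have "((\<lambda>h. F - (\<Sum>l\<in>A. M h (\<lambda>i. k i - l i) (G h l))) has_vector_derivative 0 - (\<Sum>l\<in>A. M t (\<lambda>i. k i - l i) (real (Suc (l j)) *\<^sub>R G t (incr j l))
      + (real (Suc (k j - l j)) *\<^sub>R M t (incr j (\<lambda>i. k i - l i))) (G t l))) (at t)"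
      by (intro has_vector_derivative_diff has_vector_derivative_const has_vector_derivative_sum)
    then show ?thesis unfolding r_def[abs_def] r'_def by simp
  qed
  have G_eq: "G h k = variational_solution W (L h) (r h)" for h
    using less.prems by (simp add: G_def r_def F_def A_def taylor_coeff.simps[of W "L h" "M h" f k])
  define B where "B = {l. l \<le> incr j k \<and> l \<noteq> incr j k}"
  define \<Phi> where "\<Phi> l = M t (\<lambda>i. incr j k i - l i) (G t l)" for l
  have finB: "finite B" using finite_mi_le[OF incr_multi_index[OF less.prems]] by (simp add: B_def)
  have G_incr: "G t (incr j k) = variational_solution W (L t) (- (\<Sum>l\<in>B. \<Phi> l))"
  proof -
    have "incr j k \<noteq> (\<lambda>_. 0)" by (metis incr_apply nat.distinct(1))
    then show ?thesis
      using incr_multi_index[OF less.prems]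
      by (simp add: G_def \<Phi>_def B_def taylor_coeff.simps[of W "L t" "M t" f "incr j k"])
  qed
  \<comment> \<open>The left-hand side is the right-hand side of the problem solved by the derivative, see
    lemma \<open>variational_solution_has_vector_derivative\<close>.\<close>
  have key: "r' - M t (incr j (\<lambda>_. 0)) (G t k) = real (Suc (k j)) *\<^sub>R (- (\<Sum>l\<in>B. \<Phi> l))"
  proof -
    let ?C = "{l. l \<le> k}"
    have C: "?C = insert k A" "k \<notin> A" by (auto simp: A_def)
    have CB: "?C \<subseteq> B"
    proof
      fix l assume "l \<in> ?C"
      then have l: "l i \<le> k i" for i by (simp add: le_fun_def)
      have "l i \<le> incr j k i" for i using l[of i] by (auto simp: incr_apply)
      moreover have "l j \<noteq> incr j k j" using l[of j] by (simp add: incr_apply)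
      ultimately show "l \<in> B" by (auto simp: B_def le_fun_def)
    qed
    have incr_diff: "incr j (\<lambda>i. k i - l i) = (\<lambda>i. incr j k i - l i)" if "l \<le> k" for l
      using that by (auto simp: fun_eq_iff incr_apply le_fun_def Suc_diff_le)
    have "(\<Sum>l\<in>A. real (Suc (k j - l j)) *\<^sub>R \<Phi> l) + \<Phi> k = (\<Sum>l\<in>?C. real (Suc (k j - l j)) *\<^sub>R \<Phi> l)"
      unfolding C(1) using finA C(2) by (simp add: add.commute)
    also have "\<dots> = (\<Sum>l\<in>?C. real (Suc (k j) - l j) *\<^sub>R \<Phi> l)"
      by (intro sum.cong) (auto simp: le_fun_def Suc_diff_le)
    also have "\<dots> = (\<Sum>l\<in>B. real (Suc (k j) - l j) *\<^sub>R \<Phi> l)"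
    proof (rule sum.mono_neutral_left[OF finB CB], rule ballI)
      fix l assume l: "l \<in> B - ?C"
      then have "\<not> l \<le> k" "l \<le> incr j k" by (auto simp: B_def)
      then obtain i where i: "\<not> l i \<le> k i" "l i \<le> incr j k i" by (auto simp: le_fun_def)
      then have "i = j" "l j = Suc (k j)" by (auto simp: incr_apply split: if_splits)
      then show "real (Suc (k j) - l j) *\<^sub>R \<Phi> l = 0" by simp
    qed
    \<comment> \<open>The additional indices \<open>l\<close> of \<open>B\<close> have \<open>l j = Suc (k j)\<close>, hence the factor \<open>0\<close>.\<close>
    finally have 1: "(\<Sum>l\<in>A. real (Suc (k j - l j)) *\<^sub>R \<Phi> l) + \<Phi> k = (\<Sum>l\<in>B. real (Suc (k j) - l j) *\<^sub>R \<Phi> l)" .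
    \<comment> \<open>Here the missing indices are those with \<open>l j = 0\<close>.\<close>
    have "(\<Sum>l\<in>A. real (Suc (l j)) *\<^sub>R \<Phi> (incr j l)) = (\<Sum>l\<in>incr j ` A. real (l j) *\<^sub>R \<Phi> l)"
      by (subst sum.reindex) (auto simp: inj_on_def incr_apply)
    also have "\<dots> = (\<Sum>l\<in>B. real (l j) *\<^sub>R \<Phi> l)"
    proof (rule sum.mono_neutral_left[OF finB], safe)
      fix l assume "l \<in> A"
      then show "incr j l \<in> B" by (auto simp: A_def B_def le_fun_def incr_apply)
    next
      fix l assume l: "l \<in> B" "l \<notin> incr j ` A"
      have "l j = 0"
      proof (rule ccontr)
        assume "l j \<noteq> 0"
        define l' where "l' = l(j := l j - 1)"
        have "l = incr j l'" using \<open>l j \<noteq> 0\<close> by (auto simp: l'_def incr_def)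
        moreover have "l' \<in> A" using l(1) \<open>l = incr j l'\<close>
          by (auto simp: A_def B_def le_fun_def incr_apply) (metis Suc_le_mono)
        ultimately show False using l(2) by blast
      qed
      then show "real (l j) *\<^sub>R \<Phi> l = 0" by simp
    qed
    finally have 2: "(\<Sum>l\<in>A. real (Suc (l j)) *\<^sub>R \<Phi> (incr j l)) = (\<Sum>l\<in>B. real (l j) *\<^sub>R \<Phi> l)" .
    have 3: "M t (incr j (\<lambda>_. 0)) (G t k) = \<Phi> k"
      unfolding \<Phi>_def by (rule arg_cong[where f = "\<lambda>m. M t m (G t k)"]) (auto simp: fun_eq_iff incr_apply)
    have "r' = - ((\<Sum>l\<in>A. real (Suc (l j)) *\<^sub>R \<Phi> (incr j l)) + (\<Sum>l\<in>A. real (Suc (k j - l j)) *\<^sub>R \<Phi> l))"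
    proof -
      have "M t (\<lambda>i. k i - l i) (real (Suc (l j)) *\<^sub>R G t (incr j l))
          + (real (Suc (k j - l j)) *\<^sub>R M t (incr j (\<lambda>i. k i - l i))) (G t l)
          = real (Suc (l j)) *\<^sub>R \<Phi> (incr j l) + real (Suc (k j - l j)) *\<^sub>R \<Phi> l" if "l \<in> A" for l
      proof -
        have eq: "(\<lambda>i. k i - l i) = (\<lambda>i. incr j k i - incr j l i)" by (auto simp: incr_apply)
        have le: "l \<le> k" using that by (simp add: A_def)
        show ?thesis
          by (simp only: incr_diff[OF le]) (simp only: eq \<Phi>_def blinfun.scaleR_right blinfun.scaleR_left)
      qed
      then show ?thesis unfolding r'_def by (simp add: sum.distrib)
    qed
    then have "r' - \<Phi> k = - ((\<Sum>l\<in>B. real (l j) *\<^sub>R \<Phi> l) + (\<Sum>l\<in>B. real (Suc (k j) - l j) *\<^sub>R \<Phi> l))"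
      unfolding 1[symmetric] 2 by simp
    also have "(\<Sum>l\<in>B. real (l j) *\<^sub>R \<Phi> l) + (\<Sum>l\<in>B. real (Suc (k j) - l j) *\<^sub>R \<Phi> l)
        = (\<Sum>l\<in>B. real (Suc (k j)) *\<^sub>R \<Phi> l)"
      unfolding sum.distrib[symmetric]
    proof (rule sum.cong[OF refl])
      fix l assume "l \<in> B"
      then have "l j \<le> incr j k j" by (simp add: B_def le_fun_def)
      then have "l j \<le> Suc (k j)" by (simp add: incr_apply)
      then have "real (Suc (k j)) = real (l j) + real (Suc (k j) - l j)" by (simp flip: of_nat_add)
      then show "real (l j) *\<^sub>R \<Phi> l + real (Suc (k j) - l j) *\<^sub>R \<Phi> l = real (Suc (k j)) *\<^sub>R \<Phi> l"
        by (simp only: scaleR_add_left)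
    qed
    finally show ?thesis unfolding 3 by (simp add: scaleR_sum_right)
  qed
  have "((\<lambda>h. variational_solution W (L h) (r h)) has_vector_derivative
      variational_solution W (L t) (r' - M t (incr j (\<lambda>_. 0)) (variational_solution W (L t) (r t)))) (at t)"
    by (rule variational_solution_has_vector_derivative[OF W L r coercive coercive_t])
  then show ?case
    unfolding G_eq[symmetric] key variational_solution_scaleR[OF W coercive_t] G_incr[symmetric]
    by (simp only: G_def)
qed

section \<open>The Gaussian product measure and Hermite expansions\<close>

lemma prob_space_std_normal: "prob_space std_normal"
  by (rule prob_space_normal_density) simp

lemma prob_space_gauss: "prob_space gauss"
  unfolding gauss_def by (rule prob_space_PiM) (rule prob_space_std_normal)

lemma sets_gauss [measurable_cong]: "sets gauss = sets (PiM UNIV (\<lambda>_. borel :: real measure))"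
  unfolding gauss_def by (rule sets_PiM_cong) auto

lemma space_gauss [simp]: "space gauss = UNIV"
  by (simp add: gauss_def space_PiM PiE_UNIV_domain)

lemma measurable_gauss_component [measurable]: "(\<lambda>y. y j) \<in> borel_measurable gauss"
  by measurable

lemma measurable_gauss_fun_upd [measurable]:
  assumes [measurable]: "f \<in> measurable M gauss" "g \<in> borel_measurable M"
  shows "(\<lambda>x. (f x)(j := g x)) \<in> measurable M gauss"
proof -
  have "(\<lambda>x. (f x)(j := g x)) \<in> measurable M (PiM UNIV (\<lambda>_. borel))"
  proof (rule measurable_PiM_single')
    have [measurable]: "(\<lambda>x. f x i) \<in> borel_measurable M" for i
      using measurable_compose[OF assms(1) measurable_gauss_component] .
    show "(\<lambda>x. ((f x)(j := g x)) i) \<in> borel_measurable M" for i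
      by (cases "i = j") simp_all
  qed (auto simp: PiE_UNIV_domain)
  then show ?thesis using measurable_cong_sets[OF refl sets_gauss] by blast
qed

text \<open>
  Resampling one coordinate independently does not change the product measure.  This is what allows
  arguments on lines parallel to a coordinate axis.
\<close>

lemma gauss_split: "distr (std_normal \<Otimes>\<^sub>M gauss) gauss (\<lambda>(t, y). y(j := t)) = gauss"
  using distr_pair_PiM_eq_PiM[of UNIV "\<lambda>_. std_normal" j] prob_space_std_normal
  by (simp add: gauss_def)

lemma integral_gauss_split:
  fixes f :: "(nat \<Rightarrow> real) \<Rightarrow> real"
  assumes f: "integrable gauss f"
  shows "AE y in gauss. integrable std_normal (\<lambda>t. f (y(j := t)))"
    and "integral\<^sup>L gauss f = (\<integral>y. \<integral>t. f (y(j := t)) \<partial>std_normal \<partial>gauss)"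
proof -
  interpret s: prob_space std_normal by (rule prob_space_std_normal)
  interpret g: prob_space gauss by (rule prob_space_gauss)
  interpret pair_sigma_finite std_normal gauss ..
  have [measurable]: "f \<in> borel_measurable gauss" using f by simp
  have m: "(\<lambda>(t, y). y(j := t)) \<in> measurable (std_normal \<Otimes>\<^sub>M gauss) gauss"
    by measurable
  have "integrable (distr (std_normal \<Otimes>\<^sub>M gauss) gauss (\<lambda>(t, y). y(j := t))) f"
    unfolding gauss_split by (rule f)
  then have int: "integrable (std_normal \<Otimes>\<^sub>M gauss) (\<lambda>(t, y). f (y(j := t)))"
    by (subst (asm) integrable_distr_eq[OF m]) (auto simp: split_beta')
  show "AE y in gauss. integrable std_normal (\<lambda>t. f (y(j := t)))"
    using AE_integrable_snd[OF int] by simp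
  have "integral\<^sup>L gauss f = integral\<^sup>L (distr (std_normal \<Otimes>\<^sub>M gauss) gauss (\<lambda>(t, y). y(j := t))) f"
    unfolding gauss_split ..
  also have "\<dots> = (\<integral>z. (\<lambda>(t, y). f (y(j := t))) z \<partial>(std_normal \<Otimes>\<^sub>M gauss))"
    by (subst integral_distr[OF m]) (auto simp: split_beta')
  also have "\<dots> = (\<integral>y. \<integral>t. f (y(j := t)) \<partial>std_normal \<partial>gauss)"
    using integral_snd[OF int] by simp
  finally show "integral\<^sup>L gauss f = (\<integral>y. \<integral>t. f (y(j := t)) \<partial>std_normal \<partial>gauss)" .
qed

lemma gauss_prod:
  fixes F :: "nat \<Rightarrow> real \<Rightarrow> real"
  assumes J: "finite J" and F: "\<And>j. j \<in> J \<Longrightarrow> integrable std_normal (F j)"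
  shows "integrable gauss (\<lambda>y. \<Prod>j\<in>J. F j (y j))"
    and "integral\<^sup>L gauss (\<lambda>y. \<Prod>j\<in>J. F j (y j)) = (\<Prod>j\<in>J. integral\<^sup>L std_normal (F j))"
proof -
  interpret s: prob_space std_normal by (rule prob_space_std_normal)
  interpret P: product_prob_space "\<lambda>_. std_normal" UNIV by standard
  have d: "distr gauss (PiM J (\<lambda>_. std_normal)) (\<lambda>x. restrict x J) = PiM J (\<lambda>_. std_normal)"
    unfolding gauss_def by (rule P.distr_PiM_restrict_finite) (use J in auto)
  have m: "(\<lambda>x. restrict x J) \<in> measurable gauss (PiM J (\<lambda>_. std_normal))"
    unfolding gauss_def by (rule measurable_restrict_subset) simp
  have i: "integrable (PiM J (\<lambda>_. std_normal)) (\<lambda>x. \<Prod>j\<in>J. F j (x j))"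
    by (rule P.product_integrable_prod[OF J F])
  have [measurable]: "(\<lambda>x. \<Prod>j\<in>J. F j (x j)) \<in> borel_measurable (PiM J (\<lambda>_. std_normal))"
    using i by simp
  have eq: "(\<Prod>j\<in>J. F j (restrict y J j)) = (\<Prod>j\<in>J. F j (y j))" for y
    by (rule prod.cong) auto
  show "integrable gauss (\<lambda>y. \<Prod>j\<in>J. F j (y j))"
  proof -
    have "integrable (distr gauss (PiM J (\<lambda>_. std_normal)) (\<lambda>x. restrict x J)) (\<lambda>x. \<Prod>j\<in>J. F j (x j))"
      unfolding d by (rule i)
    then show ?thesis by (subst (asm) integrable_distr_eq[OF m]) (simp_all add: eq)
  qed
  have "integral\<^sup>L (distr gauss (PiM J (\<lambda>_. std_normal)) (\<lambda>x. restrict x J)) (\<lambda>x. \<Prod>j\<in>J. F j (x j))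
      = integral\<^sup>L gauss (\<lambda>y. \<Prod>j\<in>J. F j (y j))"
    by (subst integral_distr[OF m]) (simp_all add: eq)
  then show "integral\<^sup>L gauss (\<lambda>y. \<Prod>j\<in>J. F j (y j)) = (\<Prod>j\<in>J. integral\<^sup>L std_normal (F j))"
    unfolding d by (simp add: P.product_integral_prod[OF J F])
qed

lemma hermite_0 [simp]: "hermite 0 x = 1"
  by (simp add: hermite_def)

lemma hermite_measurable [measurable]: "hermite n \<in> borel_measurable borel"
proof -
  have "continuous_on UNIV (hermite n)" unfolding hermite_def by (intro continuous_intros) auto
  then show ?thesis by (rule borel_measurable_continuous_onI)
qed

lemma hermite_multi_eq:
  assumes "finite J" "{j. \<nu> j \<noteq> 0} \<subseteq> J"
  shows "hermite_multi \<nu> y = (\<Prod>j\<in>J. hermite (\<nu> j) (y j))"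
  unfolding hermite_multi_def by (rule prod.mono_neutral_left[OF assms]) auto

lemma hermite_multi_measurable [measurable]: "hermite_multi \<nu> \<in> borel_measurable gauss"
  unfolding hermite_multi_def[abs_def] by measurable

lemma hermite_multi_orthonormal:
  assumes "\<mu> \<in> multi_indices" "\<nu> \<in> multi_indices"
  shows "integrable gauss (\<lambda>y. hermite_multi \<mu> y * hermite_multi \<nu> y)"
    and "integral\<^sup>L gauss (\<lambda>y. hermite_multi \<mu> y * hermite_multi \<nu> y) = (if \<mu> = \<nu> then 1 else 0)"
proof -
  define J where "J = {j. \<mu> j \<noteq> 0} \<union> {j. \<nu> j \<noteq> 0}"
  have J: "finite J" using assms by (simp add: J_def multi_indices_def)
  have eq: "hermite_multi \<mu> y * hermite_multi \<nu> y = (\<Prod>j\<in>J. hermite (\<mu> j) (y j) * hermite (\<nu> j) (y j))" for y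
    by (simp add: hermite_multi_eq[OF J, of \<mu>] hermite_multi_eq[OF J, of \<nu>] J_def prod.distrib)
  show "integrable gauss (\<lambda>y. hermite_multi \<mu> y * hermite_multi \<nu> y)"
    unfolding eq by (rule gauss_prod(1)[OF J]) (rule hermite_orthonormal)
  have "integral\<^sup>L gauss (\<lambda>y. hermite_multi \<mu> y * hermite_multi \<nu> y) = (\<Prod>j\<in>J. if \<mu> j = \<nu> j then 1 else 0)"
    unfolding eq by (subst gauss_prod(2)[OF J]) (rule hermite_orthonormal, simp add: hermite_orthonormal(2))
  also have "\<dots> = (if \<mu> = \<nu> then 1 else 0)"
  proof (cases "\<mu> = \<nu>")
    case False
    then obtain j where "\<mu> j \<noteq> \<nu> j" by (auto simp: fun_eq_iff)
    then have "j \<in> J" by (auto simp: J_def)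
    then show ?thesis using False \<open>\<mu> j \<noteq> \<nu> j\<close> J by (auto simp: prod_zero_iff)
  qed simp
  finally show "integral\<^sup>L gauss (\<lambda>y. hermite_multi \<mu> y * hermite_multi \<nu> y) = (if \<mu> = \<nu> then 1 else 0)" .
qed

definition gauss_L2 :: "((nat \<Rightarrow> real) \<Rightarrow> 'h::{real_inner, banach, second_countable_topology}) set" where
  "gauss_L2 = {g \<in> borel_measurable gauss. integrable gauss (\<lambda>y. (norm (g y))\<^sup>2)}"

lemma gauss_L2_measurable [measurable_dest]: "g \<in> gauss_L2 \<Longrightarrow> g \<in> borel_measurable gauss"
  and gauss_L2_integrable: "g \<in> gauss_L2 \<Longrightarrow> integrable gauss (\<lambda>y. (norm (g y))\<^sup>2)"
  by (simp_all add: gauss_L2_def)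

lemma two_mult_le_power2: "a * b \<le> a\<^sup>2 + (b::real)\<^sup>2" if "a \<ge> 0" "b \<ge> 0"
proof -
  have "0 \<le> (a - b)\<^sup>2" "0 \<le> a * b" using that by simp_all
  then show ?thesis unfolding power2_diff by linarith
qed

lemma gauss_L2_add:
  assumes f: "f \<in> gauss_L2" and g: "g \<in> gauss_L2" shows "(\<lambda>y. f y + g y) \<in> gauss_L2"
proof -
  note [measurable] = gauss_L2_measurable[OF f] gauss_L2_measurable[OF g]
  have "integrable gauss (\<lambda>y. 2 * (norm (f y))\<^sup>2 + 2 * (norm (g y))\<^sup>2)"
    using gauss_L2_integrable[OF f] gauss_L2_integrable[OF g] by simp
  then have "integrable gauss (\<lambda>y. (norm (f y + g y))\<^sup>2)"
  proof (rule Bochner_Integration.integrable_bound)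
    have "(norm (f y + g y))\<^sup>2 \<le> 2 * (norm (f y))\<^sup>2 + 2 * (norm (g y))\<^sup>2" for y
    proof -
      have "(norm (f y + g y))\<^sup>2 \<le> (norm (f y) + norm (g y))\<^sup>2"
        by (intro power_mono norm_triangle_ineq) auto
      moreover have "0 \<le> (norm (f y) - norm (g y))\<^sup>2" by simp
      ultimately show ?thesis unfolding power2_sum power2_diff by linarith
    qed
    then show "AE y in gauss. norm ((norm (f y + g y))\<^sup>2) \<le> norm (2 * (norm (f y))\<^sup>2 + 2 * (norm (g y))\<^sup>2)"
      by (auto intro!: AE_I2)
  qed measurable
  then show ?thesis by (simp add: gauss_L2_def)
qed

lemma gauss_L2_scaleR:
  assumes "g \<in> gauss_L2" shows "(\<lambda>y. c *\<^sub>R g y) \<in> gauss_L2"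
proof -
  note [measurable] = gauss_L2_measurable[OF assms]
  have "(\<lambda>y. c *\<^sub>R g y) \<in> borel_measurable gauss" by measurable
  then show ?thesis
    using integrable_mult_right[OF gauss_L2_integrable[OF assms], of "c\<^sup>2"]
    by (simp add: gauss_L2_def power_mult_distrib)
qed

lemma gauss_L2_diff:
  assumes f: "f \<in> gauss_L2" and g: "g \<in> gauss_L2" shows "(\<lambda>y. f y - g y) \<in> gauss_L2"
  using gauss_L2_add[OF f gauss_L2_scaleR[OF g, of "-1"]] by simp

lemma gauss_L2_zero: "(\<lambda>y. 0) \<in> gauss_L2"
  by (simp add: gauss_L2_def)

lemma gauss_L2_sum: "(\<And>i. i \<in> I \<Longrightarrow> f i \<in> gauss_L2) \<Longrightarrow> (\<lambda>y. \<Sum>i\<in>I. f i y) \<in> gauss_L2"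
  by (induction I rule: infinite_finite_induct) (auto simp: gauss_L2_zero gauss_L2_add)

lemma gauss_L2_scaleR_integrable:
  assumes f: "f \<in> gauss_L2" and g: "g \<in> gauss_L2"
  shows "integrable gauss (\<lambda>y. f y *\<^sub>R g y)"
proof (rule Bochner_Integration.integrable_bound)
  note [measurable] = gauss_L2_measurable[OF f] gauss_L2_measurable[OF g]
  show "integrable gauss (\<lambda>y. (norm (f y))\<^sup>2 + (norm (g y))\<^sup>2)"
    using gauss_L2_integrable[OF f] gauss_L2_integrable[OF g] by simp
  show "AE y in gauss. norm (f y *\<^sub>R g y) \<le> norm ((norm (f y))\<^sup>2 + (norm (g y))\<^sup>2)"
    using two_mult_le_power2[of "norm (f _)" "norm (g _)"] by (auto intro!: AE_I2)
  show "(\<lambda>y. f y *\<^sub>R g y) \<in> borel_measurable gauss" by measurable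
qed

lemma gauss_L2_inner_integrable:
  assumes f: "f \<in> gauss_L2" and g: "g \<in> gauss_L2"
  shows "integrable gauss (\<lambda>y. inner (f y) (g y))"
proof (rule Bochner_Integration.integrable_bound)
  note [measurable] = gauss_L2_measurable[OF f] gauss_L2_measurable[OF g]
  show "integrable gauss (\<lambda>y. (norm (f y))\<^sup>2 + (norm (g y))\<^sup>2)"
    using gauss_L2_integrable[OF f] gauss_L2_integrable[OF g] by simp
  show "AE y in gauss. norm (inner (f y) (g y)) \<le> norm ((norm (f y))\<^sup>2 + (norm (g y))\<^sup>2)"
    using order_trans[OF Cauchy_Schwarz_ineq2 two_mult_le_power2[of "norm (f _)" "norm (g _)"]] by (auto intro!: AE_I2)
  show "(\<lambda>y. inner (f y) (g y)) \<in> borel_measurable gauss" by measurable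
qed

lemma hermite_multi_gauss_L2: "\<nu> \<in> multi_indices \<Longrightarrow> hermite_multi \<nu> \<in> gauss_L2"
  using hermite_multi_orthonormal(1)[of \<nu> \<nu>] by (simp add: gauss_L2_def power2_eq_square)

lemma hermite_multi_integrable:
  assumes "\<nu> \<in> multi_indices" "g \<in> gauss_L2"
  shows "integrable gauss (\<lambda>y. hermite_multi \<nu> y *\<^sub>R g y)"
  by (rule gauss_L2_scaleR_integrable[OF hermite_multi_gauss_L2[OF assms(1)] assms(2)])

lemma inner_hermite_coeff:
  assumes "\<nu> \<in> multi_indices" "g \<in> gauss_L2"
  shows "inner (hermite_coeff g \<nu>) v = integral\<^sup>L gauss (\<lambda>y. hermite_multi \<nu> y * inner (g y) v)"
  unfolding hermite_coeff_def
  using integral_inner_left[OF hermite_multi_integrable[OF assms], of v] by simp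

definition hermite_poly :: "(nat \<Rightarrow> nat) set \<Rightarrow> ((nat \<Rightarrow> nat) \<Rightarrow> 'h::{real_inner, banach, second_countable_topology}) \<Rightarrow> (nat \<Rightarrow> real) \<Rightarrow> 'h" where
  "hermite_poly T c y = (\<Sum>\<nu>\<in>T. hermite_multi \<nu> y *\<^sub>R c \<nu>)"

lemma hermite_poly_gauss_L2:
  assumes "T \<subseteq> multi_indices" shows "hermite_poly T c \<in> gauss_L2"
  unfolding hermite_poly_def[abs_def]
proof (rule gauss_L2_sum)
  fix \<nu> assume "\<nu> \<in> T"
  then have H: "hermite_multi \<nu> \<in> gauss_L2" using assms by (auto intro: hermite_multi_gauss_L2)
  note [measurable] = gauss_L2_measurable[OF H]
  show "(\<lambda>y. hermite_multi \<nu> y *\<^sub>R c \<nu>) \<in> gauss_L2"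
    using gauss_L2_integrable[OF H] by (simp add: gauss_L2_def power_mult_distrib)
qed

lemma inner_hermite_poly:
  assumes T: "finite T" "T \<subseteq> multi_indices" and g: "g \<in> gauss_L2"
  shows "integral\<^sup>L gauss (\<lambda>y. inner (g y) (hermite_poly T c y)) = (\<Sum>\<nu>\<in>T. inner (hermite_coeff g \<nu>) (c \<nu>))"
proof -
  have "integral\<^sup>L gauss (\<lambda>y. inner (g y) (hermite_poly T c y))
      = integral\<^sup>L gauss (\<lambda>y. \<Sum>\<nu>\<in>T. inner (hermite_multi \<nu> y *\<^sub>R g y) (c \<nu>))"
    by (simp add: hermite_poly_def inner_sum_right)
  also have "\<dots> = (\<Sum>\<nu>\<in>T. integral\<^sup>L gauss (\<lambda>y. inner (hermite_multi \<nu> y *\<^sub>R g y) (c \<nu>)))"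
    using T(2) by (intro Bochner_Integration.integral_sum integrable_inner_left hermite_multi_integrable[OF _ g]) auto
  also have "\<dots> = (\<Sum>\<nu>\<in>T. inner (hermite_coeff g \<nu>) (c \<nu>))"
    unfolding hermite_coeff_def
    using T(2) by (intro sum.cong refl integral_inner_left hermite_multi_integrable[OF _ g]) auto
  finally show ?thesis .
qed

lemma hermite_coeff_hermite_poly:
  assumes T: "finite T" "T \<subseteq> multi_indices" and \<nu>: "\<nu> \<in> multi_indices"
  shows "hermite_coeff (hermite_poly T c) \<nu> = (if \<nu> \<in> T then c \<nu> else 0)"
proof -
  have "hermite_coeff (hermite_poly T c) \<nu>
      = integral\<^sup>L gauss (\<lambda>y. \<Sum>\<mu>\<in>T. (hermite_multi \<nu> y * hermite_multi \<mu> y) *\<^sub>R c \<mu>)"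
    by (simp add: hermite_coeff_def hermite_poly_def scaleR_sum_right)
  also have "\<dots> = (\<Sum>\<mu>\<in>T. integral\<^sup>L gauss (\<lambda>y. (hermite_multi \<nu> y * hermite_multi \<mu> y) *\<^sub>R c \<mu>))"
    using T(2) \<nu> by (intro Bochner_Integration.integral_sum integrable_scaleR_left hermite_multi_orthonormal) auto
  also have "\<dots> = (\<Sum>\<mu>\<in>T. (if \<nu> = \<mu> then 1 else 0) *\<^sub>R c \<mu>)"
    using T(2) \<nu> by (intro sum.cong refl) (auto simp: hermite_multi_orthonormal)
  also have "\<dots> = (\<Sum>\<mu>\<in>T. if \<nu> = \<mu> then c \<mu> else 0)"
    by (intro sum.cong) auto
  finally show ?thesis using T(1) by simp
qed

text \<open>
  For \<open>c = hermite_coeff g\<close> the right-hand side is \<open>\<parallel>g\<parallel>\<^sup>2 - \<Sum> \<parallel>c\<^sub>\<nu>\<parallel>\<^sup>2\<close>, which is Bessel's inequality; for \<open>g = 0\<close>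
  the identity computes the norm of a Hermite polynomial.
\<close>

lemma norm_diff_hermite_poly:
  assumes T: "finite T" "T \<subseteq> multi_indices" and g: "g \<in> gauss_L2"
  shows "integral\<^sup>L gauss (\<lambda>y. (norm (g y - hermite_poly T c y))\<^sup>2)
    = integral\<^sup>L gauss (\<lambda>y. (norm (g y))\<^sup>2) - 2 * (\<Sum>\<nu>\<in>T. inner (hermite_coeff g \<nu>) (c \<nu>)) + (\<Sum>\<nu>\<in>T. (norm (c \<nu>))\<^sup>2)"
proof -
  let ?P = "hermite_poly T c"
  have P: "?P \<in> gauss_L2" by (rule hermite_poly_gauss_L2[OF T(2)])
  have PP: "integral\<^sup>L gauss (\<lambda>y. inner (?P y) (?P y)) = (\<Sum>\<nu>\<in>T. (norm (c \<nu>))\<^sup>2)"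
    unfolding inner_hermite_poly[OF T P]
    by (intro sum.cong refl) (use T in \<open>auto simp: hermite_coeff_hermite_poly[OF T] subset_iff power2_norm_eq_inner\<close>)
  have "integral\<^sup>L gauss (\<lambda>y. (norm (g y - ?P y))\<^sup>2)
      = integral\<^sup>L gauss (\<lambda>y. (norm (g y))\<^sup>2 - 2 * inner (g y) (?P y) + inner (?P y) (?P y))"
    by (simp add: power2_norm_eq_inner inner_diff_left inner_diff_right inner_commute algebra_simps)
  also have "\<dots> = integral\<^sup>L gauss (\<lambda>y. (norm (g y))\<^sup>2) - 2 * integral\<^sup>L gauss (\<lambda>y. inner (g y) (?P y))
      + integral\<^sup>L gauss (\<lambda>y. inner (?P y) (?P y))"
    using gauss_L2_integrable[OF g] gauss_L2_inner_integrable[OF g P]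
      gauss_L2_inner_integrable[OF P P]
    by simp
  finally show ?thesis unfolding PP inner_hermite_poly[OF T g] .
qed

lemma hermite_Bessel:
  assumes T: "finite T" "T \<subseteq> multi_indices" and g: "g \<in> gauss_L2"
  shows "(\<Sum>\<nu>\<in>T. (norm (hermite_coeff g \<nu>))\<^sup>2) \<le> integral\<^sup>L gauss (\<lambda>y. (norm (g y))\<^sup>2)"
proof -
  have "0 \<le> integral\<^sup>L gauss (\<lambda>y. (norm (g y - hermite_poly T (hermite_coeff g) y))\<^sup>2)"
    by simp
  then show ?thesis unfolding norm_diff_hermite_poly[OF T g] by (simp add: power2_norm_eq_inner)
qed

section \<open>Hermite coefficients of derivatives\<close>

text \<open>
  By the fundamental theorem, \<open>\<bar>F a\<bar>\<close> is at most the integral of \<open>\<bar>F\<bar> + \<bar>f\<bar>\<close> over \<open>{a..a + 1}\<close>.  Integrability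
  therefore forces \<open>F\<close> to vanish at both infinities.
\<close>

lemma integral_derivative_eq_0:
  fixes F f :: "real \<Rightarrow> real"
  assumes deriv: "\<And>x. (F has_real_derivative f x) (at x)" and cont: "\<And>x. isCont f x"
    and F: "integrable lborel F" and f: "integrable lborel f"
  shows "integral\<^sup>L lborel f = 0"
proof -
  have FTC: "integral\<^sup>L lborel (\<lambda>x. f x * indicator {a..b} x) = F b - F a" if "a \<le> b" for a b
    by (rule integral_FTC_Icc_real[OF that]) (auto intro: deriv cont)
  have tail: "(\<lambda>n. integral\<^sup>L lborel (\<lambda>x. h x * indicator (A n) x)) \<longlonglongrightarrow> 0"
    if h: "integrable lborel h" and A: "\<And>n. A n \<in> sets borel" "\<And>x. \<forall>\<^sub>F n in sequentially. x \<notin> A n"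
    for h :: "real \<Rightarrow> real" and A :: "nat \<Rightarrow> real set"
  proof -
    have "(\<lambda>n. integral\<^sup>L lborel (\<lambda>x. h x * indicator (A n) x)) \<longlonglongrightarrow> integral\<^sup>L lborel (\<lambda>x::real. 0::real)"
    proof (rule integral_dominated_convergence[where w = "\<lambda>x. \<bar>h x\<bar>"])
      show "AE x in lborel. (\<lambda>n. h x * indicator (A n) x) \<longlonglongrightarrow> 0"
      proof (rule AE_I2, rule tendsto_eventually)
        fix x show "\<forall>\<^sub>F n in sequentially. h x * indicator (A n) x = 0"
          using A(2)[of x] by eventually_elim simp
      qed
    qed (use h A(1) in \<open>auto simp: indicator_def\<close>)
    then show ?thesis by simp
  qed
  have lim: "(\<lambda>n. F (a n)) \<longlonglongrightarrow> 0" if a: "\<And>x. \<forall>\<^sub>F n in sequentially. x \<notin> {a n..a n + 1}" for a :: "nat \<Rightarrow> real"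
  proof (rule Lim_null_comparison)
    let ?A = "\<lambda>n. {a n..a n + 1}"
    show "\<forall>\<^sub>F n in sequentially. norm (F (a n)) \<le>
        integral\<^sup>L lborel (\<lambda>x. \<bar>F x\<bar> * indicator (?A n) x) + integral\<^sup>L lborel (\<lambda>x. \<bar>f x\<bar> * indicator (?A n) x)"
    proof (intro always_eventually allI)
      fix n
      let ?I = "integral\<^sup>L lborel (\<lambda>x. \<bar>f x\<bar> * indicator (?A n) x)"
      have le: "\<bar>F (a n)\<bar> * indicator (?A n) x \<le> \<bar>F x\<bar> * indicator (?A n) x + ?I * indicator (?A n) x" for x
      proof (cases "x \<in> ?A n")
        case True
        have "F x - F (a n) = integral\<^sup>L lborel (\<lambda>z. f z * indicator {a n..x} z)"
          using True by (subst FTC) auto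
        also have "\<bar>\<dots>\<bar> \<le> integral\<^sup>L lborel (\<lambda>z. \<bar>f z * indicator {a n..x} z\<bar>)"
          by (rule integral_abs_bound)
        also have "\<dots> \<le> ?I"
          using True f by (intro integral_mono) (auto simp: indicator_def abs_mult integrable_abs
              intro!: integrable_real_mult_indicator Bochner_Integration.integrable_bound[OF f])
        finally have "\<bar>F (a n)\<bar> \<le> \<bar>F x\<bar> + ?I" by linarith
        then show ?thesis using True by simp
      qed simp
      have "integral\<^sup>L lborel (\<lambda>x. \<bar>F (a n)\<bar> * indicator (?A n) x)
          \<le> integral\<^sup>L lborel (\<lambda>x. \<bar>F x\<bar> * indicator (?A n) x + ?I * indicator (?A n) x)"
        using F by (intro integral_mono le Bochner_Integration.integrable_add integrable_real_mult_indicator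
            integrable_mult_right integrable_real_indicator integrable_abs) auto
      also have "\<dots> = integral\<^sup>L lborel (\<lambda>x. \<bar>F x\<bar> * indicator (?A n) x) + ?I"
        using F by (subst Bochner_Integration.integral_add)
          (auto intro!: integrable_real_mult_indicator integrable_mult_right integrable_real_indicator integrable_abs)
      finally show "norm (F (a n)) \<le> integral\<^sup>L lborel (\<lambda>x. \<bar>F x\<bar> * indicator (?A n) x) + ?I"
        by simp
    qed
    show "(\<lambda>n. integral\<^sup>L lborel (\<lambda>x. \<bar>F x\<bar> * indicator (?A n) x) + integral\<^sup>L lborel (\<lambda>x. \<bar>f x\<bar> * indicator (?A n) x)) \<longlonglongrightarrow> 0"
      using tendsto_add[OF tail[of "\<lambda>x. \<bar>F x\<bar>" ?A] tail[of "\<lambda>x. \<bar>f x\<bar>" ?A]] F f a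
      by (simp add: integrable_abs)
  qed
  have "(\<lambda>n. F (real n) - F (- real n)) \<longlonglongrightarrow> 0 - 0"
  proof (intro tendsto_diff lim)
    fix x :: real
    obtain N :: nat where N: "\<bar>x\<bar> + 1 < real N" using reals_Archimedean2 by blast
    show "\<forall>\<^sub>F n in sequentially. x \<notin> {real n..real n + 1}"
      using eventually_ge_at_top[of N] by eventually_elim (use N in auto)
    show "\<forall>\<^sub>F n in sequentially. x \<notin> {- real n..- real n + 1}"
      using eventually_ge_at_top[of N] by eventually_elim (use N in auto)
  qed
  moreover have "(\<lambda>n. F (real n) - F (- real n)) \<longlonglongrightarrow> integral\<^sup>L lborel f"
  proof -
    have "(\<lambda>n. integral\<^sup>L lborel (\<lambda>x. f x * indicator {- real n..real n} x)) \<longlonglongrightarrow> integral\<^sup>L lborel f"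
    proof (rule integral_dominated_convergence[where w = "\<lambda>x. \<bar>f x\<bar>"])
      show "AE x in lborel. (\<lambda>n. f x * indicator {- real n..real n} x) \<longlonglongrightarrow> f x"
      proof (rule AE_I2, rule tendsto_eventually)
        fix x :: real
        obtain N :: nat where N: "\<bar>x\<bar> < real N" using reals_Archimedean2 by blast
        show "\<forall>\<^sub>F n in sequentially. f x * indicator {- real n..real n} x = f x"
          using eventually_ge_at_top[of N] by eventually_elim (use N in \<open>auto simp: indicator_def\<close>)
      qed
    qed (use f in \<open>auto simp: indicator_def integrable_abs\<close>)
    then show ?thesis by (simp add: FTC)
  qed
  ultimately show ?thesis using LIMSEQ_unique by fastforce
qed

lemma pderiv_monic_hermite:
  "pderiv (monic_hermite n) = [:0, 1:] * monic_hermite n - monic_hermite (Suc n)"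
proof (induction n rule: less_induct)
  case (less n)
  consider "n = 0" | "n = 1" | k where "n = Suc (Suc k)" by (metis One_nat_def not0_implies_Suc)
  then show ?case
  proof cases
    case 3
    let ?H = monic_hermite
    have X: "?H (Suc (Suc m)) = [:0, 1:] * ?H (Suc m) - smult (real (Suc m)) (?H m)" for m by simp
    have IH1: "pderiv (?H (Suc k)) = smult (real (Suc k)) (?H k)"
      using less[of "Suc k"] 3 by (simp add: X del: monic_hermite.simps mult_pCons_left)
    have IH0: "pderiv (?H k) = [:0, 1:] * ?H k - ?H (Suc k)" using less[of k] 3 by simp
    have "pderiv (?H n) = ?H (Suc k) + [:0, 1:] * smult (real (Suc k)) (?H k) - smult (real (Suc k)) (pderiv (?H k))"
      unfolding 3 X pderiv_diff pderiv_mult pderiv_smult IH1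
      by (simp add: pderiv_pCons del: monic_hermite.simps)
    also have "\<dots> = smult (real (Suc (Suc k))) (?H (Suc k))"
    proof -
      have cancel: "a + b - (b - c) = a + c" for a b c :: "real poly" by simp
      show ?thesis
        unfolding IH0 mult_smult_right smult_diff_right cancel
        by (simp only: of_nat_Suc[of "Suc k"] smult_add_left smult_1_left)
    qed
    also have "\<dots> = [:0, 1:] * ?H n - ?H (Suc n)"
      unfolding 3 by (simp only: X[of "Suc k"] diff_diff_eq2 add_diff_cancel_left')
    finally show ?thesis .
  qed (simp_all add: pderiv_pCons pderiv_diff)
qed

lemma hermite_derivative:
  "(hermite n has_real_derivative x * hermite n x - sqrt (real (Suc n)) * hermite (Suc n) x) (at x)"
proof -
  have "((\<lambda>x. poly (monic_hermite n) x / sqrt (fact n)) has_real_derivative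
      poly (pderiv (monic_hermite n)) x / sqrt (fact n)) (at x)"
    by (auto intro!: derivative_eq_intros poly_DERIV simp: DERIV_cdivide)
  also have "poly (pderiv (monic_hermite n)) x / sqrt (fact n) = x * hermite n x - poly (monic_hermite (Suc n)) x / sqrt (fact n)"
    unfolding pderiv_monic_hermite by (simp add: hermite_def diff_divide_distrib del: monic_hermite.simps)
  also have "poly (monic_hermite (Suc n)) x / sqrt (fact n) = sqrt (real (Suc n)) * hermite (Suc n) x"
  proof -
    have "sqrt (fact (Suc n)) = sqrt (real (Suc n)) * sqrt (fact n)" by (simp only: fact_Suc real_sqrt_mult of_nat_mult)
    then show ?thesis by (simp add: hermite_def del: monic_hermite.simps)
  qed
  finally show ?thesis by (simp add: hermite_def[abs_def])
qed

lemma std_normal_density_derivative: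
  "(std_normal_density has_real_derivative - x * std_normal_density x) (at x)"
  unfolding normal_density_def[abs_def] by (auto intro!: derivative_eq_intros simp: power2_eq_square field_simps)

text \<open>
  Integration by parts: \<open>- sqrt (n + 1) hermite (n + 1) * d\<close> is the derivative of \<open>hermite n * d\<close> for the
  Gaussian density \<open>d\<close>.
\<close>

lemma std_normal_Stein:
  fixes \<phi> \<phi>' :: "real \<Rightarrow> real"
  assumes deriv: "\<And>t. (\<phi> has_real_derivative \<phi>' t) (at t)" and cont: "\<And>t. isCont \<phi>' t"
    and int: "integrable std_normal (\<lambda>t. \<phi>' t * hermite n t)" "integrable std_normal (\<lambda>t. \<phi> t * hermite n t)"
      "integrable std_normal (\<lambda>t. \<phi> t * hermite (Suc n) t)"
  shows "integral\<^sup>L std_normal (\<lambda>t. \<phi>' t * hermite n t) = sqrt (real (Suc n)) * integral\<^sup>L std_normal (\<lambda>t. \<phi> t * hermite (Suc n) t)"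
proof -
  let ?d = "std_normal_density"
  let ?f = "\<lambda>t. ?d t * (\<phi>' t * hermite n t) - sqrt (real (Suc n)) * (?d t * (\<phi> t * hermite (Suc n) t))"
  have m\<phi> [measurable]: "\<phi> \<in> borel_measurable borel"
    by (intro borel_measurable_continuous_onI continuous_at_imp_continuous_on ballI DERIV_isCont[OF deriv])
  have m\<phi>' [measurable]: "\<phi>' \<in> borel_measurable borel"
    by (intro borel_measurable_continuous_onI continuous_at_imp_continuous_on ballI cont)
  have density: "integrable lborel (\<lambda>t. ?d t * h t)" "integral\<^sup>L std_normal h = integral\<^sup>L lborel (\<lambda>t. ?d t * h t)"
    if "integrable std_normal h" "h \<in> borel_measurable borel" for h :: "real \<Rightarrow> real"
    using that by (simp_all add: integrable_density integral_density)
  note i1 = density[OF int(1)] and i2 = density[OF int(2)] and i3 = density[OF int(3)]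
  have "integral\<^sup>L lborel ?f = 0"
  proof (rule integral_derivative_eq_0)
    show "((\<lambda>t. ?d t * (\<phi> t * hermite n t)) has_real_derivative ?f x) (at x)" for x
    proof -
      have "((\<lambda>t. ?d t * (\<phi> t * hermite n t)) has_real_derivative
        - x * ?d x * (\<phi> x * hermite n x) + (\<phi>' x * hermite n x
          + (x * hermite n x - sqrt (real (Suc n)) * hermite (Suc n) x) * \<phi> x) * ?d x) (at x)"
        by (rule DERIV_mult[OF std_normal_density_derivative DERIV_mult[OF deriv hermite_derivative]])
      then show ?thesis by (rule DERIV_cong) (simp add: algebra_simps)
    qed
    have c: "isCont ?d x" "isCont (hermite m) x" "isCont \<phi> x" for x m
      by (rule DERIV_isCont std_normal_density_derivative hermite_derivative deriv)+
    show "isCont ?f x" for x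
      by (intro continuous_intros c cont)
    show "integrable lborel (\<lambda>t. ?d t * (\<phi> t * hermite n t))" by (rule i2) simp
    show "integrable lborel ?f"
      by (intro Bochner_Integration.integrable_diff integrable_mult_right i1 i3) simp_all
  qed
  then show ?thesis
    by (simp add: i1 i3)
qed

text \<open>
  On almost every line in direction \<open>j\<close> this is integration by parts in one variable, the factor \<open>R\<close> of the
  Hermite polynomial in the other variables being constant on the line.
\<close>

lemma hermite_coeff_derivative:
  fixes g g' :: "(nat \<Rightarrow> real) \<Rightarrow> 'h::{real_inner, banach, second_countable_topology}"
  assumes g: "g \<in> gauss_L2" and g': "g' \<in> gauss_L2" and \<mu>: "\<mu> \<in> multi_indices"
    and deriv: "\<And>y t. ((\<lambda>t. g (y(j := t))) has_vector_derivative g' (y(j := t))) (at t)"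
    and cont: "\<And>y t. isCont (\<lambda>t. g' (y(j := t))) t"
  shows "hermite_coeff g' \<mu> = sqrt (real (Suc (\<mu> j))) *\<^sub>R hermite_coeff g (\<mu>(j := Suc (\<mu> j)))"
proof -
  define \<nu> where "\<nu> = \<mu>(j := Suc (\<mu> j))"
  have \<nu>: "\<nu> \<in> multi_indices"
    using \<mu> by (auto simp: multi_indices_def \<nu>_def intro: finite_subset[of _ "insert j {i. \<mu> i \<noteq> 0}"])
  define J where "J = {i. \<mu> i \<noteq> 0} - {j}"
  have J: "finite J" "j \<notin> J" using \<mu> by (auto simp: J_def multi_indices_def)
  define R where "R y = (\<Prod>i\<in>J. hermite (\<mu> i) (y i))" for y
  have R: "R (y(j := t)) = R y" for y t
    unfolding R_def using J(2) by (intro prod.cong) auto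
  have H\<mu>: "hermite_multi \<mu> y = hermite (\<mu> j) (y j) * R y" for y
  proof -
    have "{i. \<mu> i \<noteq> 0} \<subseteq> insert j J" by (auto simp: J_def)
    from hermite_multi_eq[OF _ this, of y] J show ?thesis by (simp add: R_def)
  qed
  have H\<nu>: "hermite_multi \<nu> y = hermite (Suc (\<mu> j)) (y j) * R y" for y
  proof -
    have "hermite_multi \<nu> y = hermite (\<nu> j) (y j) * (\<Prod>i\<in>J. hermite (\<nu> i) (y i))"
    proof -
      have "{i. \<nu> i \<noteq> 0} \<subseteq> insert j J" by (auto simp: J_def \<nu>_def)
      from hermite_multi_eq[OF _ this, of y] J show ?thesis by simp
    qed
    also have "(\<Prod>i\<in>J. hermite (\<nu> i) (y i)) = R y"
      unfolding R_def using J(2) by (intro prod.cong) (auto simp: \<nu>_def)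
    finally have eq: "hermite_multi \<nu> y = hermite (\<nu> j) (y j) * R y" .
    have "\<nu> j = Suc (\<mu> j)" by (simp add: \<nu>_def)
    with eq show ?thesis by simp
  qed
  have "inner (hermite_coeff g' \<mu>) v = inner (sqrt (real (Suc (\<mu> j))) *\<^sub>R hermite_coeff g \<nu>) v" for v
  proof -
    have i1: "integrable gauss (\<lambda>y. hermite_multi \<mu> y * inner (g' y) v)"
      using integrable_inner_left[OF hermite_multi_integrable[OF \<mu> g'], of v] by simp
    have i2: "integrable gauss (\<lambda>y. hermite_multi \<mu> y * inner (g y) v)"
      using integrable_inner_left[OF hermite_multi_integrable[OF \<mu> g], of v] by simp
    have i3: "integrable gauss (\<lambda>y. hermite_multi \<nu> y * inner (g y) v)"
      using integrable_inner_left[OF hermite_multi_integrable[OF \<nu> g], of v] by simp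
    have line: "(\<integral>t. hermite_multi \<mu> (y(j := t)) * inner (g' (y(j := t))) v \<partial>std_normal)
        = sqrt (real (Suc (\<mu> j))) * (\<integral>t. hermite_multi \<nu> (y(j := t)) * inner (g (y(j := t))) v \<partial>std_normal)"
      if int: "integrable std_normal (\<lambda>t. hermite_multi \<mu> (y(j := t)) * inner (g' (y(j := t))) v)"
        "integrable std_normal (\<lambda>t. hermite_multi \<mu> (y(j := t)) * inner (g (y(j := t))) v)"
        "integrable std_normal (\<lambda>t. hermite_multi \<nu> (y(j := t)) * inner (g (y(j := t))) v)" for y
    proof (cases "R y = 0")
      case True
      then show ?thesis by (simp add: H\<mu> H\<nu> R)
    next
      case False
      let ?\<phi> = "\<lambda>t. inner (g (y(j := t))) v" and ?\<phi>' = "\<lambda>t. inner (g' (y(j := t))) v"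
      have eq: "hermite_multi \<mu> (y(j := t)) * r = R y * (r * hermite (\<mu> j) t)"
        "hermite_multi \<nu> (y(j := t)) * r = R y * (r * hermite (Suc (\<mu> j)) t)" for t r
        by (simp_all add: H\<mu> H\<nu> R)
      have "integral\<^sup>L std_normal (\<lambda>t. ?\<phi>' t * hermite (\<mu> j) t)
          = sqrt (real (Suc (\<mu> j))) * integral\<^sup>L std_normal (\<lambda>t. ?\<phi> t * hermite (Suc (\<mu> j)) t)"
      proof (rule std_normal_Stein)
        show "(?\<phi> has_real_derivative ?\<phi>' t) (at t)" for t
          unfolding has_real_derivative_iff_has_vector_derivative
          using bounded_linear.has_vector_derivative[OF bounded_linear_inner_left deriv] by simp
        show "isCont ?\<phi>' t" for t by (intro continuous_intros cont)
      qed (use int False in \<open>simp_all only: eq integrable_mult_left_iff[where c = "R y"] simp_thms\<close>)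
      then show ?thesis unfolding eq by (simp add: mult.left_commute)
    qed
    have "integral\<^sup>L gauss (\<lambda>y. hermite_multi \<mu> y * inner (g' y) v)
        = (\<integral>y. \<integral>t. hermite_multi \<mu> (y(j := t)) * inner (g' (y(j := t))) v \<partial>std_normal \<partial>gauss)"
      by (rule integral_gauss_split(2)[OF i1])
    also have "\<dots> = (\<integral>y. sqrt (real (Suc (\<mu> j))) * (\<integral>t. hermite_multi \<nu> (y(j := t)) * inner (g (y(j := t))) v \<partial>std_normal) \<partial>gauss)"
    proof (rule integral_cong_AE)
      show "AE y in gauss. (\<integral>t. hermite_multi \<mu> (y(j := t)) * inner (g' (y(j := t))) v \<partial>std_normal)
        = sqrt (real (Suc (\<mu> j))) * (\<integral>t. hermite_multi \<nu> (y(j := t)) * inner (g (y(j := t))) v \<partial>std_normal)"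
        using integral_gauss_split(1)[OF i1, of j] integral_gauss_split(1)[OF i2, of j] integral_gauss_split(1)[OF i3, of j]
        by eventually_elim (rule line)
      interpret s: prob_space std_normal by (rule prob_space_std_normal)
      note [measurable] = gauss_L2_measurable[OF g] gauss_L2_measurable[OF g']
      show "(\<lambda>y. \<integral>t. hermite_multi \<mu> (y(j := t)) * inner (g' (y(j := t))) v \<partial>std_normal) \<in> borel_measurable gauss"
        by measurable
      show "(\<lambda>y. sqrt (real (Suc (\<mu> j))) * (\<integral>t. hermite_multi \<nu> (y(j := t)) * inner (g (y(j := t))) v \<partial>std_normal)) \<in> borel_measurable gauss"
        by measurable
    qed
    also have "\<dots> = sqrt (real (Suc (\<mu> j))) * integral\<^sup>L gauss (\<lambda>y. hermite_multi \<nu> y * inner (g y) v)"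
      by (simp add: integral_gauss_split(2)[OF i3, of j])
    finally show ?thesis by (simp add: inner_hermite_coeff \<mu> \<nu> g g')
  qed
  from this[of "hermite_coeff g' \<mu> - sqrt (real (Suc (\<mu> j))) *\<^sub>R hermite_coeff g \<nu>"]
  have "inner (hermite_coeff g' \<mu> - sqrt (real (Suc (\<mu> j))) *\<^sub>R hermite_coeff g \<nu>)
      (hermite_coeff g' \<mu> - sqrt (real (Suc (\<mu> j))) *\<^sub>R hermite_coeff g \<nu>) = 0"
    by (simp only: inner_diff_left)
  then show ?thesis by (simp add: \<nu>_def)
qed

section \<open>Completeness of the Hermite polynomials\<close>

lemma power_le_fact_mult_exp: "x ^ k \<le> fact k * exp x" if "0 \<le> (x::real)"
proof -
  have "x ^ k /\<^sub>R fact k \<le> (\<Sum>i. x ^ i /\<^sub>R fact i)"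
    using sum_le_suminf[OF summable_exp_generic[of x], of "{k}"] that by simp
  then have "x ^ k /\<^sub>R fact k \<le> exp x" by (simp add: exp_def)
  then show ?thesis by (simp add: field_simps)
qed

lemma integrable_mult_power_of_exp:
  fixes F Y :: "'m \<Rightarrow> real"
  assumes [measurable]: "F \<in> borel_measurable M" "Y \<in> borel_measurable M"
    and F: "integrable M (\<lambda>y. \<bar>F y\<bar> * exp \<bar>Y y\<bar>)"
  shows "integrable M (\<lambda>y. F y * Y y ^ k)"
proof (rule Bochner_Integration.integrable_bound[OF integrable_mult_right[OF F, of "fact k"]])
  show "AE y in M. norm (F y * Y y ^ k) \<le> norm (fact k * (\<bar>F y\<bar> * exp \<bar>Y y\<bar>))"
  proof (rule AE_I2)
    fix y
    have "\<bar>F y\<bar> * \<bar>Y y\<bar> ^ k \<le> \<bar>F y\<bar> * (fact k * exp \<bar>Y y\<bar>)"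
      by (rule mult_left_mono[OF power_le_fact_mult_exp]) simp_all
    then show "norm (F y * Y y ^ k) \<le> norm (fact k * (\<bar>F y\<bar> * exp \<bar>Y y\<bar>))"
      by (simp add: abs_mult power_abs mult.left_commute)
  qed
qed measurable

text \<open>
  The positive and the negative part of \<open>F\<close> are densities of two measures, whose images under \<open>Y\<close> are to
  be shown equal.  The exponential moments permit the termwise integration of the series of \<open>exp (i t Y)\<close>;
  hence the characteristic functions of the images agree, and Levy's uniqueness theorem applies.
\<close>

lemma moments_determine_conditional:
  fixes F Y :: "'m \<Rightarrow> real"
  assumes [measurable]: "Y \<in> borel_measurable M"
    and F: "\<And>c. integrable M (\<lambda>y. \<bar>F y\<bar> * exp (c * \<bar>Y y\<bar>))" and Fm: "F \<in> borel_measurable M"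
    and mom: "\<And>n. integral\<^sup>L M (\<lambda>y. F y * Y y ^ n) = 0"
    and A: "A \<in> sets borel"
  shows "integral\<^sup>L M (\<lambda>y. F y * indicator A (Y y)) = 0"
proof -
  note [measurable] = Fm A
  have Fint: "integrable M F"
    using F[of 0] by (simp add: integrable_abs_iff)
  \<comment> \<open>The partial sums of the exponential series integrate to \<open>0\<close>.\<close>
  have char0: "integral\<^sup>L M (\<lambda>y. complex_of_real (F y) * iexp (t * Y y)) = 0" for t
  proof -
    let ?p = "\<lambda>n y. \<Sum>k<n. (\<i> * complex_of_real (t * Y y)) ^ k /\<^sub>R fact k"
    have bound: "norm (?p n y) \<le> exp (\<bar>t\<bar> * \<bar>Y y\<bar>)" for n y
    proof -
      have "norm (?p n y) \<le> (\<Sum>k<n. (\<bar>t\<bar> * \<bar>Y y\<bar>) ^ k /\<^sub>R fact k)"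
        by (rule order_trans[OF norm_sum sum_mono]) (simp add: norm_power norm_mult abs_mult)
      also have "\<dots> \<le> (\<Sum>k. (\<bar>t\<bar> * \<bar>Y y\<bar>) ^ k /\<^sub>R fact k)"
        by (rule sum_le_suminf, rule summable_exp_generic) auto
      also have "\<dots> = exp (\<bar>t\<bar> * \<bar>Y y\<bar>)" by (simp add: exp_def)
      finally show ?thesis .
    qed
    have int: "integrable M (\<lambda>y. F y * Y y ^ k)" for k
      by (rule integrable_mult_power_of_exp) (use F[of 1] in simp_all)
    have "integral\<^sup>L M (\<lambda>y. complex_of_real (F y) * ?p n y) = 0" for n
    proof -
      have "complex_of_real (F y) * ?p n y = (\<Sum>k<n. ((\<i> * complex_of_real t) ^ k / fact k) * complex_of_real (F y * Y y ^ k))" for y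
        unfolding sum_distrib_left
        by (intro sum.cong refl) (simp add: scaleR_conv_of_real power_mult_distrib field_simps)
      then have "integral\<^sup>L M (\<lambda>y. complex_of_real (F y) * ?p n y)
          = (\<Sum>k<n. integral\<^sup>L M (\<lambda>y. ((\<i> * complex_of_real t) ^ k / fact k) * complex_of_real (F y * Y y ^ k)))"
        by (simp only:) (intro Bochner_Integration.integral_sum integrable_mult_right integrable_of_real int)
      also have "\<dots> = 0"
        by (intro sum.neutral ballI) (simp add: mom del: of_real_mult)
      finally show ?thesis .
    qed
    moreover have "(\<lambda>n. integral\<^sup>L M (\<lambda>y. complex_of_real (F y) * ?p n y)) \<longlonglongrightarrow> integral\<^sup>L M (\<lambda>y. complex_of_real (F y) * iexp (t * Y y))"
    proof (rule integral_dominated_convergence[where w = "\<lambda>y. \<bar>F y\<bar> * exp (\<bar>t\<bar> * \<bar>Y y\<bar>)"])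
      show "integrable M (\<lambda>y. \<bar>F y\<bar> * exp (\<bar>t\<bar> * \<bar>Y y\<bar>))" by (rule F)
      show "AE y in M. (\<lambda>n. complex_of_real (F y) * ?p n y) \<longlonglongrightarrow> complex_of_real (F y) * iexp (t * Y y)"
        by (intro AE_I2 tendsto_mult tendsto_const) (use summable_LIMSEQ[OF summable_exp_generic] in \<open>simp add: exp_def\<close>)
      show "AE y in M. norm (complex_of_real (F y) * ?p n y) \<le> \<bar>F y\<bar> * exp (\<bar>t\<bar> * \<bar>Y y\<bar>)" for n
        by (intro AE_I2) (simp only: norm_mult norm_of_real, intro mult_left_mono bound, simp)
    qed measurable
    ultimately show ?thesis by (simp add: LIMSEQ_const_iff)
  qed
  define P where "P y = max 0 (F y)" for y
  define N where "N y = max 0 (- F y)" for y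
  have [measurable]: "P \<in> borel_measurable M" "N \<in> borel_measurable M"
    by (simp_all add: P_def[abs_def] N_def[abs_def])
  have PN: "integrable M P" "integrable M N" "\<And>y. 0 \<le> P y" "\<And>y. 0 \<le> N y" "\<And>y. F y = P y - N y"
    unfolding P_def N_def using Fint by (auto intro: integrable_max)
  have mass: "integral\<^sup>L M P = integral\<^sup>L M N"
    using mom[of 0] PN by simp
  define m where "m = integral\<^sup>L M P"
  have "m \<ge> 0" unfolding m_def by (rule Bochner_Integration.integral_nonneg) (simp add: PN)
  show ?thesis
  proof (cases "m = 0")
    case True
    then have "AE y in M. P y = 0" "AE y in M. N y = 0"
      using integral_nonneg_eq_0_iff_AE[OF PN(1)] integral_nonneg_eq_0_iff_AE[OF PN(2)] PN mass by (auto simp: m_def)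
    then have "AE y in M. F y * indicator A (Y y) = 0" by eventually_elim (simp add: PN(5))
    then have "integral\<^sup>L M (\<lambda>y. F y * indicator A (Y y)) = integral\<^sup>L M (\<lambda>y. 0)"
      by (intro integral_cong_AE) auto
    then show ?thesis by simp
  next
    case False
    then have m: "m > 0" using \<open>m \<ge> 0\<close> by simp
    \<comment> \<open>The normalized images under \<open>Y\<close> of the measures with the densities \<open>P\<close> and \<open>N\<close>.\<close>
    define D where "D Q = distr (density M (\<lambda>y. ennreal (Q y / m))) borel Y" for Q :: "'m \<Rightarrow> real"
    have D: "real_distribution (D Q)"
      and D_int: "\<And>h :: real \<Rightarrow> complex. h \<in> borel_measurable borel \<Longrightarrow> integral\<^sup>L (D Q) h = integral\<^sup>L M (\<lambda>y. (Q y / m) *\<^sub>R h (Y y))"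
      and D_meas: "measure (D Q) A = integral\<^sup>L M (\<lambda>y. Q y / m * indicator A (Y y))"
      if [measurable]: "Q \<in> borel_measurable M" and Q: "\<And>y. 0 \<le> Q y" "integrable M Q" "integral\<^sup>L M Q = m" for Q
    proof -
      have "emeasure (density M (\<lambda>y. ennreal (Q y / m))) (space M) = (\<integral>\<^sup>+y. ennreal (Q y / m) \<partial>M)"
        by (subst emeasure_density) (auto intro!: nn_integral_cong)
      also have "\<dots> = ennreal (integral\<^sup>L M (\<lambda>y. Q y / m))"
        using Q m by (intro nn_integral_eq_integral) auto
      also have "\<dots> = 1" using Q m by simp
      finally have "prob_space (density M (\<lambda>y. ennreal (Q y / m)))" by (intro prob_spaceI) simp
      then have "prob_space (D Q)" unfolding D_def by (rule prob_space.prob_space_distr) simp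
      then show D: "real_distribution (D Q)"
        by (simp add: real_distribution_def real_distribution_axioms_def D_def)
      show int: "integral\<^sup>L (D Q) h = integral\<^sup>L M (\<lambda>y. (Q y / m) *\<^sub>R h (Y y))"
        if [measurable]: "h \<in> borel_measurable borel" for h :: "real \<Rightarrow> complex"
        unfolding D_def using Q(1) m by (subst integral_distr) (auto simp: integral_density)
      have "integral\<^sup>L (D Q) (indicator A :: real \<Rightarrow> real) = integral\<^sup>L M (\<lambda>y. (Q y / m) *\<^sub>R indicator A (Y y))"
        unfolding D_def using Q(1) m by (subst integral_distr) (auto simp: integral_density)
      then show "measure (D Q) A = integral\<^sup>L M (\<lambda>y. Q y / m * indicator A (Y y))"
        by (simp add: D_def)
    qed
    have DPN: "D P = D N"
    proof (rule Levy_uniqueness)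
      show "real_distribution (D P)" "real_distribution (D N)"
        by (rule D; simp add: PN m_def mass)+
      show "char (D P) = char (D N)"
      proof
        fix t
        have i: "integrable M (\<lambda>y. (Q y / m) *\<^sub>R iexp (t * Y y))" if "integrable M Q" for Q
        proof (rule Bochner_Integration.integrable_bound)
          show "integrable M (\<lambda>y. Q y / m)" using that by simp
          show "AE y in M. norm ((Q y / m) *\<^sub>R iexp (t * Y y)) \<le> norm (Q y / m)" by (auto intro!: AE_I2)
        qed (use that in measurable)
        have "char (D P) t - char (D N) t = integral\<^sup>L M (\<lambda>y. (P y / m) *\<^sub>R iexp (t * Y y)) - integral\<^sup>L M (\<lambda>y. (N y / m) *\<^sub>R iexp (t * Y y))"
          unfolding char_def by (subst (1 2) D_int) (auto simp: PN m_def mass)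
        also have "\<dots> = integral\<^sup>L M (\<lambda>y. (P y / m) *\<^sub>R iexp (t * Y y) - (N y / m) *\<^sub>R iexp (t * Y y))"
          by (intro Bochner_Integration.integral_diff[symmetric] i PN)
        also have "\<dots> = integral\<^sup>L M (\<lambda>y. (1 / complex_of_real m) * (complex_of_real (F y) * iexp (t * Y y)))"
          by (intro Bochner_Integration.integral_cong refl)
            (simp add: PN(5) scaleR_conv_of_real algebra_simps diff_divide_distrib)
        also have "\<dots> = 0" using char0[of t] by simp
        finally show "char (D P) t = char (D N) t" by simp
      qed
    qed
    have "integral\<^sup>L M (\<lambda>y. P y / m * indicator A (Y y)) = integral\<^sup>L M (\<lambda>y. N y / m * indicator A (Y y))"
    proof -
      have "measure (D P) A = integral\<^sup>L M (\<lambda>y. P y / m * indicator A (Y y))"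
        by (rule D_meas) (simp_all add: PN m_def)
      moreover have "measure (D N) A = integral\<^sup>L M (\<lambda>y. N y / m * indicator A (Y y))"
        by (rule D_meas) (simp_all add: PN m_def mass)
      ultimately show ?thesis using DPN by metis
    qed
    moreover have ind: "integrable M (\<lambda>y. Q y * indicator A (Y y))" if "integrable M Q" for Q :: "'m \<Rightarrow> real"
      by (rule Bochner_Integration.integrable_bound[OF that]) (use that in \<open>auto intro!: AE_I2 simp: indicator_def\<close>)
    ultimately have "integral\<^sup>L M (\<lambda>y. P y * indicator A (Y y)) = integral\<^sup>L M (\<lambda>y. N y * indicator A (Y y))"
      using m by simp
    then show ?thesis
      by (simp add: PN(5) left_diff_distrib ind PN)
  qed
qed

lemma integrable_std_normal_exp: "integrable std_normal (\<lambda>t. exp (c * t))"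
proof -
  have "std_normal_density t * exp (c * t) = exp (c\<^sup>2 / 2) * normal_density c 1 t" for t
  proof -
    have "- (t\<^sup>2) / 2 + c * t = c\<^sup>2 / 2 + (- ((t - c)\<^sup>2) / 2)"
      by (simp add: power2_eq_square algebra_simps add_divide_distrib diff_divide_distrib)
    then show ?thesis by (simp add: normal_density_def flip: exp_add)
  qed
  then have "integrable lborel (\<lambda>t. std_normal_density t * exp (c * t))"
    by (simp add: integrable_normal_density)
  then show ?thesis by (subst integrable_density) auto
qed

lemma integrable_std_normal_exp_abs: "integrable std_normal (\<lambda>t. exp (c * \<bar>t\<bar>))"
proof (rule Bochner_Integration.integrable_bound)
  show "integrable std_normal (\<lambda>t. exp (c * t) + exp ((- c) * t))"
    by (intro Bochner_Integration.integrable_add integrable_std_normal_exp)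
  have "exp (c * \<bar>t\<bar>) \<le> exp (c * t) + exp ((- c) * t)" for t
    by (cases "t \<ge> 0") auto
  then show "AE t in std_normal. norm (exp (c * \<bar>t\<bar>)) \<le> norm (exp (c * t) + exp ((- c) * t))"
    by (intro AE_I2) (simp add: abs_of_pos[OF add_pos_pos[OF exp_gt_zero exp_gt_zero]])
qed simp

text \<open>
  The Hermite polynomials in the first \<open>m\<close> coordinates can be replaced by indicators of Borel sets, one
  coordinate after the other: since all moments of the current coordinate vanish after the earlier
  replacements, \<open>moments_determine_conditional\<close> applies to it.  In the end the signed measure with density
  \<open>f\<close> vanishes on all cylinders, and these determine it.
\<close>

lemma hermite_orthogonal_imp_zero:
  fixes f :: "(nat \<Rightarrow> real) \<Rightarrow> real"
  assumes f: "f \<in> gauss_L2" and orth: "\<And>\<nu>. \<nu> \<in> multi_indices \<Longrightarrow> integral\<^sup>L gauss (\<lambda>y. hermite_multi \<nu> y * f y) = 0"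
  shows "AE y in gauss. f y = 0"
proof -
  interpret g: prob_space gauss by (rule prob_space_gauss)
  note [measurable] = gauss_L2_measurable[OF f]
  define I where "I m A y = (\<Prod>j<m. indicator (A j) (y j) :: real)" for m :: nat and A :: "nat \<Rightarrow> real set" and y :: "nat \<Rightarrow> real"
  have I_le: "\<bar>I m A y\<bar> \<le> 1" for m A y
    unfolding I_def abs_prod by (rule prod_le_1) (auto simp: indicator_def)
  have I_meas [measurable]: "I m A \<in> borel_measurable gauss" if "\<And>j. A j \<in> sets borel" for m A
    unfolding I_def[abs_def] using that by measurable
  \<comment> \<open>The coordinates below \<open>m\<close> carry indicators, the others Hermite polynomials.\<close>
  have cyl: "integral\<^sup>L gauss (\<lambda>y. f y * I m A y * hermite_multi \<nu> y) = 0"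
    if "\<And>j. A j \<in> sets borel" "\<nu> \<in> multi_indices" "\<And>j. j < m \<Longrightarrow> \<nu> j = 0" for m A \<nu>
    using that(2,3)
  proof (induction m arbitrary: \<nu>)
    case 0
    then show ?case using orth[of \<nu>] by (simp add: I_def mult.commute)
  next
    case (Suc m)
    note A[measurable] = that(1)
    define F where "F y = f y * I m A y * hermite_multi \<nu> y" for y
    have [measurable]: "F \<in> borel_measurable gauss" unfolding F_def[abs_def] by measurable
    have \<nu>m: "\<nu> m = 0" using Suc.prems(2) by simp
    have herm: "integral\<^sup>L gauss (\<lambda>y. F y * hermite n (y m)) = 0" for n
    proof -
      let ?\<mu> = "\<nu>(m := n)"
      have \<mu>: "?\<mu> \<in> multi_indices"
        using Suc.prems(1) by (auto simp: multi_indices_def intro: finite_subset[of _ "insert m {j. \<nu> j \<noteq> 0}"])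
      have "hermite_multi ?\<mu> y = hermite_multi \<nu> y * hermite n (y m)" for y
      proof -
        let ?J = "{j. \<nu> j \<noteq> 0}"
        have J: "finite ?J" "m \<notin> ?J" using Suc.prems(1) \<nu>m by (auto simp: multi_indices_def)
        have sub: "{j. ?\<mu> j \<noteq> 0} \<subseteq> insert m ?J" by auto
        have "hermite_multi ?\<mu> y = (\<Prod>j\<in>insert m ?J. hermite (?\<mu> j) (y j))"
          using J sub by (intro hermite_multi_eq) auto
        also have "\<dots> = hermite n (y m) * (\<Prod>j\<in>?J. hermite (?\<mu> j) (y j))"
          using J by (subst prod.insert) auto
        also have "(\<Prod>j\<in>?J. hermite (?\<mu> j) (y j)) = hermite_multi \<nu> y"
          unfolding hermite_multi_def using J(2) by (intro prod.cong) auto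
        finally show ?thesis by (simp only: mult.commute)
      qed
      note split = this
      have "integral\<^sup>L gauss (\<lambda>y. f y * I m A y * hermite_multi ?\<mu> y) = 0"
        by (rule Suc.IH[OF \<mu>]) (use Suc.prems(2) in auto)
      then show ?thesis by (simp only: F_def split mult.assoc)
    qed
    have F_int: "integrable gauss (\<lambda>y. \<bar>F y\<bar> * exp (c * \<bar>y m\<bar>))" for c
    proof (rule Bochner_Integration.integrable_bound)
      let ?J = "{j. \<nu> j \<noteq> 0}"
      have J: "finite ?J" "m \<notin> ?J" using Suc.prems(1) \<nu>m by (auto simp: multi_indices_def)
      let ?G = "\<lambda>j t. if j = m then exp (2 * c * \<bar>t\<bar>) else hermite (\<nu> j) t * hermite (\<nu> j) t"
      have "integrable std_normal (?G j)" for j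
        by (cases "j = m") (simp_all add: integrable_std_normal_exp_abs hermite_orthonormal(1))
      then have "integrable gauss (\<lambda>y. \<Prod>j\<in>insert m ?J. ?G j (y j))"
        using J(1) by (intro gauss_prod(1)) auto
      also have "(\<lambda>y. \<Prod>j\<in>insert m ?J. ?G j (y j)) = (\<lambda>y. (hermite_multi \<nu> y * exp (c * \<bar>y m\<bar>))\<^sup>2)"
      proof
        fix y :: "nat \<Rightarrow> real"
        have "(\<Prod>j\<in>insert m ?J. ?G j (y j)) = exp (2 * c * \<bar>y m\<bar>) * (\<Prod>j\<in>?J. ?G j (y j))"
          using J by (subst prod.insert) auto
        also have "(\<Prod>j\<in>?J. ?G j (y j)) = (\<Prod>j\<in>?J. hermite (\<nu> j) (y j) * hermite (\<nu> j) (y j))"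
          using J(2) by (intro prod.cong) auto
        also have "\<dots> = (hermite_multi \<nu> y)\<^sup>2" by (simp add: hermite_multi_def prod.distrib power2_eq_square)
        also have "exp (2 * c * \<bar>y m\<bar>) = (exp (c * \<bar>y m\<bar>))\<^sup>2" by (simp add: power2_eq_square flip: exp_add)
        finally show "(\<Prod>j\<in>insert m ?J. ?G j (y j)) = (hermite_multi \<nu> y * exp (c * \<bar>y m\<bar>))\<^sup>2"
          by (simp add: power_mult_distrib mult.commute)
      qed
      finally show "integrable gauss (\<lambda>y. (norm (f y))\<^sup>2 + (hermite_multi \<nu> y * exp (c * \<bar>y m\<bar>))\<^sup>2)"
        by (intro Bochner_Integration.integrable_add gauss_L2_integrable[OF f])
      have "\<bar>F y\<bar> * exp (c * \<bar>y m\<bar>) \<le> (norm (f y))\<^sup>2 + (hermite_multi \<nu> y * exp (c * \<bar>y m\<bar>))\<^sup>2" for y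
      proof -
        have "\<bar>F y\<bar> * exp (c * \<bar>y m\<bar>) = \<bar>I m A y\<bar> * (\<bar>f y\<bar> * \<bar>hermite_multi \<nu> y * exp (c * \<bar>y m\<bar>)\<bar>)"
          by (simp add: F_def abs_mult)
        also have "\<dots> \<le> 1 * (\<bar>f y\<bar> * \<bar>hermite_multi \<nu> y * exp (c * \<bar>y m\<bar>)\<bar>)"
          by (intro mult_right_mono I_le) auto
        also have "\<dots> \<le> (norm (f y))\<^sup>2 + (hermite_multi \<nu> y * exp (c * \<bar>y m\<bar>))\<^sup>2"
          using two_mult_le_power2[of "\<bar>f y\<bar>" "\<bar>hermite_multi \<nu> y * exp (c * \<bar>y m\<bar>)\<bar>"] by simp
        finally show ?thesis .
      qed
      then show "AE y in gauss. norm (\<bar>F y\<bar> * exp (c * \<bar>y m\<bar>)) \<le> norm ((norm (f y))\<^sup>2 + (hermite_multi \<nu> y * exp (c * \<bar>y m\<bar>))\<^sup>2)"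
        by (auto intro!: AE_I2)
    qed measurable
    have mono_herm: "integrable gauss (\<lambda>y. F y * (y m ^ k * poly (monic_hermite n) (y m)))" for k n
    proof -
      have "F y * (y m ^ k * poly (monic_hermite n) (y m))
          = (\<Sum>i\<le>degree (monic_hermite n). coeff (monic_hermite n) i * (F y * y m ^ (k + i)))" for y
        by (simp add: poly_altdef sum_distrib_left power_add mult.assoc mult.left_commute)
      then show ?thesis
        by (simp only:) (intro Bochner_Integration.integrable_sum integrable_mult_right
          integrable_mult_power_of_exp; use F_int[of 1] in simp)
    qed
    \<comment> \<open>The recurrence for \<open>x * monic_hermite n\<close> reduces powers of \<open>x\<close> to Hermite polynomials.\<close>
    have mom: "integral\<^sup>L gauss (\<lambda>y. F y * (y m ^ k * poly (monic_hermite n) (y m))) = 0" for k n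
    proof (induction k arbitrary: n)
      case 0
      have "F y * (y m ^ 0 * poly (monic_hermite n) (y m)) = sqrt (fact n) * (F y * hermite n (y m))" for y
        by (simp add: hermite_def)
      then show ?case by (simp only: integral_mult_right_zero herm mult_zero_right)
    next
      case (Suc k)
      have rec: "poly (monic_hermite (Suc n)) x = x * poly (monic_hermite n) x - real n * poly (monic_hermite (n - 1)) x" for x
        by (cases n) auto
      have "F y * (y m ^ Suc k * poly (monic_hermite n) (y m)) = F y * (y m ^ k * poly (monic_hermite (Suc n)) (y m))
          + real n * (F y * (y m ^ k * poly (monic_hermite (n - 1)) (y m)))" for y
        unfolding rec by (simp add: algebra_simps)
      then show ?case by (simp only: Bochner_Integration.integral_add[OF mono_herm integrable_mult_right[OF mono_herm]]) (simp add: Suc.IH)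
    qed
    have "integral\<^sup>L gauss (\<lambda>y. F y * indicator (A m) (y m)) = 0"
      by (rule moments_determine_conditional[OF _ F_int]) (use mom[of _ 0] in auto)
    moreover have "F y * indicator (A m) (y m) = f y * I (Suc m) A y * hermite_multi \<nu> y" for y
      by (simp add: F_def I_def)
    ultimately show ?case by simp
  qed
  have fint: "integrable gauss f"
    using hermite_multi_integrable[OF _ f, of "\<lambda>_. 0"] by (simp add: multi_indices_def hermite_multi_def)
  define P where "P y = max 0 (f y)" for y
  define N where "N y = max 0 (- f y)" for y
  have [measurable]: "P \<in> borel_measurable gauss" "N \<in> borel_measurable gauss"
    by (simp_all add: P_def[abs_def] N_def[abs_def])
  have PN: "integrable gauss P" "integrable gauss N" "\<And>y. 0 \<le> P y" "\<And>y. 0 \<le> N y" "\<And>y. f y = P y - N y"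
    unfolding P_def N_def using fint by (auto intro: integrable_max)
  have "density gauss P = density gauss N"
  proof (rule measure_eqI_PiM_infinite)
    show "sets (density gauss P) = sets (PiM UNIV (\<lambda>_. std_normal))" "sets (density gauss N) = sets (PiM UNIV (\<lambda>_. std_normal))"
      by (simp_all add: gauss_def)
    show "finite_measure (density gauss P)"
    proof (rule finite_measureI)
      have "emeasure (density gauss P) (space (density gauss P)) = (\<integral>\<^sup>+y. ennreal (P y) \<partial>gauss)"
        by (subst emeasure_density) (auto simp: space_gauss[symmetric] simp del: space_gauss intro!: nn_integral_cong)
      also have "\<dots> = ennreal (integral\<^sup>L gauss P)"
        using PN by (intro nn_integral_eq_integral) auto
      finally show "emeasure (density gauss P) (space (density gauss P)) \<noteq> \<infinity>" by simp
    qed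
    fix A :: "nat \<Rightarrow> real set" and J :: "nat set"
    assume J: "finite J" and A: "\<And>i. i \<in> J \<Longrightarrow> A i \<in> sets std_normal"
    define A' where "A' j = (if j \<in> J then A j else UNIV)" for j
    have A'[measurable]: "A' j \<in> sets borel" for j using A by (simp add: A'_def)
    obtain m where m: "J \<subseteq> {..<m}" using finite_nat_iff_bounded J by blast
    let ?X = "prod_emb UNIV (\<lambda>_. std_normal) J (Pi\<^sub>E J A)"
    have X: "y \<in> ?X \<longleftrightarrow> (\<forall>j<m. y j \<in> A' j)" for y
      using m by (auto simp: prod_emb_def A'_def space_PiM PiE_UNIV_domain PiE_iff split: if_splits)
    have ind: "indicator ?X y = I m A' y" for y
    proof (cases "y \<in> ?X")
      case True
      then show ?thesis using X[of y] by (auto simp: I_def indicator_def intro!: prod.neutral[symmetric])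
    next
      case False
      then obtain j where "j < m" "y j \<notin> A' j" using X[of y] by auto
      then show ?thesis using False by (auto simp: I_def indicator_def intro!: prod_zero[symmetric])
    qed
    have Xm[measurable]: "?X \<in> sets gauss"
    proof -
      have "{y \<in> space gauss. \<forall>j\<in>{..<m}. y j \<in> A' j} \<in> sets gauss" by measurable
      also have "{y \<in> space gauss. \<forall>j\<in>{..<m}. y j \<in> A' j} = ?X" using X by auto
      finally show ?thesis .
    qed
    have em: "emeasure (density gauss Q) ?X = ennreal (integral\<^sup>L gauss (\<lambda>y. Q y * I m A' y))"
      if [measurable]: "Q \<in> borel_measurable gauss" and Q: "integrable gauss Q" "\<And>y. 0 \<le> Q y" for Q :: "(nat \<Rightarrow> real) \<Rightarrow> real"
    proof -
      have "emeasure (density gauss Q) ?X = (\<integral>\<^sup>+y. ennreal (Q y) * indicator ?X y \<partial>gauss)"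
        by (rule emeasure_density) auto
      also have "\<dots> = (\<integral>\<^sup>+y. ennreal (Q y * I m A' y) \<partial>gauss)"
        unfolding ind[symmetric] by (intro nn_integral_cong) (auto simp: indicator_def)
      also have "\<dots> = ennreal (integral\<^sup>L gauss (\<lambda>y. Q y * I m A' y))"
      proof (rule nn_integral_eq_integral)
        show "integrable gauss (\<lambda>y. Q y * I m A' y)"
          unfolding ind[symmetric] by (intro integrable_real_mult_indicator Q Xm)
        show "AE y in gauss. 0 \<le> Q y * I m A' y"
          unfolding ind[symmetric] using Q(2) by (auto intro!: AE_I2)
      qed
      finally show ?thesis .
    qed
    have "integral\<^sup>L gauss (\<lambda>y. P y * I m A' y) - integral\<^sup>L gauss (\<lambda>y. N y * I m A' y) = integral\<^sup>L gauss (\<lambda>y. f y * I m A' y)"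
      unfolding PN(5) left_diff_distrib ind[symmetric]
      by (intro Bochner_Integration.integral_diff[symmetric] integrable_real_mult_indicator PN Xm)
    also have "\<dots> = 0" using cyl[of A' "\<lambda>_. 0" m] by (simp add: multi_indices_def hermite_multi_def A')
    finally show "emeasure (density gauss P) ?X = emeasure (density gauss N) ?X"
      using em[of P] em[of N] PN by simp
  qed
  then have "AE y in gauss. ennreal (P y) = ennreal (N y)"
    by (intro g.density_unique) auto
  then show ?thesis by eventually_elim (simp add: PN)
qed

text \<open>
  The scalar case applies to \<open>inner (g y) v\<close> for all \<open>v\<close> in a countable dense set at once.
\<close>

lemma hermite_coeff_zero_imp_zero:
  fixes g :: "(nat \<Rightarrow> real) \<Rightarrow> 'h::{real_inner, banach, second_countable_topology}"
  assumes g: "g \<in> gauss_L2" and zero: "\<And>\<nu>. \<nu> \<in> multi_indices \<Longrightarrow> hermite_coeff g \<nu> = 0"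
  shows "AE y in gauss. g y = 0"
proof -
  obtain T :: "'h set" where T: "countable T" "\<And>X. open X \<Longrightarrow> X \<noteq> {} \<Longrightarrow> \<exists>d\<in>T. d \<in> X"
    using countable_dense_exists by metis
  have "AE y in gauss. inner (g y) v = 0" for v
  proof (rule hermite_orthogonal_imp_zero)
    note [measurable] = gauss_L2_measurable[OF g]
    have "integrable gauss (\<lambda>y. (inner (g y) v)\<^sup>2)"
    proof (rule Bochner_Integration.integrable_bound)
      show "integrable gauss (\<lambda>y. (norm v)\<^sup>2 * (norm (g y))\<^sup>2)"
        by (intro integrable_mult_right gauss_L2_integrable[OF g])
      have "(inner (g y) v)\<^sup>2 \<le> (norm v)\<^sup>2 * (norm (g y))\<^sup>2" for y
        using power_mono[OF Cauchy_Schwarz_ineq2[of "g y" v], of 2] by (simp add: power_mult_distrib mult.commute)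
      then show "AE y in gauss. norm ((inner (g y) v)\<^sup>2) \<le> norm ((norm v)\<^sup>2 * (norm (g y))\<^sup>2)"
        by (auto intro!: AE_I2)
    qed measurable
    then show "(\<lambda>y. inner (g y) v) \<in> gauss_L2" by (simp add: gauss_L2_def)
    show "integral\<^sup>L gauss (\<lambda>y. hermite_multi \<nu> y * inner (g y) v) = 0" if "\<nu> \<in> multi_indices" for \<nu>
      using inner_hermite_coeff[OF that g, of v] zero[OF that] by simp
  qed
  then have "AE y in gauss. \<forall>v\<in>T. inner (g y) v = 0"
    using T(1) by (simp add: AE_ball_countable)
  then show ?thesis
  proof eventually_elim
    case (elim y)
    have "closed {v. inner (g y) v = 0}" by (intro closed_Collect_eq continuous_intros)
    then have "open (- {v. inner (g y) v = 0})" by (rule open_Compl)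
    then have "- {v. inner (g y) v = 0} = {}"
      using T(2)[of "- {v. inner (g y) v = 0}"] elim by blast
    then have "inner (g y) (g y) = 0" by blast
    then show ?case by simp
  qed
qed

lemma countable_multi_indices: "countable multi_indices"
proof -
  define \<phi> where "\<phi> l = (\<lambda>j. if j < length l then l ! j else 0)" for l :: "nat list"
  have "multi_indices \<subseteq> range \<phi>"
  proof
    fix \<nu> :: "nat \<Rightarrow> nat" assume "\<nu> \<in> multi_indices"
    then obtain n where n: "{j. \<nu> j \<noteq> 0} \<subseteq> {..<n}"
      using finite_nat_iff_bounded by (auto simp: multi_indices_def)
    have "\<nu> = \<phi> (map \<nu> [0..<n])"
      using n by (auto simp: \<phi>_def fun_eq_iff subset_iff)
    then show "\<nu> \<in> range \<phi>" by blast
  qed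
  then show ?thesis by (rule countable_subset) simp
qed

text \<open>
  One half of Parseval's identity.  The partial sums \<open>S n\<close> over an exhaustion of the multi-indices are
  Cauchy in mean square by Bessel's inequality, and a subsequence converges almost everywhere to a
  function \<open>h\<close>.  It has the same coefficients as \<open>g\<close>, so that \<open>h = g\<close> by completeness, and Fatou's lemma
  carries the estimate from \<open>S n\<close> to \<open>g\<close>.
\<close>

lemma hermite_tail_le:
  fixes g :: "(nat \<Rightarrow> real) \<Rightarrow> 'h::{real_inner, banach, second_countable_topology}"
  assumes g: "g \<in> gauss_L2" and \<Lambda>: "finite \<Lambda>" "\<Lambda> \<subseteq> multi_indices"
    and tail: "\<And>T. finite T \<Longrightarrow> T \<subseteq> multi_indices - \<Lambda> \<Longrightarrow> (\<Sum>\<nu>\<in>T. (norm (hermite_coeff g \<nu>))\<^sup>2) \<le> B"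
  shows "integral\<^sup>L gauss (\<lambda>y. (norm (g y - hermite_sum \<Lambda> g y))\<^sup>2) \<le> B"
proof -
  interpret prob_space gauss by (rule prob_space_gauss)
  note [measurable] = gauss_L2_measurable[OF g]
  have B: "0 \<le> B" using tail[of "{}"] by simp
  let ?a = "\<lambda>\<nu>. (norm (hermite_coeff g \<nu>))\<^sup>2"
  have "\<exists>E :: nat \<Rightarrow> (nat \<Rightarrow> nat) set. (\<forall>n. finite (E n) \<and> E n \<subseteq> multi_indices \<and> \<Lambda> \<subseteq> E n) \<and> incseq E \<and> (\<Union>n. E n) = multi_indices"
  proof -
    have "countable multi_indices" by (rule countable_multi_indices)
    define E where "E n = \<Lambda> \<union> (\<lambda>i. from_nat_into multi_indices i) ` {..<n}" for n
    have ne: "multi_indices \<noteq> {}" by (auto simp: multi_indices_def intro!: exI[of _ "\<lambda>_. 0"])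
    have "finite (E n) \<and> E n \<subseteq> multi_indices \<and> \<Lambda> \<subseteq> E n" for n
      using \<Lambda> from_nat_into[OF ne] by (auto simp: E_def)
    moreover have "incseq E" by (auto simp: E_def incseq_def)
    moreover have "(\<Union>n. E n) = multi_indices"
    proof (intro equalityI subsetI)
      fix \<nu> assume "\<nu> \<in> multi_indices"
      then obtain i where "from_nat_into multi_indices i = \<nu>"
        using from_nat_into_surj[OF \<open>countable multi_indices\<close>] by blast
      then have "\<nu> \<in> E (Suc i)" by (auto simp: E_def)
      then show "\<nu> \<in> (\<Union>n. E n)" by blast
    qed (use calculation in blast)
    ultimately show ?thesis by blast
  qed
  then obtain E :: "nat \<Rightarrow> (nat \<Rightarrow> nat) set" where E: "\<And>n. finite (E n)" "\<And>n. E n \<subseteq> multi_indices" "\<And>n. \<Lambda> \<subseteq> E n" "incseq E" "(\<Union>n. E n) = multi_indices"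
    by auto
  define S where "S n = hermite_poly (E n) (hermite_coeff g)" for n
  have S: "S n \<in> gauss_L2" for n unfolding S_def by (rule hermite_poly_gauss_L2[OF E(2)])
  note [measurable] = gauss_L2_measurable[OF S]
  have diff: "S n y - S m y = hermite_poly (E n - E m) (hermite_coeff g) y" if "m \<le> n" for m n y
  proof -
    have "E m \<subseteq> E n" using E(4) that by (auto simp: incseq_def)
    then show ?thesis unfolding S_def hermite_poly_def using E(1) by (simp add: sum_diff)
  qed
  have norm_poly: "integral\<^sup>L gauss (\<lambda>y. (norm (hermite_poly T (hermite_coeff g) y))\<^sup>2) = (\<Sum>\<nu>\<in>T. ?a \<nu>)"
    if "finite T" "T \<subseteq> multi_indices" for T
    using norm_diff_hermite_poly[OF that gauss_L2_zero, of "hermite_coeff g"] by (simp add: hermite_coeff_def)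
  define s where "s n = (\<Sum>\<nu>\<in>E n. ?a \<nu>)" for n
  have s_diff: "(\<Sum>\<nu>\<in>E n - E m. ?a \<nu>) = s n - s m" if "m \<le> n" for m n
  proof -
    have "E m \<subseteq> E n" using E(4) that by (auto simp: incseq_def)
    then show ?thesis using E(1) by (simp add: s_def sum_diff)
  qed
  have s_mono: "s m \<le> s n" if "m \<le> n" for m n
    using s_diff[OF that] sum_nonneg[of "E n - E m" ?a] by simp
  have "s n \<le> integral\<^sup>L gauss (\<lambda>y. (norm (g y))\<^sup>2)" for n
    unfolding s_def by (rule hermite_Bessel[OF E(1,2) g])
  then have "Bseq s"
    by (intro BseqI'[of s "integral\<^sup>L gauss (\<lambda>y. (norm (g y))\<^sup>2)"]) (simp add: s_def sum_nonneg abs_of_nonneg)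
  then have "convergent s"
    by (rule Bseq_monoseq_convergent) (simp add: monoseq_def s_mono)
  then have "Cauchy s" by (rule convergent_Cauchy)
  have L2_diff: "integral\<^sup>L gauss (\<lambda>y. (norm (S n y - S m y))\<^sup>2) = \<bar>s n - s m\<bar>" for m n
  proof -
    have *: "integral\<^sup>L gauss (\<lambda>y. (norm (S n y - S m y))\<^sup>2) = s n - s m" if "m \<le> n" for m n
      unfolding diff[OF that] using E(1,2) by (subst norm_poly) (auto simp: s_diff[OF that])
    show ?thesis
    proof (cases "m \<le> n")
      case True
      then show ?thesis using *[OF True] s_mono[OF True] by simp
    next
      case False
      then show ?thesis using *[of n m] s_mono[of n m] by (simp add: norm_minus_commute)
    qed
  qed
  have L1_L2: "integral\<^sup>L gauss (\<lambda>y. norm (h y)) \<le> sqrt (integral\<^sup>L gauss (\<lambda>y. (norm (h y))\<^sup>2))"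
    "integrable gauss h"
    if h: "h \<in> gauss_L2" for h :: "(nat \<Rightarrow> real) \<Rightarrow> 'h"
  proof -
    note [measurable] = gauss_L2_measurable[OF h]
    show int: "integrable gauss h"
      using hermite_multi_integrable[OF _ h, of "\<lambda>_. 0"] by (simp add: multi_indices_def hermite_multi_def)
    let ?r = "integral\<^sup>L gauss (\<lambda>y. norm (h y))"
    have "0 \<le> integral\<^sup>L gauss (\<lambda>y. (norm (h y) - ?r)\<^sup>2)" by simp
    also have "\<dots> = integral\<^sup>L gauss (\<lambda>y. (norm (h y))\<^sup>2 - 2 * ?r * norm (h y) + ?r\<^sup>2)"
      by (simp add: power2_diff algebra_simps)
    also have "\<dots> = integral\<^sup>L gauss (\<lambda>y. (norm (h y))\<^sup>2) - ?r\<^sup>2"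
      using gauss_L2_integrable[OF h] int prob_space by (simp add: power2_eq_square)
    finally have "?r\<^sup>2 \<le> integral\<^sup>L gauss (\<lambda>y. (norm (h y))\<^sup>2)" by simp
    then show "?r \<le> sqrt (integral\<^sup>L gauss (\<lambda>y. (norm (h y))\<^sup>2))"
      by (rule real_le_rsqrt)
  qed
  \<comment> \<open>Convergence in mean square implies convergence in mean, as \<open>gauss\<close> is a probability measure.\<close>
  obtain r where r: "strict_mono r" "AE y in gauss. Cauchy (\<lambda>i. S (r i) y)"
  proof (rule cauchy_L1_AE_cauchy_subseq[of gauss S])
    show "integrable gauss (S n)" for n by (rule L1_L2(2)[OF S])
    fix e :: real assume e: "e > 0"
    then obtain N where N: "\<And>m n. m \<ge> N \<Longrightarrow> n \<ge> N \<Longrightarrow> \<bar>s m - s n\<bar> < e\<^sup>2"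
      using \<open>Cauchy s\<close> by (auto simp: Cauchy_def dist_real_def dest!: spec[of _ "e\<^sup>2"])
    have "integral\<^sup>L gauss (\<lambda>y. norm (S i y - S j y)) < e" if "i \<ge> N" "j \<ge> N" for i j
    proof -
      have "integral\<^sup>L gauss (\<lambda>y. norm (S i y - S j y)) \<le> sqrt \<bar>s i - s j\<bar>"
        using L1_L2(1)[OF gauss_L2_diff[OF S[of i] S[of j]]] by (simp add: L2_diff)
      also have "\<dots> < sqrt (e\<^sup>2)" using N[OF that] by (simp only: real_sqrt_less_iff)
      finally show ?thesis using e by simp
    qed
    then show "\<exists>N. \<forall>i\<ge>N. \<forall>j\<ge>N. integral\<^sup>L gauss (\<lambda>y. norm (S i y - S j y)) < e" by blast
  qed blast
  define h where "h y = lim (\<lambda>i. S (r i) y)" for y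
  have h_meas [measurable]: "h \<in> borel_measurable gauss"
    unfolding h_def[abs_def] by measurable
  have conv: "AE y in gauss. (\<lambda>i. S (r i) y) \<longlonglongrightarrow> h y"
    using r(2) by eventually_elim (simp add: h_def Cauchy_convergent_iff convergent_LIMSEQ_iff)
  have fatou: "(\<integral>\<^sup>+y. ennreal ((norm (h y - P y))\<^sup>2) \<partial>gauss) \<le> ennreal C"
    if P: "P \<in> gauss_L2" and C: "\<And>i. i \<ge> i0 \<Longrightarrow> integral\<^sup>L gauss (\<lambda>y. (norm (S (r i) y - P y))\<^sup>2) \<le> C" for P C i0
  proof -
    note [measurable] = gauss_L2_measurable[OF P]
    have "(\<integral>\<^sup>+y. ennreal ((norm (h y - P y))\<^sup>2) \<partial>gauss)
        = (\<integral>\<^sup>+y. liminf (\<lambda>i. ennreal ((norm (S (r i) y - P y))\<^sup>2)) \<partial>gauss)"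
    proof (rule nn_integral_cong_AE, use conv in eventually_elim)
      case (elim y)
      have "(\<lambda>i. ennreal ((norm (S (r i) y - P y))\<^sup>2)) \<longlonglongrightarrow> ennreal ((norm (h y - P y))\<^sup>2)"
        by (intro tendsto_ennrealI tendsto_intros elim)
      then show ?case by (intro lim_imp_Liminf[symmetric]) simp_all
    qed
    also have "\<dots> \<le> liminf (\<lambda>i. \<integral>\<^sup>+y. ennreal ((norm (S (r i) y - P y))\<^sup>2) \<partial>gauss)"
      by (rule nn_integral_liminf) simp
    also have "\<dots> \<le> ennreal C"
    proof (rule Liminf_le)
      show "\<forall>\<^sub>F i in sequentially. (\<integral>\<^sup>+y. ennreal ((norm (S (r i) y - P y))\<^sup>2) \<partial>gauss) \<le> ennreal C"
        using eventually_ge_at_top[of i0]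
      proof eventually_elim
        case (elim i)
        have "(\<integral>\<^sup>+y. ennreal ((norm (S (r i) y - P y))\<^sup>2) \<partial>gauss) = ennreal (integral\<^sup>L gauss (\<lambda>y. (norm (S (r i) y - P y))\<^sup>2))"
          by (rule nn_integral_eq_integral) (use gauss_L2_integrable[OF gauss_L2_diff[OF S P]] in auto)
        then show ?case using C[OF elim] by (simp add: ennreal_leI)
      qed
    qed simp
    finally show ?thesis .
  qed
  have sm: "strict_mono r" by (rule r(1))
  have h_coeff: "hermite_coeff h \<nu> = hermite_coeff g \<nu>" and h: "h \<in> gauss_L2" if \<nu>: "\<nu> \<in> multi_indices" for \<nu>
  proof -
    have close: "(\<lambda>y. h y - S (r i) y) \<in> gauss_L2 \<and> integral\<^sup>L gauss (\<lambda>y. (norm (h y - S (r i) y))\<^sup>2) \<le> e"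
      if "e > 0" and i: "\<And>k. k \<ge> i \<Longrightarrow> \<bar>s (r k) - s (r i)\<bar> \<le> e" for e i
    proof -
      have nn: "(\<integral>\<^sup>+y. ennreal ((norm (h y - S (r i) y))\<^sup>2) \<partial>gauss) \<le> ennreal e"
        by (rule fatou[OF S, of i]) (simp add: L2_diff i)
      have int: "integrable gauss (\<lambda>y. (norm (h y - S (r i) y))\<^sup>2)"
        by (rule integrableI_bounded) (use nn in \<open>auto intro: le_less_trans\<close>)
      moreover have "integral\<^sup>L gauss (\<lambda>y. (norm (h y - S (r i) y))\<^sup>2) \<le> e"
        using nn nn_integral_eq_integral[OF int] that(1) by (simp add: ennreal_le_iff)
      ultimately show ?thesis by (simp add: gauss_L2_def)
    qed
    have ev: "\<exists>i0. \<forall>i\<ge>i0. (\<lambda>y. h y - S (r i) y) \<in> gauss_L2 \<and> integral\<^sup>L gauss (\<lambda>y. (norm (h y - S (r i) y))\<^sup>2) \<le> e" if e: "e > 0" for e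
    proof -
      have "\<exists>N. \<forall>m\<ge>N. \<forall>n\<ge>N. \<bar>s m - s n\<bar> < e"
        using \<open>Cauchy s\<close> e by (simp add: Cauchy_def dist_real_def)
      then obtain N where N: "\<And>m n. m \<ge> N \<Longrightarrow> n \<ge> N \<Longrightarrow> \<bar>s m - s n\<bar> < e" by blast
      have rN: "r i \<ge> N" if "i \<ge> N" for i using seq_suble[OF sm, of i] that by simp
      have lt: "\<bar>s (r k) - s (r i)\<bar> < e" if "i \<ge> N" "k \<ge> i" for i k
        by (rule N) (use that rN in auto)
      have bd: "\<bar>s (r k) - s (r i)\<bar> \<le> e" if "i \<ge> N" "k \<ge> i" for i k
        by (rule less_imp_le[OF lt[OF that]])
      show ?thesis
      proof (intro exI[of _ N] allI impI)
        fix i assume "i \<ge> N"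
        then show "(\<lambda>y. h y - S (r i) y) \<in> gauss_L2 \<and> integral\<^sup>L gauss (\<lambda>y. (norm (h y - S (r i) y))\<^sup>2) \<le> e"
          by (intro close[OF e] bd)
      qed
    qed
    obtain i1 where "(\<lambda>y. h y - S (r i1) y) \<in> gauss_L2" using ev[of 1] by auto
    from gauss_L2_add[OF this S[of "r i1"]] show h: "h \<in> gauss_L2" by simp
    have "(norm (hermite_coeff h \<nu> - hermite_coeff g \<nu>))\<^sup>2 \<le> e" if e: "e > 0" for e
    proof -
      obtain i0 where i0: "\<And>i. i \<ge> i0 \<Longrightarrow> integral\<^sup>L gauss (\<lambda>y. (norm (h y - S (r i) y))\<^sup>2) \<le> e" using ev[OF e] by auto
      obtain n where n: "\<nu> \<in> E n" using \<nu> E(5) by auto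
      define i where "i = max i0 n"
      have "n \<le> r i" using seq_suble[OF sm, of i] by (simp add: i_def)
      then have "\<nu> \<in> E (r i)" using n E(4) by (auto simp: incseq_def)
      then have c: "hermite_coeff (S (r i)) \<nu> = hermite_coeff g \<nu>"
        unfolding S_def using \<nu> by (simp add: hermite_coeff_hermite_poly[OF E(1,2)])
      have "hermite_coeff (\<lambda>y. h y - S (r i) y) \<nu> = hermite_coeff h \<nu> - hermite_coeff (S (r i)) \<nu>"
        unfolding hermite_coeff_def scaleR_diff_right
        by (intro Bochner_Integration.integral_diff hermite_multi_integrable \<nu> h S)
      then have "(norm (hermite_coeff h \<nu> - hermite_coeff g \<nu>))\<^sup>2 = (\<Sum>\<nu>\<in>{\<nu>}. (norm (hermite_coeff (\<lambda>y. h y - S (r i) y) \<nu>))\<^sup>2)"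
        by (simp add: c)
      also have "\<dots> \<le> integral\<^sup>L gauss (\<lambda>y. (norm (h y - S (r i) y))\<^sup>2)"
        by (rule hermite_Bessel) (use \<nu> gauss_L2_diff[OF h S] in auto)
      also have "\<dots> \<le> e" by (rule i0) (simp add: i_def)
      finally show ?thesis .
    qed
    then have "(norm (hermite_coeff h \<nu> - hermite_coeff g \<nu>))\<^sup>2 \<le> 0" by (rule field_le_epsilon) simp
    then show "hermite_coeff h \<nu> = hermite_coeff g \<nu>" by simp
  qed
  have h: "h \<in> gauss_L2" by (rule h[of "\<lambda>_. 0"]) (simp add: multi_indices_def)
  have "AE y in gauss. h y - g y = 0"
  proof (rule hermite_coeff_zero_imp_zero[OF gauss_L2_diff[OF h g]])
    fix \<nu> assume \<nu>: "\<nu> \<in> multi_indices"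
    have "hermite_coeff (\<lambda>y. h y - g y) \<nu> = hermite_coeff h \<nu> - hermite_coeff g \<nu>"
      unfolding hermite_coeff_def scaleR_diff_right
      by (intro Bochner_Integration.integral_diff hermite_multi_integrable \<nu> h g)
    then show "hermite_coeff (\<lambda>y. h y - g y) \<nu> = 0" using h_coeff[OF \<nu>] by simp
  qed
  then have hg: "AE y in gauss. h y = g y" by eventually_elim simp
  let ?P = "hermite_poly \<Lambda> (hermite_coeff g)"
  have P: "?P \<in> gauss_L2" by (rule hermite_poly_gauss_L2[OF \<Lambda>(2)])
  have "(\<integral>\<^sup>+y. ennreal ((norm (h y - ?P y))\<^sup>2) \<partial>gauss) \<le> ennreal B"
  proof (rule fatou[OF P, of 0])
    fix i
    have "S (r i) y - ?P y = hermite_poly (E (r i) - \<Lambda>) (hermite_coeff g) y" for y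
      unfolding S_def hermite_poly_def using E(1,3) by (simp add: sum_diff)
    then have "integral\<^sup>L gauss (\<lambda>y. (norm (S (r i) y - ?P y))\<^sup>2) = (\<Sum>\<nu>\<in>E (r i) - \<Lambda>. ?a \<nu>)"
      using E(1,2) by (simp only:) (subst norm_poly, auto)
    also have "\<dots> \<le> B" by (rule tail) (use E(1,2) in auto)
    finally show "integral\<^sup>L gauss (\<lambda>y. (norm (S (r i) y - ?P y))\<^sup>2) \<le> B" .
  qed
  also have "(\<integral>\<^sup>+y. ennreal ((norm (h y - ?P y))\<^sup>2) \<partial>gauss) = (\<integral>\<^sup>+y. ennreal ((norm (g y - ?P y))\<^sup>2) \<partial>gauss)"
    by (rule nn_integral_cong_AE) (use hg in eventually_elim, simp)
  also have "\<dots> = ennreal (integral\<^sup>L gauss (\<lambda>y. (norm (g y - ?P y))\<^sup>2))"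
    by (rule nn_integral_eq_integral) (use gauss_L2_integrable[OF gauss_L2_diff[OF g P]] in auto)
  finally have "integral\<^sup>L gauss (\<lambda>y. (norm (g y - ?P y))\<^sup>2) \<le> B"
    using B by (simp add: ennreal_le_iff)
  then show ?thesis by (simp add: hermite_poly_def hermite_sum_def)
qed

section \<open>Exponential moments of a weighted supremum\<close>

lemma summable_powr_bounded:
  fixes \<rho> :: "nat \<Rightarrow> real"
  assumes \<rho>: "\<And>j. \<rho> j > 0" and q: "q > 0" and sum: "summable (\<lambda>j. (1 / \<rho> j) powr q)"
  obtains R where "R \<ge> 1" "\<And>j. 1 / \<rho> j \<le> R"
proof -
  define S where "S = (\<Sum>j. (1 / \<rho> j) powr q)"
  have le: "1 / \<rho> j \<le> S powr (1 / q)" for j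
  proof -
    have "(1 / \<rho> j) powr q \<le> S"
      using sum_le_suminf[OF sum, of "{j}"] by (simp add: S_def)
    then have "((1 / \<rho> j) powr q) powr (1 / q) \<le> S powr (1 / q)"
      using q by (intro powr_mono2) auto
    then show ?thesis using q \<rho>[of j] by (simp add: powr_powr)
  qed
  have "1 / \<rho> j \<le> max 1 (S powr (1 / q))" for j using le[of j] by simp
  then show ?thesis by (intro that[of "max 1 (S powr (1 / q))"]) auto
qed

text \<open>
  With \<open>a\<^sub>j = \<bar>y\<^sub>j\<bar> / \<rho>\<^sub>j\<close> one has \<open>exp (c a\<^sub>j) \<le> exp c\<close> if \<open>a\<^sub>j \<le> 1\<close> and \<open>exp (c a\<^sub>j) \<le> a\<^sub>j\<^sup>m exp (c a\<^sub>j)\<close> otherwise.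
  Thus \<open>exp c + \<Sum>\<^sub>j a\<^sub>j\<^sup>m exp (c a\<^sub>j)\<close> dominates \<open>exp (c sup\<^sub>j a\<^sub>j)\<close>, and its integral is finite as soon as
  \<open>\<Sum>\<^sub>j (1/\<rho>\<^sub>j)\<^sup>m\<close> is, for which \<open>m \<ge> q\<close> suffices.
\<close>

lemma gauss_exp_weighted_sup:
  fixes \<rho> :: "nat \<Rightarrow> real"
  assumes \<rho>: "\<And>j. \<rho> j > 0" and q: "q > 0" and sum: "summable (\<lambda>j. (1 / \<rho> j) powr q)" and c: "c > 0"
  obtains \<Psi> where "integrable gauss \<Psi>"
    "AE y in gauss. \<exists>B\<ge>0. (\<forall>j. \<bar>y j\<bar> \<le> B * \<rho> j) \<and> exp (c * B) \<le> \<Psi> y"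
proof -
  interpret prob_space gauss by (rule prob_space_gauss)
  obtain R where R: "R \<ge> 1" "\<And>j. 1 / \<rho> j \<le> R" using summable_powr_bounded[OF \<rho> q sum] by blast
  define m where "m = nat \<lceil>q\<rceil>"
  have m: "real m \<ge> q" unfolding m_def by (rule real_nat_ceiling_ge)
  have pow_le: "(1 / \<rho> j) ^ m \<le> R powr (real m - q) * (1 / \<rho> j) powr q" for j
  proof -
    have "(1 / \<rho> j) ^ m = (1 / \<rho> j) powr (real m - q) * (1 / \<rho> j) powr q"
      using \<rho>[of j] by (simp add: powr_add[symmetric] powr_realpow)
    also have "(1 / \<rho> j) powr (real m - q) \<le> R powr (real m - q)"
      using m R(2) \<rho>[of j] by (intro powr_mono2) (auto intro: less_imp_le)
    finally show ?thesis by (simp add: mult_right_mono)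
  qed
  have summ: "summable (\<lambda>j. (1 / \<rho> j) ^ m)"
    by (rule summable_comparison_test'[OF summable_mult[OF sum, of "R powr (real m - q)"]])
      (use pow_le \<rho> in \<open>auto simp: abs_of_pos\<close>)
  define h where "h t = \<bar>t\<bar> ^ m * exp (c * R * \<bar>t\<bar>)" for t :: real
  have h_int: "integrable std_normal h"
  proof (rule Bochner_Integration.integrable_bound[OF integrable_mult_right[OF integrable_std_normal_exp_abs[of "c * R + 1"], of "fact m"]])
    have "h t \<le> fact m * exp ((c * R + 1) * \<bar>t\<bar>)" for t
    proof -
      have "h t \<le> (fact m * exp \<bar>t\<bar>) * exp (c * R * \<bar>t\<bar>)"
        unfolding h_def by (intro mult_right_mono power_le_fact_mult_exp) auto
      also have "\<dots> = fact m * exp ((c * R + 1) * \<bar>t\<bar>)" by (simp add: distrib_right exp_add)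
      finally show ?thesis .
    qed
    then show "AE t in std_normal. norm (h t) \<le> norm (fact m * exp ((c * R + 1) * \<bar>t\<bar>))"
      by (intro AE_I2) (simp add: h_def)
  qed (simp add: h_def[abs_def])
  define M0 where "M0 = integral\<^sup>L std_normal h"
  define a where "a j y = \<bar>y j\<bar> / \<rho> j" for j and y :: "nat \<Rightarrow> real"
  define X where "X j y = a j y ^ m * exp (c * a j y)" for j y
  have a0: "a j y \<ge> 0" for j y using \<rho>[of j] by (simp add: a_def)
  have X0: "X j y \<ge> 0" for j y using a0 by (simp add: X_def)
  have [measurable]: "X j \<in> borel_measurable gauss" for j
    unfolding X_def[abs_def] a_def by measurable
  have comp: "integrable gauss (\<lambda>y. h (y j))" "integral\<^sup>L gauss (\<lambda>y. h (y j)) = M0" for j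
    using gauss_prod[of "{j}" "\<lambda>_. h"] h_int by (simp_all add: M0_def)
  have X_le: "X j y \<le> (1 / \<rho> j) ^ m * h (y j)" for j y
  proof -
    have "c * a j y \<le> c * R * \<bar>y j\<bar>"
    proof -
      have "a j y \<le> R * \<bar>y j\<bar>" using mult_right_mono[OF R(2)[of j] abs_ge_zero[of "y j"]] by (simp add: a_def)
      then have "c * a j y \<le> c * (R * \<bar>y j\<bar>)" using c by (intro mult_left_mono) auto
      then show ?thesis by (simp only: mult.assoc)
    qed
    then have "X j y \<le> a j y ^ m * exp (c * R * \<bar>y j\<bar>)"
      unfolding X_def using a0 by (intro mult_left_mono) auto
    then show ?thesis by (simp add: a_def h_def power_divide)
  qed
  have nnX: "(\<integral>\<^sup>+y. ennreal (X j y) \<partial>gauss) \<le> ennreal ((1 / \<rho> j) ^ m * M0)" for j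
  proof -
    have "(\<integral>\<^sup>+y. ennreal (X j y) \<partial>gauss) \<le> (\<integral>\<^sup>+y. ennreal ((1 / \<rho> j) ^ m * h (y j)) \<partial>gauss)"
      by (intro nn_integral_mono ennreal_leI X_le)
    also have "\<dots> = ennreal (integral\<^sup>L gauss (\<lambda>y. (1 / \<rho> j) ^ m * h (y j)))"
      using \<rho>[of j] by (intro nn_integral_eq_integral integrable_mult_right comp) (auto simp: h_def)
    finally show ?thesis by (simp add: comp)
  qed
  define N where "N y = (\<Sum>j. ennreal (X j y))" for y
  have [measurable]: "N \<in> borel_measurable gauss" unfolding N_def[abs_def] by measurable
  have "M0 \<ge> 0" unfolding M0_def by (rule Bochner_Integration.integral_nonneg) (simp add: h_def)
  have "(\<integral>\<^sup>+y. N y \<partial>gauss) = (\<Sum>j. \<integral>\<^sup>+y. ennreal (X j y) \<partial>gauss)"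
    unfolding N_def by (rule nn_integral_suminf) simp
  also have "\<dots> \<le> (\<Sum>j. ennreal ((1 / \<rho> j) ^ m * M0))"
    by (intro suminf_le nnX) auto
  also have "\<dots> < \<infinity>"
  proof -
    have "summable (\<lambda>j. (1 / \<rho> j) ^ m * M0)" by (rule summable_mult2[OF summ])
    moreover have "0 \<le> (1 / \<rho> j) ^ m * M0" for j using \<rho>[of j] \<open>M0 \<ge> 0\<close> by simp
    ultimately show ?thesis by (subst suminf_ennreal2) auto
  qed
  finally have N_int: "(\<integral>\<^sup>+y. N y \<partial>gauss) < \<infinity>" .
  define \<Psi> where "\<Psi> y = exp c + enn2real (N y)" for y
  have N_fin: "AE y in gauss. N y \<noteq> \<infinity>"
    using N_int by (intro nn_integral_PInf_AE) auto
  have "integrable gauss (\<lambda>y. enn2real (N y))"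
  proof (rule integrableI_bounded)
    have "(\<integral>\<^sup>+y. ennreal (norm (enn2real (N y))) \<partial>gauss) \<le> (\<integral>\<^sup>+y. N y \<partial>gauss)"
      by (intro nn_integral_mono) (simp add: ennreal_enn2real_if)
    then show "(\<integral>\<^sup>+y. ennreal (norm (enn2real (N y))) \<partial>gauss) < \<infinity>" using N_int by (rule le_less_trans)
  qed simp
  then have \<Psi>: "integrable gauss \<Psi>" unfolding \<Psi>_def[abs_def] by simp
  have "AE y in gauss. \<exists>B\<ge>0. (\<forall>j. \<bar>y j\<bar> \<le> B * \<rho> j) \<and> exp (c * B) \<le> \<Psi> y"
    using N_fin
  proof eventually_elim
    case (elim y)
    have X_N: "X j y \<le> enn2real (N y)" for j
    proof -
      have "ennreal (X j y) \<le> N y"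
        unfolding N_def using sum_le_suminf[of "\<lambda>j. ennreal (X j y)" "{j}"] by simp
      then show ?thesis using elim X0 by (cases "N y") auto
    qed
    have exp_a: "exp (c * a j y) \<le> \<Psi> y" for j
    proof (cases "a j y \<le> 1")
      case True
      then have "c * a j y \<le> c * 1" using c by (intro mult_left_mono) auto
      then have "exp (c * a j y) \<le> exp c" by simp
      then show ?thesis unfolding \<Psi>_def using enn2real_nonneg[of "N y"] by linarith
    next
      case False
      then have "1 \<le> a j y ^ m" by simp
      then have "exp (c * a j y) \<le> X j y" unfolding X_def by simp
      then show ?thesis unfolding \<Psi>_def using X_N[of j] exp_gt_zero[of c] by linarith
    qed
    \<comment> \<open>This is the number with \<open>exp (c * B) = \<Psi> y\<close>.\<close>
    define B where "B = ln (\<Psi> y) / c"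
    have pos: "\<Psi> y \<ge> 1" unfolding \<Psi>_def using enn2real_nonneg[of "N y"] c one_le_exp_iff[of c] by linarith
    have "B \<ge> 0" using pos c by (simp add: B_def)
    moreover have "\<bar>y j\<bar> \<le> B * \<rho> j" for j
    proof -
      have "c * a j y \<le> ln (\<Psi> y)" using exp_a[of j] pos by (simp add: ln_ge_iff)
      then have "a j y \<le> B" using c by (simp add: B_def pos_le_divide_eq mult.commute)
      then show ?thesis using \<rho>[of j] by (simp add: a_def pos_divide_le_eq)
    qed
    moreover have "exp (c * B) \<le> \<Psi> y" using c pos by (simp add: B_def)
    ultimately show ?case by blast
  qed
  with \<Psi> show ?thesis by (rule that)
qed

section \<open>Summable weights on multi-indices\<close>

text \<open>
  Every finite set of multi-indices is contained in such a box, and sums of products over boxes factorize.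
\<close>

definition mi_box :: "nat \<Rightarrow> nat \<Rightarrow> (nat \<Rightarrow> nat) set" where
  "mi_box n N = {k. (\<forall>j<n. k j \<le> N) \<and> (\<forall>j\<ge>n. k j = 0)}"

lemma mi_box_Suc: "mi_box (Suc n) N = (\<lambda>(k, i). k(n := i)) ` (mi_box n N \<times> {..N})"
proof (intro equalityI subsetI)
  fix k assume k: "k \<in> mi_box (Suc n) N"
  then have "(k(n := 0), k n) \<in> mi_box n N \<times> {..N}" by (auto simp: mi_box_def)
  moreover have "k = (\<lambda>(k, i). k(n := i)) (k(n := 0), k n)" by auto
  ultimately show "k \<in> (\<lambda>(k, i). k(n := i)) ` (mi_box n N \<times> {..N})" by blast
qed (auto simp: mi_box_def)

lemma inj_on_mi_box: "inj_on (\<lambda>(k, i). k(n := i)) (mi_box n N \<times> {..N})"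
proof (rule inj_onI, clarify)
  fix k i l m assume kl: "k \<in> mi_box n N" "l \<in> mi_box n N" and eq: "k(n := i) = l(n := m)"
  have "k j = l j" for j
  proof (cases "j = n")
    case True
    then show ?thesis using kl by (simp add: mi_box_def)
  next
    case False
    then show ?thesis using fun_cong[OF eq, of j] by simp
  qed
  then show "k = l \<and> i = m" using fun_cong[OF eq, of n] by auto
qed

lemma mi_box_0: "mi_box 0 N = {\<lambda>_. 0}"
  by (auto simp: mi_box_def)

lemma finite_mi_box: "finite (mi_box n N)"
  by (induction n) (simp_all add: mi_box_0 mi_box_Suc)

lemma mi_box_support: "k \<in> mi_box n N \<Longrightarrow> k j \<noteq> 0 \<Longrightarrow> j < n"
  unfolding mi_box_def by (rule ccontr) simp

lemma mi_box_multi_indices: "mi_box n N \<subseteq> multi_indices"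
proof
  fix k assume "k \<in> mi_box n N"
  then have "{j. k j \<noteq> 0} \<subseteq> {..<n}" by (auto dest: mi_box_support)
  then show "k \<in> multi_indices" by (auto simp: multi_indices_def intro: finite_subset)
qed

lemma mi_box_supset:
  assumes "finite T" "T \<subseteq> multi_indices"
  obtains n N where "T \<subseteq> mi_box n N"
proof -
  have "finite (\<Union>k\<in>T. {j. k j \<noteq> 0})" using assms by (auto simp: multi_indices_def)
  then obtain n where n: "(\<Union>k\<in>T. {j. k j \<noteq> 0}) \<subseteq> {..<n}" using finite_nat_iff_bounded by auto
  have "finite (\<Union>k\<in>T. k ` {..<n})" using assms(1) by auto
  then obtain N where N: "(\<Union>k\<in>T. k ` {..<n}) \<subseteq> {..N}" using finite_nat_iff_bounded_le by auto
  have "T \<subseteq> mi_box n N"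
  proof
    fix k assume k: "k \<in> T"
    have "k j \<le> N" if "j < n" for j using N k that by auto
    moreover have "k j = 0" if "j \<ge> n" for j
    proof (rule ccontr)
      assume "k j \<noteq> 0"
      then have "j \<in> (\<Union>k\<in>T. {j. k j \<noteq> 0})" using k by blast
      then have "j < n" using n by blast
      then show False using that by simp
    qed
    ultimately show "k \<in> mi_box n N" by (simp add: mi_box_def)
  qed
  then show ?thesis by (rule that)
qed

lemma sum_mi_box_prod:
  fixes f :: "nat \<Rightarrow> nat \<Rightarrow> real"
  shows "(\<Sum>k\<in>mi_box n N. \<Prod>j<n. f j (k j)) = (\<Prod>j<n. \<Sum>i\<le>N. f j i)"
proof (induction n)
  case 0
  then show ?case by (simp add: mi_box_0)
next
  case (Suc n)
  have "(\<Sum>k\<in>mi_box (Suc n) N. \<Prod>j<Suc n. f j (k j))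
      = (\<Sum>(k, i)\<in>mi_box n N \<times> {..N}. (\<Prod>j<n. f j (k j)) * f n i)"
    unfolding mi_box_Suc by (subst sum.reindex[OF inj_on_mi_box]) (auto intro!: sum.cong prod.cong)
  also have "\<dots> = (\<Sum>k\<in>mi_box n N. \<Prod>j<n. f j (k j)) * (\<Sum>i\<le>N. f n i)"
    by (simp add: sum.cartesian_product[symmetric] sum_product)
  finally show ?case using Suc by simp
qed

lemma prod_mi_box:
  assumes "k \<in> mi_box n N" "\<And>j. f j 0 = (1::real)"
  shows "(\<Prod>j | k j \<noteq> 0. f j (k j)) = (\<Prod>j<n. f j (k j))"
proof (rule prod.mono_neutral_left)
  show "{j. k j \<noteq> 0} \<subseteq> {..<n}" using assms(1) by (auto dest: mi_box_support)
qed (auto simp: assms(2))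

text \<open>
  The factor of one coordinate in the weight \<open>b\<^sub>\<nu>\<close>; it is the squared factor that relates the Hermite
  coefficient of index \<open>\<nu>\<close> of the solution to one of its derivative of order \<open>min \<nu>\<^sub>j r\<close>.
\<close>

definition coord_weight :: "nat \<Rightarrow> real \<Rightarrow> nat \<Rightarrow> real" where
  "coord_weight r \<rho> n = real (n choose min n r) / fact (min n r) * \<rho> ^ (2 * min n r)"

definition mi_weight :: "nat \<Rightarrow> (nat \<Rightarrow> real) \<Rightarrow> (nat \<Rightarrow> nat) \<Rightarrow> real" where
  "mi_weight r \<rho> \<nu> = (\<Prod>j | \<nu> j \<noteq> 0. coord_weight r (\<rho> j) (\<nu> j))"

lemma coord_weight_0 [simp]: "coord_weight r \<rho> 0 = 1"
  by (simp add: coord_weight_def)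

lemma coord_weight_pos: "\<rho> > 0 \<Longrightarrow> coord_weight r \<rho> n > 0"
  by (simp add: coord_weight_def)

text \<open>
  Since \<open>n choose r \<ge> (n/r)\<^sup>r\<close>, the summands decay like \<open>n powr (- r q / 2)\<close>.  For \<open>n \<ge> 1\<close> at least one factor
  \<open>(1/\<rho>\<^sub>j) powr q\<close> splits off, and the bound \<open>R\<close> takes care of the others uniformly in \<open>j\<close>.
\<close>

lemma coord_weight_sum:
  fixes \<rho> :: "nat \<Rightarrow> real"
  assumes \<rho>: "\<And>j. \<rho> j > 0" and q: "q > 0" and R: "R \<ge> 1" "\<And>j. 1 / \<rho> j \<le> R" and r: "real r * (q / 2) > 1"
  obtains C where "C \<ge> 0" "\<And>j N. (\<Sum>n\<le>N. coord_weight r (\<rho> j) n powr (- (q / 2))) \<le> 1 + C * (1 / \<rho> j) powr q"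
proof -
  define e where "e n = (real (n choose min n r) / fact (min n r)) powr (- (q / 2))" for n
  have r1: "r \<ge> 1" using r q by (cases r) auto
  have e0: "e n \<ge> 0" for n by (simp add: e_def)
  have "summable e"
  proof (rule summable_comparison_test_ev)
    show "summable (\<lambda>n. (real r ^ r * fact r) powr (q / 2) * real n powr (- (real r * (q / 2))))"
      using r by (intro summable_mult) (simp add: summable_real_powr_iff)
    show "\<forall>\<^sub>F n in sequentially. norm (e n) \<le> (real r ^ r * fact r) powr (q / 2) * real n powr (- (real r * (q / 2)))"
      using eventually_ge_at_top[of r]
    proof eventually_elim
      case (elim n)
      have n0: "n > 0" using elim r1 by simp
      have "(real n / real r) ^ r \<le> real (n choose r)"
        using binomial_ge_n_over_k_pow_k[OF elim, where 'a = real] by simp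
      then have "real n ^ r / (real r ^ r * fact r) \<le> real (n choose r) / fact r"
        by (simp add: power_divide divide_right_mono flip: divide_divide_eq_left)
      then have "e n \<le> (real n ^ r / (real r ^ r * fact r)) powr (- (q / 2))"
        unfolding e_def using elim n0 r1 q by (intro powr_mono2') (auto simp: min_absorb2)
      also have "\<dots> = (real r ^ r * fact r) powr (q / 2) * real n powr (- (real r * (q / 2)))"
      proof -
        have A: "(real n ^ r) powr (- (q / 2)) = real n powr (- (real r * (q / 2)))"
          using n0 by (simp add: powr_realpow[symmetric] powr_powr)
        have inv: "inverse a / inverse b = b * inverse a" for a b :: real by (simp add: divide_inverse)
        have B: "(x / z) powr (- (q / 2)) = z powr (q / 2) * x powr (- (q / 2))" for x z :: real
          unfolding powr_divide powr_minus[of x] powr_minus[of z] by (rule inv)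
        show ?thesis unfolding B A ..
      qed
      finally show ?case unfolding real_norm_def abs_of_nonneg[OF e0] .
    qed
  qed
  define C where "C = R powr (real r * q) * suminf e"
  have C: "C \<ge> 0" unfolding C_def using suminf_nonneg[OF \<open>summable e\<close> e0] by simp
  have "(\<Sum>n\<le>N. coord_weight r (\<rho> j) n powr (- (q / 2))) \<le> 1 + C * (1 / \<rho> j) powr q" for j N
  proof -
    have w: "coord_weight r (\<rho> j) n powr (- (q / 2)) \<le> R powr (real r * q) * (1 / \<rho> j) powr q * e n" if n: "n \<ge> 1" for n
    proof -
      define k where "k = min n r"
      have k: "k \<ge> 1" "k \<le> r" using n r1 by (auto simp: k_def)
      have "coord_weight r (\<rho> j) n powr (- (q / 2)) = e n * (\<rho> j ^ (2 * k)) powr (- (q / 2))"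
        unfolding coord_weight_def e_def k_def using \<rho>[of j] by (subst powr_mult) auto
      also have "(\<rho> j ^ (2 * k)) powr (- (q / 2)) = (1 / \<rho> j) powr (real k * q)"
      proof -
        have "(\<rho> j ^ (2 * k)) powr (- (q / 2)) = (\<rho> j powr real (2 * k)) powr (- (q / 2))"
          using \<rho>[of j] by (simp only: powr_realpow)
        also have "\<dots> = \<rho> j powr (- (real k * q))" by (simp add: powr_powr)
        also have "\<dots> = (1 / \<rho> j) powr (real k * q)"
          unfolding powr_divide powr_minus_divide by simp
        finally show ?thesis .
      qed
      also have "\<dots> = (1 / \<rho> j) powr (real (k - 1) * q) * (1 / \<rho> j) powr q"
        using k(1) by (simp add: powr_add[symmetric] of_nat_diff algebra_simps)
      also have "(1 / \<rho> j) powr (real (k - 1) * q) \<le> R powr (real (k - 1) * q)"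
        using R(2) \<rho>[of j] q by (intro powr_mono2) (auto intro: less_imp_le)
      also have "R powr (real (k - 1) * q) \<le> R powr (real r * q)"
        using R(1) k q by (intro powr_mono mult_right_mono) auto
      finally show ?thesis using e0 by (simp add: mult_left_mono mult_right_mono mult.commute)
    qed
    have "(\<Sum>n\<le>N. coord_weight r (\<rho> j) n powr (- (q / 2))) = 1 + (\<Sum>n\<in>{1..N}. coord_weight r (\<rho> j) n powr (- (q / 2)))"
    proof -
      have "{..N} = insert 0 {1..N}" by auto
      then show ?thesis by simp
    qed
    also have "(\<Sum>n\<in>{1..N}. coord_weight r (\<rho> j) n powr (- (q / 2))) \<le> (\<Sum>n\<in>{1..N}. R powr (real r * q) * (1 / \<rho> j) powr q * e n)"
      by (intro sum_mono w) auto
    also have "\<dots> = R powr (real r * q) * (1 / \<rho> j) powr q * (\<Sum>n\<in>{1..N}. e n)"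
      by (simp add: sum_distrib_left)
    also have "\<dots> \<le> R powr (real r * q) * (1 / \<rho> j) powr q * suminf e"
      by (intro mult_left_mono sum_le_suminf \<open>summable e\<close>) (use e0 in auto)
    finally show ?thesis by (simp add: C_def mult_ac)
  qed
  with C show ?thesis by (rule that)
qed

lemma mi_weight_pos: "(\<And>j. \<rho> j > 0) \<Longrightarrow> mi_weight r \<rho> \<nu> > 0"
  unfolding mi_weight_def by (intro prod_pos) (simp add: coord_weight_pos)

text \<open>
  The sum over a box is a product over the coordinates, and \<open>1 + x \<le> exp x\<close> bounds the product by an
  exponential of \<open>\<Sum>\<^sub>j (1/\<rho>\<^sub>j) powr q\<close>.
\<close>

lemma mi_weight_sum:
  fixes \<rho> :: "nat \<Rightarrow> real"
  assumes \<rho>: "\<And>j. \<rho> j > 0" and q: "q > 0" and sum: "summable (\<lambda>j. (1 / \<rho> j) powr q)"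
    and r: "real r * (q / 2) > 1"
  obtains S where "S > 0" "\<And>T. finite T \<Longrightarrow> T \<subseteq> multi_indices \<Longrightarrow> (\<Sum>\<nu>\<in>T. mi_weight r \<rho> \<nu> powr (- (q / 2))) \<le> S"
proof -
  obtain R where R: "R \<ge> 1" "\<And>j. 1 / \<rho> j \<le> R" using summable_powr_bounded[OF \<rho> q sum] by blast
  obtain C where C: "C \<ge> 0" "\<And>j N. (\<Sum>n\<le>N. coord_weight r (\<rho> j) n powr (- (q / 2))) \<le> 1 + C * (1 / \<rho> j) powr q"
    by (rule coord_weight_sum[OF \<rho> q R r]) (rule that)
  define S where "S = exp (C * (\<Sum>j. (1 / \<rho> j) powr q))"
  have "(\<Sum>\<nu>\<in>T. mi_weight r \<rho> \<nu> powr (- (q / 2))) \<le> S" if T: "finite T" "T \<subseteq> multi_indices" for T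
  proof -
    obtain n N where nN: "T \<subseteq> mi_box n N" by (rule mi_box_supset[OF T]) (rule that)
    have "(\<Sum>\<nu>\<in>T. mi_weight r \<rho> \<nu> powr (- (q / 2))) \<le> (\<Sum>\<nu>\<in>mi_box n N. mi_weight r \<rho> \<nu> powr (- (q / 2)))"
      by (rule sum_mono2[OF finite_mi_box nN]) simp
    also have "\<dots> = (\<Sum>\<nu>\<in>mi_box n N. \<Prod>j<n. coord_weight r (\<rho> j) (\<nu> j) powr (- (q / 2)))"
    proof (rule sum.cong[OF refl])
      fix \<nu> assume "\<nu> \<in> mi_box n N"
      then have "mi_weight r \<rho> \<nu> = (\<Prod>j<n. coord_weight r (\<rho> j) (\<nu> j))"
        unfolding mi_weight_def by (rule prod_mi_box) simp
      then show "mi_weight r \<rho> \<nu> powr (- (q / 2)) = (\<Prod>j<n. coord_weight r (\<rho> j) (\<nu> j) powr (- (q / 2)))"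
        using coord_weight_pos[OF \<rho>] by (simp add: prod_powr_distrib less_imp_le)
    qed
    also have "\<dots> = (\<Prod>j<n. \<Sum>i\<le>N. coord_weight r (\<rho> j) i powr (- (q / 2)))"
      by (rule sum_mi_box_prod)
    also have "\<dots> \<le> (\<Prod>j<n. exp (C * (1 / \<rho> j) powr q))"
    proof (rule prod_mono, safe)
      fix j
      show "0 \<le> (\<Sum>i\<le>N. coord_weight r (\<rho> j) i powr (- (q / 2)))" by (intro sum_nonneg) simp
      show "(\<Sum>i\<le>N. coord_weight r (\<rho> j) i powr (- (q / 2))) \<le> exp (C * (1 / \<rho> j) powr q)"
        using C(2)[where j = j and N = N] exp_ge_add_one_self[of "C * (1 / \<rho> j) powr q"] by linarith
    qed
    also have "\<dots> = exp (C * (\<Sum>j<n. (1 / \<rho> j) powr q))" by (simp add: exp_sum sum_distrib_left)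
    also have "\<dots> \<le> S"
      unfolding S_def exp_le_cancel_iff using C(1)
      by (intro mult_left_mono sum_le_suminf sum) auto
    finally show ?thesis .
  qed
  moreover have "S > 0" by (simp add: S_def)
  ultimately show ?thesis by (intro that)
qed

lemma infinite_multi_indices: "infinite multi_indices"
proof
  assume "finite multi_indices"
  moreover have "range (\<lambda>n j. if j = 0 then n else 0) \<subseteq> multi_indices"
    by (auto simp: multi_indices_def intro: finite_subset[of _ "{0}"])
  ultimately have "finite (range (\<lambda>n::nat. \<lambda>j::nat. if j = 0 then n else 0))" by (rule finite_subset[rotated])
  moreover have "inj (\<lambda>n::nat. \<lambda>j::nat. if j = 0 then n else 0)"
    by (auto simp: inj_def fun_eq_iff)
  ultimately show False using finite_imageD by blast
qed

text \<open>
  Fewer than \<open>N\<close> indices can have \<open>a i > S/N\<close>; further indices fill up the set to \<open>N\<close> elements.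
\<close>

lemma select_large:
  fixes a :: "'i \<Rightarrow> real"
  assumes I: "infinite I"
    and S: "\<And>T. finite T \<Longrightarrow> T \<subseteq> I \<Longrightarrow> sum a T \<le> S" and N: "N \<ge> 1"
  obtains \<Lambda> where "\<Lambda> \<subseteq> I" "finite \<Lambda>" "card \<Lambda> = N" "\<And>i. i \<in> I - \<Lambda> \<Longrightarrow> a i \<le> S / real N"
proof -
  define L where "L = {i \<in> I. a i > S / real N}"
  have card_less: "card T < N" if T: "finite T" "T \<subseteq> L" for T
  proof (cases "T = {}")
    case False
    have "real (card T) * (S / real N) < sum a T"
      using sum_strict_mono[OF T(1) False, of "\<lambda>_. S / real N" a] T(2) by (auto simp: L_def)
    also have "\<dots> \<le> S" by (rule S) (use T in \<open>auto simp: L_def\<close>)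
    finally have "real (card T) * S < real N * S" using N by (simp add: pos_divide_less_eq mult.commute)
    moreover have "S \<ge> 0" using S[of "{}"] by simp
    ultimately show ?thesis by (auto dest: mult_right_less_imp_less)
  qed (use N in simp)
  have fin: "finite L"
  proof (rule ccontr)
    assume "infinite L"
    then obtain T where "finite T" "card T = N" "T \<subseteq> L" using infinite_arbitrarily_large by blast
    then show False using card_less by blast
  qed
  have "infinite (I - L)" using I fin by simp
  then obtain T where T: "finite T" "card T = N - card L" "T \<subseteq> I - L" using infinite_arbitrarily_large by blast
  have "card (L \<union> T) = N"
    using T fin card_less[OF fin subset_refl] by (subst card_Un_disjoint) auto
  then show ?thesis
    by (intro that[of "L \<union> T"]) (use T fin in \<open>auto simp: L_def\<close>)
qed

section \<open>Taylor coefficients of the lognormal problem\<close>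

lemma energy_op_scaleR:
  assumes c: "ess_bounded c b"
  shows "energy_op \<beta> (\<lambda>x. r * c x) = r *\<^sub>R energy_op \<beta> c"
  using energy_op_linear[OF c c, of \<beta> r 0] by simp

lemma energy_form_mono:
  assumes c: "ess_bounded c b" and d: "ess_bounded d e" and le: "AE x in lborel. c x \<le> d x" and \<beta>: "\<beta> \<ge> 0"
  shows "energy_form \<beta> c w w \<le> energy_form \<beta> d w w"
  unfolding energy_form_def
proof (rule integral_mono_AE[OF integrable_energy_density[OF c] integrable_energy_density[OF d]])
  show "AE x in lborel. c x * energy_density \<beta> w w x \<le> d x * energy_density \<beta> w w x"
    using le by eventually_elim (intro mult_right_mono energy_density_nonneg[OF \<beta>])
qed

lemma ess_bounded_const: "ess_bounded (\<lambda>_. r) \<bar>r\<bar>"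
  by (simp add: ess_bounded_def)

text \<open>
  The term of multi-degree \<open>m\<close> in the expansion of \<open>exp (\<Sum>\<^sub>j t\<^sub>j)\<close>.
\<close>

definition monomial_coeff :: "(nat \<Rightarrow> real) \<Rightarrow> (nat \<Rightarrow> nat) \<Rightarrow> real" where
  "monomial_coeff t m = (\<Prod>j | m j \<noteq> 0. t j ^ m j / fact (m j))"

lemma monomial_coeff_eq:
  assumes "finite J" "{j. m j \<noteq> 0} \<subseteq> J"
  shows "monomial_coeff t m = (\<Prod>j\<in>J. t j ^ m j / fact (m j))"
  unfolding monomial_coeff_def by (rule prod.mono_neutral_left[OF assms]) auto

lemma monomial_coeff_zero [simp]: "monomial_coeff t (\<lambda>_. 0) = 1"
  by (simp add: monomial_coeff_def)

lemma monomial_coeff_incr: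
  assumes m: "m \<in> multi_indices"
  shows "real (Suc (m j)) * monomial_coeff t (incr j m) = monomial_coeff t m * t j"
proof -
  define J where "J = insert j {i. m i \<noteq> 0}"
  have J: "finite J" "j \<in> J" using m by (auto simp: J_def multi_indices_def)
  have "monomial_coeff t (incr j m) = (\<Prod>i\<in>J. t i ^ incr j m i / fact (incr j m i))"
    by (rule monomial_coeff_eq[OF J(1)]) (auto simp: J_def incr_apply split: if_splits)
  also have "\<dots> = t j ^ Suc (m j) / fact (Suc (m j)) * (\<Prod>i\<in>J - {j}. t i ^ incr j m i / fact (incr j m i))"
    by (subst prod.remove[OF J]) (simp add: incr_apply)
  also have "(\<Prod>i\<in>J - {j}. t i ^ incr j m i / fact (incr j m i)) = (\<Prod>i\<in>J - {j}. t i ^ m i / fact (m i))"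
    by (rule prod.cong) (auto simp: incr_apply)
  finally have "real (Suc (m j)) * monomial_coeff t (incr j m)
      = (t j ^ m j / fact (m j) * (\<Prod>i\<in>J - {j}. t i ^ m i / fact (m i))) * t j"
    by simp
  also have "t j ^ m j / fact (m j) * (\<Prod>i\<in>J - {j}. t i ^ m i / fact (m i)) = monomial_coeff t m"
    by (subst prod.remove[OF J, symmetric], rule monomial_coeff_eq[OF J(1), symmetric]) (auto simp: J_def)
  finally show ?thesis .
qed

lemma monomial_coeff_abs: "\<bar>monomial_coeff t m\<bar> = monomial_coeff (\<lambda>j. \<bar>t j\<bar>) m"
  by (simp add: monomial_coeff_def abs_prod power_abs)

text \<open>
  The sum over a box is the product of the partial sums of the exponential series of the \<open>t\<^sub>j\<close>.
\<close>

lemma monomial_coeff_sum_le: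
  assumes t: "\<And>j. t j \<ge> 0" and K: "(\<Sum>j<n. t j) \<le> K"
  shows "(\<Sum>m\<in>mi_box n N. monomial_coeff t m) \<le> exp K"
proof -
  have "(\<Sum>m\<in>mi_box n N. monomial_coeff t m) = (\<Sum>m\<in>mi_box n N. \<Prod>j<n. t j ^ m j / fact (m j))"
    unfolding monomial_coeff_def by (intro sum.cong refl prod_mi_box) auto
  also have "\<dots> = (\<Prod>j<n. \<Sum>i\<le>N. t j ^ i / fact i)" by (rule sum_mi_box_prod)
  also have "\<dots> \<le> (\<Prod>j<n. exp (t j))"
  proof (rule prod_mono, safe)
    fix j
    show "0 \<le> (\<Sum>i\<le>N. t j ^ i / fact i)" using t by (intro sum_nonneg) simp
    have "(\<Sum>i\<le>N. t j ^ i /\<^sub>R fact i) \<le> (\<Sum>i. t j ^ i /\<^sub>R fact i)"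
      using t by (intro sum_le_suminf summable_exp_generic) auto
    then show "(\<Sum>i\<le>N. t j ^ i / fact i) \<le> exp (t j)" by (simp add: exp_def divide_inverse mult.commute)
  qed
  also have "\<dots> = exp (\<Sum>j<n. t j)" by (simp add: exp_sum)
  finally show ?thesis using K by (meson exp_le_cancel_iff order_trans)
qed

lemma mi_box_downward:
  assumes k: "k \<in> mi_box n N" and l: "l \<le> k" shows "l \<in> mi_box n N"
proof -
  have le: "l j \<le> k j" for j using l by (simp add: le_fun_def)
  have "l j \<le> N" if "j < n" for j
    using le[of j] k that by (auto simp: mi_box_def intro: order_trans)
  moreover have "l j = 0" if "j \<ge> n" for j
    using le[of j] k that by (simp add: mi_box_def)
  ultimately show ?thesis by (simp add: mi_box_def)
qed

text \<open>
  The functional analytic content of the parametric problem: \<open>W\<close> is the space of trial functions, \<open>B0\<close>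
  represents the coupling form and \<open>F0\<close> the data.  The functions \<open>\<kappa>\<^sub>j\<close> are Borel measurable on the whole
  space, with \<open>\<Sum>\<^sub>j \<rho>\<^sub>j \<bar>\<kappa>\<^sub>j\<bar>\<close> bounded by \<open>K\<close> everywhere.  The condition \<open>K_small\<close>, attained by scaling \<open>\<rho>\<close>, makes the
  terms of lower order small enough to be absorbed in the estimate of the Taylor coefficients.
\<close>

locale lognormal_problem =
  fixes W :: "('a::euclidean_space sobolev \<times> 'a sobolev) set" and \<beta> c0 K :: real
    and \<kappa> :: "nat \<Rightarrow> 'a \<Rightarrow> real" and \<rho> :: "nat \<Rightarrow> real"
    and B0 :: "('a sobolev \<times> 'a sobolev) \<Rightarrow>\<^sub>L ('a sobolev \<times> 'a sobolev)" and F0 :: "'a sobolev \<times> 'a sobolev"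
  assumes W: "subspace W" "closed W" and \<beta>: "\<beta> > 0" and c0: "c0 > 0"
    and coercive: "\<And>w. w \<in> W \<Longrightarrow> c0 * (norm w)\<^sup>2 \<le> energy_form \<beta> (\<lambda>_. 1) w w"
    and skew: "\<And>w. inner (B0 w) w = 0"
    and \<kappa>_measurable [measurable]: "\<And>j. \<kappa> j \<in> borel_measurable borel"
    and \<rho>: "\<And>j. \<rho> j > 0"
    and K: "\<And>x n. (\<Sum>j<n. \<rho> j * \<bar>\<kappa> j x\<bar>) \<le> K"
    and K_small: "exp K \<le> 3 / 2"
begin

definition "param = {y. (AE x in lborel. summable (\<lambda>j. y j * \<kappa> j x)) \<and>
  (\<exists>b. AE x in lborel. \<bar>kappa_series \<kappa> y x\<bar> \<le> b)}"

definition "M_op y m = energy_op \<beta> (\<lambda>x. monomial_coeff (\<lambda>j. \<rho> j * \<kappa> j x) m * exp (kappa_series \<kappa> y x))"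

definition "L_op y = M_op y (\<lambda>_. 0) + B0"

definition "taylor k y = (if y \<in> param then taylor_coeff W (L_op y) (M_op y) F0 k else 0)"

lemma kappa_series_measurable [measurable]: "kappa_series \<kappa> y \<in> borel_measurable borel"
  unfolding kappa_series_def[abs_def] by measurable

lemma K_nonneg: "0 \<le> K"
  using K[of 0 0] by simp

lemma \<kappa>_le: "\<bar>\<rho> j * \<kappa> j x\<bar> \<le> K"
proof -
  have "\<rho> j * \<bar>\<kappa> j x\<bar> \<le> (\<Sum>i<Suc j. \<rho> i * \<bar>\<kappa> i x\<bar>)"
    using \<rho> by (intro member_le_sum[where f = "\<lambda>i. \<rho> i * \<bar>\<kappa> i x\<bar>"]) (auto intro!: mult_nonneg_nonneg simp: less_imp_le)
  also have "\<dots> \<le> K" by (rule K)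
  finally show ?thesis using \<rho>[of j] by (simp add: abs_mult)
qed

lemma ess_bounded_\<kappa>: "ess_bounded (\<lambda>x. \<rho> j * \<kappa> j x) K"
  using \<kappa>_le by (simp add: ess_bounded_def)

lemma ess_bounded_monomial:
  "ess_bounded (\<lambda>x. monomial_coeff (\<lambda>j. \<rho> j * \<kappa> j x) m) (monomial_coeff (\<lambda>_. K) m)"
proof -
  have "\<bar>monomial_coeff (\<lambda>j. \<rho> j * \<kappa> j x) m\<bar> \<le> monomial_coeff (\<lambda>_. K) m" for x
    unfolding monomial_coeff_abs unfolding monomial_coeff_def
    using \<kappa>_le by (intro prod_mono) (auto intro!: divide_right_mono power_mono)
  then show ?thesis unfolding ess_bounded_def monomial_coeff_def by simp
qed

lemma ess_bounded_exp:
  assumes "AE x in lborel. \<bar>kappa_series \<kappa> y x\<bar> \<le> b"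
  shows "ess_bounded (\<lambda>x. exp (kappa_series \<kappa> y x)) (exp b)"
proof -
  have "AE x in lborel. \<bar>exp (kappa_series \<kappa> y x)\<bar> \<le> exp b" using assms by eventually_elim simp
  then show ?thesis by (simp add: ess_bounded_def)
qed

lemmas ess_bounded_M = ess_bounded_mult[OF ess_bounded_monomial ess_bounded_exp]

lemma inner_M_op:
  assumes "AE x in lborel. \<bar>kappa_series \<kappa> y x\<bar> \<le> b"
  shows "inner (M_op y m w) v = energy_form \<beta> (\<lambda>x. monomial_coeff (\<lambda>j. \<rho> j * \<kappa> j x) m * exp (kappa_series \<kappa> y x)) w v"
  unfolding M_op_def by (rule inner_energy_op[OF ess_bounded_M[OF assms]])

lemma inner_L_op:
  assumes "AE x in lborel. \<bar>kappa_series \<kappa> y x\<bar> \<le> b"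
  shows "inner (L_op y w) v = energy_form \<beta> (\<lambda>x. exp (kappa_series \<kappa> y x)) w v + inner (B0 w) v"
  using inner_M_op[OF assms, of "\<lambda>_. 0" w v] by (simp add: L_op_def blinfun.add_left inner_add_left)

lemma energy_form_exp_ge:
  assumes b: "AE x in lborel. \<bar>kappa_series \<kappa> y x\<bar> \<le> b" and w: "w \<in> W"
  shows "c0 * exp (- b) * (norm w)\<^sup>2 \<le> energy_form \<beta> (\<lambda>x. exp (kappa_series \<kappa> y x)) w w"
proof -
  have "exp (- b) * (c0 * (norm w)\<^sup>2) \<le> exp (- b) * energy_form \<beta> (\<lambda>_. 1) w w"
    by (intro mult_left_mono coercive w) auto
  also have "\<dots> = energy_form \<beta> (\<lambda>_. exp (- b)) w w"
    by (simp add: energy_form_def)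
  also have "\<dots> \<le> energy_form \<beta> (\<lambda>x. exp (kappa_series \<kappa> y x)) w w"
  proof (rule energy_form_mono[OF ess_bounded_const ess_bounded_exp[OF b]])
    show "AE x in lborel. exp (- b) \<le> exp (kappa_series \<kappa> y x)" using b by eventually_elim simp
  qed (use \<beta> in simp)
  finally show ?thesis by (simp add: mult_ac)
qed

text \<open>
  The skew form drops out on the diagonal, and \<open>exp (\<kappa>(y)) \<ge> exp (- b)\<close>.
\<close>

lemma coercive_L_op:
  assumes b: "AE x in lborel. \<bar>kappa_series \<kappa> y x\<bar> \<le> b"
  shows "coercive_on W (c0 * exp (- b)) (L_op y)"
  unfolding coercive_on_def
  using energy_form_exp_ge[OF b] c0 by (simp add: inner_L_op[OF b] skew)

lemma param_bound:
  assumes "y \<in> param" obtains b where "AE x in lborel. \<bar>kappa_series \<kappa> y x\<bar> \<le> b"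
  using assms by (auto simp: param_def)

lemma summable_fun_upd:
  fixes f :: "nat \<Rightarrow> real"
  assumes "summable (\<lambda>i. y i * f i)"
  shows "summable (\<lambda>i. (y(j := s)) i * f i)"
    and "(\<Sum>i. (y(j := s)) i * f i) = (\<Sum>i. y i * f i) + (s - y j) * f j"
proof -
  have "(\<lambda>i. y i * f i + (if i = j then (s - y j) * f j else 0)) sums ((\<Sum>i. y i * f i) + (s - y j) * f j)"
    by (intro sums_add summable_sums assms sums_single)
  also have "(\<lambda>i. y i * f i + (if i = j then (s - y j) * f j else 0)) = (\<lambda>i. (y(j := s)) i * f i)"
    by (auto simp: algebra_simps)
  finally show "summable (\<lambda>i. (y(j := s)) i * f i)"
    and "(\<Sum>i. (y(j := s)) i * f i) = (\<Sum>i. y i * f i) + (s - y j) * f j"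
    by (simp_all add: sums_iff)
qed

text \<open>
  The coordinate \<open>j\<close> is measured in units of \<open>\<rho>\<^sub>j\<close>, so that the increment involves the function \<open>\<rho>\<^sub>j \<kappa>\<^sub>j\<close>, which
  is bounded by \<open>K\<close> for every \<open>j\<close>.
\<close>

lemma kappa_series_shift:
  assumes "y \<in> param"
  shows "AE x in lborel. kappa_series \<kappa> (y(j := y j + \<rho> j * h)) x = kappa_series \<kappa> y x + h * (\<rho> j * \<kappa> j x)"
proof -
  have "AE x in lborel. summable (\<lambda>j. y j * \<kappa> j x)" using assms by (simp add: param_def)
  then show ?thesis
    by eventually_elim (simp only: kappa_series_def summable_fun_upd, simp)
qed

lemma kappa_series_shift_le:
  assumes y: "y \<in> param" and b: "AE x in lborel. \<bar>kappa_series \<kappa> y x\<bar> \<le> b"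
  shows "AE x in lborel. \<bar>kappa_series \<kappa> (y(j := y j + \<rho> j * h)) x\<bar> \<le> b + \<bar>h\<bar> * K"
  using b kappa_series_shift[OF y, of j h]
proof eventually_elim
  case (elim x)
  have "\<bar>h * (\<rho> j * \<kappa> j x)\<bar> \<le> \<bar>h\<bar> * K" unfolding abs_mult[of h] by (intro mult_left_mono \<kappa>_le) auto
  then show ?case using elim by linarith
qed

lemma param_shift_imp:
  assumes y: "y \<in> param" shows "y(j := y j + \<rho> j * h) \<in> param"
proof -
  obtain b where "AE x in lborel. \<bar>kappa_series \<kappa> y x\<bar> \<le> b" by (rule param_bound[OF y])
  note kappa_series_shift_le[OF y this, of j h]
  moreover have "AE x in lborel. summable (\<lambda>i. (y(j := y j + \<rho> j * h)) i * \<kappa> i x)"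
  proof -
    have "AE x in lborel. summable (\<lambda>j. y j * \<kappa> j x)" using y by (simp add: param_def)
    then show ?thesis by eventually_elim (rule summable_fun_upd)
  qed
  ultimately show ?thesis unfolding param_def by blast
qed

lemma param_fun_upd: "y(j := t) \<in> param \<longleftrightarrow> y \<in> param"
proof -
  have *: "y(j := t) \<in> param" if "y \<in> param" for y t
    using param_shift_imp[OF that, of j "(t - y j) / \<rho> j"] \<rho>[of j] by simp
  show ?thesis using *[of y t] *[of "y(j := t)" "y j"] by auto
qed

lemma M_op_has_vector_derivative:
  assumes y: "y \<in> param" and m: "m \<in> multi_indices"
  shows "((\<lambda>h. M_op (y(j := y j + \<rho> j * h)) m) has_vector_derivative real (Suc (m j)) *\<^sub>R M_op y (incr j m)) (at 0)"
proof -
  obtain b where b: "AE x in lborel. \<bar>kappa_series \<kappa> y x\<bar> \<le> b" by (rule param_bound[OF y])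
  let ?c = "\<lambda>x. monomial_coeff (\<lambda>j. \<rho> j * \<kappa> j x) m * exp (kappa_series \<kappa> y x)"
  have eq: "M_op (y(j := y j + \<rho> j * h)) m = energy_op \<beta> (\<lambda>x. ?c x * exp (h * (\<rho> j * \<kappa> j x)))" for h
    unfolding M_op_def
  proof (rule energy_op_cong[OF ess_bounded_M[OF kappa_series_shift_le[OF y b]]])
    show "(\<lambda>x. ?c x * exp (h * (\<rho> j * \<kappa> j x))) \<in> borel_measurable borel"
      unfolding monomial_coeff_def by measurable
    show "AE x in lborel. monomial_coeff (\<lambda>j. \<rho> j * \<kappa> j x) m * exp (kappa_series \<kappa> (y(j := y j + \<rho> j * h)) x)
        = ?c x * exp (h * (\<rho> j * \<kappa> j x))"
      using kappa_series_shift[OF y, of j h] by eventually_elim (simp add: exp_add)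
  qed
  have "energy_op \<beta> (\<lambda>x. ?c x * (\<rho> j * \<kappa> j x))
      = energy_op \<beta> (\<lambda>x. real (Suc (m j)) * (monomial_coeff (\<lambda>j. \<rho> j * \<kappa> j x) (incr j m) * exp (kappa_series \<kappa> y x)))"
    by (rule arg_cong[where f = "energy_op \<beta>"])
      (use monomial_coeff_incr[OF m, where j = j] in \<open>auto simp: fun_eq_iff mult_ac\<close>)
  also have "\<dots> = real (Suc (m j)) *\<^sub>R M_op y (incr j m)"
    unfolding M_op_def by (rule energy_op_scaleR[OF ess_bounded_M[OF b]])
  finally show ?thesis
    unfolding eq using energy_op_exp_has_vector_derivative[OF ess_bounded_M[OF b] ess_bounded_\<kappa>, of \<beta> m j] by simp
qed

text \<open>
  As changing one coordinate does not lead out of \<open>param\<close>, this holds along every line parallel to an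
  axis, also outside \<open>param\<close>, where the functions vanish.
\<close>

lemma taylor_has_vector_derivative:
  assumes k: "k \<in> multi_indices"
  shows "((\<lambda>s. taylor k (y(j := s))) has_vector_derivative
    (real (Suc (k j)) / \<rho> j) *\<^sub>R taylor (incr j k) (y(j := t))) (at t)"
proof (cases "y \<in> param")
  case False
  then show ?thesis by (simp add: taylor_def param_fun_upd)
next
  case True
  define z where "z = y(j := t)"
  have z: "z \<in> param" using True by (simp add: z_def param_fun_upd)
  obtain b where b: "AE x in lborel. \<bar>kappa_series \<kappa> z x\<bar> \<le> b" by (rule param_bound[OF z])
  let ?l = "\<lambda>h. z(j := z j + \<rho> j * h)"
  have coerc: "coercive_on W (c0 * exp (- (b + K))) (L_op (?l h))" if "\<bar>h\<bar> \<le> 1" for h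
  proof (rule coercive_L_op)
    have hK: "\<bar>h\<bar> * K \<le> K" using mult_right_mono[OF that K_nonneg] by simp
    show "AE x in lborel. \<bar>kappa_series \<kappa> (?l h) x\<bar> \<le> b + K"
      using kappa_series_shift_le[OF z b, of j h] by eventually_elim (use hK in linarith)
  qed
  have "((\<lambda>h. taylor_coeff W (L_op (?l h)) (M_op (?l h)) F0 k) has_vector_derivative
      real (Suc (k j)) *\<^sub>R taylor_coeff W (L_op (?l 0)) (M_op (?l 0)) F0 (incr j k)) (at 0)"
  proof (rule taylor_coeff_has_vector_derivative[OF W _ _ _ _ k])
    show "\<forall>\<^sub>F h in at 0. coercive_on W (c0 * exp (- (b + K))) (L_op (?l h))"
      unfolding eventually_at by (rule exI[of _ 1]) (use coerc in \<open>auto simp: dist_real_def\<close>)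
    show "coercive_on W (c0 * exp (- (b + K))) (L_op (?l 0))" by (rule coerc) simp
    show "((\<lambda>h. M_op (?l h) m) has_vector_derivative real (Suc (m j)) *\<^sub>R M_op (?l 0) (incr j m)) (at 0)"
      if "m \<in> multi_indices" for m
      using M_op_has_vector_derivative[OF z that, of j] by simp
    show "((\<lambda>h. L_op (?l h)) has_vector_derivative M_op (?l 0) (incr j (\<lambda>_. 0))) (at 0)"
      unfolding L_op_def
      using has_vector_derivative_add[OF M_op_has_vector_derivative[OF z zero_multi_index, of j] has_vector_derivative_const]
      by simp
  qed
  then have line: "((\<lambda>h. taylor k (?l h)) has_vector_derivative real (Suc (k j)) *\<^sub>R taylor (incr j k) z) (at 0)"
    using z by (simp add: taylor_def param_fun_upd)
  have "((\<lambda>s. (s - t) / \<rho> j) has_vector_derivative 1 / \<rho> j) (at t)"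
    unfolding has_real_derivative_iff_has_vector_derivative[symmetric]
    by (rule derivative_eq_intros | use \<rho>[of j] in simp)+
  from vector_diff_chain_at[OF this, where g = "\<lambda>h. taylor k (?l h)" and g' = "real (Suc (k j)) *\<^sub>R taylor (incr j k) z"]
  have "((\<lambda>h. taylor k (?l h)) \<circ> (\<lambda>s. (s - t) / \<rho> j) has_vector_derivative (1 / \<rho> j) *\<^sub>R (real (Suc (k j)) *\<^sub>R taylor (incr j k) z)) (at t)"
    using line by (simp only: diff_self div_0)
  also have "(\<lambda>h. taylor k (?l h)) \<circ> (\<lambda>s. (s - t) / \<rho> j) = (\<lambda>s. taylor k (y(j := s)))"
    using \<rho>[of j] by (auto simp: fun_eq_iff z_def)
  finally show ?thesis unfolding z_def by (simp only: scaleR_scaleR times_divide_eq_left mult_1_left)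
qed

lemma taylor_mem: "taylor k y \<in> W"
proof (cases "y \<in> param \<and> k \<in> multi_indices")
  case True
  then obtain b where "AE x in lborel. \<bar>kappa_series \<kappa> y x\<bar> \<le> b" using param_bound by blast
  from variational_solution_mem[OF W coercive_L_op[OF this]] True show ?thesis
    by (simp add: taylor_def taylor_coeff.simps[of _ _ _ _ k])
qed (use W(1) in \<open>auto simp: taylor_def taylor_coeff.simps[of _ _ _ _ k] subspace_def\<close>)

text \<open>
  Let \<open>E k x\<close> be the energy density of \<open>T\<^sub>k\<close> at \<open>x\<close>.  Testing the equation of \<open>T\<^sub>k\<close> with \<open>T\<^sub>k\<close>, and estimating
  the mixed densities by \<open>(E l x + E k x) / 2\<close>, gives an inequality for the total energy
  \<open>T = \<Sum>\<^sub>k \<integral> exp (\<kappa>(y)) (E k)\<close>.  At each point the mixed terms have a sum of at most \<open>(1/2) \<Sum>\<^sub>k E k x\<close>,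
  because for fixed \<open>k\<close> as well as for fixed \<open>l\<close> the coefficients of index \<open>k - l \<noteq> 0\<close> have absolute sum
  at most \<open>exp K - 1 \<le> 1/2\<close>.  Hence half of \<open>T\<close> is absorbed, and the data enter only through \<open>k = 0\<close>.
\<close>

lemma taylor_sum_le:
  assumes y: "y \<in> param" and b: "AE x in lborel. \<bar>kappa_series \<kappa> y x\<bar> \<le> b"
  shows "(\<Sum>k\<in>mi_box n N. (norm (taylor k y))\<^sup>2) \<le> 2 * (norm F0)\<^sup>2 / c0\<^sup>2 * exp (2 * b)"
proof -
  let ?S = "mi_box n N"
  let ?e = "\<lambda>x. exp (kappa_series \<kappa> y x)"
  let ?\<theta> = "\<lambda>m x. monomial_coeff (\<lambda>j. \<rho> j * \<kappa> j x) m"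
  define E where "E k x = energy_density \<beta> (taylor k y) (taylor k y) x" for k x
  define G where "G k = taylor k y" for k
  have finS: "finite ?S" by (rule finite_mi_box)
  note co = coercive_L_op[OF b]
  have E0: "E k x \<ge> 0" for k x unfolding E_def by (rule energy_density_nonneg) (use \<beta> in simp)
  define below where "below k = {l. l \<le> k \<and> l \<noteq> k}" for k :: "nat \<Rightarrow> nat"
  have below: "finite (below k)" "below k \<subseteq> ?S" if "k \<in> ?S" for k
  proof -
    show "below k \<subseteq> ?S" using mi_box_downward[OF that] by (auto simp: below_def)
    then show "finite (below k)" using finS finite_subset by blast
  qed
  have zero_box: "(\<lambda>_. 0) \<in> ?S" by (simp add: mi_box_def)
  have int: "integrable lborel (\<lambda>x. ?e x * E k x)" for k
    unfolding E_def by (rule integrable_energy_density[OF ess_bounded_exp[OF b]])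
  have int_abs: "integrable lborel (\<lambda>x. \<bar>?\<theta> m x\<bar> * (?e x * E k x))" for m k
  proof -
    have "ess_bounded (\<lambda>x. \<bar>?\<theta> m x\<bar> * ?e x) (monomial_coeff (\<lambda>_. K) m * exp b)"
      by (rule ess_bounded_mult[OF _ ess_bounded_exp[OF b]])
        (use ess_bounded_monomial[of m] in \<open>auto simp: ess_bounded_def\<close>)
    from integrable_energy_density[OF this] show ?thesis by (simp add: E_def mult.assoc)
  qed
  have step: "(\<integral>x. ?e x * E k x \<partial>lborel) \<le> (if k = (\<lambda>_. 0) then inner F0 (G k) else 0)
      + (\<Sum>l\<in>below k. \<integral>x. \<bar>?\<theta> (\<lambda>j. k j - l j) x\<bar> * (?e x * ((E l x + E k x) / 2)) \<partial>lborel)" if k: "k \<in> ?S" for k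
  proof -
    have kmi: "k \<in> multi_indices" using k mi_box_multi_indices by blast
    let ?f = "(if k = (\<lambda>_. 0) then F0 else 0) - (\<Sum>l\<in>below k. M_op y (\<lambda>j. k j - l j) (G l))"
    have G: "G k = variational_solution W (L_op y) ?f"
      using y kmi by (simp add: G_def taylor_def taylor_coeff.simps[of _ _ _ _ k] below_def)
    have GW: "G k \<in> W" unfolding G_def by (rule taylor_mem)
    have "(\<integral>x. ?e x * E k x \<partial>lborel) = inner (L_op y (G k)) (G k)"
      unfolding inner_L_op[OF b] skew by (simp add: energy_form_def E_def G_def)
    also have "\<dots> = inner ?f (G k)"
      using variational_solution_inner[OF W co GW, of ?f] by (simp only: G[symmetric])
    also have "\<dots> = (if k = (\<lambda>_. 0) then inner F0 (G k) else 0) + (\<Sum>l\<in>below k. - inner (M_op y (\<lambda>j. k j - l j) (G l)) (G k))"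
      by (simp add: inner_diff_left inner_sum_left sum_negf)
    also have "\<dots> \<le> (if k = (\<lambda>_. 0) then inner F0 (G k) else 0)
        + (\<Sum>l\<in>below k. \<integral>x. \<bar>?\<theta> (\<lambda>j. k j - l j) x\<bar> * (?e x * ((E l x + E k x) / 2)) \<partial>lborel)"
    proof (rule add_left_mono, rule sum_mono)
      fix l
      let ?m = "\<lambda>j. k j - l j"
      have "- inner (M_op y ?m (G l)) (G k) = (\<integral>x. - (?\<theta> ?m x * ?e x * energy_density \<beta> (G l) (G k) x) \<partial>lborel)"
        unfolding inner_M_op[OF b] energy_form_def by simp
      also have "\<dots> \<le> (\<integral>x. \<bar>?\<theta> ?m x\<bar> * (?e x * ((E l x + E k x) / 2)) \<partial>lborel)"
      proof (rule integral_mono)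
        show "integrable lborel (\<lambda>x. - (?\<theta> ?m x * ?e x * energy_density \<beta> (G l) (G k) x))"
          using integrable_energy_density[OF ess_bounded_M[OF b]] by simp
        have "integrable lborel (\<lambda>x. (\<bar>?\<theta> ?m x\<bar> * (?e x * E l x) + \<bar>?\<theta> ?m x\<bar> * (?e x * E k x)) / 2)"
          using int_abs by simp
        then show "integrable lborel (\<lambda>x. \<bar>?\<theta> ?m x\<bar> * (?e x * ((E l x + E k x) / 2)))"
          by (simp add: algebra_simps add_divide_distrib)
        fix x
        have "- (?\<theta> ?m x * ?e x * energy_density \<beta> (G l) (G k) x) \<le> \<bar>?\<theta> ?m x * ?e x * energy_density \<beta> (G l) (G k) x\<bar>"
          by (rule abs_ge_minus_self)
        also have "\<dots> = \<bar>?\<theta> ?m x\<bar> * (?e x * \<bar>energy_density \<beta> (G l) (G k) x\<bar>)" by (simp add: abs_mult)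
        also have "\<dots> \<le> \<bar>?\<theta> ?m x\<bar> * (?e x * ((E l x + E k x) / 2))"
          unfolding E_def G_def by (intro mult_left_mono energy_density_Cauchy_Schwarz) (use \<beta> in auto)
        finally show "- (?\<theta> ?m x * ?e x * energy_density \<beta> (G l) (G k) x) \<le> \<bar>?\<theta> ?m x\<bar> * (?e x * ((E l x + E k x) / 2))" .
      qed
      finally show "- inner (M_op y ?m (G l)) (G k) \<le> (\<integral>x. \<bar>?\<theta> ?m x\<bar> * (?e x * ((E l x + E k x) / 2)) \<partial>lborel)" .
    qed
    finally show ?thesis .
  qed
  have pointwise: "(\<Sum>k\<in>?S. \<Sum>l\<in>below k. \<bar>?\<theta> (\<lambda>j. k j - l j) x\<bar> * ((E l x + E k x) / 2)) \<le> (1 / 2) * (\<Sum>k\<in>?S. E k x)" for x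
  proof -
    define t where "t m = \<bar>?\<theta> m x\<bar>" for m
    have t0: "t m \<ge> 0" for m by (simp add: t_def)
    \<comment> \<open>The coefficient of index \<open>0\<close> is \<open>1\<close>, and \<open>exp K - 1 \<le> 1/2\<close>.\<close>
    have tS: "(\<Sum>m\<in>?S - {\<lambda>_. 0}. t m) \<le> 1 / 2"
    proof -
      have "(\<Sum>m\<in>?S. t m) \<le> exp K"
        unfolding t_def monomial_coeff_abs
        by (rule monomial_coeff_sum_le) (use K[of x n] \<rho> in \<open>auto simp: abs_mult abs_of_pos less_imp_le\<close>)
      moreover have "(\<Sum>m\<in>?S. t m) = t (\<lambda>_. 0) + (\<Sum>m\<in>?S - {\<lambda>_. 0}. t m)"
        by (rule sum.remove[OF finS zero_box])
      ultimately show ?thesis using K_small by (simp add: t_def)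
    qed
    have sub: "(\<lambda>j. k j - l j) \<in> ?S - {\<lambda>_. 0}" if "k \<in> ?S" "l \<in> below k" for k l
    proof -
      have "(\<lambda>j. k j - l j) \<in> ?S" by (rule mi_box_downward[OF that(1)]) (simp add: le_fun_def)
      moreover have "(\<lambda>j. k j - l j) \<noteq> (\<lambda>_. 0)"
      proof
        assume "(\<lambda>j. k j - l j) = (\<lambda>_. 0)"
        then have "k \<le> l" by (auto simp: fun_eq_iff le_fun_def)
        then show False using that(2) by (auto simp: below_def)
      qed
      ultimately show ?thesis by blast
    qed
    have 1: "(\<Sum>k\<in>?S. \<Sum>l\<in>below k. t (\<lambda>j. k j - l j) * E k x) \<le> (\<Sum>k\<in>?S. (1 / 2) * E k x)"
    proof (rule sum_mono)
      fix k assume k: "k \<in> ?S"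
      have "(\<Sum>l\<in>below k. t (\<lambda>j. k j - l j)) = (\<Sum>m\<in>(\<lambda>l j. k j - l j) ` below k. t m)"
      proof (rule sum.reindex[symmetric, unfolded o_def], rule inj_onI)
        fix l l' assume l: "l \<in> below k" "l' \<in> below k" and eq: "(\<lambda>j. k j - l j) = (\<lambda>j. k j - l' j)"
        show "l = l'"
        proof
          fix j show "l j = l' j"
            using fun_cong[OF eq, of j] l by (auto simp: below_def le_fun_def) (metis diff_diff_cancel)
        qed
      qed
      also have "\<dots> \<le> (\<Sum>m\<in>?S - {\<lambda>_. 0}. t m)"
        by (rule sum_mono2) (use finS sub[OF k] t0 in auto)
      finally have "(\<Sum>l\<in>below k. t (\<lambda>j. k j - l j)) \<le> 1 / 2" using tS by linarith
      then show "(\<Sum>l\<in>below k. t (\<lambda>j. k j - l j) * E k x) \<le> (1 / 2) * E k x"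
        unfolding sum_distrib_right[symmetric] by (intro mult_right_mono E0)
    qed
    \<comment> \<open>Exchange the sums; for fixed \<open>l\<close> the differences \<open>k - l\<close> are distinct as well.\<close>
    have 2: "(\<Sum>k\<in>?S. \<Sum>l\<in>below k. t (\<lambda>j. k j - l j) * E l x) \<le> (\<Sum>l\<in>?S. (1 / 2) * E l x)"
    proof -
      have "(\<Sum>k\<in>?S. \<Sum>l\<in>below k. t (\<lambda>j. k j - l j) * E l x)
          = (\<Sum>k\<in>?S. \<Sum>l\<in>?S. if l \<in> below k then t (\<lambda>j. k j - l j) * E l x else 0)"
      proof (rule sum.cong[OF refl])
        fix k assume k: "k \<in> ?S"
        show "(\<Sum>l\<in>below k. t (\<lambda>j. k j - l j) * E l x)
            = (\<Sum>l\<in>?S. if l \<in> below k then t (\<lambda>j. k j - l j) * E l x else 0)"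
          by (rule sum.mono_neutral_cong_left[OF finS below(2)[OF k]]) auto
      qed
      also have "\<dots> = (\<Sum>l\<in>?S. \<Sum>k\<in>?S. if l \<in> below k then t (\<lambda>j. k j - l j) * E l x else 0)"
        by (rule sum.swap)
      also have "\<dots> \<le> (\<Sum>l\<in>?S. (1 / 2) * E l x)"
      proof (rule sum_mono)
        fix l assume l: "l \<in> ?S"
        let ?A = "{k \<in> ?S. l \<in> below k}"
        have "(\<Sum>k\<in>?A. t (\<lambda>j. k j - l j)) = (\<Sum>m\<in>(\<lambda>k j. k j - l j) ` ?A. t m)"
        proof (rule sum.reindex[symmetric, unfolded o_def], rule inj_onI)
          fix k k' assume k: "k \<in> ?A" "k' \<in> ?A" and eq: "(\<lambda>j. k j - l j) = (\<lambda>j. k' j - l j)"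
          show "k = k'"
          proof
            fix j
            have "l j \<le> k j" "l j \<le> k' j" using k by (auto simp: below_def le_fun_def)
            then show "k j = k' j" using fun_cong[OF eq, of j] by simp
          qed
        qed
        also have "\<dots> \<le> (\<Sum>m\<in>?S - {\<lambda>_. 0}. t m)"
        proof (rule sum_mono2)
          show "(\<lambda>k j. k j - l j) ` ?A \<subseteq> ?S - {\<lambda>_. 0}"
            by (rule image_subsetI, rule sub) auto
        qed (use finS t0 in auto)
        also have "\<dots> \<le> 1 / 2" by (rule tS)
        finally have sumA: "(\<Sum>k\<in>?A. t (\<lambda>j. k j - l j)) \<le> 1 / 2" .
        have "(\<Sum>k\<in>?S. if l \<in> below k then t (\<lambda>j. k j - l j) * E l x else 0) = (\<Sum>k\<in>?A. t (\<lambda>j. k j - l j)) * E l x"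
          using finS by (simp add: sum.If_cases sum_distrib_right Int_def)
        also have "\<dots> \<le> (1 / 2) * E l x" by (rule mult_right_mono[OF sumA E0])
        finally show "(\<Sum>k\<in>?S. if l \<in> below k then t (\<lambda>j. k j - l j) * E l x else 0) \<le> (1 / 2) * E l x" .
      qed
      finally show ?thesis .
    qed
    have "(\<Sum>k\<in>?S. \<Sum>l\<in>below k. t (\<lambda>j. k j - l j) * ((E l x + E k x) / 2))
        = ((\<Sum>k\<in>?S. \<Sum>l\<in>below k. t (\<lambda>j. k j - l j) * E l x) + (\<Sum>k\<in>?S. \<Sum>l\<in>below k. t (\<lambda>j. k j - l j) * E k x)) / 2"
      by (simp add: sum.distrib[symmetric] sum_divide_distrib distrib_left)
    also have "\<dots> \<le> (1 / 2) * (\<Sum>k\<in>?S. E k x)"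
    proof -
      have "X \<le> (\<Sum>k\<in>?S. (1 / 2) * E k x) \<Longrightarrow> Y \<le> (\<Sum>k\<in>?S. (1 / 2) * E k x)
          \<Longrightarrow> (X + Y) / 2 \<le> (1 / 2) * (\<Sum>k\<in>?S. E k x)" for X Y
        unfolding sum_distrib_left[symmetric] by argo
      from this[OF 2 1] show ?thesis .
    qed
    finally show ?thesis by (simp only: t_def)
  qed
  define T where "T = (\<Sum>k\<in>?S. \<integral>x. ?e x * E k x \<partial>lborel)"
  have "T \<le> (\<Sum>k\<in>?S. (if k = (\<lambda>_. 0) then inner F0 (G k) else 0)
      + (\<Sum>l\<in>below k. \<integral>x. \<bar>?\<theta> (\<lambda>j. k j - l j) x\<bar> * (?e x * ((E l x + E k x) / 2)) \<partial>lborel))"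
    unfolding T_def by (intro sum_mono step)
  also have "\<dots> = inner F0 (G (\<lambda>_. 0))
      + (\<Sum>k\<in>?S. \<Sum>l\<in>below k. \<integral>x. \<bar>?\<theta> (\<lambda>j. k j - l j) x\<bar> * (?e x * ((E l x + E k x) / 2)) \<partial>lborel)"
    using finS zero_box by (simp add: sum.distrib)
  also have "\<dots> \<le> inner F0 (G (\<lambda>_. 0)) + (1 / 2) * T"
  proof (rule add_left_mono)
    have i: "integrable lborel (\<lambda>x. \<bar>?\<theta> m x\<bar> * (?e x * ((E l x + E k x) / 2)))" for m k l
    proof -
      have "integrable lborel (\<lambda>x. (\<bar>?\<theta> m x\<bar> * (?e x * E l x) + \<bar>?\<theta> m x\<bar> * (?e x * E k x)) / 2)"
        using int_abs by simp
      then show ?thesis by (simp add: algebra_simps add_divide_distrib)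
    qed
    have "(\<Sum>k\<in>?S. \<Sum>l\<in>below k. \<integral>x. \<bar>?\<theta> (\<lambda>j. k j - l j) x\<bar> * (?e x * ((E l x + E k x) / 2)) \<partial>lborel)
        = (\<integral>x. (\<Sum>k\<in>?S. \<Sum>l\<in>below k. \<bar>?\<theta> (\<lambda>j. k j - l j) x\<bar> * (?e x * ((E l x + E k x) / 2))) \<partial>lborel)"
      using i by (simp add: Bochner_Integration.integral_sum Bochner_Integration.integrable_sum)
    also have "\<dots> \<le> (\<integral>x. (1 / 2) * (\<Sum>k\<in>?S. ?e x * E k x) \<partial>lborel)"
    proof (rule integral_mono)
      show "integrable lborel (\<lambda>x. \<Sum>k\<in>?S. \<Sum>l\<in>below k. \<bar>?\<theta> (\<lambda>j. k j - l j) x\<bar> * (?e x * ((E l x + E k x) / 2)))"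
        by (intro Bochner_Integration.integrable_sum i)
      show "integrable lborel (\<lambda>x. (1 / 2) * (\<Sum>k\<in>?S. ?e x * E k x))"
        by (intro integrable_mult_right Bochner_Integration.integrable_sum int)
      fix x
      have "(\<Sum>k\<in>?S. \<Sum>l\<in>below k. \<bar>?\<theta> (\<lambda>j. k j - l j) x\<bar> * (?e x * ((E l x + E k x) / 2)))
          = ?e x * (\<Sum>k\<in>?S. \<Sum>l\<in>below k. \<bar>?\<theta> (\<lambda>j. k j - l j) x\<bar> * ((E l x + E k x) / 2))"
        unfolding sum_distrib_left by (intro sum.cong refl) (rule mult.left_commute)
      also have "\<dots> \<le> ?e x * ((1 / 2) * (\<Sum>k\<in>?S. E k x))"
        by (intro mult_left_mono pointwise) simp
      also have "\<dots> = (1 / 2) * (\<Sum>k\<in>?S. ?e x * E k x)" by (simp add: sum_distrib_left)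
      finally show "(\<Sum>k\<in>?S. \<Sum>l\<in>below k. \<bar>?\<theta> (\<lambda>j. k j - l j) x\<bar> * (?e x * ((E l x + E k x) / 2))) \<le> (1 / 2) * (\<Sum>k\<in>?S. ?e x * E k x)" .
    qed
    also have "\<dots> = (1 / 2) * T" unfolding T_def using int by (simp add: Bochner_Integration.integral_sum)
    finally show "(\<Sum>k\<in>?S. \<Sum>l\<in>below k. \<integral>x. \<bar>?\<theta> (\<lambda>j. k j - l j) x\<bar> * (?e x * ((E l x + E k x) / 2)) \<partial>lborel)
      \<le> (1 / 2) * T" .
  qed
  finally have T_le: "T \<le> 2 * inner F0 (G (\<lambda>_. 0))" by simp
  define \<alpha> where "\<alpha> = c0 * exp (- b)"
  have \<alpha>: "\<alpha> > 0" using c0 by (simp add: \<alpha>_def)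
  have G0: "norm (G (\<lambda>_. 0)) \<le> norm F0 / \<alpha>"
  proof -
    have e: "{l. l \<le> (\<lambda>_. 0::nat) \<and> l \<noteq> (\<lambda>_. 0)} = {}" by (auto simp: le_fun_def)
    have "G (\<lambda>_. 0) = variational_solution W (L_op y) F0"
      unfolding G_def taylor_def taylor_coeff.simps[of _ _ _ _ "\<lambda>_. 0"] e
      using y by (simp add: zero_multi_index)
    then show ?thesis using variational_solution_norm_le[OF W co] by (simp add: \<alpha>_def)
  qed
  have "\<alpha> * (\<Sum>k\<in>?S. (norm (G k))\<^sup>2) \<le> T"
    unfolding T_def sum_distrib_left
  proof (rule sum_mono)
    fix k
    have "\<alpha> * (norm (G k))\<^sup>2 \<le> energy_form \<beta> ?e (G k) (G k)"
      unfolding \<alpha>_def by (rule energy_form_exp_ge[OF b]) (simp add: G_def taylor_mem)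
    then show "\<alpha> * (norm (G k))\<^sup>2 \<le> (\<integral>x. ?e x * E k x \<partial>lborel)" by (simp add: energy_form_def E_def G_def)
  qed
  also note T_le
  also have "2 * inner F0 (G (\<lambda>_. 0)) \<le> 2 * (norm F0 * (norm F0 / \<alpha>))"
    using norm_cauchy_schwarz[of F0 "G (\<lambda>_. 0)"] mult_left_mono[OF G0 norm_ge_zero[of F0]] by linarith
  finally have "(\<Sum>k\<in>?S. (norm (G k))\<^sup>2) \<le> 2 * (norm F0 * (norm F0 / \<alpha>)) / \<alpha>"
    using \<alpha> by (simp add: pos_le_divide_eq mult.commute)
  also have "\<dots> = 2 * (norm F0)\<^sup>2 / c0\<^sup>2 * exp (2 * b)"
  proof -
    have "exp (2 * b) * (exp (- b) * exp (- b)) = 1" by (simp flip: exp_add)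
    then show ?thesis using c0 by (simp add: \<alpha>_def power2_eq_square divide_simps)
  qed
  finally show ?thesis by (simp only: G_def)
qed

end

section \<open>Weighted summability and the rate of convergence\<close>

lemma multi_index_induct [consumes 1, case_names zero incr]:
  assumes "k \<in> multi_indices" and zero: "P (\<lambda>_. 0)"
    and incr: "\<And>k j. k \<in> multi_indices \<Longrightarrow> P k \<Longrightarrow> P (incr j k)"
  shows "P k"
  using assms(1)
proof (induction k rule: measure_induct_rule[where f = mi_degree])
  case (less k)
  show ?case
  proof (cases "k = (\<lambda>_. 0)")
    case False
    then obtain j where j: "k j \<noteq> 0" by (auto simp: fun_eq_iff)
    define l where "l = k(j := k j - 1)"
    have le: "l \<le> k" by (simp add: l_def le_fun_def)
    have "l j \<noteq> k j" using j by (simp add: l_def)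
    then have "l \<noteq> k" by auto
    have k: "k = incr j l" using j by (simp add: l_def incr_def)
    have l: "l \<in> multi_indices" by (rule multi_index_le[OF less.prems le])
    show ?thesis
      unfolding k by (rule incr[OF l less.IH[OF mi_degree_less[OF less.prems le \<open>l \<noteq> k\<close>] l]])
  qed (simp add: zero)
qed

lemma (in sigma_finite_measure) measurable_AE_collect:
  assumes "Measurable.pred (N \<Otimes>\<^sub>M M) (\<lambda>(y, x). P y x)"
  shows "{y \<in> space N. AE x in M. P y x} \<in> sets N"
proof -
  let ?A = "{z \<in> space (N \<Otimes>\<^sub>M M). \<not> (case z of (y, x) \<Rightarrow> P y x)}"
  have A: "?A \<in> sets (N \<Otimes>\<^sub>M M)" using assms by measurable
  have "(AE x in M. P y x) \<longleftrightarrow> emeasure M (Pair y -` ?A) = 0" if y: "y \<in> space N" for y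
  proof -
    have eq: "Pair y -` ?A = {x \<in> space M. \<not> P y x}" using y by (auto simp: space_pair_measure)
    have "Pair y -` ?A \<in> sets M" by (rule sets_Pair1[OF A])
    then show ?thesis unfolding eq by (rule AE_iff_measurable) simp
  qed
  then have "{y \<in> space N. AE x in M. P y x} = {y \<in> space N. emeasure M (Pair y -` ?A) = 0}" by auto
  also have "\<dots> \<in> sets N" using measurable_emeasure_Pair[OF A] by measurable
  finally show ?thesis .
qed

lemma pred_summable [measurable (raw)]:
  fixes f :: "nat \<Rightarrow> 'm \<Rightarrow> real"
  assumes [measurable]: "\<And>i. f i \<in> borel_measurable M"
  shows "Measurable.pred M (\<lambda>z. summable (\<lambda>i. f i z))"
  unfolding summable_iff_convergent Cauchy_convergent_iff[symmetric] pred_def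
  by (rule sets_Collect_Cauchy) (rule borel_measurable_sum, rule assms)

context lognormal_problem
begin

lemma kappa_series_pair_measurable [measurable]:
  "(\<lambda>(y, x). kappa_series \<kappa> y x) \<in> borel_measurable (gauss \<Otimes>\<^sub>M lborel)"
proof -
  have [measurable]: "(\<lambda>z. fst z j) \<in> borel_measurable (gauss \<Otimes>\<^sub>M lborel)" for j
    by (rule measurable_compose[OF measurable_fst measurable_gauss_component])
  show ?thesis unfolding kappa_series_def split_beta' by measurable
qed

lemma param_sets: "param \<in> sets gauss"
proof -
  have [measurable]: "(\<lambda>z. fst z j) \<in> borel_measurable (gauss \<Otimes>\<^sub>M lborel)" for j
    by (rule measurable_compose[OF measurable_fst measurable_gauss_component])
  have "{y \<in> space gauss. AE x in lborel. summable (\<lambda>j. y j * \<kappa> j x)} \<in> sets gauss"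
    by (rule lborel.measurable_AE_collect) (unfold split_beta', measurable)
  moreover have "{y \<in> space gauss. AE x in lborel. \<bar>kappa_series \<kappa> y x\<bar> \<le> real n} \<in> sets gauss" for n :: nat
    by (rule lborel.measurable_AE_collect)
      (use kappa_series_pair_measurable in \<open>unfold split_beta', measurable\<close>)
  moreover have "param = {y \<in> space gauss. AE x in lborel. summable (\<lambda>j. y j * \<kappa> j x)}
      \<inter> (\<Union>n::nat. {y \<in> space gauss. AE x in lborel. \<bar>kappa_series \<kappa> y x\<bar> \<le> real n})"
  proof -
    have "(\<exists>b. AE x in lborel. \<bar>kappa_series \<kappa> y x\<bar> \<le> b) \<longleftrightarrow> (\<exists>n::nat. AE x in lborel. \<bar>kappa_series \<kappa> y x\<bar> \<le> real n)" for y
    proof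
      assume "\<exists>b. AE x in lborel. \<bar>kappa_series \<kappa> y x\<bar> \<le> b"
      then obtain b where b: "AE x in lborel. \<bar>kappa_series \<kappa> y x\<bar> \<le> b" by blast
      have "AE x in lborel. \<bar>kappa_series \<kappa> y x\<bar> \<le> real (nat \<lceil>b\<rceil>)"
        using b by eventually_elim (use real_nat_ceiling_ge[of b] in linarith)
      then show "\<exists>n::nat. AE x in lborel. \<bar>kappa_series \<kappa> y x\<bar> \<le> real n" by blast
    qed blast
    then show ?thesis by (auto simp: param_def)
  qed
  ultimately show ?thesis by simp
qed

lemma taylor_0: "taylor (\<lambda>_. 0) y = (if y \<in> param then variational_solution W (L_op y) F0 else 0)"
proof -
  have e: "{l. l \<le> (\<lambda>_. 0::nat) \<and> l \<noteq> (\<lambda>_. 0)} = {}" by (auto simp: le_fun_def)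
  show ?thesis
    unfolding taylor_def taylor_coeff.simps[of _ _ _ _ "\<lambda>_. 0"] e by (simp add: zero_multi_index)
qed

text \<open>
  For index \<open>0\<close> this is the measurability of solutions, and every further coefficient is a limit of
  difference quotients of an earlier one.
\<close>

lemma taylor_measurable:
  assumes "k \<in> multi_indices"
  shows "taylor k \<in> borel_measurable gauss"
  using assms
proof (induction rule: multi_index_induct)
  case zero
  have eq: "taylor (\<lambda>_. 0) = (\<lambda>y. if y \<in> param then variational_solution W (L_op y) F0 else 0)"
    by (rule ext) (rule taylor_0)
  have P: "{y \<in> space gauss. y \<in> param} \<in> sets gauss" using param_sets by simp
  show ?case
    unfolding eq measurable_If_restrict_space_iff[OF P]
  proof (intro conjI variational_solution_measurable[OF W])
    fix u v
    have m: "(\<lambda>y. energy_form \<beta> (\<lambda>x. exp (kappa_series \<kappa> y x)) u v + inner (B0 u) v) \<in> borel_measurable gauss"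
    proof -
      have "(\<lambda>(y, x). exp (kappa_series \<kappa> y x) * energy_density \<beta> u v x) \<in> borel_measurable (gauss \<Otimes>\<^sub>M lborel)"
        using kappa_series_pair_measurable unfolding split_beta' by measurable
      from lborel.borel_measurable_lebesgue_integral[OF this] show ?thesis
        unfolding energy_form_def by simp
    qed
    show "(\<lambda>y. inner (L_op y u) v) \<in> borel_measurable (restrict_space gauss {y. y \<in> param})"
    proof (subst measurable_cong)
      fix y assume "y \<in> space (restrict_space gauss {y. y \<in> param})"
      then have "y \<in> param" by (simp add: space_restrict_space)
      then obtain b where "AE x in lborel. \<bar>kappa_series \<kappa> y x\<bar> \<le> b" by (rule param_bound)
      then show "inner (L_op y u) v = energy_form \<beta> (\<lambda>x. exp (kappa_series \<kappa> y x)) u v + inner (B0 u) v"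
        by (rule inner_L_op)
    qed (rule measurable_restrict_space1[OF m])
  next
    fix y assume "y \<in> space (restrict_space gauss {y. y \<in> param})"
    then have "y \<in> param" by (simp add: space_restrict_space)
    then obtain b where "AE x in lborel. \<bar>kappa_series \<kappa> y x\<bar> \<le> b" by (rule param_bound)
    then show "\<exists>\<alpha>. coercive_on W \<alpha> (L_op y)" using coercive_L_op by blast
  qed simp
next
  case (incr k j)
  note [measurable] = incr.IH
  let ?r = "\<rho> j / real (Suc (k j))"
  \<comment> \<open>Difference quotients with step \<open>1 / (n + 1)\<close>, scaled so that they tend to the coefficient of index \<open>incr j k\<close>.\<close>
  define q where "q n y = (?r * real (Suc n)) *\<^sub>R (taylor k (y(j := y j + 1 / real (Suc n))) - taylor k y)" for n y
  show ?case
  proof (rule borel_measurable_LIMSEQ_metric)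
    show "q n \<in> borel_measurable gauss" for n
      unfolding q_def by measurable
    fix y
    have "((\<lambda>s. (1 / (s - y j)) *\<^sub>R (taylor k (y(j := s)) - taylor k (y(j := y j))))
        \<longlongrightarrow> (real (Suc (k j)) / \<rho> j) *\<^sub>R taylor (incr j k) (y(j := y j))) (at (y j))"
      using taylor_has_vector_derivative[OF incr.hyps, of y j "y j"] unfolding has_vector_derivative_iff_quotient .
    moreover have "filterlim (\<lambda>n. y j + 1 / real (Suc n)) (at (y j)) sequentially"
    proof (rule filterlim_atI)
      have "(\<lambda>n. y j + 1 / real (Suc n)) \<longlonglongrightarrow> y j + 0"
        by (intro tendsto_add tendsto_const LIMSEQ_Suc[OF lim_1_over_n])
      then show "(\<lambda>n. y j + 1 / real (Suc n)) \<longlonglongrightarrow> y j" by simp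
    qed simp
    ultimately have "(\<lambda>n. (1 / (y j + 1 / real (Suc n) - y j)) *\<^sub>R (taylor k (y(j := y j + 1 / real (Suc n))) - taylor k (y(j := y j))))
        \<longlonglongrightarrow> (real (Suc (k j)) / \<rho> j) *\<^sub>R taylor (incr j k) (y(j := y j))"
      by (rule filterlim_compose)
    then have "(\<lambda>n. ?r *\<^sub>R ((1 / (y j + 1 / real (Suc n) - y j)) *\<^sub>R (taylor k (y(j := y j + 1 / real (Suc n))) - taylor k (y(j := y j)))))
        \<longlonglongrightarrow> ?r *\<^sub>R ((real (Suc (k j)) / \<rho> j) *\<^sub>R taylor (incr j k) (y(j := y j)))"
      by (rule tendsto_scaleR[OF tendsto_const])
    moreover have "?r *\<^sub>R ((real (Suc (k j)) / \<rho> j) *\<^sub>R taylor (incr j k) (y(j := y j))) = taylor (incr j k) y"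
      using \<rho>[of j] by simp
    moreover have "?r *\<^sub>R ((1 / (y j + 1 / real (Suc n) - y j)) *\<^sub>R (taylor k (y(j := y j + 1 / real (Suc n))) - taylor k (y(j := y j)))) = q n y" for n
      by (simp add: q_def)
    ultimately show "(\<lambda>n. q n y) \<longlonglongrightarrow> taylor (incr j k) y" by simp
  qed
qed

end

locale lognormal_problem_summable = lognormal_problem W \<beta> c0 K \<kappa> \<rho> B0 F0
  for W :: "('a::euclidean_space sobolev \<times> 'a sobolev) set" and \<beta> c0 K \<kappa> \<rho> B0 F0 +
  fixes q :: real
  assumes q: "q > 0" and summable_\<rho>: "summable (\<lambda>j. (1 / \<rho> j) powr q)"
begin

text \<open>
  If \<open>\<bar>y\<^sub>j\<bar> \<le> B \<rho>\<^sub>j\<close> for all \<open>j\<close>, then \<open>\<bar>\<kappa>(y)\<bar> \<le> B K\<close>; in particular almost every \<open>y\<close> belongs to \<open>param\<close>.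
\<close>

lemma taylor_sum_integrable_bound:
  obtains \<Phi> where "integrable gauss \<Phi>"
    "AE y in gauss. \<forall>n N. (\<Sum>k\<in>mi_box n N. (norm (taylor k y))\<^sup>2) \<le> \<Phi> y"
proof -
  \<comment> \<open>The constant \<open>2 * K\<close> would do; the summand \<open>1\<close> makes it positive also if \<open>K = 0\<close>.\<close>
  have c: "2 * K + 1 > 0" using K_nonneg by simp
  obtain \<Psi> where \<Psi>: "integrable gauss \<Psi>"
    "AE y in gauss. \<exists>B\<ge>0. (\<forall>j. \<bar>y j\<bar> \<le> B * \<rho> j) \<and> exp ((2 * K + 1) * B) \<le> \<Psi> y"
    by (rule gauss_exp_weighted_sup[OF \<rho> q summable_\<rho> c]) (rule that)
  let ?C = "2 * (norm F0)\<^sup>2 / c0\<^sup>2"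
  have C: "?C \<ge> 0" by simp
  have "AE y in gauss. \<forall>n N. (\<Sum>k\<in>mi_box n N. (norm (taylor k y))\<^sup>2) \<le> ?C * \<Psi> y"
    using \<Psi>(2)
  proof eventually_elim
    case (elim y)
    then obtain B where B: "B \<ge> 0" "\<And>j. \<bar>y j\<bar> \<le> B * \<rho> j" "exp ((2 * K + 1) * B) \<le> \<Psi> y" by blast
    have term_le: "norm (y j * \<kappa> j x) \<le> B * (\<rho> j * \<bar>\<kappa> j x\<bar>)" for j x
      using mult_right_mono[OF B(2)[of j], of "\<bar>\<kappa> j x\<bar>"] by (simp add: abs_mult mult.assoc)
    have sum_\<kappa>: "summable (\<lambda>j. \<rho> j * \<bar>\<kappa> j x\<bar>)" for x
      by (rule summableI_nonneg_bounded[OF _ K]) (simp add: \<rho> less_imp_le)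
    have sum_abs: "summable (\<lambda>j. norm (y j * \<kappa> j x))" for x
      by (rule summable_comparison_test'[OF summable_mult[OF sum_\<kappa>, of B]]) (use term_le in simp)
    have bound: "\<bar>kappa_series \<kappa> y x\<bar> \<le> B * K" for x
    proof -
      have "\<bar>kappa_series \<kappa> y x\<bar> \<le> (\<Sum>j. norm (y j * \<kappa> j x))"
        unfolding kappa_series_def using summable_norm[OF sum_abs] by simp
      also have "\<dots> \<le> (\<Sum>j. B * (\<rho> j * \<bar>\<kappa> j x\<bar>))"
        by (rule suminf_le[OF term_le sum_abs summable_mult[OF sum_\<kappa>]])
      also have "\<dots> = B * (\<Sum>j. \<rho> j * \<bar>\<kappa> j x\<bar>)" by (rule suminf_mult[OF sum_\<kappa>])
      also have "\<dots> \<le> B * K"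
        by (intro mult_left_mono B suminf_le_const[OF sum_\<kappa>] K)
      finally show ?thesis .
    qed
    have "summable (\<lambda>j. y j * \<kappa> j x)" for x by (rule summable_norm_cancel[OF sum_abs])
    then have y: "y \<in> param" using bound by (auto simp: param_def)
    have "(\<Sum>k\<in>mi_box n N. (norm (taylor k y))\<^sup>2) \<le> ?C * \<Psi> y" for n N
    proof -
      have "(\<Sum>k\<in>mi_box n N. (norm (taylor k y))\<^sup>2) \<le> ?C * exp (2 * (B * K))"
        by (rule taylor_sum_le[OF y]) (simp add: bound)
      also have "\<dots> \<le> ?C * \<Psi> y"
      proof (rule mult_left_mono[OF _ C])
        have "2 * (B * K) \<le> (2 * K + 1) * B" using B(1) by (simp add: algebra_simps)
        then have "exp (2 * (B * K)) \<le> exp ((2 * K + 1) * B)" by simp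
        then show "exp (2 * (B * K)) \<le> \<Psi> y" using B(3) by linarith
      qed
      finally show ?thesis .
    qed
    then show ?case by blast
  qed
  moreover have "integrable gauss (\<lambda>y. ?C * \<Psi> y)" by (rule integrable_mult_right[OF \<Psi>(1)])
  ultimately show ?thesis by (intro that)
qed

lemma taylor_gauss_L2:
  assumes k: "k \<in> multi_indices"
  shows "taylor k \<in> gauss_L2"
proof -
  note [measurable] = taylor_measurable[OF k]
  obtain \<Phi> where \<Phi>: "integrable gauss \<Phi>"
    "AE y in gauss. \<forall>n N. (\<Sum>k\<in>mi_box n N. (norm (taylor k y))\<^sup>2) \<le> \<Phi> y"
    by (rule taylor_sum_integrable_bound) (rule that)
  obtain n N where "{k} \<subseteq> mi_box n N" by (rule mi_box_supset[of "{k}"]) (use k in auto)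
  then have kS: "k \<in> mi_box n N" by simp
  have "integrable gauss (\<lambda>y. (norm (taylor k y))\<^sup>2)"
  proof (rule Bochner_Integration.integrable_bound[OF \<Phi>(1)])
    show "AE y in gauss. norm ((norm (taylor k y))\<^sup>2) \<le> norm (\<Phi> y)"
      using \<Phi>(2)
    proof eventually_elim
      case (elim y)
      have "(norm (taylor k y))\<^sup>2 \<le> (\<Sum>k\<in>mi_box n N. (norm (taylor k y))\<^sup>2)"
        by (rule member_le_sum[OF kS]) (simp_all add: finite_mi_box)
      also have "\<dots> \<le> \<Phi> y" using elim by blast
      finally show ?case by simp
    qed
  qed measurable
  then show ?thesis by (simp add: gauss_L2_def taylor_measurable[OF k])
qed

lemma taylor_sum_integral_bound:
  obtains C where "C \<ge> 0" "\<And>n N. (\<Sum>k\<in>mi_box n N. integral\<^sup>L gauss (\<lambda>y. (norm (taylor k y))\<^sup>2)) \<le> C"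
proof -
  obtain \<Phi> where \<Phi>: "integrable gauss \<Phi>"
    "AE y in gauss. \<forall>n N. (\<Sum>k\<in>mi_box n N. (norm (taylor k y))\<^sup>2) \<le> \<Phi> y"
    by (rule taylor_sum_integrable_bound) (rule that)
  have le: "(\<Sum>k\<in>mi_box n N. integral\<^sup>L gauss (\<lambda>y. (norm (taylor k y))\<^sup>2)) \<le> integral\<^sup>L gauss \<Phi>" for n N
  proof -
    have int: "integrable gauss (\<lambda>y. (norm (taylor k y))\<^sup>2)" if "k \<in> mi_box n N" for k
      using that mi_box_multi_indices by (intro gauss_L2_integrable taylor_gauss_L2) blast
    have "(\<Sum>k\<in>mi_box n N. integral\<^sup>L gauss (\<lambda>y. (norm (taylor k y))\<^sup>2))
        = integral\<^sup>L gauss (\<lambda>y. \<Sum>k\<in>mi_box n N. (norm (taylor k y))\<^sup>2)"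
      by (rule Bochner_Integration.integral_sum[symmetric]) (rule int)
    also have "\<dots> \<le> integral\<^sup>L gauss \<Phi>"
    proof (rule integral_mono_AE[OF _ \<Phi>(1)])
      show "integrable gauss (\<lambda>y. \<Sum>k\<in>mi_box n N. (norm (taylor k y))\<^sup>2)"
        by (intro Bochner_Integration.integrable_sum int)
      show "AE y in gauss. (\<Sum>k\<in>mi_box n N. (norm (taylor k y))\<^sup>2) \<le> \<Phi> y"
        using \<Phi>(2) by eventually_elim blast
    qed
    finally show ?thesis .
  qed
  have "0 \<le> integral\<^sup>L gauss \<Phi>" using le[of 0 0] by (rule order_trans[rotated]) (intro sum_nonneg; simp)
  then show ?thesis using le by (rule that)
qed

text \<open>
  For \<open>k\<^sub>j = min \<nu>\<^sub>j r\<close> and \<open>\<mu> = \<nu> - k\<close> this is the weight \<open>b\<^sub>\<nu>\<close>.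
\<close>

definition coeff_factor :: "(nat \<Rightarrow> nat) \<Rightarrow> (nat \<Rightarrow> nat) \<Rightarrow> real" where
  "coeff_factor k \<mu> = (\<Prod>j | k j \<noteq> 0. real ((k j + \<mu> j) choose k j) / fact (k j) * \<rho> j ^ (2 * k j))"

lemma coeff_factor_incr:
  assumes k: "k \<in> multi_indices"
  shows "coeff_factor (incr j k) \<mu> = (\<rho> j / real (Suc (k j)))\<^sup>2 * real (Suc (\<mu> j)) * coeff_factor k (incr j \<mu>)"
proof -
  define J where "J = insert j {i. k i \<noteq> 0}"
  have J: "finite J" "j \<in> J" using k by (auto simp: J_def multi_indices_def)
  let ?f = "\<lambda>k \<mu> j. real ((k + \<mu>) choose k) / fact k * \<rho> j ^ (2 * k)"
  have eq: "coeff_factor l \<nu> = (\<Prod>i\<in>J. ?f (l i) (\<nu> i) i)" if "{i. l i \<noteq> 0} \<subseteq> J" for l \<nu>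
    unfolding coeff_factor_def by (rule prod.mono_neutral_left[OF J(1) that]) auto
  have f: "?f (Suc a) b j = (\<rho> j / real (Suc a))\<^sup>2 * real (Suc b) * ?f a (Suc b) j" for a b
  proof -
    have "real (Suc a) * real (Suc (a + b) choose Suc a) = real (Suc b) * real (Suc (a + b) choose a)"
      using Suc_times_binomial_add[of a b] by (simp only: of_nat_mult[symmetric])
    then have eq: "real (Suc (a + b) choose Suc a) = real (Suc b) * real (Suc (a + b) choose a) / real (Suc a)"
      by (simp only: eq_divide_eq) (simp add: mult.commute)
    have "s * X / m / (m * F) * (t\<^sup>2 * P) = (t / m)\<^sup>2 * s * (X / F * P)" for s X m F t P :: real
      unfolding power_divide power2_eq_square divide_inverse inverse_mult_distrib by (simp only: mult_ac)
    then show ?thesis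
      by (simp only: add_Suc add_Suc_right eq fact_Suc of_nat_mult mult_Suc_right power_add)
  qed
  have "coeff_factor (incr j k) \<mu> = (\<Prod>i\<in>J. ?f (incr j k i) (\<mu> i) i)"
    by (rule eq) (auto simp: J_def incr_apply)
  also have "\<dots> = ?f (Suc (k j)) (\<mu> j) j * (\<Prod>i\<in>J - {j}. ?f (incr j k i) (\<mu> i) i)"
    by (subst prod.remove[OF J]) (simp add: incr_apply)
  also have "(\<Prod>i\<in>J - {j}. ?f (incr j k i) (\<mu> i) i) = (\<Prod>i\<in>J - {j}. ?f (k i) (incr j \<mu> i) i)"
    by (rule prod.cong) (auto simp: incr_apply)
  also have "?f (Suc (k j)) (\<mu> j) j = (\<rho> j / real (Suc (k j)))\<^sup>2 * real (Suc (\<mu> j)) * ?f (k j) (incr j \<mu> j) j"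
    unfolding f by (simp add: incr_apply)
  finally have "coeff_factor (incr j k) \<mu> = (\<rho> j / real (Suc (k j)))\<^sup>2 * real (Suc (\<mu> j)) *
      (?f (k j) (incr j \<mu> j) j * (\<Prod>i\<in>J - {j}. ?f (k i) (incr j \<mu> i) i))"
    by (simp only: mult.assoc)
  also have "?f (k j) (incr j \<mu> j) j * (\<Prod>i\<in>J - {j}. ?f (k i) (incr j \<mu> i) i) = coeff_factor k (incr j \<mu>)"
    by (subst prod.remove[OF J, symmetric], rule eq[symmetric]) (auto simp: J_def)
  finally show ?thesis .
qed

text \<open>
  Raising the coordinate \<open>j\<close> of \<open>k\<close> by one is a derivative divided by \<open>(k\<^sub>j + 1) / \<rho>\<^sub>j\<close>, and the derivative
  raises \<open>\<mu>\<^sub>j\<close> at the price of a factor \<open>sqrt (\<mu>\<^sub>j + 1)\<close>.  Iterating this moves all of \<open>k\<close> to the second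
  argument; the squared factors multiply to \<open>coeff_factor\<close>.
\<close>

lemma hermite_coeff_taylor:
  assumes "k \<in> multi_indices" "\<mu> \<in> multi_indices"
  shows "(norm (hermite_coeff (taylor k) \<mu>))\<^sup>2
    = coeff_factor k \<mu> * (norm (hermite_coeff (taylor (\<lambda>_. 0)) (\<lambda>j. k j + \<mu> j)))\<^sup>2"
  using assms
proof (induction k arbitrary: \<mu> rule: multi_index_induct)
  case zero
  then show ?case by (simp add: coeff_factor_def)
next
  case (incr k j)
  let ?c = "real (Suc (k j)) / \<rho> j"
  have c: "?c > 0" using \<rho>[of j] by simp
  have \<mu>: "incr j \<mu> \<in> multi_indices" by (rule incr_multi_index[OF incr.prems])
  have g: "(\<lambda>y. ?c *\<^sub>R taylor (incr j k) y) \<in> gauss_L2"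
    by (rule gauss_L2_scaleR[OF taylor_gauss_L2[OF incr_multi_index[OF incr.hyps]]])
  have "hermite_coeff (\<lambda>y. ?c *\<^sub>R taylor (incr j k) y) \<mu>
      = sqrt (real (Suc (\<mu> j))) *\<^sub>R hermite_coeff (taylor k) (\<mu>(j := Suc (\<mu> j)))"
  proof (rule hermite_coeff_derivative[OF taylor_gauss_L2[OF incr.hyps] g incr.prems taylor_has_vector_derivative[OF incr.hyps]])
    show "isCont (\<lambda>t. ?c *\<^sub>R taylor (incr j k) (y(j := t))) t" for y t
      using taylor_has_vector_derivative[OF incr_multi_index[OF incr.hyps], of j y j t]
      by (intro continuous_intros has_vector_derivative_continuous)
  qed
  moreover have "hermite_coeff (\<lambda>y. ?c *\<^sub>R taylor (incr j k) y) \<mu> = ?c *\<^sub>R hermite_coeff (taylor (incr j k)) \<mu>"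
    unfolding hermite_coeff_def by (simp only: scaleR_left_commute[of _ ?c] integral_scaleR_right)
  ultimately have eq: "?c *\<^sub>R hermite_coeff (taylor (incr j k)) \<mu> = sqrt (real (Suc (\<mu> j))) *\<^sub>R hermite_coeff (taylor k) (incr j \<mu>)"
    by (simp only: incr_def)
  have "?c\<^sup>2 * (norm (hermite_coeff (taylor (incr j k)) \<mu>))\<^sup>2 = (norm (?c *\<^sub>R hermite_coeff (taylor (incr j k)) \<mu>))\<^sup>2"
    by (simp only: norm_scaleR power_mult_distrib power2_abs)
  also have "\<dots> = real (Suc (\<mu> j)) * (norm (hermite_coeff (taylor k) (incr j \<mu>)))\<^sup>2"
    unfolding eq by (simp add: power_mult_distrib)
  also have "(norm (hermite_coeff (taylor k) (incr j \<mu>)))\<^sup>2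
      = coeff_factor k (incr j \<mu>) * (norm (hermite_coeff (taylor (\<lambda>_. 0)) (\<lambda>i. k i + incr j \<mu> i)))\<^sup>2"
    by (rule incr.IH[OF \<mu>])
  also have "(\<lambda>i. k i + incr j \<mu> i) = (\<lambda>i. incr j k i + \<mu> i)" by (auto simp: incr_apply)
  finally have *: "?c\<^sup>2 * (norm (hermite_coeff (taylor (incr j k)) \<mu>))\<^sup>2
      = real (Suc (\<mu> j)) * (coeff_factor k (incr j \<mu>) * (norm (hermite_coeff (taylor (\<lambda>_. 0)) (\<lambda>i. incr j k i + \<mu> i)))\<^sup>2)" .
  have "(norm (hermite_coeff (taylor (incr j k)) \<mu>))\<^sup>2
      = (1 / ?c)\<^sup>2 * (real (Suc (\<mu> j)) * (coeff_factor k (incr j \<mu>) * (norm (hermite_coeff (taylor (\<lambda>_. 0)) (\<lambda>i. incr j k i + \<mu> i)))\<^sup>2))"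
  proof -
    have "X = (1 / a)\<^sup>2 * Y" if "a\<^sup>2 * X = Y" "a > 0" for a X Y :: real
      using that by (auto simp: power_divide)
    from this[OF * c] show ?thesis .
  qed
  also have "1 / ?c = \<rho> j / real (Suc (k j))" by simp
  finally show ?case by (simp only: coeff_factor_incr[OF incr.hyps] mult.assoc)
qed

text \<open>
  Each \<open>\<nu>\<close> is the sum of \<open>low \<nu>\<close>, its truncation at \<open>r\<close>, and the rest \<open>high \<nu>\<close>.  The indices with a common
  \<open>low \<nu> = k\<close> are treated by Bessel's inequality for the Taylor coefficient of index \<open>k\<close>.  Truncation
  keeps the support, which makes every coordinate in the support contribute a power of \<open>\<rho>\<^sub>j\<close>.
\<close>

theorem hermite_coeff_weighted_summable:
  assumes r: "r \<ge> 1"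
  obtains C where "C \<ge> 0" "\<And>T. finite T \<Longrightarrow> T \<subseteq> multi_indices \<Longrightarrow>
    (\<Sum>\<nu>\<in>T. mi_weight r \<rho> \<nu> * (norm (hermite_coeff (taylor (\<lambda>_. 0)) \<nu>))\<^sup>2) \<le> C"
proof -
  obtain C where C: "C \<ge> 0" "\<And>n N. (\<Sum>k\<in>mi_box n N. integral\<^sup>L gauss (\<lambda>y. (norm (taylor k y))\<^sup>2)) \<le> C"
    by (rule taylor_sum_integral_bound) (rule that)
  have "(\<Sum>\<nu>\<in>T. mi_weight r \<rho> \<nu> * (norm (hermite_coeff (taylor (\<lambda>_. 0)) \<nu>))\<^sup>2) \<le> C"
    if T: "finite T" "T \<subseteq> multi_indices" for T
  proof -
    define low where "low \<nu> = (\<lambda>j. min (\<nu> j) r)" for \<nu> :: "nat \<Rightarrow> nat"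
    define high where "high \<nu> = (\<lambda>j. \<nu> j - min (\<nu> j) r)" for \<nu> :: "nat \<Rightarrow> nat"
    have low: "low \<nu> \<in> multi_indices" and high: "high \<nu> \<in> multi_indices" if "\<nu> \<in> T" for \<nu>
    proof -
      have \<nu>: "\<nu> \<in> multi_indices" using that T(2) by blast
      show "low \<nu> \<in> multi_indices" "high \<nu> \<in> multi_indices"
        by (rule multi_index_le[OF \<nu>]; simp add: low_def high_def le_fun_def)+
    qed
    have add: "(\<lambda>j. low \<nu> j + high \<nu> j) = \<nu>" for \<nu> by (auto simp: low_def high_def)
    have factor: "coeff_factor (low \<nu>) (high \<nu>) = mi_weight r \<rho> \<nu>" for \<nu>
    proof -
      have "{j. low \<nu> j \<noteq> 0} = {j. \<nu> j \<noteq> 0}" using r by (auto simp: low_def)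
      moreover have "low \<nu> j + high \<nu> j = \<nu> j" for j using fun_cong[OF add[of \<nu>], of j] .
      ultimately show ?thesis unfolding coeff_factor_def mi_weight_def coord_weight_def by (simp add: low_def)
    qed
    obtain n N where S: "low ` T \<subseteq> mi_box n N"
      by (rule mi_box_supset[of "low ` T"]) (use T low in auto)
    have "(\<Sum>\<nu>\<in>T. mi_weight r \<rho> \<nu> * (norm (hermite_coeff (taylor (\<lambda>_. 0)) \<nu>))\<^sup>2)
        = (\<Sum>\<nu>\<in>T. (norm (hermite_coeff (taylor (low \<nu>)) (high \<nu>)))\<^sup>2)"
    proof (rule sum.cong[OF refl])
      fix \<nu> assume "\<nu> \<in> T"
      from hermite_coeff_taylor[OF low[OF this] high[OF this]]
      show "mi_weight r \<rho> \<nu> * (norm (hermite_coeff (taylor (\<lambda>_. 0)) \<nu>))\<^sup>2 = (norm (hermite_coeff (taylor (low \<nu>)) (high \<nu>)))\<^sup>2"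
        unfolding factor add by simp
    qed
    also have "\<dots> = (\<Sum>k\<in>mi_box n N. \<Sum>\<nu>\<in>{\<nu> \<in> T. low \<nu> = k}. (norm (hermite_coeff (taylor (low \<nu>)) (high \<nu>)))\<^sup>2)"
      by (rule sum.group[OF T(1) finite_mi_box S, symmetric])
    also have "\<dots> \<le> (\<Sum>k\<in>mi_box n N. integral\<^sup>L gauss (\<lambda>y. (norm (taylor k y))\<^sup>2))"
    proof (rule sum_mono)
      fix k assume "k \<in> mi_box n N"
      then have k: "k \<in> multi_indices" using mi_box_multi_indices by blast
      let ?U = "{\<nu> \<in> T. low \<nu> = k}"
      have inj: "inj_on high ?U"
      proof (rule inj_onI)
        fix \<nu> \<nu>' assume "\<nu> \<in> ?U" "\<nu>' \<in> ?U" "high \<nu> = high \<nu>'"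
        then show "\<nu> = \<nu>'" using add[of \<nu>] add[of \<nu>'] by simp
      qed
      have "(\<Sum>\<nu>\<in>?U. (norm (hermite_coeff (taylor (low \<nu>)) (high \<nu>)))\<^sup>2) = (\<Sum>\<nu>\<in>?U. (norm (hermite_coeff (taylor k) (high \<nu>)))\<^sup>2)"
        by (rule sum.cong) auto
      also have "\<dots> = (\<Sum>\<mu>\<in>high ` ?U. (norm (hermite_coeff (taylor k) \<mu>))\<^sup>2)"
        by (rule sum.reindex[OF inj, symmetric, unfolded o_def])
      also have "\<dots> \<le> integral\<^sup>L gauss (\<lambda>y. (norm (taylor k y))\<^sup>2)"
        by (rule hermite_Bessel[OF _ _ taylor_gauss_L2[OF k]]) (use T(1) high in auto)
      finally show "(\<Sum>\<nu>\<in>?U. (norm (hermite_coeff (taylor (low \<nu>)) (high \<nu>)))\<^sup>2) \<le> integral\<^sup>L gauss (\<lambda>y. (norm (taylor k y))\<^sup>2)" .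
    qed
    also have "\<dots> \<le> C" by (rule C)
    finally show ?thesis .
  qed
  with C(1) show ?thesis by (rule that)
qed

text \<open>
  The number \<open>r\<close> of derivatives per coordinate is chosen such that \<open>r q / 2 > 1\<close>, and \<open>\<Lambda> N\<close> contains
  all indices of small weight, namely those with \<open>b\<^sub>\<nu> powr (- q/2) > S / N\<close>.
\<close>

theorem best_N_term_rate:
  assumes s: "s = 1 / q"
  obtains \<Lambda> C where "C > 0" "\<And>N. N \<ge> 1 \<Longrightarrow> \<Lambda> N \<subseteq> multi_indices \<and> finite (\<Lambda> N) \<and> card (\<Lambda> N) = N \<and>
    integral\<^sup>L gauss (\<lambda>y. (norm (taylor (\<lambda>_. 0) y - hermite_sum (\<Lambda> N) (taylor (\<lambda>_. 0)) y))\<^sup>2) \<le> (C * real N powr (- s))\<^sup>2"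
proof -
  define r where "r = nat \<lceil>2 / q\<rceil> + 1"
  have r: "r \<ge> 1" "real r * (q / 2) > 1"
  proof -
    have "real r > 2 / q" unfolding r_def using real_nat_ceiling_ge[of "2 / q"] by linarith
    then show "real r * (q / 2) > 1" using q by (simp add: pos_divide_less_eq)
  qed (simp add: r_def)
  let ?w = "taylor (\<lambda>_. 0)" and ?b = "mi_weight r \<rho>"
  have b: "?b \<nu> > 0" for \<nu> by (rule mi_weight_pos[OF \<rho>])
  obtain S where S: "S > 0" "\<And>T. finite T \<Longrightarrow> T \<subseteq> multi_indices \<Longrightarrow> (\<Sum>\<nu>\<in>T. ?b \<nu> powr (- (q / 2))) \<le> S"
    by (rule mi_weight_sum[OF \<rho> q summable_\<rho> r(2)]) (rule that)
  obtain C0 where C0: "C0 \<ge> 0" "\<And>T. finite T \<Longrightarrow> T \<subseteq> multi_indices \<Longrightarrow> (\<Sum>\<nu>\<in>T. ?b \<nu> * (norm (hermite_coeff ?w \<nu>))\<^sup>2) \<le> C0"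
    by (rule hermite_coeff_weighted_summable[OF r(1)]) (rule that)
  have "\<exists>\<Lambda>. \<Lambda> \<subseteq> multi_indices \<and> finite \<Lambda> \<and> card \<Lambda> = N \<and> (\<forall>\<nu>\<in>multi_indices - \<Lambda>. ?b \<nu> powr (- (q / 2)) \<le> S / real N)"
    if N: "N \<ge> 1" for N :: nat
  proof -
    obtain \<Lambda> where "\<Lambda> \<subseteq> multi_indices" "finite \<Lambda>" "card \<Lambda> = N" "\<And>\<nu>. \<nu> \<in> multi_indices - \<Lambda> \<Longrightarrow> ?b \<nu> powr (- (q / 2)) \<le> S / real N"
      by (rule select_large[OF infinite_multi_indices S(2) N]) simp_all
    then show ?thesis by blast
  qed
  then obtain \<Lambda> where \<Lambda>: "\<And>N. N \<ge> 1 \<Longrightarrow> \<Lambda> N \<subseteq> multi_indices" "\<And>N. N \<ge> 1 \<Longrightarrow> finite (\<Lambda> N)"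
    "\<And>N. N \<ge> 1 \<Longrightarrow> card (\<Lambda> N) = N"
    "\<And>N \<nu>. N \<ge> 1 \<Longrightarrow> \<nu> \<in> multi_indices - \<Lambda> N \<Longrightarrow> ?b \<nu> powr (- (q / 2)) \<le> S / real N"
    by metis
  \<comment> \<open>The summand \<open>1\<close> keeps \<open>C\<close> positive if all coefficients vanish.\<close>
  define C where "C = S powr (1 / q) * sqrt (C0 + 1)"
  have err: "integral\<^sup>L gauss (\<lambda>y. (norm (?w y - hermite_sum (\<Lambda> N) ?w y))\<^sup>2) \<le> (C * real N powr (- s))\<^sup>2" if N: "N \<ge> 1" for N
  proof (rule hermite_tail_le[OF taylor_gauss_L2[OF zero_multi_index] \<Lambda>(2,1)[OF N]])
    fix T assume T: "finite T" "T \<subseteq> multi_indices - \<Lambda> N"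
    let ?h = "(S / real N) powr (2 / q)"
    have inv: "1 \<le> ?h * ?b \<nu>" if "\<nu> \<in> T" for \<nu>
    proof -
      have "(?b \<nu> powr (- (q / 2))) powr (2 / q) \<le> ?h"
        using \<Lambda>(4)[OF N] that T(2) q by (intro powr_mono2) auto
      moreover have "(?b \<nu> powr (- (q / 2))) powr (2 / q) = inverse (?b \<nu>)"
      proof -
        have "- (q / 2) * (2 / q) = -1" using q by simp
        then show ?thesis using b[of \<nu>] unfolding powr_powr by (simp add: powr_minus)
      qed
      ultimately have "inverse (?b \<nu>) \<le> ?h" by simp
      then have "inverse (?b \<nu>) * ?b \<nu> \<le> ?h * ?b \<nu>" using b[of \<nu>] by (intro mult_right_mono) auto
      then show ?thesis using b[of \<nu>] by simp
    qed
    have "(\<Sum>\<nu>\<in>T. (norm (hermite_coeff ?w \<nu>))\<^sup>2) \<le> (\<Sum>\<nu>\<in>T. ?h * (?b \<nu> * (norm (hermite_coeff ?w \<nu>))\<^sup>2))"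
    proof (rule sum_mono)
      fix \<nu> assume "\<nu> \<in> T"
      from mult_right_mono[OF inv[OF this], of "(norm (hermite_coeff ?w \<nu>))\<^sup>2"]
      show "(norm (hermite_coeff ?w \<nu>))\<^sup>2 \<le> ?h * (?b \<nu> * (norm (hermite_coeff ?w \<nu>))\<^sup>2)" by (simp add: mult.assoc)
    qed
    also have "\<dots> = ?h * (\<Sum>\<nu>\<in>T. ?b \<nu> * (norm (hermite_coeff ?w \<nu>))\<^sup>2)" by (simp add: sum_distrib_left)
    also have "\<dots> \<le> ?h * (C0 + 1)"
    proof (rule mult_left_mono)
      have "(\<Sum>\<nu>\<in>T. ?b \<nu> * (norm (hermite_coeff ?w \<nu>))\<^sup>2) \<le> C0" by (rule C0(2)) (use T in auto)
      then show "(\<Sum>\<nu>\<in>T. ?b \<nu> * (norm (hermite_coeff ?w \<nu>))\<^sup>2) \<le> C0 + 1" by linarith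
    qed simp
    also have "\<dots> = (C * real N powr (- s))\<^sup>2"
    proof -
      have "?h = (S powr (1 / q) * real N powr (- s))\<^sup>2"
      proof -
        have "S powr (1 / q) * real N powr (- s) = (S / real N) powr (1 / q)"
          unfolding s using powr_divide[of S "real N" "1 / q"] powr_minus[of "real N" "1 / q"] S(1)
          by (simp only: divide_inverse)
        moreover have "((S / real N) powr (1 / q))\<^sup>2 = ?h"
          by (simp add: power2_eq_square powr_add[symmetric])
        ultimately show ?thesis by simp
      qed
      then show ?thesis using C0(1) by (simp add: C_def power_mult_distrib)
    qed
    finally show "(\<Sum>\<nu>\<in>T. (norm (hermite_coeff ?w \<nu>))\<^sup>2) \<le> (C * real N powr (- s))\<^sup>2" .
  qed
  have "C > 0" unfolding C_def using S(1) C0(1) by (intro mult_pos_pos) auto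
  then show ?thesis using \<Lambda>(1-3) err by (intro that[of C \<Lambda>]) auto
qed

end

section \<open>The reduced optimality problem\<close>

lemma AE_lebesgue_on_iff:
  fixes D :: "'a::euclidean_space set"
  assumes D: "D \<in> sets borel"
  shows "(AE x in lebesgue_on D. P x) \<longleftrightarrow> (AE x in lborel. x \<in> D \<longrightarrow> P x)"
proof -
  have "D \<inter> space lebesgue \<in> sets lebesgue" using D by simp
  then show ?thesis by (simp add: AE_restrict_space_iff AE_completion_iff)
qed

lemma borel_measurable_lebesgue_on:
  assumes "g \<in> borel_measurable borel"
  shows "g \<in> borel_measurable (lebesgue_on D)"
  by (rule measurable_restrict_space1, rule measurable_completion) (use assms in simp)

text \<open>
  The problem is posed with Lebesgue measure on \<open>D\<close>, while the Sobolev functions are Borel functions on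
  the whole space that vanish outside \<open>D\<close>.
\<close>

lemma integral_lebesgue_on_eq_lborel:
  fixes g h :: "'a::euclidean_space \<Rightarrow> real"
  assumes D: "D \<in> sets borel" and g: "g \<in> borel_measurable (lebesgue_on D)" and h: "h \<in> borel_measurable borel"
    and eq: "AE x in lborel. x \<in> D \<longrightarrow> g x = h x" and zero: "AE x in lborel. x \<notin> D \<longrightarrow> h x = 0"
  shows "integral\<^sup>L (lebesgue_on D) g = integral\<^sup>L lborel h"
    and "integrable (lebesgue_on D) g \<longleftrightarrow> integrable lborel h"
proof -
  have D': "D \<inter> space lebesgue \<in> sets lebesgue" using D by simp
  have h': "h \<in> borel_measurable lborel" using h by simp
  have g': "(\<lambda>x. indicator D x *\<^sub>R g x) \<in> borel_measurable lebesgue"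
    using g unfolding borel_measurable_restrict_space_iff[OF D'] .
  have ae: "AE x in lebesgue. indicator D x *\<^sub>R g x = h x"
    unfolding AE_completion_iff using eq zero by eventually_elim (auto simp: indicator_def)
  have "integral\<^sup>L (lebesgue_on D) g = integral\<^sup>L lebesgue h"
    unfolding integral_restrict_space[OF D'] by (rule integral_cong_AE[OF g' measurable_completion[OF h'] ae])
  then show "integral\<^sup>L (lebesgue_on D) g = integral\<^sup>L lborel h"
    by (simp only: integral_completion[OF h'])
  have "integrable (lebesgue_on D) g \<longleftrightarrow> integrable lebesgue h"
    unfolding integrable_restrict_space[OF D'] by (rule integrable_cong_AE[OF g' measurable_completion[OF h'] ae])
  then show "integrable (lebesgue_on D) g \<longleftrightarrow> integrable lborel h"
    by (simp only: integrable_completion[OF h'])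
qed

lemma ex_borel_version:
  fixes g :: "'a::euclidean_space \<Rightarrow> real"
  assumes D: "D \<in> sets borel" and g: "g \<in> borel_measurable (lebesgue_on D)"
  obtains g' where "g' \<in> borel_measurable borel" "\<And>x. x \<notin> D \<Longrightarrow> g' x = 0" "AE x in lborel. x \<in> D \<longrightarrow> g x = g' x"
proof -
  have D': "D \<inter> space lebesgue \<in> sets lebesgue" using D by simp
  have "(\<lambda>x. indicator D x *\<^sub>R g x) \<in> borel_measurable lebesgue"
    using g unfolding borel_measurable_restrict_space_iff[OF D'] .
  from completion_ex_borel_measurable_real[OF this]
  obtain h where h: "h \<in> borel_measurable lborel" "AE x in lborel. indicator D x *\<^sub>R g x = h x" by blast
  show thesis
  proof (rule that[of "\<lambda>x. indicator D x * h x"])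
    show "(\<lambda>x. indicator D x * h x) \<in> borel_measurable borel" using h(1) D by simp
    show "AE x in lborel. x \<in> D \<longrightarrow> g x = indicator D x * h x" using h(2) by eventually_elim auto
  qed simp
qed

lemma subspace_W_space: "subspace (W_space D)"
  using subspace_H10[of D] by (auto simp: W_space_def subspace_def zero_prod_def)

lemma closed_W_space: "closed (W_space D)"
  unfolding W_space_def by (intro closed_Times closed_H10)

lemma energy_form_one: "energy_form \<beta> (\<lambda>_. 1) w w = \<beta> * (norm (snd (fst w)))\<^sup>2 + (norm (snd (snd w)))\<^sup>2"
proof -
  have c: "ess_bounded (\<lambda>_. 1) \<bar>1\<bar>" by (rule ess_bounded_const)
  have m: "mult_L2 (\<lambda>_. 1) u = u" for u :: "('a, 'a) L2"
    by (simp add: mult_L2_def abs_rep_L2)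
  show ?thesis
    unfolding inner_energy_op[OF c, symmetric] energy_op_apply[OF c] m
    by (simp add: inner_prod_def power2_norm_eq_inner)
qed

text \<open>
  On \<open>W_space D\<close> the Poincare inequality bounds the full norm of \<open>H\<^sup>1\<close> by the norm of the gradient.
\<close>

lemma energy_form_coercive:
  assumes w: "w \<in> W_space D" and D: "\<And>x. x \<in> D \<Longrightarrow> norm x \<le> r" and r: "r \<ge> 0" and \<beta>: "\<beta> > 0"
  shows "min \<beta> 1 / (1 + 4 * r\<^sup>2) * (norm w)\<^sup>2 \<le> energy_form \<beta> (\<lambda>_. 1) w w"
proof -
  have H: "(norm u)\<^sup>2 \<le> (1 + 4 * r\<^sup>2) * (norm (snd u))\<^sup>2" if "u \<in> H10 D" for u
  proof -
    have "(norm (fst u))\<^sup>2 \<le> (2 * r * norm (snd u))\<^sup>2"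
      by (intro power_mono Poincare[OF that D r] norm_ge_zero)
    moreover have "(norm u)\<^sup>2 = (norm (fst u))\<^sup>2 + (norm (snd u))\<^sup>2" by (simp add: norm_prod_def)
    ultimately show ?thesis by (simp add: power_mult_distrib algebra_simps)
  qed
  let ?m = "min \<beta> 1" and ?p = "1 + 4 * r\<^sup>2"
  have p: "?p > 0" by (simp add: add_pos_nonneg)
  have w': "fst w \<in> H10 D" "snd w \<in> H10 D" using w by (auto simp: W_space_def)
  have "?m * (norm w)\<^sup>2 = ?m * (norm (fst w))\<^sup>2 + ?m * (norm (snd w))\<^sup>2"
    by (simp add: norm_prod_def[of w] distrib_left)
  also have "\<dots> \<le> ?m * (?p * (norm (snd (fst w)))\<^sup>2) + ?m * (?p * (norm (snd (snd w)))\<^sup>2)"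
    using \<beta> by (intro add_mono mult_left_mono H w') auto
  also have "\<dots> \<le> \<beta> * (?p * (norm (snd (fst w)))\<^sup>2) + 1 * (?p * (norm (snd (snd w)))\<^sup>2)"
    using p by (intro add_mono mult_right_mono mult_nonneg_nonneg) auto
  also have "\<dots> = ?p * energy_form \<beta> (\<lambda>_. 1) w w" unfolding energy_form_one by (simp add: algebra_simps)
  finally have "?m * (norm w)\<^sup>2 \<le> energy_form \<beta> (\<lambda>_. 1) w w * ?p" by (simp only: mult.commute)
  then show ?thesis using p by (simp add: pos_divide_le_eq)
qed

lemma V_norm_eq:
  assumes D: "D \<in> sets borel" and u: "u \<in> H10 D"
  shows "(V_norm D u)\<^sup>2 = (norm (snd u))\<^sup>2"
proof -
  have [measurable]: "grad u \<in> borel_measurable borel" by (simp add: grad_def sq_intD[OF rep_L2_sq_int])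
  have m: "(\<lambda>x. (norm (grad u x))\<^sup>2) \<in> borel_measurable borel" by measurable
  have "integral\<^sup>L (lebesgue_on D) (\<lambda>x. (norm (grad u x))\<^sup>2) = integral\<^sup>L lborel (\<lambda>x. (norm (grad u x))\<^sup>2)"
  proof (rule integral_lebesgue_on_eq_lborel(1)[OF D borel_measurable_lebesgue_on[OF m] m])
    show "AE x in lborel. x \<notin> D \<longrightarrow> (norm (grad u x))\<^sup>2 = 0"
      using H10_zero_outside(2)[OF u D] by eventually_elim simp
  qed simp
  also have "\<dots> = (norm (snd u))\<^sup>2" by (simp add: norm_L2_eq grad_def)
  finally show ?thesis by (simp add: V_norm_def)
qed

lemma W_norm_eq:
  assumes D: "D \<in> sets borel" and w: "w \<in> W_space D" and \<beta>: "\<beta> > 0"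
  shows "(W_norm D \<beta> w)\<^sup>2 = \<beta> * (norm (snd (fst w)))\<^sup>2 + (norm (snd (snd w)))\<^sup>2"
proof -
  have w': "fst w \<in> H10 D" "snd w \<in> H10 D" using w by (auto simp: W_space_def)
  show ?thesis using \<beta> by (simp add: W_norm_def V_norm_eq[OF D w'(1)] V_norm_eq[OF D w'(2)])
qed

lemma W_norm_le:
  assumes D: "D \<in> sets borel" and w: "w \<in> W_space D" and \<beta>: "\<beta> > 0"
  shows "(W_norm D \<beta> w)\<^sup>2 \<le> (\<beta> + 1) * (norm w)\<^sup>2"
proof -
  have "(norm (snd (fst w)))\<^sup>2 \<le> (norm (fst w))\<^sup>2" "(norm (snd (snd w)))\<^sup>2 \<le> (norm (snd w))\<^sup>2"
    by (simp_all add: norm_prod_def)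
  then have "\<beta> * (norm (snd (fst w)))\<^sup>2 + (norm (snd (snd w)))\<^sup>2 \<le> (\<beta> + 1) * (norm (fst w))\<^sup>2 + (\<beta> + 1) * (norm (snd w))\<^sup>2"
    using \<beta> by (intro add_mono mult_mono order_trans[OF _ mult_right_mono[of 1 "\<beta> + 1"]]) auto
  also have "\<dots> = (\<beta> + 1) * (norm w)\<^sup>2" by (simp add: norm_prod_def[of w] distrib_left)
  finally show ?thesis by (simp only: W_norm_eq[OF assms])
qed

definition coupling_op :: "('a::euclidean_space sobolev \<times> 'a sobolev) \<Rightarrow>\<^sub>L ('a sobolev \<times> 'a sobolev)" where
  "coupling_op = Blinfun (\<lambda>w. ((fst (snd w), 0), (- fst (fst w), 0)))"

lemma inner_coupling_op:
  "inner (coupling_op w) w' = inner (fst (snd w)) (fst (fst w')) - inner (fst (fst w)) (fst (snd w'))"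
proof -
  have "bounded_linear (\<lambda>w :: 'a sobolev \<times> 'a sobolev. ((fst (snd w), 0 :: ('a, 'a) L2), (- fst (fst w), 0 :: ('a, 'a) L2)))"
    by (intro bounded_linear_Pair bounded_linear_minus bounded_linear_zero
        bounded_linear_compose[OF bounded_linear_fst bounded_linear_fst]
        bounded_linear_compose[OF bounded_linear_fst bounded_linear_snd])
  then show ?thesis
    unfolding coupling_op_def by (simp add: bounded_linear_Blinfun_apply inner_prod_def)
qed

lemma coupling_op_skew: "inner (coupling_op w) w = 0"
  unfolding inner_coupling_op by (simp add: inner_commute)

lemma L2_inner_representation:
  assumes D: "D \<in> sets borel" and f: "f \<in> L2_on D"
  obtains u :: "('a::euclidean_space, real) L2" where "\<And>v. v \<in> H10 D \<Longrightarrow> L2_inner D f (val v) = inner u (fst v)"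
proof -
  have f_meas: "f \<in> borel_measurable (lebesgue_on D)" and f_int: "integrable (lebesgue_on D) (\<lambda>x. (f x)\<^sup>2)"
    using f by (auto simp: L2_on_def)
  obtain f' where [measurable]: "f' \<in> borel_measurable borel" and zero: "\<And>x. x \<notin> D \<Longrightarrow> f' x = 0"
    and eq: "AE x in lborel. x \<in> D \<longrightarrow> f x = f' x"
    using ex_borel_version[OF D f_meas] by blast
  have "integrable lborel (\<lambda>x. (f' x)\<^sup>2)"
  proof (rule integral_lebesgue_on_eq_lborel(2)[THEN iffD1, OF D _ _ _ _ f_int])
    show "AE x in lborel. x \<in> D \<longrightarrow> (f x)\<^sup>2 = (f' x)\<^sup>2" using eq by eventually_elim simp
  qed (use f_meas zero in simp_all)
  then have f': "f' \<in> sq_int" by (simp add: sq_int_def)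
  show thesis
  proof (rule that[of "abs_L2 f'"])
    fix v :: "'a sobolev" assume v: "v \<in> H10 D"
    have [measurable]: "val v \<in> borel_measurable borel" by (simp add: val_def sq_intD[OF rep_L2_sq_int])
    have v_meas: "val v \<in> borel_measurable (lebesgue_on D)" by (rule borel_measurable_lebesgue_on) simp
    have "L2_inner D f (val v) = integral\<^sup>L lborel (\<lambda>x. f' x * val v x)"
      unfolding L2_inner_def
    proof (rule integral_lebesgue_on_eq_lborel(1)[OF D])
      show "AE x in lborel. x \<in> D \<longrightarrow> f x * val v x = f' x * val v x" using eq by eventually_elim simp
    qed (use f_meas v_meas zero in simp_all)
    also have "\<dots> = inner (abs_L2 f') (fst v)"
    proof -
      have "inner (abs_L2 f') (abs_L2 (rep_L2 (fst v))) = integral\<^sup>L lborel (\<lambda>x. inner (f' x) (rep_L2 (fst v) x))"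
        by (rule inner_L2.abs_eq) (simp_all add: L2_rel_refl rep_L2_sq_int f')
      then show ?thesis by (simp add: abs_rep_L2 val_def)
    qed
    finally show "L2_inner D f (val v) = inner (abs_L2 f') (fst v)" .
  qed
qed

lemma L2_inner_val:
  assumes D: "D \<in> sets borel" and v: "v \<in> H10 D"
  shows "L2_inner D (val u) (val v) = inner (fst u) (fst v)"
proof -
  have [measurable]: "val w \<in> borel_measurable borel" for w :: "'a sobolev"
    by (simp add: val_def sq_intD[OF rep_L2_sq_int])
  have m: "(\<lambda>x. val u x * val v x) \<in> borel_measurable borel" by measurable
  have "L2_inner D (val u) (val v) = integral\<^sup>L lborel (\<lambda>x. val u x * val v x)"
    unfolding L2_inner_def
  proof (rule integral_lebesgue_on_eq_lborel(1)[OF D borel_measurable_lebesgue_on[OF m] m])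
    show "AE x in lborel. x \<notin> D \<longrightarrow> val u x * val v x = 0"
      using H10_zero_outside(1)[OF v D] by eventually_elim simp
  qed simp
  also have "\<dots> = inner (fst u) (fst v)" by (simp add: inner_L2_eq val_def)
  finally show ?thesis .
qed

lemma B_form_eq:
  assumes "D \<in> sets borel" "w' \<in> W_space D"
  shows "B_form D w w' = inner (coupling_op w) w'"
  using assms by (auto simp: B_form_def inner_coupling_op W_space_def L2_inner_val)

lemma F_form_representation:
  fixes f ud :: "'a::euclidean_space \<Rightarrow> real"
  assumes D: "D \<in> sets borel" and f: "f \<in> L2_on D" and ud: "ud \<in> L2_on D"
  obtains F0 :: "'a sobolev \<times> 'a sobolev" where "\<And>w'. w' \<in> W_space D \<Longrightarrow> F_form D \<beta> f ud w' = inner F0 w'"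
proof -
  obtain u where u: "\<And>v. v \<in> H10 D \<Longrightarrow> L2_inner D f (val v) = inner u (fst v)"
    by (rule L2_inner_representation[OF D f]) (rule that)
  obtain v where v: "\<And>w. w \<in> H10 D \<Longrightarrow> L2_inner D ud (val w) = inner v (fst w)"
    by (rule L2_inner_representation[OF D ud]) (rule that)
  show thesis
    by (rule that[of "((\<beta> *\<^sub>R u, 0), (- v, 0))"]) (auto simp: F_form_def W_space_def u v inner_prod_def)
qed

lemma A_form_eq:
  fixes k k' :: "'a::euclidean_space \<Rightarrow> real"
  assumes D: "D \<in> sets borel" and k: "k \<in> borel_measurable (lebesgue_on D)" and k': "k' \<in> borel_measurable borel"
    and eq: "AE x in lborel. x \<in> D \<longrightarrow> k x = k' x" and b: "AE x in lborel. \<bar>k' x\<bar> \<le> b" and w': "w' \<in> W_space D"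
  shows "A_form D \<beta> w w' k = energy_form \<beta> (\<lambda>x. exp (k' x)) w w'"
proof -
  note [measurable] = k'
  have bd: "ess_bounded (\<lambda>x. exp (k' x)) (exp b)"
    unfolding ess_bounded_def
  proof
    show "AE x in lborel. \<bar>exp (k' x)\<bar> \<le> exp b" using b by eventually_elim simp
  qed measurable
  have gm [measurable]: "grad u \<in> borel_measurable borel" for u :: "'a sobolev"
    by (simp add: grad_def sq_intD[OF rep_L2_sq_int])
  have a: "a_form D u u' k = inner (mult_L2 (\<lambda>x. exp (k' x)) (snd u)) (snd u')" if u': "u' \<in> H10 D" for u u'
  proof -
    note gm' [measurable] = borel_measurable_lebesgue_on[OF gm, where D = D] and k [measurable]
    have "a_form D u u' k = integral\<^sup>L lborel (\<lambda>x. exp (k' x) * (grad u x \<bullet> grad u' x))"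
      unfolding a_form_def
    proof (rule integral_lebesgue_on_eq_lborel(1)[OF D])
      show "AE x in lborel. x \<in> D \<longrightarrow> exp (k x) * (grad u x \<bullet> grad u' x) = exp (k' x) * (grad u x \<bullet> grad u' x)"
        using eq by eventually_elim simp
      show "AE x in lborel. x \<notin> D \<longrightarrow> exp (k' x) * (grad u x \<bullet> grad u' x) = 0"
        using H10_zero_outside(2)[OF u' D] by eventually_elim simp
    qed measurable
    then show ?thesis by (simp add: inner_mult_L2[OF bd] grad_def)
  qed
  have "fst w' \<in> H10 D" "snd w' \<in> H10 D" using w' by (auto simp: W_space_def)
  then show ?thesis
    unfolding inner_energy_op[OF bd, symmetric] energy_op_apply[OF bd] A_form_def
    by (simp add: a inner_prod_def)
qed

text \<open>
  Finiteness of the essential supremum amounts to the existence of a real bound; if the supremum is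
  \<open>- \<infinity>\<close>, which happens for a null set \<open>D\<close>, every real number is one.
\<close>

lemma Linf_on_iff:
  fixes g g' :: "'a::euclidean_space \<Rightarrow> real"
  assumes D: "D \<in> sets borel" and g: "g \<in> borel_measurable (lebesgue_on D)"
    and eq: "AE x in lborel. x \<in> D \<longrightarrow> g x = g' x" and zero: "AE x in lborel. x \<notin> D \<longrightarrow> g' x = 0"
  shows "g \<in> Linf_on D \<longleftrightarrow> (\<exists>b. AE x in lborel. \<bar>g' x\<bar> \<le> b)"
proof
  assume "g \<in> Linf_on D"
  then have "esssup (lebesgue_on D) (\<lambda>x. ereal \<bar>g x\<bar>) < \<infinity>" by (simp add: Linf_on_def)
  then obtain b where b: "esssup (lebesgue_on D) (\<lambda>x. ereal \<bar>g x\<bar>) \<le> ereal b"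
    by (cases "esssup (lebesgue_on D) (\<lambda>x. ereal \<bar>g x\<bar>)") auto
  have "AE x in lborel. x \<in> D \<longrightarrow> ereal \<bar>g x\<bar> \<le> esssup (lebesgue_on D) (\<lambda>x. ereal \<bar>g x\<bar>)"
    using esssup_AE[of "\<lambda>x. ereal \<bar>g x\<bar>" "lebesgue_on D"] unfolding AE_lebesgue_on_iff[OF D] .
  then have "AE x in lborel. \<bar>g' x\<bar> \<le> max b 0"
    using eq zero
  proof eventually_elim
    case (elim x)
    show ?case
    proof (cases "x \<in> D")
      case True
      then have "ereal \<bar>g x\<bar> \<le> ereal b" using elim(1) b order_trans by blast
      then show ?thesis using elim(2) True by simp
    qed (use elim(3) in simp)
  qed
  then show "\<exists>b. AE x in lborel. \<bar>g' x\<bar> \<le> b" by blast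
next
  assume "\<exists>b. AE x in lborel. \<bar>g' x\<bar> \<le> b"
  then obtain b where b: "AE x in lborel. \<bar>g' x\<bar> \<le> b" by blast
  have "AE x in lebesgue_on D. ereal \<bar>g x\<bar> \<le> ereal b"
    unfolding AE_lebesgue_on_iff[OF D] using b eq by eventually_elim simp
  then have "esssup (lebesgue_on D) (\<lambda>x. ereal \<bar>g x\<bar>) \<le> ereal b"
    by (rule esssup_I[rotated]) (use g in measurable)
  also have "\<dots> < \<infinity>" by simp
  finally show "g \<in> Linf_on D" using g by (simp add: Linf_on_def)
qed

text \<open>
  The Borel versions of the \<open>\<kappa>\<^sub>j\<close> obey the bound only almost everywhere; setting all of them to \<open>0\<close> wherever
  it is violated makes it hold everywhere.
\<close>

lemma weighted_family_borel_version:
  fixes \<kappa> :: "nat \<Rightarrow> 'a::euclidean_space \<Rightarrow> real"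
  assumes D: "D \<in> sets borel" and \<kappa>: "\<And>j. \<kappa> j \<in> borel_measurable (lebesgue_on D)" and \<rho>: "\<And>j. \<rho> j > 0"
    and sup: "(SUP x\<in>D. \<Sum>j. ennreal (\<rho> j * \<bar>\<kappa> j x\<bar>)) < \<infinity>"
  obtains \<kappa>' K where "\<And>j. \<kappa>' j \<in> borel_measurable borel" "\<And>j x. x \<notin> D \<Longrightarrow> \<kappa>' j x = 0"
    "AE x in lborel. x \<in> D \<longrightarrow> (\<forall>j. \<kappa> j x = \<kappa>' j x)" "K \<ge> 0" "\<And>x n. (\<Sum>j<n. \<rho> j * \<bar>\<kappa>' j x\<bar>) \<le> K"
proof -
  define S where "S = (SUP x\<in>D. \<Sum>j. ennreal (\<rho> j * \<bar>\<kappa> j x\<bar>))"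
  define K where "K = enn2real S"
  have S: "S = ennreal K" unfolding K_def using sup by (simp add: S_def)
  have K: "K \<ge> 0" by (simp add: K_def)
  have \<kappa>_sum: "(\<Sum>j<n. \<rho> j * \<bar>\<kappa> j x\<bar>) \<le> K" if "x \<in> D" for x n
  proof -
    have "ennreal (\<Sum>j<n. \<rho> j * \<bar>\<kappa> j x\<bar>) = (\<Sum>j<n. ennreal (\<rho> j * \<bar>\<kappa> j x\<bar>))"
      by (rule sum_ennreal[symmetric]) (simp add: \<rho> less_imp_le)
    also have "\<dots> \<le> (\<Sum>j. ennreal (\<rho> j * \<bar>\<kappa> j x\<bar>))" by (rule sum_le_suminf) auto
    also have "\<dots> \<le> S" unfolding S_def by (rule SUP_upper[OF that])
    finally show ?thesis using K by (simp add: S)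
  qed
  have "\<exists>g. g \<in> borel_measurable borel \<and> (\<forall>x. x \<notin> D \<longrightarrow> g x = 0) \<and> (AE x in lborel. x \<in> D \<longrightarrow> \<kappa> j x = g x)" for j
    using ex_borel_version[OF D \<kappa>[of j]] by blast
  then obtain g where g: "\<And>j. g j \<in> borel_measurable borel" "\<And>j x. x \<notin> D \<Longrightarrow> g j x = 0"
    "\<And>j. AE x in lborel. x \<in> D \<longrightarrow> \<kappa> j x = g j x" by metis
  note [measurable] = g(1)
  \<comment> \<open>On almost all of \<open>D\<close> the condition holds, because there \<open>g j x = \<kappa> j x\<close> for all \<open>j\<close>.\<close>
  define \<kappa>' where "\<kappa>' j x = (if \<forall>n. (\<Sum>i<n. \<rho> i * \<bar>g i x\<bar>) \<le> K then g j x else 0)" for j x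
  show thesis
  proof (rule that[of \<kappa>' K])
    show "\<kappa>' j \<in> borel_measurable borel" for j unfolding \<kappa>'_def[abs_def] by measurable
    show "\<kappa>' j x = 0" if "x \<notin> D" for j x using g(2)[OF that] by (simp add: \<kappa>'_def)
    have "AE x in lborel. \<forall>j. x \<in> D \<longrightarrow> \<kappa> j x = g j x" unfolding AE_all_countable using g(3) by blast
    then show "AE x in lborel. x \<in> D \<longrightarrow> (\<forall>j. \<kappa> j x = \<kappa>' j x)"
    proof eventually_elim
      case (elim x)
      show ?case
      proof
        assume x: "x \<in> D"
        then have eq: "\<kappa> j x = g j x" for j using elim by blast
        show "\<forall>j. \<kappa> j x = \<kappa>' j x" using \<kappa>_sum[OF x] unfolding \<kappa>'_def eq by simp
      qed
    qed
    show "(\<Sum>j<n. \<rho> j * \<bar>\<kappa>' j x\<bar>) \<le> K" for x n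
    proof (cases "\<forall>n. (\<Sum>i<n. \<rho> i * \<bar>g i x\<bar>) \<le> K")
      case True
      then have "\<kappa>' j x = g j x" for j by (simp add: \<kappa>'_def)
      then show ?thesis using True by simp
    next
      case False
      then have "\<kappa>' j x = 0" for j unfolding \<kappa>'_def by (rule if_not_P)
      then show ?thesis using K by simp
    qed
  qed (rule K)
qed

text \<open>
  Both problems have the same forms on \<open>W_space D\<close>, and the same parameters are admissible.
\<close>

lemma reduced_solution_eq_taylor:
  fixes D :: "'a::euclidean_space set"
  assumes P: "lognormal_problem (W_space D) \<beta> c0 K \<kappa>' \<rho> (coupling_op :: ('a sobolev \<times> 'a sobolev) \<Rightarrow>\<^sub>L ('a sobolev \<times> 'a sobolev))"
    and D: "D \<in> sets borel" and \<kappa>: "\<And>j. \<kappa> j \<in> borel_measurable (lebesgue_on D)"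
    and zero: "\<And>j x. x \<notin> D \<Longrightarrow> \<kappa>' j x = 0" and eq: "AE x in lborel. x \<in> D \<longrightarrow> (\<forall>j. \<kappa> j x = \<kappa>' j x)"
    and F: "\<And>w'. w' \<in> W_space D \<Longrightarrow> F_form D \<beta> f ud w' = inner F0 w'"
  shows "reduced_solution D \<beta> f ud \<kappa> = lognormal_problem.taylor (W_space D) \<beta> \<kappa>' \<rho> coupling_op F0 (\<lambda>_. 0)"
proof
  interpret lognormal_problem "W_space D" \<beta> c0 K \<kappa>' \<rho> coupling_op F0 by (rule P)
  fix y
  note [measurable] = \<kappa>
  have meas: "kappa_series \<kappa> y \<in> borel_measurable (lebesgue_on D)"
    unfolding kappa_series_def[abs_def] by measurable
  have series: "AE x in lborel. x \<in> D \<longrightarrow> kappa_series \<kappa> y x = kappa_series \<kappa>' y x"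
    using eq by eventually_elim (simp add: kappa_series_def)
  have series_0: "AE x in lborel. x \<notin> D \<longrightarrow> kappa_series \<kappa>' y x = 0" by (simp add: kappa_series_def zero)
  have "(AE x in lebesgue_on D. summable (\<lambda>j. y j * \<kappa> j x)) \<longleftrightarrow> (AE x in lborel. summable (\<lambda>j. y j * \<kappa>' j x))"
    unfolding AE_lebesgue_on_iff[OF D]
  proof
    assume "AE x in lborel. x \<in> D \<longrightarrow> summable (\<lambda>j. y j * \<kappa> j x)"
    then show "AE x in lborel. summable (\<lambda>j. y j * \<kappa>' j x)"
      using eq
    proof eventually_elim
      case (elim x)
      then show ?case by (cases "x \<in> D") (simp_all add: zero)
    qed
  next
    assume "AE x in lborel. summable (\<lambda>j. y j * \<kappa>' j x)"
    then show "AE x in lborel. x \<in> D \<longrightarrow> summable (\<lambda>j. y j * \<kappa> j x)"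
      using eq by eventually_elim simp
  qed
  then have admissible: "y \<in> admissible D \<kappa> \<longleftrightarrow> y \<in> param"
    by (simp add: admissible_def param_def Linf_on_iff[OF D meas series series_0])
  show "reduced_solution D \<beta> f ud \<kappa> y = taylor (\<lambda>_. 0) y"
  proof (cases "y \<in> param")
    case True
    then obtain b where b: "AE x in lborel. \<bar>kappa_series \<kappa>' y x\<bar> \<le> b" by (rule param_bound)
    note co = coercive_L_op[OF b]
    have form: "A_form D \<beta> w w' (kappa_series \<kappa> y) + B_form D w w' = inner (L_op y w) w'" if "w' \<in> W_space D" for w w'
      by (simp add: A_form_eq[OF D meas kappa_series_measurable series b that] B_form_eq[OF D that] inner_L_op[OF b])
    have "(THE w. solves_reduced D \<beta> f ud (kappa_series \<kappa> y) w) = variational_solution (W_space D) (L_op y) F0"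
    proof (rule the_equality)
      show "solves_reduced D \<beta> f ud (kappa_series \<kappa> y) (variational_solution (W_space D) (L_op y) F0)"
        unfolding solves_reduced_def
        by (simp add: form F variational_solution_mem[OF W co] variational_solution_inner[OF W co])
      fix w assume "solves_reduced D \<beta> f ud (kappa_series \<kappa> y) w"
      then have "w \<in> W_space D" "\<And>w'. w' \<in> W_space D \<Longrightarrow> inner (L_op y w) w' = inner F0 w'"
        by (simp_all add: solves_reduced_def form F)
      then show "w = variational_solution (W_space D) (L_op y) F0"
        by (rule variational_solution_eqI[OF W co, symmetric])
    qed
    then show ?thesis using True by (simp add: reduced_solution_def admissible taylor_0)
  qed (simp add: reduced_solution_def admissible taylor_0)
qed

theorem theorem3p1:
  fixes D :: "'a::euclidean_space set"
    and f ud :: "'a \<Rightarrow> real"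
    and \<kappa> :: "nat \<Rightarrow> 'a \<Rightarrow> real"
    and \<rho> :: "nat \<Rightarrow> real"
    and \<beta> p q s :: real
    and w :: "(nat \<Rightarrow> real) \<Rightarrow> 'a sobolev \<times> 'a sobolev"
  assumes "DIM('a) \<in> {1, 2, 3}"
    and "bounded_lipschitz_domain D"
    and "f \<in> L2_on D" and "ud \<in> L2_on D"
    and "\<beta> > 0"
    and "\<And>j. \<kappa> j \<in> Linf_on D"
    and "0 < p" and "p < 2"
    and "q = 2 * p / (2 - p)"
    and "s = 1 / p - 1 / 2"
    and "\<And>j. \<rho> j > 0"
    and "summable (\<lambda>j. (1 / \<rho> j) powr q)"
    and "(SUP x\<in>D. \<Sum>j. ennreal (\<rho> j * \<bar>\<kappa> j x\<bar>)) < \<infinity>"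
    and "w = reduced_solution D \<beta> f ud \<kappa>"
  shows "\<exists>(\<Lambda> :: nat \<Rightarrow> (nat \<Rightarrow> nat) set) C. C > 0 \<and>
    (\<forall>N\<ge>1. \<Lambda> N \<subseteq> multi_indices \<and> finite (\<Lambda> N) \<and> card (\<Lambda> N) = N \<and>
      (\<lambda>y. w y - hermite_sum (\<Lambda> N) w y) \<in> bochner_L2 D \<beta> \<and>
      bochner_L2_norm D \<beta> (\<lambda>y. w y - hermite_sum (\<Lambda> N) w y) \<le> C * real N powr (- s))"
proof -
  have D: "D \<in> sets borel" using assms(2) by (simp add: bounded_lipschitz_domain_def)
  have "bounded D" using assms(2) by (simp add: bounded_lipschitz_domain_def)
  then obtain r where r: "r \<ge> 0" "\<And>x. x \<in> D \<Longrightarrow> norm x \<le> r"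
    by (meson bounded_pos less_imp_le)
  have q: "q > 0" using assms(7-9) by simp
  have sq: "s = 1 / q" using assms(7,8) unfolding assms(9,10) by (simp add: diff_divide_distrib)
  have \<kappa>: "\<kappa> j \<in> borel_measurable (lebesgue_on D)" for j using assms(6)[of j] by (simp add: Linf_on_def)
  obtain \<kappa>' K where \<kappa>': "\<And>j. \<kappa>' j \<in> borel_measurable borel" "\<And>j x. x \<notin> D \<Longrightarrow> \<kappa>' j x = 0"
    "AE x in lborel. x \<in> D \<longrightarrow> (\<forall>j. \<kappa> j x = \<kappa>' j x)"
    and K: "K \<ge> 0" "\<And>x n. (\<Sum>j<n. \<rho> j * \<bar>\<kappa>' j x\<bar>) \<le> K"
    by (rule weighted_family_borel_version[OF D \<kappa> assms(11,13)]) (rule that)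
  obtain F0 :: "'a sobolev \<times> 'a sobolev" where F0: "\<And>w'. w' \<in> W_space D \<Longrightarrow> F_form D \<beta> f ud w' = inner F0 w'"
    by (rule F_form_representation[OF D assms(3,4)]) (rule that)
  \<comment> \<open>Multiplying \<open>\<rho>\<close> by \<open>\<epsilon>\<close> preserves the summability of \<open>1 / \<rho>\<close> and makes the bound \<open>\<epsilon> * K\<close> small.\<close>
  define \<epsilon> where "\<epsilon> = ln (3 / 2) / (K + 1)"
  have \<epsilon>: "\<epsilon> > 0" using K(1) by (simp add: \<epsilon>_def)
  let ?c0 = "min \<beta> 1 / (1 + 4 * r\<^sup>2)" and ?\<rho> = "\<lambda>j. \<epsilon> * \<rho> j"
  interpret lognormal_problem_summable "W_space D" \<beta> ?c0 "\<epsilon> * K" \<kappa>' ?\<rho> coupling_op F0 q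
  proof
    show "?c0 > 0" using assms(5) by (simp add: add_pos_nonneg)
    show "?c0 * (norm w)\<^sup>2 \<le> energy_form \<beta> (\<lambda>_. 1) w w" if "w \<in> W_space D" for w
      by (rule energy_form_coercive[OF that r(2,1) assms(5)])
    show "(\<Sum>j<n. ?\<rho> j * \<bar>\<kappa>' j x\<bar>) \<le> \<epsilon> * K" for x n
      using mult_left_mono[OF K(2), of \<epsilon>] \<epsilon> by (simp add: sum_distrib_left mult.assoc)
    have "\<epsilon> * K \<le> \<epsilon> * (K + 1)" using \<epsilon> by simp
    also have "\<dots> = ln (3 / 2)" using K(1) by (simp add: \<epsilon>_def)
    finally have "exp (\<epsilon> * K) \<le> exp (ln (3 / 2))" by (simp only: exp_le_cancel_iff)
    then show "exp (\<epsilon> * K) \<le> 3 / 2" by simp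
    have "(1 / ?\<rho> j) powr q = (1 / \<epsilon>) powr q * (1 / \<rho> j) powr q" for j
      using powr_mult[of "1 / \<epsilon>" "1 / \<rho> j" q] \<epsilon> assms(11)[of j] by simp
    then show "summable (\<lambda>j. (1 / ?\<rho> j) powr q)" using summable_mult[OF assms(12)] by simp
  qed (use assms(5,11) \<epsilon> q \<kappa>' subspace_W_space closed_W_space coupling_op_skew in auto)
  have w: "w = taylor (\<lambda>_. 0)"
    unfolding assms(14)
    by (rule reduced_solution_eq_taylor[OF _ D \<kappa> \<kappa>'(2,3) F0]) (rule lognormal_problem_axioms)
  have wW: "w y \<in> W_space D" for y unfolding w by (rule taylor_mem)
  have w_L2: "w \<in> gauss_L2" unfolding w by (rule taylor_gauss_L2[OF zero_multi_index])
  obtain \<Lambda> C where C: "C > 0" and \<Lambda>: "\<And>N. N \<ge> 1 \<Longrightarrow> \<Lambda> N \<subseteq> multi_indices \<and> finite (\<Lambda> N) \<and> card (\<Lambda> N) = N \<and>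
    integral\<^sup>L gauss (\<lambda>y. (norm (w y - hermite_sum (\<Lambda> N) w y))\<^sup>2) \<le> (C * real N powr (- s))\<^sup>2"
    by (rule best_N_term_rate[OF sq, folded w]) (rule that)
  show ?thesis
  proof (intro exI[of _ \<Lambda>] exI[of _ "sqrt (\<beta> + 1) * C"] conjI allI impI)
    show "sqrt (\<beta> + 1) * C > 0" using C assms(5) by simp
    fix N :: nat assume N: "N \<ge> 1"
    show "\<Lambda> N \<subseteq> multi_indices" "finite (\<Lambda> N)" "card (\<Lambda> N) = N" using \<Lambda>[OF N] by auto
    define g where "g y = w y - hermite_sum (\<Lambda> N) w y" for y
    have g_L2: "g \<in> gauss_L2"
    proof -
      have "hermite_poly (\<Lambda> N) (hermite_coeff w) \<in> gauss_L2" by (rule hermite_poly_gauss_L2) (use \<Lambda>[OF N] in blast)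
      from gauss_L2_diff[OF w_L2 this] show ?thesis by (simp add: g_def[abs_def] hermite_sum_def hermite_poly_def)
    qed
    have gW: "g y \<in> W_space D" for y
    proof -
      have "hermite_coeff w \<nu> \<in> W_space D" for \<nu>
        unfolding hermite_coeff_def
        by (rule integral_mem_closed_subspace[OF subspace_W_space closed_W_space subspace_scale[OF subspace_W_space wW]])
      then have "hermite_sum (\<Lambda> N) w y \<in> W_space D"
        unfolding hermite_sum_def by (intro subspace_sum subspace_scale subspace_W_space)
      then show ?thesis unfolding g_def by (intro subspace_diff subspace_W_space wW)
    qed
    have W_meas: "(\<lambda>y. (W_norm D \<beta> (g y))\<^sup>2) \<in> borel_measurable gauss"
      unfolding W_norm_eq[OF D gW assms(5)]
      by (rule measurable_compose[OF gauss_L2_measurable[OF g_L2] borel_measurable_continuous_onI])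
        (intro continuous_intros)
    have int: "integrable gauss (\<lambda>y. (\<beta> + 1) * (norm (g y))\<^sup>2)"
      by (rule integrable_mult_right[OF gauss_L2_integrable[OF g_L2]])
    have intW: "integrable gauss (\<lambda>y. (W_norm D \<beta> (g y))\<^sup>2)"
    proof (rule Bochner_Integration.integrable_bound[OF int W_meas])
      show "AE y in gauss. norm ((W_norm D \<beta> (g y))\<^sup>2) \<le> norm ((\<beta> + 1) * (norm (g y))\<^sup>2)"
        using W_norm_le[OF D gW assms(5)] assms(5) by (intro AE_I2) simp
    qed
    show "(\<lambda>y. w y - hermite_sum (\<Lambda> N) w y) \<in> bochner_L2 D \<beta>"
      using gW intW gauss_L2_measurable[OF g_L2] unfolding bochner_L2_def g_def[symmetric] by simp
    have "integral\<^sup>L gauss (\<lambda>y. (W_norm D \<beta> (g y))\<^sup>2) \<le> integral\<^sup>L gauss (\<lambda>y. (\<beta> + 1) * (norm (g y))\<^sup>2)"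
      by (rule integral_mono[OF intW int W_norm_le[OF D gW assms(5)]])
    also have "\<dots> = (\<beta> + 1) * integral\<^sup>L gauss (\<lambda>y. (norm (g y))\<^sup>2)" by simp
    also have "\<dots> \<le> (\<beta> + 1) * (C * real N powr (- s))\<^sup>2"
      using \<Lambda>[OF N] assms(5) unfolding g_def by (intro mult_left_mono) auto
    finally have "sqrt (integral\<^sup>L gauss (\<lambda>y. (W_norm D \<beta> (g y))\<^sup>2)) \<le> sqrt ((\<beta> + 1) * (C * real N powr (- s))\<^sup>2)"
      by (rule real_sqrt_le_mono)
    also have "\<dots> = sqrt (\<beta> + 1) * C * real N powr (- s)" using C by (simp add: real_sqrt_mult)
    finally show "bochner_L2_norm D \<beta> (\<lambda>y. w y - hermite_sum (\<Lambda> N) w y) \<le> sqrt (\<beta> + 1) * C * real N powr (- s)"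
      unfolding bochner_L2_norm_def g_def .
  qed
qed

end
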